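(* Let $\Omega\subset\mathbb R^3$ be bounded and connected with smooth boundary, let $\nu>0$, and let $\alpha\in L^\infty(\partial\Omega)$ satisfy $\alpha\ge0$ almost everywhere and $\mathcal H^2(\{x\in\partial\Omega:\alpha(x)>0\})>0$. Let $C_{(KP,\alpha)}>0$ be a constant, depending on $\Omega$ and $\alpha$, such that $$\|v\|_{L^2(\Omega)}^2\le C_{(KP,\alpha)}\left(\|S(v)\|_{L^2(\Omega)}^2+\int_{\partial\Omega}\alpha|v|^2\,dS\right)\qquad\text{for every }v\in H^1_{\sigma,\tan}(\Omega)$$ (such a constant exists). Let $u$ be a Leray--Hopf weak solution of the three-dimensional incompressible Navier--Stokes equations with Navier boundary conditions and initial datum $u_0\in L^2_{\sigma,\tan}(\Omega)$. Then $$\|u(t)\|_{L^2(\Omega)}^2\le\|u_0\|_{L^2(\Omega)}^2\exp\left(-\frac{2\nu}{C_{(KP,\alpha)}}\,t\right),\qquad t\ge0.$$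
   Context: Setting: $\mathbf n$ is the outward unit normal on $\partial\Omega$; $\mathcal H^2$ is surface measure on $\partial\Omega$; the subscript $\tan$ denotes orthogonal projection onto the tangent space of $\partial\Omega$; $S(u)=\tfrac12(\nabla u+(\nabla u)^T)$. The Navier--Stokes equations with Navier boundary conditions are $\partial_tu-\nu\Delta u+(u\cdot\nabla)u+\nabla p=0$, $\nabla\cdot u=0$ in $\Omega$, with $u\cdot\mathbf n=0$, $[2S(u)\mathbf n+\alpha u]_{\tan}=0$ on $\partial\Omega$, $u(0)=u_0$, understood in the weak sense below. Spaces: $C^\infty_{\sigma,\tan}(\overline\Omega)=\{u\in C^\infty(\overline\Omega;\mathbb R^3):\nabla\cdot u=0,\ u\cdot\mathbf n=0\text{ on }\partial\Omega\}$; $L^2_{\sigma,\tan}(\Omega)$ is its closure in $L^2(\Omega;\mathbb R^3)$; $H^1_{\sigma,\tan}(\Omega)=H^1(\Omega;\mathbb R^3)\cap L^2_{\sigma,\tan}(\Omega)$. Geometry: $d\mathbf n_x:T_x(\partial\Omega)\to T_x(\partial\Omega)$ is the differential of the outward unit normal (Gauss map) at $x$; the eigenvalues of $-d\mathbf n_x$ are the principal curvatures $k_1(x),k_2(x)$. $\Lambda_\Omega:=\sup_{x\in\partial\Omega}\max\{|k_1(x)|,|k_2(x)|\}$. A Leray--Hopf weak solution of the Navier--Stokes equations with Navier boundary conditions means a velocity field $u$ such that $(u,0)$ is a Leray--Hopf weak solution of the Boussinesq system (in which the momentum equation has the extra right-hand side $\rho e_3$ and is coupled to $\partial_t\rho-\kappa\Delta\rho+u\cdot\nabla\rho=0$,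 $\rho|_{\partial\Omega}=0$) with data $(u_0,0)$. Spelled out with $\rho\equiv0$, this means: for every finite $T>0$, $u\in L^2(0,T;H^1_{\sigma,\tan}(\Omega))\cap C_w([0,T];L^2_{\sigma,\tan}(\Omega))$ ($C_w$: weakly continuous), $\partial_tu\in L^{4/3}(0,T;(H^1_{\sigma,\tan}(\Omega))')$, and for every $v\in C_c^1([0,T);H^1_{\sigma,\tan}(\Omega))$ $$-\int_0^T(u,\partial_tv)_{L^2}dt+\nu\int_0^T\Big(\int_\Omega\nabla u:\nabla v\,dx+\int_{\partial\Omega}\alpha u_{\tan}\cdot v_{\tan}\,dS-\int_{\partial\Omega}v\cdot d\mathbf n(u)\,dS\Big)dt+\int_0^T\!\!\int_\Omega(u\cdot\nabla)u\cdot v\,dx\,dt=(u_0,v(0))_{L^2};$$ and there is a set $\mathcal T\subset[0,\infty)$ of full measure with $0\in\mathcal T$ such that for every $s\in\mathcal T$ and every $t\ge s$: (1) $\frac12\|u(t)\|_{L^2}^2+\nu\int_s^t\|\nabla u\|_{L^2}^2d\tau\le\frac12\|u(s)\|_{L^2}^2+\nu\int_s^t\int_{\partial\Omega}(\Lambda_\Omega-\alpha)|u_{\tan}|^2dS\,d\tau$; (2) $\frac12\|u(t)\|_{L^2}^2+2\nu\int_s^t\|S(u)\|_{L^2}^2d\tau\le\frac12\|u(s)\|_{L^2}^2-\nu\int_s^t\int_{\partial\Omega}\alpha|u_{\tan}|^2dS\,d\tau$. *)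

theory Defs
  imports "HOL-Analysis.Analysis"
begin

type_synonym R3 = "real^3"
type_synonym vfield = "R3 \<Rightarrow> R3"

text \<open>Only meant for open \<open>S\<close>; \<open>Ck_on k S\<close> is the class \<open>C\<^sup>k(S)\<close>.\<close>

primrec Ck_on :: "nat \<Rightarrow> 'a::euclidean_space set \<Rightarrow> ('a \<Rightarrow> 'b::real_normed_vector) \<Rightarrow> bool" where
  "Ck_on 0 S f \<longleftrightarrow> continuous_on S f"
| "Ck_on (Suc k) S f \<longleftrightarrow> (\<forall>x\<in>S. f differentiable (at x)) \<and>
     (\<forall>b\<in>Basis. Ck_on k S (\<lambda>x. frechet_derivative f (at x) b))"

definition smooth_on :: "'a::euclidean_space set \<Rightarrow> ('a \<Rightarrow> 'b::real_normed_vector) \<Rightarrow> bool" where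
  "smooth_on S f \<longleftrightarrow> (\<forall>k. Ck_on k S f)"

definition test_functions :: "'a::euclidean_space set \<Rightarrow> ('a \<Rightarrow> real) set" where
  "test_functions U =
     {\<phi>. smooth_on UNIV \<phi> \<and> (\<exists>K. compact K \<and> K \<subseteq> U \<and> (\<forall>x. x \<notin> K \<longrightarrow> \<phi> x = 0))}"

text \<open>\<open>C\<^sup>\<infinity>\<close> up to the boundary means being the restriction of a smooth function on the
  whole space; on bounded smooth domains this agrees with all derivatives extending continuously
  to the closure. Values outside \<open>closure \<Omega>\<close> are irrelevant.\<close>

definition smooth_closure :: "R3 set \<Rightarrow> vfield set" where
  "smooth_closure \<Omega> = {u. \<exists>U. smooth_on UNIV U \<and> (\<forall>x\<in>closure \<Omega>. u x = U x)}"

definition gradient :: "(R3 \<Rightarrow> real) \<Rightarrow> vfield" where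
  "gradient \<rho> x = (\<chi> i. frechet_derivative \<rho> (at x) (axis i 1))"

definition divergence :: "vfield \<Rightarrow> R3 \<Rightarrow> real" where
  "divergence u x = (\<Sum>i\<in>UNIV. frechet_derivative u (at x) (axis i 1) $ i)"

definition defining_function :: "R3 set \<Rightarrow> R3 set \<Rightarrow> (R3 \<Rightarrow> real) \<Rightarrow> bool" where
  "defining_function \<Omega> U \<rho> \<longleftrightarrow> open U \<and> smooth_on U \<rho> \<and>
     (\<forall>x\<in>U. gradient \<rho> x \<noteq> 0) \<and> \<Omega> \<inter> U = {x\<in>U. \<rho> x < 0}"

definition smooth_boundary :: "R3 set \<Rightarrow> bool" where
  "smooth_boundary \<Omega> \<longleftrightarrow> (\<forall>x\<in>frontier \<Omega>. \<exists>U \<rho>. x \<in> U \<and> defining_function \<Omega> U \<rho>)"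

definition outward_normal :: "R3 set \<Rightarrow> vfield" where
  "outward_normal \<Omega> x =
     (THE n. \<exists>U \<rho>. x \<in> U \<and> defining_function \<Omega> U \<rho> \<and>
        n = gradient \<rho> x /\<^sub>R norm (gradient \<rho> x))"

definition tangential :: "R3 set \<Rightarrow> R3 \<Rightarrow> R3 \<Rightarrow> R3" where
  "tangential \<Omega> x v = v - (v \<bullet> outward_normal \<Omega> x) *\<^sub>R outward_normal \<Omega> x"

text \<open>A derivative of the normal within the surface \<open>frontier \<Omega>\<close> is determined only on the
  tangent space, whence the projection of the argument.\<close>

definition gauss_differential :: "R3 set \<Rightarrow> R3 \<Rightarrow> R3 \<Rightarrow> R3" where
  "gauss_differential \<Omega> x v =
     frechet_derivative (outward_normal \<Omega>) (at x within frontier \<Omega>) (tangential \<Omega> x v)"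

definition principal_curvature :: "R3 set \<Rightarrow> R3 \<Rightarrow> real \<Rightarrow> bool" where
  "principal_curvature \<Omega> x k \<longleftrightarrow>
     (\<exists>\<tau>. \<tau> \<noteq> 0 \<and> \<tau> \<bullet> outward_normal \<Omega> x = 0 \<and> - gauss_differential \<Omega> x \<tau> = k *\<^sub>R \<tau>)"

definition curvature_bound :: "R3 set \<Rightarrow> real" where
  "curvature_bound \<Omega> = (SUP x\<in>frontier \<Omega>. Max {\<bar>k\<bar> |k. principal_curvature \<Omega> x k})"

text \<open>Two-dimensional Hausdorff measure, normalised (factor \<open>\<pi>/4\<close>) so that it is surface area
  on smooth surfaces. Boundedness is required since \<^const>\<open>diameter\<close> is unspecified on
  unbounded sets.\<close>

definition hausdorff2_outer :: "R3 set \<Rightarrow> ennreal" where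
  "hausdorff2_outer A =
     (SUP \<delta>\<in>{0<..}. INF E\<in>{E :: nat \<Rightarrow> R3 set. A \<subseteq> (\<Union>i. E i) \<and>
        (\<forall>i. bounded (E i) \<and> diameter (E i) \<le> \<delta>)}.
        \<Sum>i. ennreal (pi / 4 * (diameter (E i))\<^sup>2))"

definition hausdorff2 :: "R3 measure" where
  "hausdorff2 = measure_of UNIV (sets borel) hausdorff2_outer"

definition surface_measure :: "R3 set \<Rightarrow> R3 measure" where
  "surface_measure \<Omega> = completion (restrict_space hausdorff2 (frontier \<Omega>))"

text \<open>Elements of Lebesgue and Sobolev spaces are represented by functions; equality almost
  everywhere is equality up to norm zero.\<close>

definition L2 :: "'a measure \<Rightarrow> ('a \<Rightarrow> 'b::euclidean_space) set" where
  "L2 M = {f \<in> borel_measurable M. integrable M (\<lambda>x. (norm (f x))\<^sup>2)}"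

definition L2_norm :: "'a measure \<Rightarrow> ('a \<Rightarrow> 'b::euclidean_space) \<Rightarrow> real" where
  "L2_norm M f = sqrt (\<integral>x. (norm (f x))\<^sup>2 \<partial>M)"

definition L2_inner :: "'a measure \<Rightarrow> ('a \<Rightarrow> 'b::euclidean_space) \<Rightarrow> ('a \<Rightarrow> 'b) \<Rightarrow> real" where
  "L2_inner M f g = (\<integral>x. f x \<bullet> g x \<partial>M)"

definition Linfinity :: "'a measure \<Rightarrow> ('a \<Rightarrow> real) set" where
  "Linfinity M = {f \<in> borel_measurable M. \<exists>B. AE x in M. \<bar>f x\<bar> \<le> B}"

text \<open>The convention is \<open>G x $ i $ j = \<partial>\<^sub>j u\<^sub>i\<close>; the norm and inner product of
  \<open>real^3^3\<close> are those of Frobenius.\<close>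

definition has_weak_gradient :: "R3 set \<Rightarrow> vfield \<Rightarrow> (R3 \<Rightarrow> real^3^3) \<Rightarrow> bool" where
  "has_weak_gradient \<Omega> u G \<longleftrightarrow> u \<in> L2 (lebesgue_on \<Omega>) \<and> G \<in> L2 (lebesgue_on \<Omega>) \<and>
     (\<forall>\<phi>\<in>test_functions \<Omega>. \<forall>i j.
        (\<integral>x. u x $ i * gradient \<phi> x $ j \<partial>lebesgue_on \<Omega>)
          = - (\<integral>x. G x $ i $ j * \<phi> x \<partial>lebesgue_on \<Omega>))"

definition H1 :: "R3 set \<Rightarrow> vfield set" where
  "H1 \<Omega> = {u. \<exists>G. has_weak_gradient \<Omega> u G}"

definition weak_grad :: "R3 set \<Rightarrow> vfield \<Rightarrow> R3 \<Rightarrow> real^3^3" where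
  "weak_grad \<Omega> u = (SOME G. has_weak_gradient \<Omega> u G)"

definition sym_grad :: "R3 set \<Rightarrow> vfield \<Rightarrow> R3 \<Rightarrow> real^3^3" where
  "sym_grad \<Omega> u x = (1/2) *\<^sub>R (weak_grad \<Omega> u x + transpose (weak_grad \<Omega> u x))"

definition H1_norm :: "R3 set \<Rightarrow> vfield \<Rightarrow> real" where
  "H1_norm \<Omega> u =
     sqrt ((L2_norm (lebesgue_on \<Omega>) u)\<^sup>2 + (L2_norm (lebesgue_on \<Omega>) (weak_grad \<Omega> u))\<^sup>2)"

definition smooth_sigma_tan :: "R3 set \<Rightarrow> vfield set" where
  "smooth_sigma_tan \<Omega> = {u \<in> smooth_closure \<Omega>.
     (\<forall>x\<in>\<Omega>. divergence u x = 0) \<and> (\<forall>x\<in>frontier \<Omega>. u x \<bullet> outward_normal \<Omega> x = 0)}"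

definition L2_sigma_tan :: "R3 set \<Rightarrow> vfield set" where
  "L2_sigma_tan \<Omega> = {u \<in> L2 (lebesgue_on \<Omega>).
     \<exists>w. (\<forall>n::nat. w n \<in> smooth_sigma_tan \<Omega>) \<and>
         (\<lambda>n. L2_norm (lebesgue_on \<Omega>) (w n - u)) \<longlonglongrightarrow> 0}"

definition H1_sigma_tan :: "R3 set \<Rightarrow> vfield set" where
  "H1_sigma_tan \<Omega> = H1 \<Omega> \<inter> L2_sigma_tan \<Omega>"

text \<open>\<open>g\<close> is the boundary trace of \<open>u \<in> H\<^sup>1(\<Omega>)\<close>: the trace operator is the
  closure of the restriction map \<open>C\<^sup>\<infinity>(closure \<Omega>) \<rightarrow> L\<^sup>2(\<partial>\<Omega>)\<close>
  with respect to the \<open>H\<^sup>1\<close> norm.\<close>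

definition has_trace :: "R3 set \<Rightarrow> vfield \<Rightarrow> vfield \<Rightarrow> bool" where
  "has_trace \<Omega> u g \<longleftrightarrow> u \<in> H1 \<Omega> \<and> g \<in> L2 (surface_measure \<Omega>) \<and>
     (\<exists>w. (\<forall>n::nat. w n \<in> smooth_closure \<Omega>) \<and>
          (\<lambda>n. H1_norm \<Omega> (w n - u)) \<longlonglongrightarrow> 0 \<and>
          (\<lambda>n. L2_norm (surface_measure \<Omega>) (w n - g)) \<longlonglongrightarrow> 0)"

text \<open>A normed space is given by its carrier \<open>X\<close> and its norm \<open>N\<close>. Strong measurability
  means being an almost everywhere limit of measurable functions with finitely many values.\<close>

definition strongly_measurable ::
    "real set \<Rightarrow> 'v::minus set \<Rightarrow> ('v \<Rightarrow> real) \<Rightarrow> (real \<Rightarrow> 'v) \<Rightarrow> bool" where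
  "strongly_measurable I X N f \<longleftrightarrow>
     (\<exists>s. (\<forall>n::nat. finite (s n ` I) \<and> s n ` I \<subseteq> X \<and> (\<forall>y. {t\<in>I. s n t = y} \<in> sets lebesgue)) \<and>
          (AE t in lebesgue_on I. (\<lambda>n. N (f t - s n t)) \<longlonglongrightarrow> 0))"

definition bochner_Lp ::
    "real \<Rightarrow> real \<Rightarrow> 'v::minus set \<Rightarrow> ('v \<Rightarrow> real) \<Rightarrow> (real \<Rightarrow> 'v) set" where
  "bochner_Lp p T X N = {f. strongly_measurable {0<..<T} X N f \<and>
     (AE t in lebesgue_on {0<..<T}. f t \<in> X) \<and>
     integrable (lebesgue_on {0<..<T}) (\<lambda>t. N (f t) powr p)}"

definition dual_space :: "vfield set \<Rightarrow> (vfield \<Rightarrow> real) \<Rightarrow> (vfield \<Rightarrow> real) set" where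
  "dual_space X N = {l.
     (\<forall>v\<in>X. \<forall>w\<in>X. l (\<lambda>x. v x + w x) = l v + l w) \<and>
     (\<forall>c. \<forall>v\<in>X. l (\<lambda>x. c *\<^sub>R v x) = c * l v) \<and>
     (\<exists>B. \<forall>v\<in>X. \<bar>l v\<bar> \<le> B * N v)}"

definition dual_norm :: "vfield set \<Rightarrow> (vfield \<Rightarrow> real) \<Rightarrow> (vfield \<Rightarrow> real) \<Rightarrow> real" where
  "dual_norm X N l = Sup {\<bar>l v\<bar> |v. v \<in> X \<and> N v \<le> 1}"

definition weakly_continuous :: "R3 set \<Rightarrow> real \<Rightarrow> (real \<Rightarrow> vfield) \<Rightarrow> bool" where
  "weakly_continuous \<Omega> T u \<longleftrightarrow> (\<forall>t\<in>{0..T}. u t \<in> L2_sigma_tan \<Omega>) \<and>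
     (\<forall>w\<in>L2_sigma_tan \<Omega>. continuous_on {0..T} (\<lambda>t. L2_inner (lebesgue_on \<Omega>) (u t) w))"

text \<open>The distributional time derivative of \<open>u\<close>, where \<open>L\<^sup>2\<close> is embedded in the dual of
  \<open>H1_sigma_tan \<Omega>\<close> by the \<open>L\<^sup>2\<close> inner product.\<close>

definition has_time_derivative ::
    "R3 set \<Rightarrow> real \<Rightarrow> (real \<Rightarrow> vfield) \<Rightarrow> (real \<Rightarrow> vfield \<Rightarrow> real) \<Rightarrow> bool" where
  "has_time_derivative \<Omega> T u u' \<longleftrightarrow>
     (\<forall>\<phi>\<in>test_functions {0<..<T}. \<forall>w\<in>H1_sigma_tan \<Omega>.
        (\<integral>t. deriv \<phi> t * L2_inner (lebesgue_on \<Omega>) (u t) w \<partial>lebesgue_on {0<..<T})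
          = - (\<integral>t. \<phi> t * u' t w \<partial>lebesgue_on {0<..<T}))"

text \<open>\<open>v \<in> C\<^sub>c\<^sup>1([0,T); H1_sigma_tan \<Omega>)\<close> with time derivative \<open>v'\<close>.\<close>

definition C1c_test ::
    "R3 set \<Rightarrow> real \<Rightarrow> (real \<Rightarrow> vfield) \<Rightarrow> (real \<Rightarrow> vfield) \<Rightarrow> bool" where
  "C1c_test \<Omega> T v v' \<longleftrightarrow>
     (\<forall>t\<in>{0..<T}. v t \<in> H1_sigma_tan \<Omega> \<and> v' t \<in> H1_sigma_tan \<Omega> \<and>
        ((\<lambda>s. H1_norm \<Omega> (\<lambda>x. (v s x - v t x) /\<^sub>R (s - t) - v' t x)) \<longlongrightarrow> 0) (at t within {0..<T}) \<and>
        ((\<lambda>s. H1_norm \<Omega> (v' s - v' t)) \<longlongrightarrow> 0) (at t within {0..<T})) \<and>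
     (\<exists>T'<T. \<forall>t\<in>{0..<T}. T' < t \<longrightarrow> H1_norm \<Omega> (v t) = 0)"

text \<open>In the following definitions \<open>g t\<close> and \<open>h t\<close> are the boundary traces of \<open>u t\<close> and
  \<open>v t\<close>.\<close>

definition weak_formulation ::
    "R3 set \<Rightarrow> real \<Rightarrow> (R3 \<Rightarrow> real) \<Rightarrow> vfield \<Rightarrow> real \<Rightarrow> (real \<Rightarrow> vfield) \<Rightarrow> (real \<Rightarrow> vfield) \<Rightarrow> bool"
  where
  "weak_formulation \<Omega> \<nu> \<alpha> u0 T u g \<longleftrightarrow>
     (\<forall>v v' h. C1c_test \<Omega> T v v' \<and> (\<forall>t\<in>{0..<T}. has_trace \<Omega> (v t) (h t)) \<longrightarrow>
        - (\<integral>t. L2_inner (lebesgue_on \<Omega>) (u t) (v' t) \<partial>lebesgue_on {0<..<T})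
        + \<nu> * (\<integral>t. L2_inner (lebesgue_on \<Omega>) (weak_grad \<Omega> (u t)) (weak_grad \<Omega> (v t))
                 + (\<integral>x. \<alpha> x * (tangential \<Omega> x (g t x) \<bullet> tangential \<Omega> x (h t x))
                      \<partial>surface_measure \<Omega>)
                 - (\<integral>x. h t x \<bullet> gauss_differential \<Omega> x (g t x) \<partial>surface_measure \<Omega>)
               \<partial>lebesgue_on {0<..<T})
        + (\<integral>t. (\<integral>x. (weak_grad \<Omega> (u t) x *v u t x) \<bullet> v t x \<partial>lebesgue_on \<Omega>)
               \<partial>lebesgue_on {0<..<T})
        = L2_inner (lebesgue_on \<Omega>) u0 (v 0))"

definition energy_inequalities ::
    "R3 set \<Rightarrow> real \<Rightarrow> (R3 \<Rightarrow> real) \<Rightarrow> (real \<Rightarrow> vfield) \<Rightarrow> (real \<Rightarrow> vfield) \<Rightarrow> real \<Rightarrow> real \<Rightarrow> bool"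
  where
  "energy_inequalities \<Omega> \<nu> \<alpha> u g s t \<longleftrightarrow>
     1/2 * (L2_norm (lebesgue_on \<Omega>) (u t))\<^sup>2
       + \<nu> * (\<integral>\<tau>. (L2_norm (lebesgue_on \<Omega>) (weak_grad \<Omega> (u \<tau>)))\<^sup>2 \<partial>lebesgue_on {s..t})
     \<le> 1/2 * (L2_norm (lebesgue_on \<Omega>) (u s))\<^sup>2
       + \<nu> * (\<integral>\<tau>. (\<integral>x. (curvature_bound \<Omega> - \<alpha> x) * (norm (tangential \<Omega> x (g \<tau> x)))\<^sup>2
                   \<partial>surface_measure \<Omega>) \<partial>lebesgue_on {s..t})
     \<and>
     1/2 * (L2_norm (lebesgue_on \<Omega>) (u t))\<^sup>2
       + 2 * \<nu> * (\<integral>\<tau>. (L2_norm (lebesgue_on \<Omega>) (sym_grad \<Omega> (u \<tau>)))\<^sup>2 \<partial>lebesgue_on {s..t})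
     \<le> 1/2 * (L2_norm (lebesgue_on \<Omega>) (u s))\<^sup>2
       - \<nu> * (\<integral>\<tau>. (\<integral>x. \<alpha> x * (norm (tangential \<Omega> x (g \<tau> x)))\<^sup>2
                   \<partial>surface_measure \<Omega>) \<partial>lebesgue_on {s..t})"

text \<open>The trace of \<open>u t\<close> exists (by the trace theorem) for almost every \<open>t\<close>, namely whenever
  \<open>u t\<close> is in \<open>H1 \<Omega>\<close>; \<open>g\<close> only names it.\<close>

definition leray_hopf_solution ::
    "R3 set \<Rightarrow> real \<Rightarrow> (R3 \<Rightarrow> real) \<Rightarrow> vfield \<Rightarrow> (real \<Rightarrow> vfield) \<Rightarrow> bool" where
  "leray_hopf_solution \<Omega> \<nu> \<alpha> u0 u \<longleftrightarrow>
     (\<forall>T>0. u \<in> bochner_Lp 2 T (H1_sigma_tan \<Omega>) (H1_norm \<Omega>) \<and>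
        weakly_continuous \<Omega> T u \<and>
        (\<exists>u' \<in> bochner_Lp (4/3) T (dual_space (H1_sigma_tan \<Omega>) (H1_norm \<Omega>))
                   (dual_norm (H1_sigma_tan \<Omega>) (H1_norm \<Omega>)).
           has_time_derivative \<Omega> T u u')) \<and>
     (\<exists>g. (AE t in lebesgue_on {0..}. has_trace \<Omega> (u t) (g t)) \<and>
        (\<forall>T>0. weak_formulation \<Omega> \<nu> \<alpha> u0 T u g) \<and>
        (\<exists>S \<subseteq> {0..}. 0 \<in> S \<and> (AE t in lebesgue_on {0..}. t \<in> S) \<and>
           (\<forall>s\<in>S. \<forall>t\<ge>s. energy_inequalities \<Omega> \<nu> \<alpha> u g s t)))"

end

(* Korn's inequality turns the dissipation in the second energy inequality into a multiple of the
   energy, provided that the trace g of u(t) satisfies g = g_tan almost everywhere on the boundary,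
   that the dissipation is integrable in time, and that the norm of u(0) does not exceed that of u0.

   Traces are tangential: near a boundary point the set lies below a Lipschitz graph, and the integral
   over the set of a derivative in the direction b of the axis equals the integral over a cylinder
   of the boundary values, because a suitable Lipschitz function of compact support has a directional
   derivative with integral zero.  Replacing a direction e by the multiple of b with the same normal
   component gives the divergence theorem in the chart.  If smooth w converge to u in H^1, the integral
   of zeta (w.n)^2 over the surface equals the integral of w.grad(phi) + phi div w over the domain,
   with phi linear in w; both terms are small since u is solenoidal and tangential in the weak sense.
   The Hausdorff measure of a piece of the surface is bounded by the volume of the cylinder above
   and below it, which gives the trace inequality and transfers the previous statement to the surface.

   Integrability: the square roots of both dissipation terms are Lipschitz functions of u(t) in H^1.

   Initial value: test the weak formulation with cutoffs in time multiplied by u(t1), then let t1 tend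
   to 0.

   Decay: y(t) + int_s^t D <= y(s) with D >= c y is iterated backwards in s, which yields
   y(s) >= y(t) sum_k (c (t - s))^k / k!. *)
theory Submission
  imports Defs
begin

text \<open>The three provisos answer three mismatches. The Korn hypothesis involves the full trace
  \<open>g\<close>, the energy inequality only \<open>tangential \<Omega> x (g \<tau> x)\<close>.
  The integral of a non-integrable function is zero by convention, so an energy inequality without
  integrability would carry no information about the dissipation. And it starts from the value
  \<open>u 0\<close>, which is tied to \<open>u0\<close> only through the weak formulation. The
  energy inequality runs from almost every \<open>s\<close> to every later \<open>t\<close>, and the
  energy is not known to be continuous in time; hence \<open>t\<close> is kept fixed and the
  iteration varies the starting time. The rate arises as follows: doubling the energy inequality
  gives the dissipation 4 \<nu> |S|^2 + 2 \<nu> \<alpha> |g|^2, of which 2 \<nu> (|S|^2 + \<alpha>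
  |g|^2) is compared with the energy, so c = 2 \<nu> / C. In a chart, boundary integrals are written
  as volume integrals of F (P x) times a vertical probability density, with \<open>P\<close> the
  projection onto the surface along the axis. Hausdorff measure is bounded by these from above,
  which is the direction that carries over both an upper bound and a vanishing integral.\<close>

section \<open>Square-integrable functions\<close>

lemma L2_borel [measurable_dest]: "f \<in> L2 M \<Longrightarrow> f \<in> borel_measurable M"
  by (simp add: L2_def)

lemma L2_integrable_square: "f \<in> L2 M \<Longrightarrow> integrable M (\<lambda>x. (norm (f x))\<^sup>2)"
  by (simp add: L2_def)

lemma L2_I:
  assumes "f \<in> borel_measurable M" "integrable M h" "AE x in M. (norm (f x))\<^sup>2 \<le> h x"
  shows "f \<in> L2 M"
proof -
  have "integrable M (\<lambda>x. (norm (f x))\<^sup>2)"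
    using assms by (intro Bochner_Integration.integrable_bound[OF assms(2)]) auto
  then show ?thesis using assms by (simp add: L2_def)
qed

lemma L2_norm_nonneg [simp]: "0 \<le> L2_norm M f"
  by (simp add: L2_norm_def)

lemma L2_norm_power2: "(L2_norm M f)\<^sup>2 = (\<integral>x. (norm (f x))\<^sup>2 \<partial>M)"
  by (simp add: L2_norm_def)

lemma L2_scaleR: "f \<in> L2 M \<Longrightarrow> (\<lambda>x. c *\<^sub>R f x) \<in> L2 M"
  by (auto simp: L2_def power_mult_distrib)

lemma square_sum_le: "(norm (a + b :: 'a::real_normed_vector))\<^sup>2 \<le> 2 * (norm a)\<^sup>2 + 2 * (norm b)\<^sup>2"
proof -
  have "(norm (a + b))\<^sup>2 \<le> (norm a + norm b)\<^sup>2"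
    by (intro power_mono norm_triangle_ineq) auto
  also have "\<dots> \<le> 2 * (norm a)\<^sup>2 + 2 * (norm b)\<^sup>2"
    using sum_squares_bound[of "norm a" "norm b"] by (simp add: power2_sum)
  finally show ?thesis .
qed

lemma L2_add:
  assumes f: "f \<in> L2 M" and g: "g \<in> L2 M"
  shows "(\<lambda>x. f x + g x) \<in> L2 M"
  by (rule L2_I[where h="\<lambda>x. 2 * (norm (f x))\<^sup>2 + 2 * (norm (g x))\<^sup>2"])
     (use f g in \<open>auto simp: L2_def intro!: AE_I2 square_sum_le\<close>)

lemma L2_diff:
  assumes f: "f \<in> L2 M" and g: "g \<in> L2 M"
  shows "(\<lambda>x. f x - g x) \<in> L2 M"
  using L2_add[OF f L2_scaleR[OF g, of "-1"]] by simp

lemma integrable_L2_inner: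
  assumes f: "f \<in> L2 M" and g: "g \<in> L2 M"
  shows "integrable M (\<lambda>x. f x \<bullet> g x)"
proof (rule Bochner_Integration.integrable_bound[of M "\<lambda>x. (norm (f x))\<^sup>2 + (norm (g x))\<^sup>2"])
  show "integrable M (\<lambda>x. (norm (f x))\<^sup>2 + (norm (g x))\<^sup>2)"
    using f g by (simp add: L2_def)
  show "(\<lambda>x. f x \<bullet> g x) \<in> borel_measurable M"
    using f g by (auto simp: L2_def)
  have "\<bar>f x \<bullet> g x\<bar> \<le> (norm (f x))\<^sup>2 + (norm (g x))\<^sup>2" for x
  proof -
    have "\<bar>f x \<bullet> g x\<bar> \<le> norm (f x) * norm (g x)" by (rule Cauchy_Schwarz_ineq2)
    also have "\<dots> \<le> (norm (f x))\<^sup>2 + (norm (g x))\<^sup>2"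
      using sum_squares_bound[of "norm (f x)" "norm (g x)"]
        mult_nonneg_nonneg[OF norm_ge_zero[of "f x"] norm_ge_zero[of "g x"]] by linarith
    finally show ?thesis .
  qed
  then show "AE x in M. norm (f x \<bullet> g x) \<le> norm ((norm (f x))\<^sup>2 + (norm (g x))\<^sup>2)"
    by auto
qed

lemma L2_norm_add_power2:
  assumes f: "f \<in> L2 M" and g: "g \<in> L2 M"
  shows "(L2_norm M (\<lambda>x. f x + t *\<^sub>R g x))\<^sup>2
    = (L2_norm M f)\<^sup>2 + 2 * t * L2_inner M f g + t\<^sup>2 * (L2_norm M g)\<^sup>2"
proof -
  have "(norm (f x + t *\<^sub>R g x))\<^sup>2 = (norm (f x))\<^sup>2 + 2 * t * (f x \<bullet> g x) + t\<^sup>2 * (norm (g x))\<^sup>2" for x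
    unfolding power2_norm_eq_inner
    by (simp add: inner_add_left inner_add_right inner_commute power2_eq_square algebra_simps)
  then show ?thesis
    using integrable_L2_inner[OF f g] f g
    by (simp add: L2_norm_power2 L2_inner_def L2_def)
qed

text \<open>The minimum over \<open>t\<close> is attained at \<open>- Q / R\<close>. The degenerate
  case \<open>R = 0\<close> occurs because \<open>L2_norm\<close> is only a seminorm on
  functions.\<close>

lemma quadratic_nonneg_discriminant:
  fixes P Q R :: real
  assumes "\<And>t. 0 \<le> P + 2 * t * Q + t\<^sup>2 * R" "0 \<le> R"
  shows "Q\<^sup>2 \<le> P * R"
proof (cases "R = 0")
  case True
  have "Q = 0"
  proof (rule ccontr)
    assume "Q \<noteq> 0"
    \<comment> \<open>At this \<open>t\<close> the assumed nonnegative expression takes the value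
      -1.\<close>
    then show False using assms(1)[of "- (P + 1) / (2 * Q)"] True by (simp add: field_simps)
  qed
  then show ?thesis using True by simp
next
  case False
  then have "0 < R" using assms by simp
  then show ?thesis using assms(1)[of "- Q / R"]
    by (simp add: field_simps power2_eq_square)
qed

text \<open>The squared norm of f + t g is a nonnegative quadratic polynomial in t, so its
  discriminant has a sign.\<close>

lemma L2_Cauchy_Schwarz:
  assumes f: "f \<in> L2 M" and g: "g \<in> L2 M"
  shows "\<bar>L2_inner M f g\<bar> \<le> L2_norm M f * L2_norm M g"
proof -
  have "(L2_inner M f g)\<^sup>2 \<le> (L2_norm M f)\<^sup>2 * (L2_norm M g)\<^sup>2"
  proof (rule quadratic_nonneg_discriminant)
    show "0 \<le> (L2_norm M f)\<^sup>2 + 2 * t * L2_inner M f g + t\<^sup>2 * (L2_norm M g)\<^sup>2" for t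
      by (metis L2_norm_add_power2[OF f g] zero_le_power2)
  qed simp
  then show ?thesis
    by (metis power_mult_distrib L2_norm_nonneg mult_nonneg_nonneg power2_abs power2_le_imp_le)
qed

lemma L2_norm_add_le:
  assumes f: "f \<in> L2 M" and g: "g \<in> L2 M"
  shows "L2_norm M (\<lambda>x. f x + g x) \<le> L2_norm M f + L2_norm M g"
proof (rule power2_le_imp_le)
  have "(L2_norm M (\<lambda>x. f x + g x))\<^sup>2 = (L2_norm M f)\<^sup>2 + 2 * L2_inner M f g + (L2_norm M g)\<^sup>2"
    using L2_norm_add_power2[OF f g, of 1] by simp
  also have "\<dots> \<le> (L2_norm M f + L2_norm M g)\<^sup>2"
    using L2_Cauchy_Schwarz[OF f g] by (simp add: power2_sum)
  finally show "(L2_norm M (\<lambda>x. f x + g x))\<^sup>2 \<le> (L2_norm M f + L2_norm M g)\<^sup>2" .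
qed simp

lemma L2_norm_scaleR: "L2_norm M (\<lambda>x. c *\<^sub>R f x) = \<bar>c\<bar> * L2_norm M f"
  by (simp add: L2_norm_def power_mult_distrib real_sqrt_mult)

lemma L2_norm_minus_commute: "L2_norm M (\<lambda>x. f x - g x) = L2_norm M (\<lambda>x. g x - f x)"
  by (simp add: L2_norm_def norm_minus_commute)

lemma L2_norm_diff_ge:
  assumes f: "f \<in> L2 M" and g: "g \<in> L2 M"
  shows "\<bar>L2_norm M f - L2_norm M g\<bar> \<le> L2_norm M (\<lambda>x. f x - g x)"
  using L2_norm_add_le[OF L2_diff[OF f g] g] L2_norm_add_le[OF L2_diff[OF g f] f]
    L2_norm_minus_commute[of M f g] by simp

lemma L2_norm_cong_AE:
  assumes "f \<in> borel_measurable M" "g \<in> borel_measurable M" "AE x in M. f x = g x"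
  shows "L2_norm M f = L2_norm M g"
  unfolding L2_norm_def using assms by (intro arg_cong[where f=sqrt] integral_cong_AE) auto

lemma L2_norm_mono:
  assumes "f \<in> borel_measurable M" "g \<in> L2 M" "AE x in M. norm (f x) \<le> c * norm (g x)" "0 \<le> c"
  shows "L2_norm M f \<le> c * L2_norm M g"
proof -
  have sq: "AE x in M. (norm (f x))\<^sup>2 \<le> c\<^sup>2 * (norm (g x))\<^sup>2"
    using assms(3) by eventually_elim (metis norm_ge_zero power_mono power_mult_distrib)
  have "f \<in> L2 M"
    by (rule L2_I[where h="\<lambda>x. c\<^sup>2 * (norm (g x))\<^sup>2"]) (use assms sq in \<open>auto simp: L2_def\<close>)
  then have "(L2_norm M f)\<^sup>2 \<le> (c * L2_norm M g)\<^sup>2"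
    using sq assms unfolding power_mult_distrib L2_norm_power2
    by (subst integral_mult_right_zero[symmetric], intro integral_mono_AE) (auto simp: L2_def)
  then show ?thesis using assms(4) by (meson L2_norm_nonneg mult_nonneg_nonneg power2_le_imp_le)
qed

lemma L2_mono:
  assumes "f \<in> borel_measurable M" "g \<in> L2 M" "AE x in M. norm (f x) \<le> c * norm (g x)"
  shows "f \<in> L2 M"
proof -
  have sq: "AE x in M. (norm (f x))\<^sup>2 \<le> c\<^sup>2 * (norm (g x))\<^sup>2"
    using assms(3) by eventually_elim (metis norm_ge_zero power_mono power_mult_distrib)
  show ?thesis
    by (rule L2_I[where h="\<lambda>x. c\<^sup>2 * (norm (g x))\<^sup>2"]) (use assms sq in \<open>auto simp: L2_def\<close>)
qed

lemma L2_bounded: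
  assumes "finite_measure M" "f \<in> borel_measurable M" "\<And>x. x \<in> space M \<Longrightarrow> norm (f x) \<le> B"
  shows "f \<in> L2 M"
proof -
  interpret finite_measure M by fact
  show ?thesis
    by (rule L2_I[where h="\<lambda>_. B\<^sup>2"]) (use assms in \<open>auto intro!: AE_I2 power_mono\<close>)
qed

lemma L2_imp_integrable:
  assumes "finite_measure M" "f \<in> L2 M"
  shows "integrable M f"
proof -
  interpret finite_measure M by fact
  have "norm (f x) \<le> 1 + (norm (f x))\<^sup>2" for x
    using sum_squares_bound[of 1 "norm (f x)"] norm_ge_zero[of "f x"] unfolding one_power2 by linarith
  then have "AE x in M. norm (f x) \<le> norm (1 + (norm (f x))\<^sup>2)"
    by (intro AE_I2) (simp add: abs_of_nonneg)
  moreover have "integrable M (\<lambda>x. 1 + (norm (f x))\<^sup>2)"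
    using assms(2) by (simp add: L2_def)
  ultimately show ?thesis
    using Bochner_Integration.integrable_bound L2_borel[OF assms(2)] by blast
qed

lemma L2_nth:
  fixes f :: "'a \<Rightarrow> real^'n"
  assumes "f \<in> L2 M" shows "(\<lambda>x. f x $ i) \<in> L2 M"
proof (rule L2_mono[OF _ assms, where c=1])
  have "(\<lambda>x. f x \<bullet> axis i 1) \<in> borel_measurable M"
    using L2_borel[OF assms] by measurable
  then show "(\<lambda>x. f x $ i) \<in> borel_measurable M"
    by (simp add: inner_axis)
  show "AE x in M. norm (f x $ i) \<le> 1 * norm (f x)"
    by (intro AE_I2) (simp add: component_le_norm_cart)
qed

lemma L2_nth_nth:
  fixes f :: "'a \<Rightarrow> real^'n^'m"
  assumes "f \<in> L2 M" shows "(\<lambda>x. f x $ i $ j) \<in> L2 M"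
proof (rule L2_mono[OF _ assms, where c=1])
  have "(\<lambda>x. f x \<bullet> axis i (axis j 1)) \<in> borel_measurable M"
    using L2_borel[OF assms] by measurable
  then show "(\<lambda>x. f x $ i $ j) \<in> borel_measurable M"
    by (simp add: inner_axis)
  show "AE x in M. norm (f x $ i $ j) \<le> 1 * norm (f x)"
    by (metis (no_types, lifting) AE_I2 Finite_Cartesian_Product.norm_nth_le mult_1 order_trans)
qed

lemma L2_inner_diff_left:
  assumes "f \<in> L2 M" "g \<in> L2 M" "h \<in> L2 M"
  shows "L2_inner M (\<lambda>x. f x - g x) h = L2_inner M f h - L2_inner M g h"
  unfolding L2_inner_def inner_diff_left
  by (intro Bochner_Integration.integral_diff integrable_L2_inner assms)

section \<open>Smooth bump functions and the fundamental lemma of the calculus of variations\<close>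

text \<open>These are the functions p(1/s) exp(-1/s), continued by zero. Carrying the polynomial
  along makes the family closed under differentiation, so smoothness is an induction over the order
  for all p at once.\<close>

definition eflat :: "real poly \<Rightarrow> real \<Rightarrow> real" where
  "eflat p s = (if s > 0 then poly p (1 / s) * exp (- (1 / s)) else 0)"

lemma poly_times_exp_minus_tendsto_0: "((\<lambda>y::real. poly q y * exp (- y)) \<longlongrightarrow> 0) at_top"
proof -
  have "((\<lambda>y. \<Sum>i\<le>degree q. coeff q i * (y ^ i / exp y)) \<longlongrightarrow> (\<Sum>i\<le>degree q. coeff q i * 0)) at_top"
    by (intro tendsto_intros tendsto_power_div_exp_0)
  then show ?thesis
    by (simp add: poly_altdef sum_distrib_right exp_minus divide_inverse mult.assoc)
qed

text \<open>For positive s, the derivative of p(1/s) exp(-1/s) has the factor p - p' at 1/s divided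
  by s^2, whence the polynomial X^2 (p - p'). At 0 the right difference quotient is again a
  polynomial in 1/s times the exponential and tends to zero.\<close>

lemma eflat_has_real_derivative:
  "(eflat p has_real_derivative eflat ([:0, 0, 1:] * (p - pderiv p)) s) (at s)"
proof -
  consider "s > 0" | "s < 0" | "s = 0" by linarith
  then show ?thesis
  proof cases
    case 1
    have "((\<lambda>s. poly p (1 / s) * exp (- (1 / s))) has_real_derivative
        eflat ([:0, 0, 1:] * (p - pderiv p)) s) (at s)"
      using 1 by (auto intro!: derivative_eq_intros simp: eflat_def power2_eq_square field_simps)
    then show ?thesis
      by (rule has_field_derivative_transform_within_open[where S="{0<..}"]) (use 1 in \<open>auto simp: eflat_def\<close>)
  next
    case 2
    have "((\<lambda>s. 0) has_real_derivative eflat ([:0, 0, 1:] * (p - pderiv p)) s) (at s)"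
      using 2 by (simp add: eflat_def)
    then show ?thesis
      by (rule has_field_derivative_transform_within_open[where S="{..<0}"]) (use 2 in \<open>auto simp: eflat_def\<close>)
  next
    case 3
    have right: "((\<lambda>h. eflat p h / h) \<longlongrightarrow> 0) (at_right 0)"
    proof -
      have "((\<lambda>h. poly ([:0, 1:] * p) (inverse h) * exp (- inverse h)) \<longlongrightarrow> 0) (at_right (0::real))"
        by (rule filterlim_compose[OF poly_times_exp_minus_tendsto_0 filterlim_inverse_at_top_right])
      moreover have "\<forall>\<^sub>F h in at_right (0::real).
          poly ([:0, 1:] * p) (inverse h) * exp (- inverse h) = eflat p h / h"
        by (rule eventually_at_rightI[of 0 1]) (auto simp: eflat_def field_simps)
      ultimately show ?thesis
        by (rule Lim_transform_eventually)
    qed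
    have left: "((\<lambda>h. eflat p h / h) \<longlongrightarrow> 0) (at_left 0)"
    proof (rule Lim_transform_eventually[OF tendsto_const])
      show "\<forall>\<^sub>F h in at_left (0::real). 0 = eflat p h / h"
        by (rule eventually_at_leftI[of "-1"]) (auto simp: eflat_def)
    qed
    have "((\<lambda>h. eflat p h / h) \<longlongrightarrow> 0) (at 0)"
      using left right by (simp add: filterlim_split_at)
    then show ?thesis
      using 3 by (simp add: DERIV_def eflat_def)
  qed
qed

text \<open>The inner derivative \<open>d * b $ i\<close> is a constant and is absorbed into the
  polynomial by \<open>smult\<close>; the induction hypothesis for arbitrary \<open>p\<close> then
  applies to the derivative as it stands.\<close>

lemma Ck_on_eflat: "Ck_on k UNIV (\<lambda>x::R3. eflat p (c + d * x $ i))"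
proof (induction k arbitrary: p)
  case 0
  have "isCont (eflat p) s" for s
    using eflat_has_real_derivative DERIV_isCont by blast
  then have "continuous_on UNIV (eflat p)"
    by (simp add: continuous_at_imp_continuous_on)
  then show ?case
    unfolding Ck_on.simps
    by (rule continuous_on_compose2) (auto intro!: continuous_intros)
next
  case (Suc k)
  let ?q = "[:0, 0, 1:] * (p - pderiv p)"
  have D: "((\<lambda>x::R3. eflat p (c + d * x $ i)) has_derivative
      (\<lambda>h. eflat ?q (c + d * x $ i) * (d * h $ i))) (at x)" for x :: R3
  proof -
    have "((\<lambda>x::R3. c + d * x $ i) has_derivative (\<lambda>h. d * h $ i)) (at x)"
      by (auto intro!: derivative_eq_intros bounded_linear_imp_has_derivative bounded_linear_vec_nth)
    from has_derivative_compose[OF this eflat_has_real_derivative[unfolded has_field_derivative_def]]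
    show ?thesis by (simp add: mult.commute)
  qed
  have "frechet_derivative (\<lambda>x::R3. eflat p (c + d * x $ i)) (at x) b
      = eflat (smult (d * b $ i) ?q) (c + d * x $ i)" for x b :: R3
    unfolding frechet_derivative_at[OF D, symmetric] by (simp add: eflat_def)
  then show ?case
    using D Suc.IH by (auto simp: differentiable_def)
qed

section \<open>Closure of C^k under sums and products\<close>

lemma Ck_on_const: "Ck_on k UNIV (\<lambda>x. c)"
proof (induction k arbitrary: c)
  case (Suc k)
  then show ?case by (simp add: frechet_derivative_const)
qed simp

lemma Ck_on_SucD:
  fixes f :: "'a::euclidean_space \<Rightarrow> 'b::real_normed_vector"
  assumes "Ck_on (Suc k) S f" shows "Ck_on k S f"
  using assms
proof (induction k arbitrary: f)
  case 0
  then show ?case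
    by (auto intro!: continuous_at_imp_continuous_on differentiable_imp_continuous_within)
next
  case (Suc k)
  then show ?case by (metis Ck_on.simps(2))
qed

lemma Ck_on_add:
  assumes "Ck_on k UNIV f" "Ck_on k UNIV g"
  shows "Ck_on k UNIV (\<lambda>x. f x + g x)"
  using assms
proof (induction k arbitrary: f g)
  case 0
  then show ?case by (auto intro: continuous_intros)
next
  case (Suc k)
  have "frechet_derivative (\<lambda>x. f x + g x) (at x)
      = (\<lambda>b. frechet_derivative f (at x) b + frechet_derivative g (at x) b)" for x
    using Suc.prems by (intro frechet_derivative_at[symmetric] has_derivative_add)
      (simp_all add: frechet_derivative_works[symmetric])
  then show ?case using Suc by auto
qed

lemma Ck_on_mult:
  fixes f g :: "'a::euclidean_space \<Rightarrow> real"
  assumes "Ck_on k UNIV f" "Ck_on k UNIV g"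
  shows "Ck_on k UNIV (\<lambda>x. f x * g x)"
  using assms
proof (induction k arbitrary: f g)
  case 0
  then show ?case by (auto intro: continuous_intros)
next
  case (Suc k)
  have "frechet_derivative (\<lambda>x. f x * g x) (at x)
      = (\<lambda>b. f x * frechet_derivative g (at x) b + frechet_derivative f (at x) b * g x)" for x
    using Suc.prems by (intro frechet_derivative_at[symmetric] has_derivative_mult)
      (simp_all add: frechet_derivative_works[symmetric])
  moreover have "Ck_on k UNIV (\<lambda>x. f x * frechet_derivative g (at x) b + frechet_derivative f (at x) b * g x)"
    if "b \<in> Basis" for b
    using Suc.prems that Ck_on_SucD[OF Suc.prems(1)] Ck_on_SucD[OF Suc.prems(2)]
    by (intro Ck_on_add Suc.IH) auto
  ultimately show ?case using Suc.prems by simp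
qed

lemma Ck_on_prod:
  fixes f :: "'i \<Rightarrow> 'a::euclidean_space \<Rightarrow> real"
  assumes "finite I" "\<And>i. i \<in> I \<Longrightarrow> Ck_on k UNIV (f i)"
  shows "Ck_on k UNIV (\<lambda>x. \<Prod>i\<in>I. f i x)"
  using assms by (induction I rule: finite_induct) (auto intro: Ck_on_const Ck_on_mult)

text \<open>The factor exp(-1/(m s)) tends to 1 for every s > 0 as \<open>m\<close> grows, so
  scaling the argument yields smooth functions, bounded by 1, that converge pointwise to the
  indicator of the open box.\<close>

definition box_bump :: "R3 \<Rightarrow> R3 \<Rightarrow> real \<Rightarrow> R3 \<Rightarrow> real" where
  "box_bump a b m x = (\<Prod>i\<in>UNIV. eflat 1 (m * (x $ i - a $ i)) * eflat 1 (m * (b $ i - x $ i)))"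

lemma eflat_1_bounds: "0 \<le> eflat 1 s" "eflat 1 s \<le> 1"
  by (auto simp: eflat_def)

lemma box_bump_bounds: "0 \<le> box_bump a b m x" "box_bump a b m x \<le> 1"
  unfolding box_bump_def
  by (auto intro!: prod_nonneg prod_le_1 mult_nonneg_nonneg mult_le_one eflat_1_bounds)

lemma smooth_box_bump: "smooth_on UNIV (box_bump a b m)"
proof -
  have "Ck_on k UNIV (\<lambda>x::R3. eflat 1 (- (m * a $ i) + m * x $ i) * eflat 1 (m * b $ i + (- m) * x $ i))" for k i
    by (intro Ck_on_mult Ck_on_eflat)
  then have "Ck_on k UNIV (\<lambda>x::R3. eflat 1 (m * (x $ i - a $ i)) * eflat 1 (m * (b $ i - x $ i)))" for k i
    by (simp add: algebra_simps)
  then show ?thesis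
    unfolding smooth_on_def box_bump_def[abs_def] by (auto intro!: Ck_on_prod)
qed

lemma box_bump_eq_0: "m \<ge> 0 \<Longrightarrow> x \<notin> box a b \<Longrightarrow> box_bump a b m x = 0"
proof -
  assume m: "m \<ge> 0" and "x \<notin> box a b"
  then obtain i where "x $ i \<le> a $ i \<or> b $ i \<le> x $ i"
    by (auto simp: mem_box_cart not_less)
  then have "m * (x $ i - a $ i) \<le> 0 \<or> m * (b $ i - x $ i) \<le> 0"
    using m by (auto simp: mult_le_0_iff)
  then have "eflat 1 (m * (x $ i - a $ i)) * eflat 1 (m * (b $ i - x $ i)) = 0"
    by (auto simp: eflat_def)
  then show "box_bump a b m x = 0"
    unfolding box_bump_def by (intro prod_zero) auto
qed

lemma box_bump_test_function:
  assumes "cbox a b \<subseteq> \<Omega>" "m \<ge> 0"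
  shows "box_bump a b m \<in> test_functions \<Omega>"
  unfolding test_functions_def using assms smooth_box_bump
  by (auto intro!: exI[of _ "cbox a b"] box_bump_eq_0 dest: set_mp[OF box_subset_cbox])

lemma box_bump_tendsto:
  "(\<lambda>n. box_bump a b (real n) x) \<longlonglongrightarrow> indicator (box a b) x"
proof (cases "x \<in> box a b")
  case True
  have lim: "(\<lambda>n. eflat 1 (real n * s)) \<longlonglongrightarrow> 1" if "s > 0" for s
  proof (rule Lim_transform_eventually)
    have "(\<lambda>n. exp (- (1 / s * (1 / real n)))) \<longlonglongrightarrow> exp (- (1 / s * 0))"
      by (intro tendsto_intros lim_1_over_n)
    then show "(\<lambda>n. exp (- (1 / s * (1 / real n)))) \<longlonglongrightarrow> 1" by simp
    show "\<forall>\<^sub>F n in sequentially. exp (- (1 / s * (1 / real n))) = eflat 1 (real n * s)"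
      using eventually_gt_at_top[of 0] by eventually_elim (use that in \<open>simp add: eflat_def field_simps\<close>)
  qed
  have "(\<lambda>n. box_bump a b (real n) x) \<longlonglongrightarrow> (\<Prod>i\<in>(UNIV::3 set). 1 * 1)"
    unfolding box_bump_def using True by (intro tendsto_prod tendsto_mult lim) (auto simp: mem_box_cart)
  then show ?thesis using True by simp
qed (simp add: box_bump_eq_0)

lemma finite_measure_bounded_open:
  fixes \<Omega> :: "'a::euclidean_space set"
  assumes "bounded \<Omega>" "open \<Omega>"
  shows "finite_measure (lebesgue_on \<Omega>)"
  using assms by (intro finite_measure_lebesgue_on bounded_set_imp_lmeasurable) auto

text \<open>Bump functions give vanishing integrals over all boxes whose closure lies in \<Omega>;
  Lebesgue differentiation over shrinking cubes then gives the pointwise values.\<close>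

lemma fundamental_lemma_variations:
  fixes f :: "R3 \<Rightarrow> real"
  assumes "open \<Omega>" and f: "integrable (lebesgue_on \<Omega>) f"
    and test: "\<And>\<phi>. \<phi> \<in> test_functions \<Omega> \<Longrightarrow> (\<integral>x. f x * \<phi> x \<partial>lebesgue_on \<Omega>) = 0"
  shows "AE x in lebesgue_on \<Omega>. f x = 0"
proof -
  let ?F = "\<lambda>x. indicator \<Omega> x *\<^sub>R f x"
  have meas\<Omega>: "\<Omega> \<in> sets lebesgue" using assms(1) by simp
  have F: "integrable lebesgue ?F"
    using f meas\<Omega> by (subst integrable_restrict_space[symmetric]) auto
  have F_on: "?F integrable_on cbox a b" for a b
    using F integrable_on_lebesgue integrable_on_subcbox by blast
  have box0: "integral (cbox a b) ?F = 0" if ab: "cbox a b \<subseteq> \<Omega>" for a b :: R3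
  proof -
    have "(\<lambda>n. \<integral>x. f x * box_bump a b (real n) x \<partial>lebesgue_on \<Omega>) \<longlonglongrightarrow>
        (\<integral>x. f x * indicator (box a b) x \<partial>lebesgue_on \<Omega>)"
    proof (rule integral_dominated_convergence[where w="\<lambda>x. \<bar>f x\<bar>"])
      show "(\<lambda>x. f x * indicator (box a b) x) \<in> borel_measurable (lebesgue_on \<Omega>)"
        using f by (intro borel_measurable_times borel_measurable_indicator)
          (auto simp: sets_restrict_space_iff intro!: image_eqI[where x="box a b"] simp: sets_restrict_space
            dest: set_mp[OF box_subset_cbox] set_mp[OF ab])
      show "(\<lambda>x. f x * box_bump a b (real n) x) \<in> borel_measurable (lebesgue_on \<Omega>)" for n
      proof -
        have "continuous_on UNIV (box_bump a b (real n))"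
          using smooth_box_bump[of a b "real n"] Ck_on.simps(1) unfolding smooth_on_def by blast
        then have "box_bump a b (real n) \<in> borel_measurable (lebesgue_on \<Omega>)"
          by (metis continuous_imp_measurable_on_sets_lebesgue continuous_on_subset meas\<Omega> subset_UNIV)
        then show ?thesis using f by (intro borel_measurable_times) auto
      qed
      show "AE x in lebesgue_on \<Omega>. (\<lambda>n. f x * box_bump a b (real n) x) \<longlonglongrightarrow> f x * indicator (box a b) x"
        by (intro AE_I2 tendsto_mult tendsto_const box_bump_tendsto)
      show "AE x in lebesgue_on \<Omega>. norm (f x * box_bump a b (real n) x) \<le> \<bar>f x\<bar>" for n
        using box_bump_bounds[of a b "real n"] by (intro AE_I2) (simp add: abs_mult mult_left_le)
    qed (use f in auto)
    moreover have "(\<integral>x. f x * box_bump a b (real n) x \<partial>lebesgue_on \<Omega>) = 0" for n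
      by (rule test[OF box_bump_test_function[OF ab]]) simp
    ultimately have 0: "(\<integral>x. f x * indicator (box a b) x \<partial>lebesgue_on \<Omega>) = 0"
      by (simp add: LIMSEQ_const_iff)
    have "(\<integral>x. f x * indicator (box a b) x \<partial>lebesgue_on \<Omega>) = (\<integral>x. indicator (box a b) x *\<^sub>R ?F x \<partial>lebesgue)"
      using meas\<Omega> by (subst integral_restrict_space) (auto simp: mult_ac)
    also have "\<dots> = integral (box a b) ?F"
    proof -
      have "set_integrable lebesgue (box a b) ?F"
        unfolding set_integrable_def by (rule integrable_mult_indicator[OF _ F]) simp
      from set_lebesgue_integral_eq_integral(2)[OF this]
      show ?thesis unfolding set_lebesgue_integral_def .
    qed
    finally show ?thesis using 0 by (simp add: integral_open_interval)
  qed
  \<comment> \<open>Lebesgue differentiation for cubes with lower corner \<open>x\<close>, outside a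
    negligible set.\<close>
  obtain N where N: "negligible N" and dens: "\<And>x e. \<lbrakk>x \<notin> N; 0 < e\<rbrakk> \<Longrightarrow>
      \<exists>d>0. \<forall>h. 0 < h \<and> h < d \<longrightarrow>
        norm (integral (cbox x (x + h *\<^sub>R One)) ?F /\<^sub>R h ^ DIM(R3) - ?F x) < e"
    using integrable_ccontinuous_explicit[of ?F] F_on by blast
  have "?F x = 0" if x: "x \<in> \<Omega>" "x \<notin> N" for x
  proof (rule ccontr)
    assume "?F x \<noteq> 0"
    then have "0 < norm (?F x)" by simp
    from dens[OF x(2) this] obtain d where d: "d > 0"
      "\<And>h. 0 < h \<Longrightarrow> h < d \<Longrightarrow> norm (integral (cbox x (x + h *\<^sub>R One)) ?F /\<^sub>R h ^ DIM(R3) - ?F x) < norm (?F x)"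
      by blast
    obtain r where r: "r > 0" "ball x r \<subseteq> \<Omega>"
      using assms(1) x(1) openE by blast
    \<comment> \<open>The second bound makes the diagonal of the cube shorter than \<open>r\<close>,
      so that the cube stays inside the ball.\<close>
    define h where "h = min (d / 2) (r / 2 / norm (One :: R3))"
    have One: "norm (One :: R3) > 0" by (simp only: zero_less_norm_iff One_neq_0 simp_thms)
    have h: "0 < h" "h < d" "h * norm (One :: R3) < r"
      using d(1) r(1) One by (auto simp: h_def min_def field_simps split: if_splits)
    have "cbox x (x + h *\<^sub>R One) \<subseteq> \<Omega>"
    proof
      fix y assume y: "y \<in> cbox x (x + h *\<^sub>R One)"
      have "norm (y - x) \<le> norm (h *\<^sub>R (One :: R3))"
      proof (rule norm_le_componentwise)
        fix b :: R3 assume b: "b \<in> Basis"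
        have "(h *\<^sub>R (One :: R3)) \<bullet> b = h" using b by (simp add: inner_sum_left_Basis)
        moreover have "x \<bullet> b \<le> y \<bullet> b" "y \<bullet> b \<le> x \<bullet> b + (h *\<^sub>R (One :: R3)) \<bullet> b"
          using y b unfolding mem_box inner_add_left by blast+
        ultimately show "\<bar>(y - x) \<bullet> b\<bar> \<le> \<bar>(h *\<^sub>R (One :: R3)) \<bullet> b\<bar>"
          by (simp only: inner_diff_left)
      qed
      also have "\<dots> < r" using h by (simp only: norm_scaleR abs_of_pos)
      finally have "y \<in> ball x r" by (simp add: dist_norm norm_minus_commute)
      then show "y \<in> \<Omega>" using r(2) by blast
    qed
    from box0[OF this] d(2)[OF h(1,2)] show False by simp
  qed
  moreover have "AE x in lebesgue. x \<notin> N"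
    using N by (intro AE_not_in) (simp add: negligible_iff_null_sets)
  ultimately have "AE x in lebesgue. x \<in> \<Omega> \<longrightarrow> f x = 0"
    by (auto elim!: eventually_mono)
  then show ?thesis
    using meas\<Omega> by (subst AE_restrict_space_iff) auto
qed

section \<open>Integrals of directional derivatives\<close>

lemma integrable_bounded_support:
  fixes f :: "'a::euclidean_space \<Rightarrow> real"
  assumes "f \<in> borel_measurable borel" "\<And>x. \<bar>f x\<bar> \<le> B" "\<And>x. norm x > R \<Longrightarrow> f x = 0"
  shows "integrable lborel f"
proof (rule Bochner_Integration.integrable_bound[of lborel "\<lambda>x. B * indicator (cball 0 R) x"])
  show "integrable lborel (\<lambda>x. B * indicator (cball (0::'a) R) x)"
    by (intro integrable_mult_right integrable_real_indicator)
      (use emeasure_bounded_finite[OF bounded_cball] in \<open>auto simp: infinity_ennreal_def\<close>)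
  have B: "0 \<le> B" using assms(2)[of 0] by linarith
  show "AE x in lborel. norm (f x) \<le> norm (B * indicator (cball 0 R) x)"
  proof (intro AE_I2)
    fix x show "norm (f x) \<le> norm (B * indicator (cball 0 R) x)"
      using assms(2,3)[of x] B by (cases "norm x > R") (auto simp: indicator_def)
  qed
qed (use assms in simp)

text \<open>Translation invariance makes every difference quotient integrate to zero, and the
  Lipschitz bound along \<open>b\<close> dominates them. Only right-hand derivatives are assumed,
  because the function built in \<open>vertical_divergence\<close> has kinks at the surface and at
  the ends of the cylinder.\<close>

lemma integral_directional_derivative:
  fixes Z D :: "'a::euclidean_space \<Rightarrow> real"
  assumes Z: "Z \<in> borel_measurable borel" "\<And>x. \<bar>Z x\<bar> \<le> B" "\<And>x. norm x > R \<Longrightarrow> Z x = 0"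
    and L: "\<And>x h. h \<ge> 0 \<Longrightarrow> \<bar>Z (x + h *\<^sub>R b) - Z x\<bar> \<le> L * h"
    and D: "\<And>x. ((\<lambda>h. (Z (x + h *\<^sub>R b) - Z x) / h) \<longlongrightarrow> D x) (at_right 0)"
  shows "integrable lborel D" "integral\<^sup>L lborel D = 0"
proof -
  have intZ: "integrable lborel Z" by (rule integrable_bounded_support[OF Z])
  let ?h = "\<lambda>n. inverse (real (Suc n))"
  let ?f = "\<lambda>n x. (Z (x + ?h n *\<^sub>R b) - Z x) / ?h n"
  have shift: "integrable lborel (\<lambda>x. Z (x + c))" "(\<integral>x. Z (x + c) \<partial>lborel) = (\<integral>x. Z x \<partial>lborel)" for c
  proof -
    have m: "(+) c \<in> measurable lborel borel" by simp
    have "integrable (distr lborel borel ((+) c)) Z" using intZ by (simp add: lborel_distr_plus)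
    then show "integrable lborel (\<lambda>x. Z (x + c))"
      by (subst (asm) integrable_distr_eq[OF m]) (use Z in \<open>auto simp: add.commute\<close>)
    have "(\<integral>x. Z x \<partial>lborel) = (\<integral>x. Z x \<partial>distr lborel borel ((+) c))" by (simp add: lborel_distr_plus)
    also have "\<dots> = (\<integral>x. Z (x + c) \<partial>lborel)"
      by (subst integral_distr[OF m]) (use Z in \<open>auto simp: add.commute\<close>)
    finally show "(\<integral>x. Z (x + c) \<partial>lborel) = (\<integral>x. Z x \<partial>lborel)" ..
  qed
  have int0: "(\<integral>x. ?f n x \<partial>lborel) = 0" for n
    using shift intZ by simp
  have h0: "?h \<longlonglongrightarrow> 0" by (rule LIMSEQ_inverse_real_of_nat)
  have "filterlim ?h (at_right 0) sequentially"
    using h0 by (auto simp: filterlim_at eventually_sequentially)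
  then have lim: "(\<lambda>n. ?f n x) \<longlonglongrightarrow> D x" for x
    using filterlim_compose[OF D] by fastforce
  have mf: "?f n \<in> borel_measurable lborel" for n
    using shift intZ by (intro borel_measurable_divide borel_measurable_diff) auto
  have mD: "D \<in> borel_measurable lborel"
    by (rule borel_measurable_LIMSEQ_real[OF lim mf])
  \<comment> \<open>The increments are at most 1, hence all quotients vanish beyond distance
    \<open>R + norm b\<close>.\<close>
  let ?w = "\<lambda>x. L * indicator (cball (0::'a) (R + norm b)) x"
  have L0: "0 \<le> L" using L[of 1 0] by (smt (verit) mult_cancel_left2)
  have bnd: "norm (?f n x) \<le> ?w x" for n x
  proof (cases "norm x \<le> R + norm b")
    case True
    have "\<bar>Z (x + ?h n *\<^sub>R b) - Z x\<bar> \<le> L * ?h n" by (rule L) simp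
    then have "norm (?f n x) \<le> L"
      by (simp add: abs_divide abs_mult divide_simps del: of_nat_Suc)
    then show ?thesis using True by simp
  next
    case False
    have "norm (?h n *\<^sub>R b) \<le> norm b"
      by (simp add: mult_left_le_one_le inverse_le_1_iff del: of_nat_Suc)
    then have "norm (x + ?h n *\<^sub>R b) > R" "norm x > R"
    proof -
      have "norm x \<le> norm (x + ?h n *\<^sub>R b) + norm (?h n *\<^sub>R b)"
        using norm_triangle_ineq4[of "x + ?h n *\<^sub>R b" "?h n *\<^sub>R b"] by simp
      with \<open>norm (?h n *\<^sub>R b) \<le> norm b\<close> False show "norm (x + ?h n *\<^sub>R b) > R" by linarith
      show "norm x > R" using False norm_ge_zero[of b] by linarith
    qed
    then have "Z (x + ?h n *\<^sub>R b) = 0" "Z x = 0" by (auto intro!: Z(3))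
    then show ?thesis using L0 by (simp add: indicator_def)
  qed
  have w: "integrable lborel ?w"
    by (intro integrable_mult_right integrable_real_indicator) (use emeasure_bounded_finite[OF bounded_cball] in \<open>auto simp: infinity_ennreal_def\<close>)
  show "integrable lborel D"
    by (rule integrable_dominated_convergence[where s="?f", OF mD mf w]) (use lim bnd in auto)
  have "(\<lambda>n. \<integral>x. ?f n x \<partial>lborel) \<longlonglongrightarrow> integral\<^sup>L lborel D"
    by (rule integral_dominated_convergence[where s="?f", OF mD mf w]) (use lim bnd in auto)
  then show "integral\<^sup>L lborel D = 0"
    unfolding int0 by (simp add: LIMSEQ_const_iff)
qed

text \<open>The direction comes before the point, so that \<open>dirderiv f v\<close> is itself a
  scalar field that can be differentiated and integrated.\<close>

definition dirderiv :: "('a::euclidean_space \<Rightarrow> real) \<Rightarrow> 'a \<Rightarrow> 'a \<Rightarrow> real" where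
  "dirderiv f v x = frechet_derivative f (at x) v"

text \<open>Only one derivative is demanded: the cutoffs used later come from
  \<open>neg_square\<close>, which is C^1 but not C^2. Differentiability is required on the whole
  space so that translation arguments apply.\<close>

definition C1c :: "'a::euclidean_space set \<Rightarrow> ('a \<Rightarrow> real) \<Rightarrow> bool" where
  "C1c U f \<longleftrightarrow> (\<forall>x. f differentiable (at x)) \<and> (\<forall>v. continuous_on UNIV (dirderiv f v)) \<and>
     (\<exists>K. compact K \<and> K \<subseteq> U \<and> (\<forall>x. x \<notin> K \<longrightarrow> f x = 0))"

lemma dirderiv_eqI: "(f has_derivative f') (at x) \<Longrightarrow> dirderiv f v x = f' v"
  by (simp add: dirderiv_def frechet_derivative_at[symmetric])

lemma has_derivative_dirderiv: "f differentiable (at x) \<Longrightarrow> (f has_derivative (\<lambda>v. dirderiv f v x)) (at x)"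
  by (simp add: dirderiv_def frechet_derivative_works)

lemma dirderiv_add:
  assumes "f differentiable (at x)" "g differentiable (at x)"
  shows "dirderiv (\<lambda>x. f x + g x) v x = dirderiv f v x + dirderiv g v x"
  by (rule dirderiv_eqI) (intro has_derivative_add has_derivative_dirderiv assms)

lemma dirderiv_mult:
  assumes "f differentiable (at x)" "g differentiable (at x)"
  shows "dirderiv (\<lambda>x. f x * g x) v x = f x * dirderiv g v x + dirderiv f v x * g x"
  by (rule dirderiv_eqI) (intro has_derivative_mult has_derivative_dirderiv assms)

lemma dirderiv_transform_open:
  assumes "open S" "x \<in> S" "\<And>y. y \<in> S \<Longrightarrow> f y = g y" "g differentiable (at x)"
  shows "f differentiable (at x)" "dirderiv f v x = dirderiv g v x"
proof -
  have "(f has_derivative (\<lambda>v. dirderiv g v x)) (at x)"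
    by (rule has_derivative_transform_within_open[OF has_derivative_dirderiv[OF assms(4)] assms(1,2)])
      (use assms(3) in auto)
  then show "f differentiable (at x)" "dirderiv f v x = dirderiv g v x"
    by (auto simp: differentiable_def dirderiv_eqI)
qed

lemma dirderiv_0_outside:
  assumes "compact K" "\<And>x. x \<notin> K \<Longrightarrow> f x = 0" "x \<notin> K"
  shows "dirderiv f v x = 0"
proof -
  have "dirderiv f v x = dirderiv (\<lambda>x. 0) v x"
    using assms by (intro dirderiv_transform_open(2)[where S="- K"]) (auto simp: compact_imp_closed open_Compl)
  also have "\<dots> = 0" by (rule dirderiv_eqI) simp
  finally show ?thesis .
qed

lemma continuous_compact_support_bounded:
  fixes f :: "'a::euclidean_space \<Rightarrow> real"
  assumes "continuous_on K f" "compact K" "\<And>x. x \<notin> K \<Longrightarrow> f x = 0"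
  obtains B where "\<And>x. \<bar>f x\<bar> \<le> B"
proof -
  have "bounded (f ` K)"
    using assms(1,2) compact_continuous_image compact_imp_bounded by blast
  then obtain B where B: "\<And>x. x \<in> K \<Longrightarrow> \<bar>f x\<bar> \<le> B" by (auto simp: bounded_iff)
  have "\<bar>f x\<bar> \<le> max B 0" for x using B[of x] assms(3)[of x] by (cases "x \<in> K") auto
  then show thesis by (rule that)
qed

text \<open>The bounds come from the compact support, the increment bound from the mean value
  theorem on the segment in direction \<open>v\<close>.\<close>

lemma C1c_bounds:
  fixes f :: "'a::euclidean_space \<Rightarrow> real"
  assumes "C1c U f"
  obtains B L R where "\<And>x. \<bar>f x\<bar> \<le> B" "\<And>x. norm x > R \<Longrightarrow> f x = 0"
    "\<And>x. norm x > R \<Longrightarrow> dirderiv f v x = 0"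
    "\<And>x. \<bar>dirderiv f v x\<bar> \<le> L" "\<And>x h. h \<ge> 0 \<Longrightarrow> \<bar>f (x + h *\<^sub>R v) - f x\<bar> \<le> L * h"
proof -
  obtain K where K: "compact K" "\<And>x. x \<notin> K \<Longrightarrow> f x = 0"
    and dif: "\<And>x. f differentiable (at x)" and cont: "continuous_on UNIV (dirderiv f v)"
    using assms unfolding C1c_def by blast
  have contf: "continuous_on K f"
    by (meson continuous_at_imp_continuous_on dif differentiable_imp_continuous_within)
  obtain B where B: "\<And>x. \<bar>f x\<bar> \<le> B" using continuous_compact_support_bounded[OF contf K] by blast
  have d0: "dirderiv f v x = 0" if "x \<notin> K" for x using dirderiv_0_outside[OF K that] .
  obtain L where L: "\<And>x. \<bar>dirderiv f v x\<bar> \<le> L"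
    using continuous_compact_support_bounded[OF continuous_on_subset[OF cont subset_UNIV] K(1) d0] by blast
  obtain R where R: "\<And>x. x \<in> K \<Longrightarrow> norm x \<le> R" using K(1) compact_imp_bounded bounded_iff by metis
  have lip: "\<bar>f (x + h *\<^sub>R v) - f x\<bar> \<le> L * h" if h: "h \<ge> 0" for x h
  proof (cases "h = 0")
    case False
    have "((\<lambda>t. f (x + t *\<^sub>R v)) has_real_derivative dirderiv f v (x + t *\<^sub>R v)) (at t)" for t
    proof -
      have "((\<lambda>t. x + t *\<^sub>R v) has_derivative (\<lambda>s. s *\<^sub>R v)) (at t)"
        by (auto intro!: derivative_eq_intros)
      from has_derivative_compose[OF this has_derivative_dirderiv[OF dif]]
      have "((\<lambda>t. f (x + t *\<^sub>R v)) has_derivative (\<lambda>s. dirderiv f (s *\<^sub>R v) (x + t *\<^sub>R v))) (at t)" .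
      moreover have "dirderiv f (s *\<^sub>R v) y = dirderiv f v y * s" for s y
        using linear_frechet_derivative[OF dif[of y]] by (simp add: dirderiv_def linear_scale)
      ultimately show ?thesis by (simp add: has_field_derivative_def)
    qed
    then obtain z where "f (x + h *\<^sub>R v) - f (x + 0 *\<^sub>R v) = (h - 0) * dirderiv f v (x + z *\<^sub>R v)"
      using MVT2[of 0 h "\<lambda>t. f (x + t *\<^sub>R v)"] h False by force
    then have "\<bar>f (x + h *\<^sub>R v) - f x\<bar> = \<bar>dirderiv f v (x + z *\<^sub>R v)\<bar> * h"
      using h by (simp add: abs_mult)
    then show ?thesis
      using mult_right_mono[OF L h] by simp
  qed simp
  show thesis
  proof (rule that[OF B _ _ L lip])
    fix x :: 'a assume "R < norm x"
    then have "x \<notin> K" using R[of x] by linarith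
    then show "f x = 0" "dirderiv f v x = 0" using K(2) d0 by auto
  qed
qed

lemma dirderiv_tendsto:
  assumes "f differentiable (at x)"
  shows "((\<lambda>h. (f (x + h *\<^sub>R v) - f x) / h) \<longlongrightarrow> dirderiv f v x) (at 0)"
proof -
  have "((\<lambda>t. x + t *\<^sub>R v) has_derivative (\<lambda>s. s *\<^sub>R v)) (at 0)"
    by (auto intro!: derivative_eq_intros)
  from has_derivative_compose[OF this, of f] has_derivative_dirderiv[OF assms]
  have "((\<lambda>t. f (x + t *\<^sub>R v)) has_derivative (\<lambda>s. dirderiv f (s *\<^sub>R v) x)) (at 0)" by simp
  moreover have "dirderiv f (s *\<^sub>R v) x = dirderiv f v x * s" for s
    using linear_frechet_derivative[OF assms] by (simp add: dirderiv_def linear_scale)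
  ultimately have "((\<lambda>t. f (x + t *\<^sub>R v)) has_real_derivative dirderiv f v x) (at 0)"
    by (simp add: has_field_derivative_def)
  then show ?thesis by (simp add: DERIV_def)
qed

lemma C1c_continuous: "C1c U f \<Longrightarrow> continuous_on S f"
  unfolding C1c_def by (meson continuous_at_imp_continuous_on differentiable_imp_continuous_within)

lemma C1c_integral:
  assumes "C1c U f"
  shows "integrable lborel (dirderiv f v)" "integral\<^sup>L lborel (dirderiv f v) = 0"
proof -
  obtain B L R where *: "\<And>x. \<bar>f x\<bar> \<le> B" "\<And>x. norm x > R \<Longrightarrow> f x = 0"
    "\<And>x h. h \<ge> 0 \<Longrightarrow> \<bar>f (x + h *\<^sub>R v) - f x\<bar> \<le> L * h"
    using C1c_bounds[OF assms] by metis
  have m: "f \<in> borel_measurable borel"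
    by (rule borel_measurable_continuous_onI[OF C1c_continuous[OF assms]])
  have t: "((\<lambda>h. (f (x + h *\<^sub>R v) - f x) / h) \<longlongrightarrow> dirderiv f v x) (at_right 0)" for x
    using dirderiv_tendsto[of f x v] assms unfolding C1c_def
    by (meson filterlim_at_split)
  show "integrable lborel (dirderiv f v)" "integral\<^sup>L lborel (dirderiv f v) = 0"
    using integral_directional_derivative[OF m * t] by auto
qed

text \<open>The second factor is C^1 only on \<open>V\<close>, typically a function of \<rho>. The
  product vanishes on the complement of the compact support of \<open>f\<close>, and this open set
  and \<open>V\<close> together cover the space.\<close>

lemma C1c_mult:
  assumes f: "C1c U f" and "open V" "U \<subseteq> V"
    and g: "\<And>x. x \<in> V \<Longrightarrow> g differentiable (at x)" "\<And>v. continuous_on V (dirderiv g v)"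
  shows "C1c U (\<lambda>x. f x * g x)"
    and "\<And>x v. x \<in> V \<Longrightarrow> dirderiv (\<lambda>x. f x * g x) v x = f x * dirderiv g v x + dirderiv f v x * g x"
proof -
  obtain K where K: "compact K" "K \<subseteq> U" "\<And>x. x \<notin> K \<Longrightarrow> f x = 0"
    and dif: "\<And>x. f differentiable (at x)" and cont: "\<And>v. continuous_on UNIV (dirderiv f v)"
    using f unfolding C1c_def by blast
  show inV: "dirderiv (\<lambda>x. f x * g x) v x = f x * dirderiv g v x + dirderiv f v x * g x"
    if "x \<in> V" for x v using dirderiv_mult[OF dif g(1)[OF that]] .
  have oK: "open (- K)" using compact_imp_closed[OF K(1)] by (simp add: open_Compl)
  have z: "(\<lambda>x. 0) differentiable (at x)" for x :: 'a by simp
  have out: "(\<lambda>x. f x * g x) differentiable (at x)" "dirderiv (\<lambda>x. f x * g x) v x = 0" if "x \<notin> K" for x v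
    using dirderiv_transform_open[OF oK, of x "\<lambda>x. f x * g x" "\<lambda>x. 0"] K(3) that
      dirderiv_eqI[of "\<lambda>x. 0" "\<lambda>x. 0" x v] by auto
  have cg: "continuous_on V g"
    by (meson continuous_at_imp_continuous_on g(1) differentiable_imp_continuous_within)
  have cV: "continuous_on V (dirderiv (\<lambda>x. f x * g x) v)" for v
    using inV by (subst continuous_on_cong[OF refl inV])
      (auto intro!: continuous_intros g(2) cg continuous_on_subset[OF cont] C1c_continuous[OF f])
  have cK: "continuous_on (- K) (dirderiv (\<lambda>x. f x * g x) v)" for v
    using out(2) by (subst continuous_on_cong[OF refl, where g="\<lambda>x. 0"]) auto
  have "continuous_on (V \<union> - K) (dirderiv (\<lambda>x. f x * g x) v)" for v
    by (rule continuous_on_open_Un[OF assms(2) oK cV cK])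
  moreover have "V \<union> - K = UNIV" using K(2) assms(3) by auto
  ultimately have "continuous_on UNIV (dirderiv (\<lambda>x. f x * g x) v)" for v by simp
  moreover have "(\<lambda>x. f x * g x) differentiable (at x)" for x
  proof (cases "x \<in> K")
    case True
    then have "x \<in> V" using K(2) assms(3) by auto
    then show ?thesis using dif[of x] g(1)[of x] by (intro differentiable_mult)
  qed (use out in auto)
  ultimately show "C1c U (\<lambda>x. f x * g x)"
    unfolding C1c_def using K by (auto intro!: exI[of _ K])
qed

section \<open>Weak gradients\<close>

definition C1_on :: "'a::euclidean_space set \<Rightarrow> ('a \<Rightarrow> real) \<Rightarrow> bool" where
  "C1_on U f \<longleftrightarrow> (\<forall>x\<in>U. f differentiable (at x)) \<and> (\<forall>v. continuous_on U (dirderiv f v))"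

lemma C1_on_D:
  assumes "C1_on U f"
  shows "x \<in> U \<Longrightarrow> f differentiable (at x)" "continuous_on U (dirderiv f v)" "continuous_on U f"
  using assms unfolding C1_on_def
  by (auto intro!: continuous_at_imp_continuous_on differentiable_imp_continuous_within)

lemma C1_on_subset: "C1_on U f \<Longrightarrow> V \<subseteq> U \<Longrightarrow> C1_on V f"
  unfolding C1_on_def by (blast intro: continuous_on_subset)

lemma dirderiv_linear:
  assumes "f differentiable (at x)"
  shows "dirderiv f v x = (\<Sum>b\<in>Basis. (v \<bullet> b) * dirderiv f b x)"
proof -
  have l: "linear (\<lambda>v. dirderiv f v x)"
    using linear_frechet_derivative[OF assms] by (simp add: dirderiv_def)
  have "dirderiv f v x = dirderiv f (\<Sum>b\<in>Basis. (v \<bullet> b) *\<^sub>R b) x" by (simp add: euclidean_representation)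
  also have "\<dots> = (\<Sum>b\<in>Basis. (v \<bullet> b) * dirderiv f b x)"
    by (simp add: linear_sum[OF l] linear_scale[OF l] del: euclidean_representation)
  finally show ?thesis .
qed

lemma dirderiv_axis:
  fixes f :: "real^'n \<Rightarrow> real"
  assumes "f differentiable (at x)"
  shows "dirderiv f v x = (\<Sum>i\<in>UNIV. v $ i * dirderiv f (axis i 1) x)"
proof -
  have l: "linear (\<lambda>v. dirderiv f v x)"
    using linear_frechet_derivative[OF assms] by (simp add: dirderiv_def)
  have "dirderiv f v x = dirderiv f (\<Sum>i\<in>UNIV. v $ i *\<^sub>R axis i 1) x"
    using basis_expansion[of v] by (simp add: scalar_mult_eq_scaleR)
  also have "\<dots> = (\<Sum>i\<in>UNIV. v $ i * dirderiv f (axis i 1) x)"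
    by (simp add: linear_sum[OF l] linear_scale[OF l] del: euclidean_representation)
  finally show ?thesis .
qed

lemma Ck_on_1_imp_C1_on:
  assumes "Ck_on (Suc 0) U f"
  shows "C1_on U f"
proof -
  have d: "\<forall>x\<in>U. f differentiable (at x)" and c: "\<And>b. b \<in> Basis \<Longrightarrow> continuous_on U (dirderiv f b)"
    using assms by (auto simp: dirderiv_def[abs_def])
  have "continuous_on U (dirderiv f v)" for v
    by (subst continuous_on_cong[OF refl dirderiv_linear[of f _ v]])
      (use c d in \<open>auto intro!: continuous_intros\<close>)
  then show ?thesis using d by (simp add: C1_on_def)
qed

lemma C1_on_cong:
  assumes "open U" "C1_on U g" "\<And>x. x \<in> U \<Longrightarrow> f x = g x"
  shows "C1_on U f"
proof -
  have *: "f differentiable (at x)" "dirderiv f v x = dirderiv g v x" if "x \<in> U" for x v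
    using dirderiv_transform_open[OF assms(1) that assms(3)] C1_on_D(1)[OF assms(2) that] by auto
  have "continuous_on U (dirderiv f v)" for v
    using C1_on_D(2)[OF assms(2)] by (subst continuous_on_cong[OF refl *(2)]) auto
  then show ?thesis using * by (auto simp: C1_on_def)
qed

lemma C1_on_const: "C1_on U (\<lambda>x. c)"
proof -
  have "dirderiv (\<lambda>x. c) v = (\<lambda>x. 0)" for v :: 'a
    by (rule ext) (rule dirderiv_eqI, simp)
  then show ?thesis by (simp add: C1_on_def)
qed

lemma C1_on_add: assumes "C1_on U f" "C1_on U g" shows "C1_on U (\<lambda>x. f x + g x)"
  unfolding C1_on_def
proof (intro conjI ballI allI)
  show "continuous_on U (dirderiv (\<lambda>x. f x + g x) v)" for v
    using C1_on_D[OF assms(1)] C1_on_D[OF assms(2)]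
    by (subst continuous_on_cong[OF refl dirderiv_add]) (auto intro!: continuous_intros)
qed (use C1_on_D(1)[OF assms(1)] C1_on_D(1)[OF assms(2)] in auto)

lemma C1_on_mult: assumes "C1_on U f" "C1_on U g" shows "C1_on U (\<lambda>x. f x * g x)"
  unfolding C1_on_def
proof (intro conjI ballI allI)
  show "continuous_on U (dirderiv (\<lambda>x. f x * g x) v)" for v
    using C1_on_D[OF assms(1)] C1_on_D[OF assms(2)]
    by (subst continuous_on_cong[OF refl dirderiv_mult]) (auto intro!: continuous_intros)
qed (use C1_on_D(1)[OF assms(1)] C1_on_D(1)[OF assms(2)] in auto)

lemma C1_on_sum: "(\<And>i. i \<in> I \<Longrightarrow> C1_on U (f i)) \<Longrightarrow> C1_on U (\<lambda>x. \<Sum>i\<in>I. f i x)"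
  by (induction I rule: infinite_finite_induct) (auto intro: C1_on_const C1_on_add)

lemma C1_on_inverse:
  assumes "C1_on U f" "\<And>x. x \<in> U \<Longrightarrow> f x \<noteq> 0"
  shows "C1_on U (\<lambda>x. inverse (f x))"
  unfolding C1_on_def
proof (intro conjI ballI allI)
  have d: "((\<lambda>x. inverse (f x)) has_derivative (\<lambda>v. - (inverse (f x) * dirderiv f v x * inverse (f x)))) (at x)"
    if "x \<in> U" for x
    using Deriv.has_derivative_inverse[OF assms(2)[OF that] has_derivative_dirderiv[OF C1_on_D(1)[OF assms(1) that]]] .
  show "(\<lambda>x. inverse (f x)) differentiable (at x)" if "x \<in> U" for x
    using d[OF that] by (auto simp: differentiable_def)
  show "continuous_on U (dirderiv (\<lambda>x. inverse (f x)) v)" for v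
    using C1_on_D[OF assms(1)] assms(2)
    by (subst continuous_on_cong[OF refl dirderiv_eqI[OF d]]) (auto intro!: continuous_intros)
qed

lemma C1c_mult_C1_on:
  assumes "C1c U f" "C1_on U g" "open U"
  shows "C1c U (\<lambda>x. f x * g x)"
  using C1c_mult(1)[OF assms(1,3) order_refl] C1_on_D[OF assms(2)] by blast

lemma smooth_on_imp_C1_on: "smooth_on U f \<Longrightarrow> C1_on U f"
  by (rule Ck_on_1_imp_C1_on) (metis smooth_on_def)

lemma smooth_on_dirderiv_C1_on:
  assumes "smooth_on U f" "open U"
  shows "C1_on U (dirderiv f v)"
proof -
  have 2: "Ck_on (Suc (Suc 0)) U f" using assms(1) smooth_on_def by blast
  have b: "C1_on U (dirderiv f b)" if "b \<in> Basis" for b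
    using 2 that by (intro Ck_on_1_imp_C1_on) (simp add: dirderiv_def[abs_def])
  have "dirderiv f v x = (\<Sum>b\<in>Basis. (v \<bullet> b) * dirderiv f b x)" if "x \<in> U" for x
    by (rule dirderiv_linear) (use 2 that in auto)
  moreover have "C1_on U (\<lambda>x. \<Sum>b\<in>Basis. (v \<bullet> b) * dirderiv f b x)"
    using b by (intro C1_on_sum C1_on_mult C1_on_const)
  ultimately show ?thesis by (rule C1_on_cong[OF assms(2), rotated])
qed

lemma smooth_on_nth:
  assumes "smooth_on UNIV (W :: vfield)"
  shows "C1_on UNIV (\<lambda>x. W x $ i)"
proof -
  have 1: "Ck_on (Suc 0) UNIV W" using assms by (metis smooth_on_def)
  have D: "((\<lambda>x. W x $ i) has_derivative (\<lambda>v. frechet_derivative W (at x) v $ i)) (at x)" for x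
    using 1 by (intro bounded_linear.has_derivative[OF bounded_linear_vec_nth])
      (simp add: frechet_derivative_works[symmetric])
  have "Ck_on (Suc 0) UNIV (\<lambda>x. W x $ i)"
    using 1 D by (auto simp: differentiable_def frechet_derivative_at[OF D, symmetric] intro!: continuous_intros)
  then show ?thesis by (rule Ck_on_1_imp_C1_on)
qed

definition jac :: "vfield \<Rightarrow> R3 \<Rightarrow> real^3^3" where
  "jac W x = (\<chi> i j. dirderiv (\<lambda>y. W y $ i) (axis j 1) x)"

lemma continuous_jac: "smooth_on UNIV W \<Longrightarrow> continuous_on S (jac W)"
  unfolding jac_def[abs_def]
  by (intro continuous_intros) (metis C1_on_D(2) continuous_on_subset smooth_on_nth subset_UNIV)

lemma continuous_smooth: "smooth_on UNIV W \<Longrightarrow> continuous_on S W"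
  by (metis Ck_on.simps(1) continuous_on_subset smooth_on_def subset_UNIV)

text \<open>The bridge between \<open>lebesgue_on\<close>, in which the definitions are stated, and
  \<open>lborel\<close>, in which translations and directional derivatives are handled.\<close>

lemma integral_lebesgue_on_open:
  fixes f :: "'a::euclidean_space \<Rightarrow> real"
  assumes "open \<Omega>" "f \<in> borel_measurable borel"
  shows "(\<integral>x. f x \<partial>lebesgue_on \<Omega>) = (\<integral>x. indicator \<Omega> x * f x \<partial>lborel)"
proof -
  have "(\<integral>x. f x \<partial>lebesgue_on \<Omega>) = (\<integral>x. indicator \<Omega> x *\<^sub>R f x \<partial>lebesgue)"
    using assms by (intro integral_restrict_space) auto
  also have "\<dots> = (\<integral>x. indicator \<Omega> x * f x \<partial>lborel)"
    using assms by (subst integral_completion) (auto intro!: borel_measurable_times borel_measurable_indicator)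
  finally show ?thesis .
qed

lemma continuous_on_closure_L2:
  fixes f :: "'a::euclidean_space \<Rightarrow> 'b::euclidean_space"
  assumes "open \<Omega>" "bounded \<Omega>" "continuous_on (closure \<Omega>) f"
  shows "f \<in> L2 (lebesgue_on \<Omega>)"
proof -
  have "compact (closure \<Omega>)" using assms(2) by (simp add: compact_closure)
  then have "bounded (f ` closure \<Omega>)" using assms(3) compact_continuous_image compact_imp_bounded by blast
  then obtain B where B: "\<And>x. x \<in> closure \<Omega> \<Longrightarrow> norm (f x) \<le> B" by (auto simp: bounded_iff)
  show ?thesis
  proof (rule L2_bounded[OF finite_measure_bounded_open[OF assms(2,1)]])
    show "f \<in> borel_measurable (lebesgue_on \<Omega>)"
      using assms by (intro continuous_imp_measurable_on_sets_lebesgue) (auto intro: continuous_on_subset[OF assms(3) closure_subset])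
    show "norm (f x) \<le> B" if "x \<in> space (lebesgue_on \<Omega>)" for x
      using that B closure_subset by fastforce
  qed
qed

lemma test_function_C1c: "\<phi> \<in> test_functions \<Omega> \<Longrightarrow> C1c \<Omega> \<phi>"
  using smooth_on_imp_C1_on[of UNIV \<phi>] by (auto simp: test_functions_def C1c_def C1_on_def)

lemma gradient_nth: "gradient \<phi> x $ j = dirderiv \<phi> (axis j 1) x"
  by (simp add: gradient_def dirderiv_def)

lemma C1c_inside_integral:
  fixes f :: "R3 \<Rightarrow> real"
  assumes "open \<Omega>" "C1c \<Omega> f"
  shows "(\<integral>x. dirderiv f v x \<partial>lebesgue_on \<Omega>) = 0"
proof -
  obtain K where K: "compact K" "K \<subseteq> \<Omega>" "\<And>x. x \<notin> K \<Longrightarrow> f x = 0"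
    using assms(2) unfolding C1c_def by blast
  have d0: "dirderiv f v x = 0" if "x \<notin> K" for x
    by (rule dirderiv_0_outside[OF K(1) _ that]) (rule K(3))
  have "indicator \<Omega> x * dirderiv f v x = dirderiv f v x" for x
    using d0[of x] K(2) by (auto simp: indicator_def)
  moreover have "dirderiv f v \<in> borel_measurable borel"
    using assms(2) unfolding C1c_def by (auto intro: borel_measurable_continuous_onI)
  ultimately show ?thesis
    by (simp only: integral_lebesgue_on_open[OF assms(1)] C1c_integral(2)[OF assms(2)])
qed

text \<open>The product of a test function and a component of \<open>W\<close> has compact support
  in \<Omega>, so its derivatives integrate to zero.\<close>

lemma has_weak_gradient_smooth:
  assumes "open \<Omega>" "bounded \<Omega>" "smooth_on UNIV W"
  shows "has_weak_gradient \<Omega> W (jac W)"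
  unfolding has_weak_gradient_def
proof (intro conjI ballI allI)
  show W: "W \<in> L2 (lebesgue_on \<Omega>)" and J: "jac W \<in> L2 (lebesgue_on \<Omega>)"
    using assms continuous_smooth continuous_jac by (auto intro!: continuous_on_closure_L2)
  fix \<phi> i j assume \<phi>: "\<phi> \<in> test_functions \<Omega>"
  note c = test_function_C1c[OF \<phi>] and w = smooth_on_nth[OF assms(3), of i]
  have cc: "C1c \<Omega> (\<lambda>x. \<phi> x * W x $ i)"
    by (rule C1c_mult_C1_on[OF c C1_on_subset[OF w] assms(1)]) simp
  have dd: "dirderiv (\<lambda>x. \<phi> x * W x $ i) (axis j 1) x = jac W x $ i $ j * \<phi> x + W x $ i * gradient \<phi> x $ j" for x
    using dirderiv_mult[of \<phi> x "\<lambda>x. W x $ i" "axis j 1"] c w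
    by (simp add: C1c_def C1_on_def jac_def gradient_nth)
  have g: "continuous_on UNIV (\<lambda>x. gradient \<phi> x $ j)"
    using c unfolding gradient_nth C1c_def by auto
  have phiL: "\<phi> \<in> L2 (lebesgue_on \<Omega>)" "(\<lambda>x. gradient \<phi> x $ j) \<in> L2 (lebesgue_on \<Omega>)"
    using assms g C1c_continuous[OF c] by (auto intro!: continuous_on_closure_L2 intro: continuous_on_subset)
  have int: "integrable (lebesgue_on \<Omega>) (\<lambda>x. jac W x $ i $ j * \<phi> x)"
      "integrable (lebesgue_on \<Omega>) (\<lambda>x. W x $ i * gradient \<phi> x $ j)"
    using integrable_L2_inner[OF L2_nth_nth[OF J] phiL(1)] integrable_L2_inner[OF L2_nth[OF W] phiL(2)]
    by simp_all
  have "(\<integral>x. jac W x $ i $ j * \<phi> x + W x $ i * gradient \<phi> x $ j \<partial>lebesgue_on \<Omega>) = 0"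
    using C1c_inside_integral[OF assms(1) cc, of "axis j 1"] unfolding dd .
  then show "(\<integral>x. W x $ i * gradient \<phi> x $ j \<partial>lebesgue_on \<Omega>) = - (\<integral>x. jac W x $ i $ j * \<phi> x \<partial>lebesgue_on \<Omega>)"
    using int by simp
qed

text \<open>Needed because a member of \<open>smooth_closure \<Omega>\<close> agrees with its smooth
  representative only on the closure of \<Omega>.\<close>

lemma has_weak_gradient_cong:
  assumes "open \<Omega>" "has_weak_gradient \<Omega> u G" "\<And>x. x \<in> \<Omega> \<Longrightarrow> u x = u' x"
  shows "has_weak_gradient \<Omega> u' G"
proof -
  have "u' \<in> borel_measurable (lebesgue_on \<Omega>) \<longleftrightarrow> u \<in> borel_measurable (lebesgue_on \<Omega>)"
    by (rule measurable_cong) (use assms(3) in simp)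
  moreover have "integrable (lebesgue_on \<Omega>) (\<lambda>x. (norm (u' x))\<^sup>2) \<longleftrightarrow> integrable (lebesgue_on \<Omega>) (\<lambda>x. (norm (u x))\<^sup>2)"
    by (rule Bochner_Integration.integrable_cong) (use assms(3) in auto)
  moreover have "(\<integral>x. u' x $ i * gradient \<phi> x $ j \<partial>lebesgue_on \<Omega>) = (\<integral>x. u x $ i * gradient \<phi> x $ j \<partial>lebesgue_on \<Omega>)" for \<phi> i j
    by (rule Bochner_Integration.integral_cong) (use assms(3) in auto)
  ultimately show ?thesis using assms(2) by (simp add: has_weak_gradient_def L2_def)
qed

lemma test_function_L2:
  assumes "open \<Omega>" "bounded \<Omega>" "\<phi> \<in> test_functions \<Omega>"
  shows "\<phi> \<in> L2 (lebesgue_on \<Omega>)" "(\<lambda>x. gradient \<phi> x $ j) \<in> L2 (lebesgue_on \<Omega>)"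
proof -
  note c = test_function_C1c[OF assms(3)]
  have g: "continuous_on UNIV (\<lambda>x. gradient \<phi> x $ j)"
    using c unfolding gradient_nth C1c_def by auto
  show "\<phi> \<in> L2 (lebesgue_on \<Omega>)" "(\<lambda>x. gradient \<phi> x $ j) \<in> L2 (lebesgue_on \<Omega>)"
    using assms g C1c_continuous[OF c] by (auto intro!: continuous_on_closure_L2 intro: continuous_on_subset)
qed

lemma has_weak_gradient_lincomb:
  assumes "open \<Omega>" "bounded \<Omega>" "has_weak_gradient \<Omega> u G" "has_weak_gradient \<Omega> v H"
  shows "has_weak_gradient \<Omega> (\<lambda>x. u x + c *\<^sub>R v x) (\<lambda>x. G x + c *\<^sub>R H x)"
  unfolding has_weak_gradient_def
proof (intro conjI ballI allI)
  have L: "u \<in> L2 (lebesgue_on \<Omega>)" "v \<in> L2 (lebesgue_on \<Omega>)" "G \<in> L2 (lebesgue_on \<Omega>)" "H \<in> L2 (lebesgue_on \<Omega>)"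
    using assms by (auto simp: has_weak_gradient_def)
  then show "(\<lambda>x. u x + c *\<^sub>R v x) \<in> L2 (lebesgue_on \<Omega>)" "(\<lambda>x. G x + c *\<^sub>R H x) \<in> L2 (lebesgue_on \<Omega>)"
    by (auto intro!: L2_add L2_scaleR)
  fix \<phi> i j assume \<phi>: "\<phi> \<in> test_functions \<Omega>"
  note phiL = test_function_L2[OF assms(1,2) \<phi>]
  have int: "integrable (lebesgue_on \<Omega>) (\<lambda>x. G x $ i $ j * \<phi> x)" "integrable (lebesgue_on \<Omega>) (\<lambda>x. H x $ i $ j * \<phi> x)"
      "integrable (lebesgue_on \<Omega>) (\<lambda>x. u x $ i * gradient \<phi> x $ j)" "integrable (lebesgue_on \<Omega>) (\<lambda>x. v x $ i * gradient \<phi> x $ j)"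
    using integrable_L2_inner[OF L2_nth_nth[OF L(3)] phiL(1)] integrable_L2_inner[OF L2_nth_nth[OF L(4)] phiL(1)]
      integrable_L2_inner[OF L2_nth[OF L(1)] phiL(2)] integrable_L2_inner[OF L2_nth[OF L(2)] phiL(2)]
    by simp_all
  have "(\<integral>x. (u x + c *\<^sub>R v x) $ i * gradient \<phi> x $ j \<partial>lebesgue_on \<Omega>)
      = (\<integral>x. u x $ i * gradient \<phi> x $ j \<partial>lebesgue_on \<Omega>) + c * (\<integral>x. v x $ i * gradient \<phi> x $ j \<partial>lebesgue_on \<Omega>)"
    using int by (simp add: distrib_right mult.assoc)
  also have "\<dots> = - (\<integral>x. G x $ i $ j * \<phi> x \<partial>lebesgue_on \<Omega>) - c * (\<integral>x. H x $ i $ j * \<phi> x \<partial>lebesgue_on \<Omega>)"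
    using assms(3,4) \<phi> by (simp add: has_weak_gradient_def)
  also have "\<dots> = - (\<integral>x. (G x + c *\<^sub>R H x) $ i $ j * \<phi> x \<partial>lebesgue_on \<Omega>)"
    using int by (simp add: distrib_right mult.assoc)
  finally show "(\<integral>x. (u x + c *\<^sub>R v x) $ i * gradient \<phi> x $ j \<partial>lebesgue_on \<Omega>)
      = - (\<integral>x. (G x + c *\<^sub>R H x) $ i $ j * \<phi> x \<partial>lebesgue_on \<Omega>)" .
qed

text \<open>Makes the choice in \<open>weak_grad\<close> irrelevant up to null sets.\<close>

lemma weak_gradient_unique:
  assumes "open \<Omega>" "bounded \<Omega>" "has_weak_gradient \<Omega> u G" "has_weak_gradient \<Omega> u H"
  shows "AE x in lebesgue_on \<Omega>. G x = H x"
proof -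
  have L: "G \<in> L2 (lebesgue_on \<Omega>)" "H \<in> L2 (lebesgue_on \<Omega>)"
    using assms by (auto simp: has_weak_gradient_def)
  have "AE x in lebesgue_on \<Omega>. G x $ i $ j - H x $ i $ j = 0" for i j
  proof (rule fundamental_lemma_variations[OF assms(1)])
    show "integrable (lebesgue_on \<Omega>) (\<lambda>x. G x $ i $ j - H x $ i $ j)"
      by (intro Bochner_Integration.integrable_diff L2_imp_integrable[OF finite_measure_bounded_open[OF assms(2,1)]] L2_nth_nth L)
    fix \<phi> assume \<phi>: "\<phi> \<in> test_functions \<Omega>"
    note phiL = test_function_L2[OF assms(1,2) \<phi>]
    have "(\<integral>x. G x $ i $ j * \<phi> x \<partial>lebesgue_on \<Omega>) = (\<integral>x. H x $ i $ j * \<phi> x \<partial>lebesgue_on \<Omega>)"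
    proof -
      have "(\<integral>x. u x $ i * gradient \<phi> x $ j \<partial>lebesgue_on \<Omega>) = - (\<integral>x. G x $ i $ j * \<phi> x \<partial>lebesgue_on \<Omega>)"
        "(\<integral>x. u x $ i * gradient \<phi> x $ j \<partial>lebesgue_on \<Omega>) = - (\<integral>x. H x $ i $ j * \<phi> x \<partial>lebesgue_on \<Omega>)"
        using assms(3,4) \<phi> unfolding has_weak_gradient_def by blast+
      then show ?thesis by linarith
    qed
    then show "(\<integral>x. (G x $ i $ j - H x $ i $ j) * \<phi> x \<partial>lebesgue_on \<Omega>) = 0"
      using integrable_L2_inner[OF L2_nth_nth[OF L(1), of i j] phiL(1)] integrable_L2_inner[OF L2_nth_nth[OF L(2), of i j] phiL(1)]
      by (simp add: left_diff_distrib)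
  qed
  then have "AE x in lebesgue_on \<Omega>. \<forall>i j. G x $ i $ j - H x $ i $ j = 0"
    by (simp add: AE_all_countable)
  then show ?thesis by eventually_elim (simp add: vec_eq_iff)
qed

section \<open>The space H^1 and its seminorm\<close>

lemma weak_grad_has_weak_gradient: "u \<in> H1 \<Omega> \<Longrightarrow> has_weak_gradient \<Omega> u (weak_grad \<Omega> u)"
  unfolding H1_def weak_grad_def using someI[of "has_weak_gradient \<Omega> u"] by blast

lemma H1_D:
  assumes "u \<in> H1 \<Omega>" shows "u \<in> L2 (lebesgue_on \<Omega>)" "weak_grad \<Omega> u \<in> L2 (lebesgue_on \<Omega>)"
  using weak_grad_has_weak_gradient[OF assms] by (auto simp: has_weak_gradient_def)

lemma weak_grad_eqI:
  assumes "open \<Omega>" "bounded \<Omega>" "has_weak_gradient \<Omega> u G"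
  shows "AE x in lebesgue_on \<Omega>. weak_grad \<Omega> u x = G x"
  using weak_gradient_unique[OF assms(1,2) weak_grad_has_weak_gradient assms(3)] assms(3) by (auto simp: H1_def)

text \<open>Since \<open>weak_grad\<close> is a choice, linearity holds almost everywhere only.
  Differences are the case \<open>c = -1\<close>, and multiples arise from \<open>v = u\<close> with
  \<open>c - 1\<close>.\<close>

lemma H1_lincomb:
  assumes "open \<Omega>" "bounded \<Omega>" "u \<in> H1 \<Omega>" "v \<in> H1 \<Omega>"
  shows "(\<lambda>x. u x + c *\<^sub>R v x) \<in> H1 \<Omega>"
    and "AE x in lebesgue_on \<Omega>. weak_grad \<Omega> (\<lambda>x. u x + c *\<^sub>R v x) x = weak_grad \<Omega> u x + c *\<^sub>R weak_grad \<Omega> v x"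
proof -
  note * = has_weak_gradient_lincomb[OF assms(1,2) weak_grad_has_weak_gradient[OF assms(3)]
      weak_grad_has_weak_gradient[OF assms(4)], of c]
  from * show "(\<lambda>x. u x + c *\<^sub>R v x) \<in> H1 \<Omega>" by (auto simp: H1_def)
  from weak_grad_eqI[OF assms(1,2) *]
  show "AE x in lebesgue_on \<Omega>. weak_grad \<Omega> (\<lambda>x. u x + c *\<^sub>R v x) x = weak_grad \<Omega> u x + c *\<^sub>R weak_grad \<Omega> v x" .
qed

lemma H1_diff:
  assumes "open \<Omega>" "bounded \<Omega>" "u \<in> H1 \<Omega>" "v \<in> H1 \<Omega>"
  shows "u - v \<in> H1 \<Omega>"
    and "AE x in lebesgue_on \<Omega>. weak_grad \<Omega> (u - v) x = weak_grad \<Omega> u x - weak_grad \<Omega> v x"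
  using H1_lincomb[OF assms, of "-1"] by (simp_all add: fun_diff_def)

lemma H1_scaleR:
  assumes "open \<Omega>" "bounded \<Omega>" "u \<in> H1 \<Omega>"
  shows "(\<lambda>x. c *\<^sub>R u x) \<in> H1 \<Omega>"
    and "AE x in lebesgue_on \<Omega>. weak_grad \<Omega> (\<lambda>x. c *\<^sub>R u x) x = c *\<^sub>R weak_grad \<Omega> u x"
  using H1_lincomb[OF assms(1,2,3,3), of "c - 1"] by (simp_all add: scaleR_left_diff_distrib)

lemma L2_norm_le_H1_norm: "L2_norm (lebesgue_on \<Omega>) u \<le> H1_norm \<Omega> u"
    "L2_norm (lebesgue_on \<Omega>) (weak_grad \<Omega> u) \<le> H1_norm \<Omega> u"
  by (simp_all add: H1_norm_def real_le_rsqrt)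

lemma H1_norm_nonneg [simp]: "0 \<le> H1_norm \<Omega> u"
  by (simp add: H1_norm_def)

lemma H1_norm_add_le:
  assumes \<Omega>: "open \<Omega>" "bounded \<Omega>" and u: "u \<in> H1 \<Omega>" and v: "v \<in> H1 \<Omega>"
  shows "H1_norm \<Omega> (\<lambda>x. u x + v x) \<le> H1_norm \<Omega> u + H1_norm \<Omega> v"
proof -
  note * = H1_lincomb[OF assms, of 1, simplified]
  have "L2_norm (lebesgue_on \<Omega>) (weak_grad \<Omega> (\<lambda>x. u x + v x))
      = L2_norm (lebesgue_on \<Omega>) (\<lambda>x. weak_grad \<Omega> u x + weak_grad \<Omega> v x)"
    using H1_D(2)[OF *(1)] H1_D(2)[OF u] H1_D(2)[OF v]
    by (intro L2_norm_cong_AE *(2)) (auto simp: L2_def)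
  also have "\<dots> \<le> L2_norm (lebesgue_on \<Omega>) (weak_grad \<Omega> u) + L2_norm (lebesgue_on \<Omega>) (weak_grad \<Omega> v)"
    by (intro L2_norm_add_le H1_D u v)
  finally have "H1_norm \<Omega> (\<lambda>x. u x + v x) \<le> sqrt ((L2_norm (lebesgue_on \<Omega>) u + L2_norm (lebesgue_on \<Omega>) v)\<^sup>2
      + (L2_norm (lebesgue_on \<Omega>) (weak_grad \<Omega> u) + L2_norm (lebesgue_on \<Omega>) (weak_grad \<Omega> v))\<^sup>2)"
    unfolding H1_norm_def using H1_D(1)[OF u] H1_D(1)[OF v]
    by (intro real_sqrt_le_mono add_mono power_mono L2_norm_add_le) auto
  also have "\<dots> \<le> H1_norm \<Omega> u + H1_norm \<Omega> v"
    unfolding H1_norm_def by (rule real_sqrt_sum_squares_triangle_ineq)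
  finally show ?thesis .
qed

lemma H1_norm_scaleR:
  assumes "open \<Omega>" "bounded \<Omega>" "u \<in> H1 \<Omega>"
  shows "H1_norm \<Omega> (\<lambda>x. c *\<^sub>R u x) = \<bar>c\<bar> * H1_norm \<Omega> u"
proof -
  note * = H1_scaleR[OF assms, of c]
  have "L2_norm (lebesgue_on \<Omega>) (weak_grad \<Omega> (\<lambda>x. c *\<^sub>R u x)) = \<bar>c\<bar> * L2_norm (lebesgue_on \<Omega>) (weak_grad \<Omega> u)"
    unfolding L2_norm_scaleR[symmetric] using H1_D(2)[OF *(1)] H1_D(2)[OF assms(3)]
    by (intro L2_norm_cong_AE *(2)) (auto simp: L2_def)
  then show ?thesis
    unfolding H1_norm_def L2_norm_scaleR power_mult_distrib
    by (simp add: distrib_left[symmetric] real_sqrt_mult power_mult_distrib)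
qed

lemma H1_norm_diff_commute:
  assumes "open \<Omega>" "bounded \<Omega>" "u \<in> H1 \<Omega>" "v \<in> H1 \<Omega>"
  shows "H1_norm \<Omega> (u - v) = H1_norm \<Omega> (v - u)"
  using H1_norm_scaleR[OF assms(1,2) H1_diff(1)[OF assms], of "-1"]
  by (simp add: fun_diff_def minus_diff_eq scaleR_minus_left)

lemma H1_norm_diff_triangle:
  assumes "open \<Omega>" "bounded \<Omega>" "u \<in> H1 \<Omega>" "v \<in> H1 \<Omega>" "w \<in> H1 \<Omega>"
  shows "H1_norm \<Omega> (u - w) \<le> H1_norm \<Omega> (u - v) + H1_norm \<Omega> (v - w)"
  using H1_norm_add_le[OF assms(1,2) H1_diff(1)[OF assms(1-4)] H1_diff(1)[OF assms(1,2,4,5)]]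
  by (simp add: fun_diff_def)

section \<open>The symmetric gradient\<close>

lemma norm_transpose: "norm (transpose (A :: real^3^3)) = norm A"
proof -
  have e: "(norm B)\<^sup>2 = (\<Sum>i\<in>UNIV. \<Sum>j\<in>UNIV. (B $ i $ j)\<^sup>2)" for B :: "real^3^3"
    unfolding power2_norm_eq_inner by (simp only: inner_vec_def power2_eq_square inner_real_def)
  have "(norm (transpose A))\<^sup>2 = (norm A)\<^sup>2"
    by (simp only: e transpose_def vec_lambda_beta) (rule sum.swap)
  then show ?thesis by simp
qed

lemma norm_symmetric_part_le: "norm ((1/2) *\<^sub>R (A + transpose A)) \<le> norm (A :: real^3^3)"
  using norm_triangle_ineq[of A "transpose A"] by (simp add: norm_transpose)

lemma symmetric_part_diff:
  "(1/2) *\<^sub>R ((A - B) + transpose (A - B)) = (1/2) *\<^sub>R (A + transpose A) - (1/2) *\<^sub>R (B + transpose (B :: real^3^3))"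
  by (simp add: transpose_def vec_eq_iff algebra_simps)

lemma borel_measurable_symmetric_part:
  assumes "G \<in> borel_measurable M"
  shows "(\<lambda>x. (1/2) *\<^sub>R (G x + transpose (G x :: real^3^3))) \<in> borel_measurable M"
proof -
  have "continuous_on UNIV (\<lambda>A::real^3^3. (1/2) *\<^sub>R (A + transpose A))"
    unfolding transpose_def by (intro continuous_intros)
  from borel_measurable_continuous_on[OF this assms] show ?thesis .
qed

lemma sym_grad_L2:
  assumes "u \<in> H1 \<Omega>" shows "sym_grad \<Omega> u \<in> L2 (lebesgue_on \<Omega>)"
proof (rule L2_mono[where c=1, OF _ H1_D(2)[OF assms]])
  show "sym_grad \<Omega> u \<in> borel_measurable (lebesgue_on \<Omega>)"
    unfolding sym_grad_def[abs_def] by (rule borel_measurable_symmetric_part[OF L2_borel[OF H1_D(2)[OF assms]]])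
  show "AE x in lebesgue_on \<Omega>. norm (sym_grad \<Omega> u x) \<le> 1 * norm (weak_grad \<Omega> u x)"
    unfolding sym_grad_def mult_1 by (intro AE_I2 norm_symmetric_part_le)
qed

text \<open>Provides measurability in time of the interior dissipation, via
  \<open>strongly_measurable_Lipschitz_functional\<close>.\<close>

lemma sym_grad_Lipschitz:
  assumes "open \<Omega>" "bounded \<Omega>" "u \<in> H1 \<Omega>" "v \<in> H1 \<Omega>"
  shows "\<bar>L2_norm (lebesgue_on \<Omega>) (sym_grad \<Omega> u) - L2_norm (lebesgue_on \<Omega>) (sym_grad \<Omega> v)\<bar> \<le> H1_norm \<Omega> (u - v)"
proof -
  note * = H1_diff[OF assms]
  have "\<bar>L2_norm (lebesgue_on \<Omega>) (sym_grad \<Omega> u) - L2_norm (lebesgue_on \<Omega>) (sym_grad \<Omega> v)\<bar>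
      \<le> L2_norm (lebesgue_on \<Omega>) (\<lambda>x. sym_grad \<Omega> u x - sym_grad \<Omega> v x)"
    by (rule L2_norm_diff_ge[OF sym_grad_L2[OF assms(3)] sym_grad_L2[OF assms(4)]])
  also have "\<dots> \<le> 1 * L2_norm (lebesgue_on \<Omega>) (weak_grad \<Omega> (u - v))"
  proof (rule L2_norm_mono)
    show "(\<lambda>x. sym_grad \<Omega> u x - sym_grad \<Omega> v x) \<in> borel_measurable (lebesgue_on \<Omega>)"
      by (intro borel_measurable_diff L2_borel[OF sym_grad_L2] assms)
    show "AE x in lebesgue_on \<Omega>. norm (sym_grad \<Omega> u x - sym_grad \<Omega> v x) \<le> 1 * norm (weak_grad \<Omega> (u - v) x)"
      using *(2)
    proof eventually_elim
      case (elim x)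
      show ?case
        using norm_symmetric_part_le[of "weak_grad \<Omega> u x - weak_grad \<Omega> v x"]
        unfolding sym_grad_def symmetric_part_diff[symmetric] elim by simp
    qed
  qed (use H1_D(2)[OF *(1)] in auto)
  also have "\<dots> \<le> H1_norm \<Omega> (u - v)" using L2_norm_le_H1_norm(2) by simp
  finally show ?thesis .
qed

section \<open>Fields that are smooth up to the boundary\<close>

lemma smooth_closureE:
  assumes "w \<in> smooth_closure \<Omega>"
  obtains W where "smooth_on UNIV W" "\<And>x. x \<in> closure \<Omega> \<Longrightarrow> w x = W x"
  using assms by (auto simp: smooth_closure_def)

lemma smooth_closure_weak_gradient:
  assumes "open \<Omega>" "bounded \<Omega>" "smooth_on UNIV W" "\<And>x. x \<in> closure \<Omega> \<Longrightarrow> w x = W x"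
  shows "has_weak_gradient \<Omega> w (jac W)" "w \<in> H1 \<Omega>" "AE x in lebesgue_on \<Omega>. weak_grad \<Omega> w x = jac W x"
proof -
  show *: "has_weak_gradient \<Omega> w (jac W)"
  proof (rule has_weak_gradient_cong[OF assms(1) has_weak_gradient_smooth[OF assms(1-3)]])
    show "W x = w x" if "x \<in> \<Omega>" for x using assms(4)[of x] that subsetD[OF closure_subset] by metis
  qed
  then show "w \<in> H1 \<Omega>" by (auto simp: H1_def)
  show "AE x in lebesgue_on \<Omega>. weak_grad \<Omega> w x = jac W x"
    by (rule weak_grad_eqI[OF assms(1,2) *])
qed

section \<open>Boundary charts\<close>

text \<open>For a unit vector \<open>b\<close> this is the signed distance from the plane through
  \<open>x0\<close> orthogonal to \<open>b\<close>, and \<open>foot\<close> is the orthogonal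
  projection onto that plane. The base coordinate remains a point of space, so all integrals are
  three-dimensional.\<close>

definition height :: "R3 \<Rightarrow> R3 \<Rightarrow> R3 \<Rightarrow> real" where
  "height x0 b x = (x - x0) \<bullet> b"

definition foot :: "R3 \<Rightarrow> R3 \<Rightarrow> R3 \<Rightarrow> R3" where
  "foot x0 b x = x - height x0 b x *\<^sub>R b"

definition cylinder :: "R3 \<Rightarrow> R3 \<Rightarrow> real \<Rightarrow> real \<Rightarrow> R3 set" where
  "cylinder x0 b r \<delta> = {x. norm (foot x0 b x - x0) \<le> r \<and> \<bar>height x0 b x\<bar> \<le> \<delta>}"

text \<open>The closed cylinder carries the bounds on \<rho>, the open one contains the supports of
  the functions that are integrated.\<close>

definition open_cylinder :: "R3 \<Rightarrow> R3 \<Rightarrow> real \<Rightarrow> real \<Rightarrow> R3 set" where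
  "open_cylinder x0 b r \<delta> = {x. norm (foot x0 b x - x0) < r \<and> \<bar>height x0 b x\<bar> < \<delta>}"

text \<open>A frontier point of an open set lies outside it, so \<rho> is not negative there; a
  positive value would persist on a neighbourhood disjoint from \<Omega>.\<close>

lemma frontier_level_set:
  fixes \<rho> :: "R3 \<Rightarrow> real"
  assumes "open \<Omega>" "open U" "continuous_on U \<rho>" "\<Omega> \<inter> U = {x\<in>U. \<rho> x < 0}" "x \<in> frontier \<Omega>" "x \<in> U"
  shows "\<rho> x = 0"
proof (rule ccontr)
  assume "\<rho> x \<noteq> 0"
  have "x \<notin> \<Omega>" using assms by (simp add: frontier_def interior_open)
  then have "\<rho> x > 0" using assms(4,6) \<open>\<rho> x \<noteq> 0\<close> by force
  have "open (U \<inter> \<rho> -` {0<..})"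
    by (rule continuous_open_preimage[OF assms(3,2)]) simp
  moreover have "x \<in> U \<inter> \<rho> -` {0<..}" using assms(6) \<open>\<rho> x > 0\<close> by simp
  moreover have "(U \<inter> \<rho> -` {0<..}) \<inter> \<Omega> = {}" using assms(4) by force
  ultimately have "x \<notin> closure \<Omega>" using open_Int_closure_eq_empty by blast
  then show False using assms(5) by (simp add: frontier_def)
qed

text \<open>Near a boundary point \<open>x0\<close> the set \<open>\<Omega>\<close> is the part of a cylinder with axis \<open>b\<close> below the graph of a
  Lipschitz function.\<close>

locale boundary_chart =
  fixes \<Omega> U :: "R3 set" and \<rho> :: "R3 \<Rightarrow> real" and x0 b :: R3 and r \<delta> m M :: real
  assumes open_\<Omega>: "open \<Omega>" and open_U: "open U" and smooth: "smooth_on U \<rho>"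
    and inside: "\<Omega> \<inter> U = {x\<in>U. \<rho> x < 0}"
    and norm_b: "norm b = 1" and r_pos: "r > 0" and \<delta>_pos: "\<delta> > 0" and m_pos: "m > 0" and M_nonneg: "M \<ge> 0"
    and cyl_U: "cylinder x0 b r \<delta> \<subseteq> U"
    and slope: "\<And>x. x \<in> cylinder x0 b r \<delta> \<Longrightarrow> m \<le> dirderiv \<rho> b x"
    and lip: "\<And>x y. x \<in> cylinder x0 b r \<delta> \<Longrightarrow> y \<in> cylinder x0 b r \<delta> \<Longrightarrow> \<bar>\<rho> x - \<rho> y\<bar> \<le> M * norm (x - y)"
    and small: "M * r < m * \<delta> / 2" and center: "\<rho> x0 = 0"
begin

abbreviation "ht \<equiv> height x0 b"
abbreviation "ft \<equiv> foot x0 b"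
abbreviation "K \<equiv> cylinder x0 b r \<delta>"
abbreviation "V \<equiv> open_cylinder x0 b r \<delta>"

lemma b_b: "b \<bullet> b = 1"
  using norm_b by (simp add: norm_eq_sqrt_inner)

lemma ht_ft [simp]: "ht (ft x) = 0"
  by (simp add: height_def foot_def inner_diff_left b_b)

lemma ht_add: "ht (x + t *\<^sub>R b) = ht x + t"
  by (simp add: height_def inner_diff_left inner_add_left b_b)

lemma ft_add: "ft (x + t *\<^sub>R b) = ft x"
  by (simp add: foot_def ht_add algebra_simps)

lemma ft_decomp: "ft x + ht x *\<^sub>R b = x"
  by (simp add: foot_def)

lemma ft_ft [simp]: "ft (ft x) = ft x"
  by (simp add: foot_def[of _ _ "ft x"])

lemma ht_lift [simp]: "ht (ft x + t *\<^sub>R b) = t" and ft_lift [simp]: "ft (ft x + t *\<^sub>R b) = ft x"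
  by (simp_all add: ht_add ft_add)

lemma ht_x0 [simp]: "ht x0 = 0" and ft_x0 [simp]: "ft x0 = x0"
  by (simp_all add: height_def foot_def)

lemma continuous_ht [continuous_intros]: "continuous_on S ht"
  unfolding height_def[abs_def] by (intro continuous_intros)

lemma continuous_ft [continuous_intros]: "continuous_on S ft"
  unfolding foot_def[abs_def] by (intro continuous_intros)

lemma norm_ft_diff: "norm (ft x - ft y) \<le> norm (x - y)"
proof -
  define z where "z = x - y"
  have "ft x - ft y = z - (z \<bullet> b) *\<^sub>R b"
    by (simp add: foot_def height_def z_def inner_diff_left algebra_simps)
  moreover have "(norm (z - (z \<bullet> b) *\<^sub>R b))\<^sup>2 = (norm z)\<^sup>2 - (z \<bullet> b)\<^sup>2"
    unfolding power2_norm_eq_inner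
    by (simp add: inner_diff_left inner_diff_right b_b inner_commute power2_eq_square algebra_simps)
  ultimately have "(norm (ft x - ft y))\<^sup>2 \<le> (norm z)\<^sup>2" by simp
  then show ?thesis unfolding z_def by (meson norm_ge_zero power2_le_imp_le)
qed

lemma ht_diff: "\<bar>ht x - ht y\<bar> \<le> norm (x - y)"
proof -
  have "ht x - ht y = (x - y) \<bullet> b" by (simp add: height_def inner_diff_left)
  then show ?thesis using Cauchy_Schwarz_ineq2[of "x - y" b] norm_b by simp
qed

lemma V_subset_K: "V \<subseteq> K"
  by (auto simp: cylinder_def open_cylinder_def)

lemma open_V: "open V"
proof -
  have "V = {x. norm (ft x - x0) < r} \<inter> {x. \<bar>ht x\<bar> < \<delta>}" by (auto simp: open_cylinder_def)
  moreover have "open {x. norm (ft x - x0) < r}" "open {x. \<bar>ht x\<bar> < \<delta>}"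
    by (intro open_Collect_less continuous_intros)+
  ultimately show ?thesis by (simp only: open_Int)
qed

lemma lift_K: "norm (ft x - x0) \<le> r \<Longrightarrow> \<bar>t\<bar> \<le> \<delta> \<Longrightarrow> ft x + t *\<^sub>R b \<in> K"
  by (simp add: cylinder_def)

lemma K_tube: "x \<in> K \<Longrightarrow> norm (ft x - x0) \<le> r"
  by (simp add: cylinder_def)

lemma C1_\<rho>: "C1_on U \<rho>"
  by (rule smooth_on_imp_C1_on[OF smooth])

lemma slope_increment:
  assumes "norm (ft x - x0) \<le> r" "- \<delta> \<le> s" "s \<le> t" "t \<le> \<delta>"
  shows "m * (t - s) \<le> \<rho> (ft x + t *\<^sub>R b) - \<rho> (ft x + s *\<^sub>R b)"
proof (cases "s = t")
  case False
  have inK: "ft x + z *\<^sub>R b \<in> K" if "s \<le> z" "z \<le> t" for z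
    using assms that by (intro lift_K) auto
  have "((\<lambda>t. \<rho> (ft x + t *\<^sub>R b)) has_real_derivative dirderiv \<rho> b (ft x + z *\<^sub>R b)) (at z)"
    if "s \<le> z" "z \<le> t" for z
  proof -
    have "ft x + z *\<^sub>R b \<in> U" using inK[OF that] cyl_U by auto
    then have dif: "\<rho> differentiable (at (ft x + z *\<^sub>R b))" using C1_on_D(1)[OF C1_\<rho>] by blast
    have "((\<lambda>t. ft x + t *\<^sub>R b) has_derivative (\<lambda>s. s *\<^sub>R b)) (at z)"
      by (auto intro!: derivative_eq_intros)
    from has_derivative_compose[OF this has_derivative_dirderiv[OF dif]]
    have "((\<lambda>t. \<rho> (ft x + t *\<^sub>R b)) has_derivative (\<lambda>s. dirderiv \<rho> (s *\<^sub>R b) (ft x + z *\<^sub>R b))) (at z)" .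
    moreover have "dirderiv \<rho> (s *\<^sub>R b) y = dirderiv \<rho> b y * s" if "y = ft x + z *\<^sub>R b" for s y
      using linear_frechet_derivative[OF dif] that by (simp add: dirderiv_def linear_scale)
    ultimately show ?thesis by (simp add: has_field_derivative_def)
  qed
  then obtain z where z: "s < z" "z < t" "\<rho> (ft x + t *\<^sub>R b) - \<rho> (ft x + s *\<^sub>R b) = (t - s) * dirderiv \<rho> b (ft x + z *\<^sub>R b)"
    using MVT2[of s t "\<lambda>t. \<rho> (ft x + t *\<^sub>R b)"] assms False by force
  have "m \<le> dirderiv \<rho> b (ft x + z *\<^sub>R b)" using slope inK z by simp
  then show ?thesis using z by (simp add: mult.commute mult_right_mono)
qed simp

text \<open>The zero set of \<rho> instead of \<open>frontier \<Omega> \<inter> K\<close>: zeros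
  delivered by the intermediate value theorem belong to it at once. The relation to the frontier is
  given by \<open>frontier_K\<close> and \<open>P_frontier\<close>.\<close>

definition \<Gamma> :: "R3 set" where
  "\<Gamma> = {y \<in> K. \<rho> y = 0}"

lemma x0_\<Gamma>: "x0 \<in> \<Gamma>"
  using center r_pos \<delta>_pos by (simp add: \<Gamma>_def cylinder_def)

text \<open>On the base disc |\<rho>| is at most \<open>M * r\<close>, while moving by
  \<open>\<delta> / 2\<close> along the axis changes \<rho> by at least
  \<open>m * \<delta> / 2\<close>; by \<open>small\<close> the sign changes in between.\<close>

lemma vertical_zero:
  assumes "norm (ft x - x0) \<le> r"
  obtains s where "\<bar>s\<bar> \<le> \<delta> / 2" "ft x + s *\<^sub>R b \<in> \<Gamma>"
proof -
  have inK: "ft x + s *\<^sub>R b \<in> K" if "\<bar>s\<bar> \<le> \<delta>" for s using lift_K assms that by simp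
  have "continuous_on {- (\<delta> / 2)..\<delta> / 2} (\<lambda>s. \<rho> (ft x + s *\<^sub>R b))"
    by (rule continuous_on_compose2[OF C1_on_D(3)[OF C1_\<rho>]])
      (use inK cyl_U in \<open>force intro!: continuous_intros\<close>)+
  moreover have "\<bar>\<rho> (ft x)\<bar> \<le> M * r"
  proof -
    have "x0 \<in> K" "ft x \<in> K" using x0_\<Gamma> inK[of 0] \<delta>_pos by (auto simp: \<Gamma>_def)
    from lip[OF this(2,1)] have "\<bar>\<rho> (ft x)\<bar> \<le> M * norm (ft x - x0)" by (simp add: center)
    also have "\<dots> \<le> M * r" using assms M_nonneg by (rule mult_left_mono)
    finally show ?thesis .
  qed
  moreover have "m * (\<delta> / 2) \<le> \<rho> (ft x + (\<delta> / 2) *\<^sub>R b) - \<rho> (ft x)"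
    using slope_increment[OF assms, of 0 "\<delta> / 2"] \<delta>_pos by simp
  moreover have "m * (\<delta> / 2) \<le> \<rho> (ft x) - \<rho> (ft x + (- (\<delta> / 2)) *\<^sub>R b)"
    using slope_increment[OF assms, of "- (\<delta> / 2)" 0] \<delta>_pos by simp
  moreover from calculation have "\<rho> (ft x + (- (\<delta> / 2)) *\<^sub>R b) \<le> 0" "0 \<le> \<rho> (ft x + (\<delta> / 2) *\<^sub>R b)"
    using small by auto
  ultimately obtain s where "- (\<delta> / 2) \<le> s" "s \<le> \<delta> / 2" "\<rho> (ft x + s *\<^sub>R b) = 0"
    using IVT'[of "\<lambda>s. \<rho> (ft x + s *\<^sub>R b)" "- (\<delta> / 2)" 0 "\<delta> / 2"] \<delta>_pos by auto
  then show thesis using inK[of s] \<delta>_pos by (intro that[of s]) (auto simp: \<Gamma>_def)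
qed

text \<open>From \<open>y\<close>, move vertically to the height of \<open>z\<close>: \<rho> falls
  by at least \<open>m\<close> times the height difference. The remaining horizontal move to
  \<open>z\<close> has to undo this at a rate of at most \<open>M\<close>.\<close>

lemma \<Gamma>_lipschitz:
  assumes "y \<in> \<Gamma>" "z \<in> \<Gamma>"
  shows "ht y - ht z \<le> M / m * norm (ft y - ft z)"
proof (cases "ht z \<le> ht y")
  case True
  have K: "y \<in> K" "z \<in> K" "\<rho> y = 0" "\<rho> z = 0" using assms by (auto simp: \<Gamma>_def)
  then have h: "\<bar>ht y\<bar> \<le> \<delta>" "\<bar>ht z\<bar> \<le> \<delta>" "norm (ft y - x0) \<le> r" by (auto simp: cylinder_def)
  let ?w = "ft y + ht z *\<^sub>R b"
  have "m * (ht y - ht z) \<le> \<rho> (ft y + ht y *\<^sub>R b) - \<rho> ?w"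
    using True h by (intro slope_increment) auto
  also have "\<dots> = \<rho> z - \<rho> ?w" using K ft_decomp[of y] by simp
  also have "\<dots> \<le> M * norm (z - ?w)"
    using lip[OF K(2), of ?w] lift_K[of y "ht z"] h by simp
  also have "z - ?w = ft z - ft y" using ft_decomp[of z] by (metis add_diff_cancel_right)
  finally show ?thesis
    using m_pos by (simp add: field_simps norm_minus_commute)
next
  case False
  have "0 \<le> M / m * norm (ft y - ft z)" using M_nonneg m_pos by simp
  then show ?thesis using False by simp
qed

text \<open>The McShane extension of the height function on the surface: it is defined and Lipschitz on the
  whole space.\<close>

definition \<gamma> :: "R3 \<Rightarrow> real" where
  "\<gamma> x = (INF y\<in>\<Gamma>. ht y + M / m * norm (ft x - ft y))"

text \<open>The projection along \<open>b\<close> onto the graph, defined on the whole space and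
  constant in the direction \<open>b\<close>.\<close>

definition P :: "R3 \<Rightarrow> R3" where
  "P x = ft x + \<gamma> x *\<^sub>R b"

lemma slope_nonneg: "0 \<le> M / m"
  using M_nonneg m_pos by simp

lemma \<gamma>_bdd: "bdd_below ((\<lambda>y. ht y + M / m * norm (ft x - ft y)) ` \<Gamma>)"
proof (rule bdd_belowI2)
  fix y assume "y \<in> \<Gamma>"
  then have "- \<delta> \<le> ht y" by (auto simp: \<Gamma>_def cylinder_def)
  moreover have "0 \<le> M / m * norm (ft x - ft y)" by (rule mult_nonneg_nonneg[OF slope_nonneg norm_ge_zero])
  ultimately show "- \<delta> \<le> ht y + M / m * norm (ft x - ft y)" by linarith
qed

text \<open>The point \<open>y\<close> itself bounds the infimum from above; the Lipschitz estimate
  on the surface bounds it from below.\<close>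

lemma \<gamma>_\<Gamma>: assumes "y \<in> \<Gamma>" shows "\<gamma> y = ht y"
proof (rule antisym)
  show "\<gamma> y \<le> ht y"
    unfolding \<gamma>_def using cINF_lower[OF \<gamma>_bdd assms, of y] by simp
  show "ht y \<le> \<gamma> y"
    unfolding \<gamma>_def
  proof (rule cINF_greatest)
    show "\<Gamma> \<noteq> {}" using x0_\<Gamma> by blast
    show "ht y \<le> ht z + M / m * norm (ft y - ft z)" if "z \<in> \<Gamma>" for z
      using \<Gamma>_lipschitz[OF assms that] by simp
  qed
qed

lemma \<gamma>_cong: "ft x = ft y \<Longrightarrow> \<gamma> x = \<gamma> y"
  by (simp add: \<gamma>_def)

lemma \<gamma>_le: "\<gamma> x \<le> \<gamma> y + M / m * norm (ft x - ft y)"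
proof -
  have "\<gamma> x - M / m * norm (ft x - ft y) \<le> \<gamma> y"
    unfolding \<gamma>_def[of y]
  proof (rule cINF_greatest)
    show "\<Gamma> \<noteq> {}" using x0_\<Gamma> by blast
    fix z assume z: "z \<in> \<Gamma>"
    have "\<gamma> x \<le> ht z + M / m * norm (ft x - ft z)"
      unfolding \<gamma>_def using cINF_lower[OF \<gamma>_bdd z, of x] by simp
    also have "\<dots> \<le> ht z + M / m * (norm (ft y - ft z) + norm (ft x - ft y))"
      using slope_nonneg norm_triangle_ineq[of "ft x - ft y" "ft y - ft z"]
      by (intro add_left_mono mult_left_mono) auto
    finally show "\<gamma> x - M / m * norm (ft x - ft y) \<le> ht z + M / m * norm (ft y - ft z)"
      by (simp add: distrib_left)
  qed
  then show ?thesis by simp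
qed

lemma \<gamma>_lipschitz: "\<bar>\<gamma> x - \<gamma> y\<bar> \<le> M / m * norm (ft x - ft y)"
  using \<gamma>_le[of x y] \<gamma>_le[of y x] by (simp add: norm_minus_commute)

lemma P_lipschitz: "norm (P x - P y) \<le> (1 + M / m) * norm (ft x - ft y)"
proof -
  have "P x - P y = (ft x - ft y) + (\<gamma> x - \<gamma> y) *\<^sub>R b" by (simp add: P_def algebra_simps)
  then have "norm (P x - P y) \<le> norm (ft x - ft y) + \<bar>\<gamma> x - \<gamma> y\<bar>"
    using norm_triangle_ineq[of "ft x - ft y" "(\<gamma> x - \<gamma> y) *\<^sub>R b"] norm_b by simp
  then show ?thesis using \<gamma>_lipschitz[of x y] by (simp add: distrib_right)
qed

lemma continuous_P: "continuous_on S P"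
proof (rule lipschitz_on_continuous_on)
  show "(1 + M / m)-lipschitz_on S P"
  proof (rule lipschitz_onI)
    show "dist (P x) (P y) \<le> (1 + M / m) * dist x y" for x y
    proof -
      have "norm (P x - P y) \<le> (1 + M / m) * norm (ft x - ft y)" by (rule P_lipschitz)
      also have "\<dots> \<le> (1 + M / m) * norm (x - y)"
        using slope_nonneg by (intro mult_left_mono norm_ft_diff) auto
      finally show ?thesis by (simp add: dist_norm)
    qed
  qed (use slope_nonneg in simp)
qed

lemma continuous_\<gamma>: "continuous_on S \<gamma>"
proof -
  have "continuous_on S (\<lambda>x. ht (P x))"
    by (rule continuous_on_compose2[OF continuous_ht continuous_P]) auto
  then show ?thesis by (simp add: P_def)
qed

lemma P_cong: "ft x = ft y \<Longrightarrow> P x = P y"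
  by (simp add: P_def \<gamma>_cong[of x y])

lemma P_add: "P (x + t *\<^sub>R b) = P x"
  by (rule P_cong) (simp add: ft_add)

lemma P_eq: "y \<in> \<Gamma> \<Longrightarrow> P y = y"
  by (simp add: P_def \<gamma>_\<Gamma> ft_decomp)

lemma ft_P [simp]: "ft (P x) = ft x" and ht_P [simp]: "ht (P x) = \<gamma> x"
  by (simp_all add: P_def)

lemma P_in_\<Gamma>:
  assumes "norm (ft x - x0) \<le> r"
  shows "P x \<in> \<Gamma>" "\<bar>\<gamma> x\<bar> \<le> \<delta> / 2"
proof -
  obtain s where s: "\<bar>s\<bar> \<le> \<delta> / 2" "ft x + s *\<^sub>R b \<in> \<Gamma>" using vertical_zero[OF assms] .
  have "P x = P (ft x + s *\<^sub>R b)" by (rule P_cong) simp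
  also have "\<dots> = ft x + s *\<^sub>R b" by (rule P_eq[OF s(2)])
  finally show "P x \<in> \<Gamma>" "\<bar>\<gamma> x\<bar> \<le> \<delta> / 2" using s ht_P[of x] by simp_all
qed

text \<open>On each vertical segment of the cylinder \<rho> is strictly increasing and vanishes at
  height \<open>\<gamma> x\<close>.\<close>

lemma in_\<Omega>_iff:
  assumes "x \<in> K" shows "x \<in> \<Omega> \<longleftrightarrow> ht x < \<gamma> x"
proof -
  have h: "norm (ft x - x0) \<le> r" "- \<delta> \<le> ht x" "ht x \<le> \<delta>" using assms by (auto simp: cylinder_def)
  note P = P_in_\<Gamma>[OF h(1)]
  have g: "- \<delta> \<le> \<gamma> x" "\<gamma> x \<le> \<delta>" using P(2) \<delta>_pos by auto
  have 0: "\<rho> (ft x + \<gamma> x *\<^sub>R b) = 0" using P(1) by (simp add: \<Gamma>_def P_def)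
  have "x \<in> \<Omega> \<longleftrightarrow> \<rho> x < 0" using inside assms cyl_U by blast
  also have "\<dots> \<longleftrightarrow> ht x < \<gamma> x"
  proof
    show "\<rho> x < 0" if "ht x < \<gamma> x"
      using slope_increment[OF h(1,2) _ g(2)] that 0 ft_decomp[of x] m_pos
      by (smt (verit) mult_pos_pos)
    show "ht x < \<gamma> x" if "\<rho> x < 0"
    proof (rule ccontr)
      assume "\<not> ht x < \<gamma> x"
      then have "0 \<le> m * (ht x - \<gamma> x)" "m * (ht x - \<gamma> x) \<le> \<rho> x"
        using slope_increment[OF h(1) g(1) _ h(3)] 0 ft_decomp[of x] m_pos by auto
      then show False using that by simp
    qed
  qed
  finally show ?thesis .
qed

lemma \<rho>_frontier:
  assumes "x \<in> frontier \<Omega>" "x \<in> U" shows "\<rho> x = 0"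
  by (rule frontier_level_set[OF open_\<Omega> open_U C1_on_D(3)[OF C1_\<rho>] inside assms])

lemma frontier_K: "x \<in> frontier \<Omega> \<Longrightarrow> x \<in> K \<Longrightarrow> x \<in> \<Gamma>"
  using \<rho>_frontier cyl_U by (auto simp: \<Gamma>_def)

lemma P_frontier:
  assumes "norm (ft x - x0) \<le> r" shows "P x \<in> frontier \<Omega>"
proof -
  note P = P_in_\<Gamma>[OF assms]
  have PK: "P x \<in> K" "\<rho> (P x) = 0" using P(1) by (auto simp: \<Gamma>_def)
  have "P x \<notin> \<Omega>" using in_\<Omega>_iff[OF PK(1)] \<gamma>_cong[of "P x" x] by simp
  moreover have "P x \<in> closure \<Omega>"
    unfolding closure_approachable
  proof (intro allI impI)
    fix e :: real assume e: "e > 0"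
    \<comment> \<open>The bound \<open>\<delta> / 2\<close> keeps the lowered point in the cylinder,
      since \<open>\<gamma> x\<close> itself is at most \<open>\<delta> / 2\<close> in absolute
      value.\<close>
    define t where "t = min (e / 2) (\<delta> / 2)"
    have t: "0 < t" "t < e" "t \<le> \<delta> / 2" using e \<delta>_pos by (auto simp: t_def)
    let ?y = "ft x + (\<gamma> x - t) *\<^sub>R b"
    have "?y \<in> K" using assms P(2) t by (intro lift_K) auto
    then have "?y \<in> \<Omega>" using in_\<Omega>_iff[of ?y] \<gamma>_cong[of ?y x] t by simp
    moreover have "dist ?y (P x) < e" using t norm_b by (simp add: dist_norm P_def algebra_simps)
    ultimately show "\<exists>y\<in>\<Omega>. dist y (P x) < e" by blast
  qed
  ultimately show ?thesis using open_\<Omega> by (simp add: frontier_def interior_open)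
qed

end

section \<open>The divergence theorem in a boundary chart\<close>

text \<open>The squared negative part is the common C^1 building block of the cutoff across the
  surface, of the spatial bump and of the time ramp.\<close>

definition neg_square :: "real \<Rightarrow> real" where
  "neg_square s = (min 0 s)\<^sup>2"

lemma neg_square_has_derivative: "(neg_square has_real_derivative 2 * min 0 s) (at s)"
proof -
  consider "s < 0" | "s > 0" | "s = 0" by linarith
  then show ?thesis
  proof cases
    case 1
    have "((\<lambda>s. s\<^sup>2) has_real_derivative 2 * min 0 s) (at s)"
      using 1 by (auto intro!: derivative_eq_intros)
    then show ?thesis
      by (rule has_field_derivative_transform_within_open[where S="{..<0}"]) (use 1 in \<open>auto simp: neg_square_def\<close>)
  next
    case 2
    have "((\<lambda>s. 0) has_real_derivative 2 * min 0 s) (at s)" using 2 by simp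
    then show ?thesis
      by (rule has_field_derivative_transform_within_open[where S="{0<..}"]) (use 2 in \<open>auto simp: neg_square_def\<close>)
  next
    case 3
    have "isCont (\<lambda>h::real. min 0 h) 0" by (intro continuous_intros)
    then have "((\<lambda>h::real. min 0 h) \<longlongrightarrow> 0) (at 0)" by (simp add: isCont_def)
    moreover have "\<forall>\<^sub>F h in at (0::real). min 0 h = (neg_square (0 + h) - neg_square 0) / h"
      by (auto simp: eventually_at_filter neg_square_def power2_eq_square min_def)
    ultimately have "((\<lambda>h. (neg_square (0 + h) - neg_square 0) / h) \<longlongrightarrow> 0) (at 0)"
      by (rule Lim_transform_eventually)
    then show ?thesis using 3 by (simp add: DERIV_def)
  qed
qed

text \<open>A C^1 approximation, as \<open>e\<close> tends to 0, of the indicator of the negative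
  half-line. It vanishes for s >= 0, and applied to \<rho> it approximates the indicator of \<Omega>
  inside the chart.\<close>

definition cutoff :: "real \<Rightarrow> real \<Rightarrow> real" where
  "cutoff e s = neg_square s / (e\<^sup>2 + neg_square s)"

definition cutoff_deriv :: "real \<Rightarrow> real \<Rightarrow> real" where
  "cutoff_deriv e s = 2 * min 0 s * e\<^sup>2 / (e\<^sup>2 + neg_square s)\<^sup>2"

lemma neg_square_nonneg: "0 \<le> neg_square s" by (simp add: neg_square_def)

lemma cutoff_bounds: "0 \<le> cutoff e s" "cutoff e s \<le> 1"
proof -
  have "0 \<le> neg_square s" "neg_square s \<le> e\<^sup>2 + neg_square s" using neg_square_nonneg by auto
  moreover from this have "0 \<le> e\<^sup>2 + neg_square s" by linarith
  ultimately show "0 \<le> cutoff e s" "cutoff e s \<le> 1"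
    unfolding cutoff_def
    by (metis divide_nonneg_nonneg)
      (metis \<open>neg_square s \<le> e\<^sup>2 + neg_square s\<close> \<open>0 \<le> e\<^sup>2 + neg_square s\<close> divide_le_eq_1_pos div_by_0 order_le_less zero_le_one)
qed

lemma cutoff_denom_pos: "e \<noteq> 0 \<Longrightarrow> 0 < e\<^sup>2 + neg_square s"
  using neg_square_nonneg[of s] by (simp add: add_pos_nonneg)

lemma cutoff_has_derivative:
  assumes "e \<noteq> 0" shows "(cutoff e has_real_derivative cutoff_deriv e s) (at s)"
  unfolding cutoff_def[abs_def] cutoff_deriv_def using cutoff_denom_pos[OF assms, of s]
  by (auto intro!: derivative_eq_intros neg_square_has_derivative simp: power2_eq_square algebra_simps)

lemma continuous_cutoff_deriv: "e \<noteq> 0 \<Longrightarrow> continuous_on S (cutoff_deriv e)"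
  unfolding cutoff_deriv_def[abs_def] neg_square_def using cutoff_denom_pos[of e]
  by (intro continuous_intros) (auto simp: neg_square_def less_imp_neq[symmetric])

lemma cutoff_tendsto: "(\<lambda>n. cutoff (1 / real (Suc n)) s) \<longlonglongrightarrow> (if s < 0 then 1 else 0)"
proof (cases "s < 0")
  case True
  have "(\<lambda>n. 1 / real (Suc n)) \<longlonglongrightarrow> 0" by (rule LIMSEQ_Suc[OF lim_1_over_n])
  then have "(\<lambda>n. s\<^sup>2 / ((1 / real (Suc n))\<^sup>2 + s\<^sup>2)) \<longlonglongrightarrow> s\<^sup>2 / (0\<^sup>2 + s\<^sup>2)"
    using True by (intro tendsto_intros) auto
  then show ?thesis using True by (simp add: cutoff_def neg_square_def)
next
  case False
  then show ?thesis by (simp add: cutoff_def neg_square_def)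
qed

lemma C1_on_compose_cutoff:
  assumes "C1_on U f" "e \<noteq> 0"
  shows "C1_on U (\<lambda>x. cutoff e (f x))"
    and "x \<in> U \<Longrightarrow> dirderiv (\<lambda>x. cutoff e (f x)) v x = cutoff_deriv e (f x) * dirderiv f v x"
proof -
  have d: "((\<lambda>x. cutoff e (f x)) has_derivative (\<lambda>v. cutoff_deriv e (f x) * dirderiv f v x)) (at x)" if "x \<in> U" for x
    using has_derivative_compose[OF has_derivative_dirderiv[OF C1_on_D(1)[OF assms(1) that]]
        cutoff_has_derivative[OF assms(2), unfolded has_field_derivative_def]] .
  show "x \<in> U \<Longrightarrow> dirderiv (\<lambda>x. cutoff e (f x)) v x = cutoff_deriv e (f x) * dirderiv f v x"
    using dirderiv_eqI[OF d] by simp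
  have "continuous_on U (dirderiv (\<lambda>x. cutoff e (f x)) v)" for v
  proof (subst continuous_on_cong[OF refl dirderiv_eqI[OF d]])
    show "continuous_on U (\<lambda>x. cutoff_deriv e (f x) * dirderiv f v x)"
      by (intro continuous_on_mult C1_on_D(2)[OF assms(1)]
          continuous_on_compose2[OF continuous_cutoff_deriv[OF assms(2)] C1_on_D(3)[OF assms(1)] subset_UNIV])
  qed auto
  then show "C1_on U (\<lambda>x. cutoff e (f x))"
    using d by (auto simp: C1_on_def differentiable_def)
qed

lemma C1c_borel: "C1c U f \<Longrightarrow> f \<in> borel_measurable borel" "C1c U f \<Longrightarrow> dirderiv f v \<in> borel_measurable borel"
  using C1c_continuous[of U f UNIV] unfolding C1c_def by (auto intro: borel_measurable_continuous_onI)

section \<open>Integration along the axis of a chart\<close>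

context boundary_chart
begin

text \<open>A probability density in the height. As F (P x) is independent of the height,
  integrating it against \<open>weight\<close> is integration of boundary values over the base
  plane. The interval is half-open because \<open>weight\<close> arises as a right-hand
  derivative.\<close>

definition weight :: "R3 \<Rightarrow> real" where
  "weight x = indicator {- \<delta>..<\<delta>} (ht x) / (2 * \<delta>)"

lemma weight_nonneg: "0 \<le> weight x"
  using \<delta>_pos by (simp add: weight_def)

lemma borel_ht [measurable]: "ht \<in> borel_measurable borel"
  by (rule borel_measurable_continuous_onI[OF continuous_ht])

lemma borel_P [measurable]: "P \<in> borel_measurable borel"
  by (rule borel_measurable_continuous_onI[OF continuous_P])

lemma borel_weight [measurable]: "weight \<in> borel_measurable borel"
  unfolding weight_def[abs_def] by measurable

lemma P_in_V_tube: "P x \<in> V \<Longrightarrow> norm (ft x - x0) < r"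
  by (simp add: open_cylinder_def)

lemma bounded_tube_weight:
  assumes "norm x > norm x0 + r + \<delta>" "norm (ft x - x0) \<le> r"
  shows "\<bar>ht x\<bar> > \<delta>"
proof (rule ccontr)
  assume "\<not> \<bar>ht x\<bar> > \<delta>"
  moreover have "norm x \<le> norm (ft x - x0) + norm x0 + \<bar>ht x\<bar>"
  proof -
    have "x = (ft x - x0) + x0 + ht x *\<^sub>R b" using ft_decomp[of x] by simp
    then have "norm x \<le> norm ((ft x - x0) + x0) + norm (ht x *\<^sub>R b)" by (metis norm_triangle_ineq)
    also have "\<dots> \<le> norm (ft x - x0) + norm x0 + norm (ht x *\<^sub>R b)" by (intro add_right_mono norm_triangle_ineq)
    finally show ?thesis using norm_b by simp
  qed
  ultimately show False using assms by linarith
qed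

text \<open>The function \<open>Z\<close> equals \<open>F\<close> below the surface and is continued constantly along \<open>b\<close> above it; the
  second term makes its support compact.\<close>

lemma vertical_divergence:
  assumes F: "C1c V F"
  shows "integrable lborel (\<lambda>x. indicator \<Omega> x * dirderiv F b x)"
    and "integrable lborel (\<lambda>x. F (P x) * weight x)"
    and "(\<integral>x. indicator \<Omega> x * dirderiv F b x \<partial>lborel) = (\<integral>x. F (P x) * weight x \<partial>lborel)"
proof -
  \<comment> \<open>A linear transition from 0 to 1 over the height of the cylinder; its right-hand
    derivative is the profile of \<open>weight\<close>.\<close>
  define \<kappa> where "\<kappa> t = max 0 (min 1 ((t + \<delta>) / (2 * \<delta>)))" for t
  define Z where "Z x = F (ft x + min (ht x) (\<gamma> x) *\<^sub>R b) - F (P x) * \<kappa> (ht x)" for x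
  define D where "D x = indicator \<Omega> x * dirderiv F b x - F (P x) * weight x" for x
  obtain B L R where B: "\<And>x. \<bar>F x\<bar> \<le> B" and R: "\<And>x. norm x > R \<Longrightarrow> dirderiv F b x = 0"
    and L: "\<And>x. \<bar>dirderiv F b x\<bar> \<le> L" and lipF: "\<And>x h. h \<ge> 0 \<Longrightarrow> \<bar>F (x + h *\<^sub>R b) - F x\<bar> \<le> L * h"
    using C1c_bounds[OF F, of b] by metis
  obtain C where C: "compact C" "C \<subseteq> V" "\<And>x. x \<notin> C \<Longrightarrow> F x = 0" using F unfolding C1c_def by blast
  have F0: "F x = 0" "dirderiv F b x = 0" if "x \<notin> V" for x
    using C(3)[of x] dirderiv_0_outside[OF C(1), of F x b] C(3) that C(2) by auto
  have B0: "0 \<le> B" using B[of x0] by linarith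
  have L0: "0 \<le> L" using L[of x0] by linarith
  have \<kappa>01: "0 \<le> \<kappa> t" "\<kappa> t \<le> 1" for t by (auto simp: \<kappa>_def)
  have tube: "F (ft x + t *\<^sub>R b) = 0" "dirderiv F b (ft x + t *\<^sub>R b) = 0" if "\<not> norm (ft x - x0) < r" for x t
    using that by (intro F0; simp add: open_cylinder_def)+
  have Z0: "Z x = 0" if x: "norm x > norm x0 + r + \<delta>" for x
  proof (cases "norm (ft x - x0) < r")
    case True
    then have "\<bar>ht x\<bar> > \<delta>" using bounded_tube_weight[OF x] by simp
    moreover have g: "\<bar>\<gamma> x\<bar> \<le> \<delta> / 2" using P_in_\<Gamma>(2)[of x] True by simp
    ultimately consider "ht x > \<delta>" | "ht x < - \<delta>" by linarith
    then show ?thesis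
    proof cases
      case 1
      \<comment> \<open>Above the cylinder the two terms of \<open>Z\<close> are both F (P x) and
        cancel; below it both are zero.\<close>
      then have "\<kappa> (ht x) = 1" "min (ht x) (\<gamma> x) = \<gamma> x" using \<delta>_pos g by (auto simp: \<kappa>_def min_def max_def field_simps)
      then show ?thesis by (simp add: Z_def P_def)
    next
      case 2
      then have "\<kappa> (ht x) = 0" "min (ht x) (\<gamma> x) = ht x" using \<delta>_pos g by (auto simp: \<kappa>_def min_def max_def field_simps)
      moreover have "F x = 0" using 2 by (intro F0) (auto simp: open_cylinder_def)
      ultimately show ?thesis by (simp add: Z_def ft_decomp)
    qed
  qed (use tube in \<open>simp add: Z_def P_def\<close>)
  have contF: "continuous_on UNIV F" using C1c_continuous[OF F] .
  have contZ: "continuous_on UNIV Z"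
    unfolding Z_def \<kappa>_def
    by (intro continuous_intros continuous_on_compose2[OF contF] continuous_\<gamma> continuous_P) (use \<delta>_pos in auto)
  have Zb: "\<bar>Z x\<bar> \<le> 2 * B" for x
  proof -
    have "\<bar>F (P x) * \<kappa> (ht x)\<bar> \<le> B * 1"
      unfolding abs_mult using \<kappa>01 B B0 by (intro mult_mono) auto
    then show ?thesis unfolding Z_def using B[of "ft x + min (ht x) (\<gamma> x) *\<^sub>R b"] by linarith
  qed
  have \<kappa>lip: "\<bar>\<kappa> (t + h) - \<kappa> t\<bar> \<le> h / (2 * \<delta>)" if "h \<ge> 0" for t h
  proof -
    have "\<bar>max 0 (min 1 c) - max 0 (min 1 d)\<bar> \<le> \<bar>c - d\<bar>" for c d :: real by (auto simp: min_def max_def)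
    from this[of "(t + h + \<delta>) / (2 * \<delta>)" "(t + \<delta>) / (2 * \<delta>)"]
    have "\<bar>\<kappa> (t + h) - \<kappa> t\<bar> \<le> \<bar>(t + h + \<delta>) / (2 * \<delta>) - (t + \<delta>) / (2 * \<delta>)\<bar>" unfolding \<kappa>_def .
    also have "(t + h + \<delta>) / (2 * \<delta>) - (t + \<delta>) / (2 * \<delta>) = h / (2 * \<delta>)" by (simp add: diff_divide_distrib[symmetric])
    finally show ?thesis using that \<delta>_pos by simp
  qed
  have \<kappa>cases: "t \<le> - \<delta> \<Longrightarrow> \<kappa> t = 0" "- \<delta> \<le> t \<Longrightarrow> t \<le> \<delta> \<Longrightarrow> \<kappa> t = (t + \<delta>) / (2 * \<delta>)" "\<delta> \<le> t \<Longrightarrow> \<kappa> t = 1" for t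
    using \<delta>_pos by (auto simp: \<kappa>_def min_def max_def divide_le_0_iff zero_le_divide_iff le_divide_eq_1 divide_le_eq_1)
  \<comment> \<open>The constant is the slope of \<open>F\<close> along \<open>b\<close> plus the
    bound on \<open>F\<close> times the slope of \<kappa>.\<close>
  have Zl: "\<bar>Z (x + h *\<^sub>R b) - Z x\<bar> \<le> (L + B / (2 * \<delta>)) * h" if h: "h \<ge> 0" for x h
  proof -
    define s where "s = min (ht x) (\<gamma> x)"
    define s' where "s' = min (ht x + h) (\<gamma> x)"
    have s: "0 \<le> s' - s" "s' - s \<le> h" using h by (auto simp: s_def s'_def)
    have g: "\<gamma> (x + h *\<^sub>R b) = \<gamma> x" by (rule \<gamma>_cong) (simp add: ft_add)
    have "Z (x + h *\<^sub>R b) - Z x = (F (ft x + s' *\<^sub>R b) - F (ft x + s *\<^sub>R b)) - F (P x) * (\<kappa> (ht x + h) - \<kappa> (ht x))"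
      by (simp add: Z_def ft_add ht_add P_add g s_def s'_def algebra_simps)
    moreover have "\<bar>F (ft x + s' *\<^sub>R b) - F (ft x + s *\<^sub>R b)\<bar> \<le> L * h"
    proof -
      have "\<bar>F ((ft x + s *\<^sub>R b) + (s' - s) *\<^sub>R b) - F (ft x + s *\<^sub>R b)\<bar> \<le> L * (s' - s)"
        using lipF s(1) by blast
      also have "\<dots> \<le> L * h" using L0 s(2) by (rule mult_left_mono[rotated])
      finally show ?thesis by (simp add: algebra_simps)
    qed
    moreover have "\<bar>F (P x) * (\<kappa> (ht x + h) - \<kappa> (ht x))\<bar> \<le> B * (h / (2 * \<delta>))"
      unfolding abs_mult using B B0 \<kappa>lip[OF h] by (intro mult_mono) auto
    ultimately show ?thesis by (simp add: distrib_right)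
  qed
  have \<kappa>d: "((\<lambda>h. (\<kappa> (t + h) - \<kappa> t) / h) \<longlongrightarrow> indicator {- \<delta>..<\<delta>} t / (2 * \<delta>)) (at_right 0)" for t
  proof -
    consider "t < - \<delta>" | "- \<delta> \<le> t" "t < \<delta>" | "\<delta> \<le> t" by linarith
    then show ?thesis
    proof cases
      case 1
      have "\<forall>\<^sub>F h in at_right 0. 0 = (\<kappa> (t + h) - \<kappa> t) / h"
        by (rule eventually_at_rightI[of 0 "- \<delta> - t"]) (use 1 \<delta>_pos in \<open>auto simp: \<kappa>cases(1)\<close>)
      from Lim_transform_eventually[OF tendsto_const this] show ?thesis using 1 by simp
    next
      case 2
      have "\<forall>\<^sub>F h in at_right 0. 1 / (2 * \<delta>) = (\<kappa> (t + h) - \<kappa> t) / h"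
        by (rule eventually_at_rightI[of 0 "\<delta> - t"]) (use 2 \<delta>_pos in \<open>auto simp: \<kappa>cases(2) diff_divide_distrib[symmetric]\<close>)
      from Lim_transform_eventually[OF tendsto_const this] show ?thesis using 2 by simp
    next
      case 3
      have "\<forall>\<^sub>F h in at_right 0. 0 = (\<kappa> (t + h) - \<kappa> t) / h"
        by (rule eventually_at_rightI[of 0 1]) (use 3 \<delta>_pos in \<open>auto simp: \<kappa>cases(3)\<close>)
      from Lim_transform_eventually[OF tendsto_const this] show ?thesis using 3 by simp
    qed
  qed
  have Zd: "((\<lambda>h. (Z (x + h *\<^sub>R b) - Z x) / h) \<longlongrightarrow> D x) (at_right 0)" for x
  proof -
    have g: "\<gamma> (x + h *\<^sub>R b) = \<gamma> x" for h by (rule \<gamma>_cong) (simp add: ft_add)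
    define E where "E h = F (ft x + min (ht x + h) (\<gamma> x) *\<^sub>R b) - F (ft x + min (ht x) (\<gamma> x) *\<^sub>R b)" for h
    have "((\<lambda>h. E h / h) \<longlongrightarrow> indicator \<Omega> x * dirderiv F b x) (at_right 0)"
    proof (cases "ht x < \<gamma> x")
      case True
      have "((\<lambda>h. (F (x + h *\<^sub>R b) - F x) / h) \<longlongrightarrow> dirderiv F b x) (at_right 0)"
        using dirderiv_tendsto[of F x b] F unfolding C1c_def by (meson filterlim_at_split)
      moreover have "\<forall>\<^sub>F h in at_right 0. (F (x + h *\<^sub>R b) - F x) / h = E h / h"
      proof (rule eventually_at_rightI[of 0 "\<gamma> x - ht x"])
        fix h assume "h \<in> {0<..<\<gamma> x - ht x}"
        then have "min (ht x + h) (\<gamma> x) = ht x + h" "min (ht x) (\<gamma> x) = ht x" by auto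
        moreover have "ft x + (ht x + h) *\<^sub>R b = x + h *\<^sub>R b" using ft_decomp[of x] by (simp add: scaleR_add_left add.assoc[symmetric])
        ultimately show "(F (x + h *\<^sub>R b) - F x) / h = E h / h" by (simp add: E_def ft_decomp)
      qed (use True in simp)
      ultimately have "((\<lambda>h. E h / h) \<longlongrightarrow> dirderiv F b x) (at_right 0)" by (rule Lim_transform_eventually)
      moreover have "indicator \<Omega> x * dirderiv F b x = dirderiv F b x"
        using in_\<Omega>_iff[of x] F0(2)[of x] V_subset_K True by (auto simp: indicator_def)
      ultimately show ?thesis by (simp only:)
    next
      case False
      \<comment> \<open>This case contains the surface itself: there the right-hand quotient is
        zero, in accordance with \<Omega> being open.\<close>
      have "\<forall>\<^sub>F h in at_right 0. 0 = E h / h"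
        by (rule eventually_at_rightI[of 0 1]) (use False in \<open>auto simp: E_def min_def\<close>)
      from Lim_transform_eventually[OF tendsto_const this] have "((\<lambda>h. E h / h) \<longlongrightarrow> 0) (at_right 0)" .
      moreover have "indicator \<Omega> x * dirderiv F b x = 0"
        using in_\<Omega>_iff[of x] F0(2)[of x] V_subset_K False by (auto simp: indicator_def)
      ultimately show ?thesis by (simp only:)
    qed
    from tendsto_diff[OF this tendsto_mult_left[OF \<kappa>d[of "ht x"], of "F (P x)"]]
    have "((\<lambda>h. E h / h - F (P x) * ((\<kappa> (ht x + h) - \<kappa> (ht x)) / h)) \<longlongrightarrow> D x) (at_right 0)"
      by (simp add: D_def weight_def)
    moreover have "(Z (x + h *\<^sub>R b) - Z x) / h = E h / h - F (P x) * ((\<kappa> (ht x + h) - \<kappa> (ht x)) / h)" for h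
      by (simp add: Z_def E_def ft_add ht_add P_add g diff_divide_distrib add_divide_distrib right_diff_distrib)
    ultimately show ?thesis by simp
  qed
  have intD: "integrable lborel D" "integral\<^sup>L lborel D = 0"
    using integral_directional_derivative[OF borel_measurable_continuous_onI[OF contZ] Zb Z0 Zl Zd] by auto
  show 1: "integrable lborel (\<lambda>x. indicator \<Omega> x * dirderiv F b x)"
  proof (rule integrable_bounded_support)
    show "(\<lambda>x. indicator \<Omega> x * dirderiv F b x) \<in> borel_measurable borel"
      using open_\<Omega> C1c_borel(2)[OF F] by (intro borel_measurable_times borel_measurable_indicator) auto
    show "\<bar>indicator \<Omega> x * dirderiv F b x\<bar> \<le> L" for x using L[of x] L0 by (simp add: indicator_def)
    show "indicator \<Omega> x * dirderiv F b x = 0" if "norm x > R" for x using R that by simp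
  qed
  have "integrable lborel (\<lambda>x. indicator \<Omega> x * dirderiv F b x - D x)"
    using 1 intD by (intro Bochner_Integration.integrable_diff)
  then show 2: "integrable lborel (\<lambda>x. F (P x) * weight x)" by (simp add: D_def)
  show "(\<integral>x. indicator \<Omega> x * dirderiv F b x \<partial>lborel) = (\<integral>x. F (P x) * weight x \<partial>lborel)"
    using intD(2) 1 2 unfolding D_def by simp
qed

text \<open>The \<open>e\<close>-component of the outer normal direction, scaled to have \<open>b\<close>-component one.\<close>

definition conormal :: "R3 \<Rightarrow> R3 \<Rightarrow> real" where
  "conormal e x = dirderiv \<rho> e x * inverse (dirderiv \<rho> b x)"

lemma V_U: "V \<subseteq> U"
  using V_subset_K cyl_U by blast

lemma C1_conormal: "C1_on V (conormal e)"
  unfolding conormal_def[abs_def]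
  using C1_on_subset[OF smooth_on_dirderiv_C1_on[OF smooth open_U] V_U] slope V_subset_K m_pos
  by (intro C1_on_mult C1_on_inverse) (auto, force)

lemma C1_\<rho>_V: "C1_on V \<rho>"
  by (rule C1_on_subset[OF C1_\<rho> V_U])

text \<open>The field \<open>e - conormal e b\<close> is tangential to the level sets of \<open>\<rho>\<close>, hence multiplying by a function of
  \<open>\<rho>\<close> produces no boundary term.\<close>

lemma chart_divergence_theorem:
  assumes f: "C1c V f"
  shows "integrable lborel (\<lambda>x. f (P x) * conormal e (P x) * weight x)"
    and "(\<integral>x. indicator \<Omega> x * dirderiv f e x \<partial>lborel) = (\<integral>x. f (P x) * conormal e (P x) * weight x \<partial>lborel)"
proof -
  define q where "q x = f x * conormal e x" for x
  have q: "C1c V q" unfolding q_def by (rule C1c_mult_C1_on[OF f C1_conormal open_V])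
  \<comment> \<open>It suffices that \<open>E\<close> integrates to zero over \<Omega>; the vertical
    theorem applied to \<open>q\<close> then produces the boundary term.\<close>
  define E where "E x = dirderiv f e x - dirderiv q b x" for x
  have intE: "integrable lborel E" unfolding E_def using C1c_integral[OF f] C1c_integral[OF q] by auto
  have z: "f x = 0" "dirderiv f e x = 0" "dirderiv q b x = 0" "E x = 0" if "x \<notin> V" for x
  proof -
    have *: "g x = 0 \<and> dirderiv g v x = 0" if g: "C1c V g" for g v
    proof -
      obtain C where "compact C" "C \<subseteq> V" "\<And>x. x \<notin> C \<Longrightarrow> g x = 0" using g unfolding C1c_def by blast
      then show ?thesis using dirderiv_0_outside[of C g x v] \<open>x \<notin> V\<close> by blast
    qed
    show "f x = 0" "dirderiv f e x = 0" "dirderiv q b x = 0" "E x = 0"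
      using *[OF f] *[OF q] by (auto simp: E_def)
  qed
  \<comment> \<open>Inside the chart an approximation of the indicator of \<Omega> by functions of
    \<rho>; outside, \<open>E\<close> vanishes, so zero is taken.\<close>
  define \<theta> where "\<theta> n x = (if x \<in> V then cutoff (1 / real (Suc n)) (\<rho> x) else 0)" for n x
  have 0: "(\<integral>x. \<theta> n x * E x \<partial>lborel) = 0" for n
  proof -
    let ?e = "1 / real (Suc n)"
    let ?c = "\<lambda>x. cutoff ?e (\<rho> x)"
    have e: "?e \<noteq> 0" by simp
    note c = C1_on_compose_cutoff[OF C1_\<rho>_V e]
    have fc: "C1c V (\<lambda>x. f x * ?c x)" and qc: "C1c V (\<lambda>x. q x * ?c x)"
      by (intro C1c_mult_C1_on f q c(1) open_V)+
    have "\<theta> n x * E x = dirderiv (\<lambda>x. f x * ?c x) e x - dirderiv (\<lambda>x. q x * ?c x) b x" for x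
    proof (cases "x \<in> V")
      case True
      \<comment> \<open>By this identity the terms containing the derivative of the cutoff cancel.
        They are the ones that become unbounded as the cutoff sharpens.\<close>
      have "q x * dirderiv \<rho> b x = f x * dirderiv \<rho> e x"
        using slope[of x] True V_subset_K m_pos by (force simp: q_def conormal_def)
      then have "f x * (cutoff_deriv ?e (\<rho> x) * dirderiv \<rho> e x) = q x * (cutoff_deriv ?e (\<rho> x) * dirderiv \<rho> b x)"
        by (metis mult.left_commute)
      moreover have "dirderiv (\<lambda>x. f x * ?c x) e x = f x * (cutoff_deriv ?e (\<rho> x) * dirderiv \<rho> e x) + dirderiv f e x * ?c x"
        "dirderiv (\<lambda>x. q x * ?c x) b x = q x * (cutoff_deriv ?e (\<rho> x) * dirderiv \<rho> b x) + dirderiv q b x * ?c x"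
        using dirderiv_mult[of _ x ?c] c(2)[OF True] C1_on_D(1)[OF c(1) True] f q unfolding C1c_def by auto
      ultimately have "dirderiv (\<lambda>x. f x * ?c x) e x - dirderiv (\<lambda>x. q x * ?c x) b x
          = dirderiv f e x * ?c x - dirderiv q b x * ?c x" by linarith
      then show ?thesis using True by (simp add: \<theta>_def E_def algebra_simps)
    next
      case False
      have "g x = 0 \<and> dirderiv g v x = 0" if g: "C1c V g" for g v
      proof -
        obtain C where "compact C" "C \<subseteq> V" "\<And>x. x \<notin> C \<Longrightarrow> g x = 0" using g unfolding C1c_def by blast
        then show ?thesis using dirderiv_0_outside[of C g x v] False by blast
      qed
      from this[OF fc] this[OF qc] show ?thesis using False by (simp add: \<theta>_def)
    qed
    then show ?thesis using C1c_integral[OF fc, of e] C1c_integral[OF qc, of b] by simp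
  qed
  have \<theta>m: "\<theta> n \<in> borel_measurable borel" for n
  proof -
    have "continuous_on V (\<lambda>x. cutoff (1 / real (Suc n)) (\<rho> x))"
      by (rule C1_on_D(3)[OF C1_on_compose_cutoff(1)[OF C1_\<rho>_V]]) simp
    then have "(\<lambda>x. indicator V x *\<^sub>R cutoff (1 / real (Suc n)) (\<rho> x)) \<in> borel_measurable borel"
      by (rule borel_measurable_continuous_on_indicator[rotated]) (use open_V in auto)
    moreover have "\<theta> n = (\<lambda>x. indicator V x *\<^sub>R cutoff (1 / real (Suc n)) (\<rho> x))" by (auto simp: \<theta>_def)
    ultimately show ?thesis by simp
  qed
  have Em: "E \<in> borel_measurable borel" using intE by (simp add: borel_measurable_integrable)
  have "(\<lambda>n. \<integral>x. \<theta> n x * E x \<partial>lborel) \<longlonglongrightarrow> (\<integral>x. indicator \<Omega> x * E x \<partial>lborel)"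
  proof (rule integral_dominated_convergence[where w="\<lambda>x. \<bar>E x\<bar>"])
    show "(\<lambda>x. indicator \<Omega> x * E x) \<in> borel_measurable lborel"
      using open_\<Omega> Em by (intro borel_measurable_times borel_measurable_indicator) auto
    show "(\<lambda>x. \<theta> n x * E x) \<in> borel_measurable lborel" for n
      using \<theta>m Em by simp
    show "AE x in lborel. (\<lambda>n. \<theta> n x * E x) \<longlonglongrightarrow> indicator \<Omega> x * E x"
    proof (intro AE_I2)
      fix x show "(\<lambda>n. \<theta> n x * E x) \<longlonglongrightarrow> indicator \<Omega> x * E x"
      proof (cases "x \<in> V")
        case True
        then have "x \<in> \<Omega> \<longleftrightarrow> \<rho> x < 0" using inside V_U by blast
        then have "indicator \<Omega> x = (if \<rho> x < 0 then 1 else 0 :: real)" by (simp add: indicator_def)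
        then show ?thesis using cutoff_tendsto[of "\<rho> x"] True
          by (intro tendsto_mult_right) (simp only: \<theta>_def if_True)
      qed (use z in simp)
    qed
    show "AE x in lborel. norm (\<theta> n x * E x) \<le> \<bar>E x\<bar>" for n
      using cutoff_bounds by (intro AE_I2) (auto simp: \<theta>_def abs_mult intro: mult_left_le_one_le)
  qed (use intE in auto)
  then have "(\<integral>x. indicator \<Omega> x * E x \<partial>lborel) = 0" unfolding 0 by (simp add: LIMSEQ_const_iff)
  moreover have "integrable lborel (\<lambda>x. indicator \<Omega> x * dirderiv f e x)"
    using integrable_mult_indicator[of \<Omega> lborel "dirderiv f e"] C1c_integral(1)[OF f] open_\<Omega> by simp
  ultimately have "(\<integral>x. indicator \<Omega> x * dirderiv f e x \<partial>lborel) = (\<integral>x. indicator \<Omega> x * dirderiv q b x \<partial>lborel)"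
    using vertical_divergence(1)[OF q] by (simp add: E_def right_diff_distrib)
  then show "(\<integral>x. indicator \<Omega> x * dirderiv f e x \<partial>lborel) = (\<integral>x. f (P x) * conormal e (P x) * weight x \<partial>lborel)"
    using vertical_divergence(3)[OF q] by (simp add: q_def)
  show "integrable lborel (\<lambda>x. f (P x) * conormal e (P x) * weight x)"
    using vertical_divergence(2)[OF q] by (simp add: q_def)
qed

end

section \<open>Surface measure in a boundary chart\<close>

text \<open>Non-overlapping dyadic cubes inside \<open>G\<close> are chosen by the covering lemma. A
  cube of side s has diameter at most 3 s by comparison with the l1 norm and volume s^3, whence the
  factor 27.\<close>

lemma cube_cover:
  fixes T G :: "R3 set"
  assumes "bounded T" "open G" "T \<subseteq> G" "d > 0"
  obtains K :: "nat \<Rightarrow> R3 set" where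
    "\<And>n. bounded (K n)" "\<And>n. diameter (K n) \<le> d" "T \<subseteq> (\<Union>n. K n)"
    "(\<Sum>n. ennreal ((diameter (K n)) ^ 3)) \<le> 27 * emeasure lborel G"
proof -
  obtain c where c: "c > 0" "\<And>x. x \<in> T \<Longrightarrow> norm x \<le> c"
    using assms(1) bounded_pos by metis
  have comp: "\<bar>x \<bullet> i\<bar> \<le> c" if "x \<in> T" "i \<in> Basis" for x i
    using Basis_le_norm[OF that(2), of x] c(2)[OF that(1)] by linarith
  let ?a = "- (c *\<^sub>R One) :: R3" and ?b = "c *\<^sub>R One :: R3"
  have ab: "?a \<bullet> i = - c" "?b \<bullet> i = c" if "i \<in> Basis" for i
    using that by (simp_all add: inner_sum_left_Basis)
  have sub: "T \<subseteq> cbox ?a ?b"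
  proof
    fix x assume "x \<in> T"
    then show "x \<in> cbox ?a ?b" unfolding mem_box using comp[of x] ab by (metis abs_le_iff minus_le_iff)
  qed
  have ne: "box ?a ?b \<noteq> {}"
    unfolding box_ne_empty using ab c(1) by auto
  obtain e where e: "\<And>x. x \<in> G \<Longrightarrow> e x > 0 \<and> ball x (e x) \<subseteq> G"
    using assms(2) open_contains_ball by metis
  \<comment> \<open>The first radius keeps the cubes inside \<open>G\<close>, the second bounds
    their diameters by \<open>d\<close>.\<close>
  define g where "g x = ball x (if x \<in> G then min (e x) (d / 2) else 1)" for x
  have "gauge g" unfolding gauge_def g_def using e assms(4) by auto
  from covering_lemma[OF sub ne this] obtain \<D> where
    \<D>: "countable \<D>" "\<And>K. K \<in> \<D> \<Longrightarrow> interior K \<noteq> {} \<and> (\<exists>c d. K = cbox c d)"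
      "pairwise (\<lambda>A B. interior A \<inter> interior B = {}) \<D>"
      "\<And>K. K \<in> \<D> \<Longrightarrow> \<exists>x \<in> T \<inter> K. K \<subseteq> g x"
      "\<And>u v. cbox u v \<in> \<D> \<Longrightarrow> \<exists>n. \<forall>i \<in> Basis. v \<bullet> i - u \<bullet> i = (?b \<bullet> i - ?a \<bullet> i) / 2^n"
      "T \<subseteq> \<Union>\<D>" by metis
  have KG: "K \<subseteq> G" "diameter K \<le> d" "bounded K" if K: "K \<in> \<D>" for K
  proof -
    obtain x where x: "x \<in> T" "K \<subseteq> g x" using \<D>(4)[OF K] by blast
    then have xG: "x \<in> G" using assms(3) by auto
    then show "K \<subseteq> G" using x(2) e[OF xG] by (force simp: g_def)
    have *: "norm (y - x) \<le> d / 2" if "y \<in> K" for y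
      using x(2) that xG by (force simp: g_def dist_norm norm_minus_commute)
    show "diameter K \<le> d"
    proof (rule diameter_le)
      fix y z assume "y \<in> K" "z \<in> K"
      then show "norm (y - z) \<le> d"
        using *[of y] *[of z] norm_triangle_ineq4[of "y - x" "z - x"] by simp
    qed (use assms in auto)
    show "bounded K" using x(2) bounded_subset[OF bounded_ball] by (simp add: g_def)
  qed
  have vol: "ennreal ((diameter K) ^ 3) \<le> 27 * emeasure lborel (interior K)" if K: "K \<in> \<D>" for K
  proof -
    obtain u v where uv: "K = cbox u v" using \<D>(2)[OF K] by blast
    obtain n :: nat where n: "\<And>i. i \<in> Basis \<Longrightarrow> v \<bullet> i - u \<bullet> i = (?b \<bullet> i - ?a \<bullet> i) / 2^n"
      using \<D>(5) K uv by blast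
    define s where "s = 2 * c / 2 ^ n"
    have s: "v \<bullet> i - u \<bullet> i = s" if "i \<in> Basis" for i
      using n[OF that] ab[OF that] by (simp only: s_def) simp
    have s0: "s > 0" using c by (simp add: s_def)
    have "diameter K \<le> 3 * s"
    proof (rule diameter_le)
      fix x y assume xy: "x \<in> K" "y \<in> K"
      have "norm (x - y) \<le> (\<Sum>i\<in>Basis. \<bar>(x - y) \<bullet> i\<bar>)" by (rule norm_le_l1)
      also have "\<dots> \<le> (\<Sum>i\<in>(Basis :: R3 set). s)"
      proof (rule sum_mono)
        fix i :: R3 assume i: "i \<in> Basis"
        have "u \<bullet> i \<le> x \<bullet> i" "x \<bullet> i \<le> v \<bullet> i" "u \<bullet> i \<le> y \<bullet> i" "y \<bullet> i \<le> v \<bullet> i"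
          using xy i unfolding uv mem_box by blast+
        then show "\<bar>(x - y) \<bullet> i\<bar> \<le> s" using s[OF i] by (simp add: inner_diff_left)
      qed
      also have "\<dots> = 3 * s" by simp
      finally show "norm (x - y) \<le> 3 * s" .
    qed (use s0 in auto)
    then have "(diameter K) ^ 3 \<le> (3 * s) ^ 3"
      using diameter_ge_0[OF KG(3)[OF K]] by (intro power_mono) auto
    also have "\<dots> = 27 * s ^ 3" by (simp add: power_mult_distrib)
    finally have "ennreal ((diameter K) ^ 3) \<le> 27 * ennreal (s ^ 3)"
      using s0 by (subst ennreal_numeral[symmetric], subst ennreal_mult[symmetric]) (auto intro: ennreal_leI)
    also have "ennreal (s ^ 3) = emeasure lborel (interior K)"
    proof -
      have "emeasure lborel (box u v) = (\<Prod>i\<in>Basis. (v - u) \<bullet> i)"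
        using s s0 by (intro emeasure_lborel_box) (metis add_diff_cancel_left' diff_ge_0_iff_ge less_imp_le)
      also have "(\<Prod>i\<in>Basis. (v - u) \<bullet> i) = (\<Prod>i\<in>(Basis :: R3 set). s)"
        by (rule prod.cong) (use s in \<open>auto simp: inner_diff_left\<close>)
      finally show ?thesis by (simp add: uv interior_cbox)
    qed
    finally show ?thesis .
  qed
  define K where "K n = (if n \<in> to_nat_on \<D> ` \<D> then from_nat_into \<D> n else {})" for n
  have Kto: "K (to_nat_on \<D> k) = k" if "k \<in> \<D>" for k
    using that \<D>(1) by (auto simp: K_def)
  have Kcases: "K n = {} \<or> (K n \<in> \<D> \<and> n = to_nat_on \<D> (K n))" for n
    using \<D>(1) by (auto simp: K_def)
  show thesis
  proof (rule that)
    show "bounded (K n)" "diameter (K n) \<le> d" for n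
      using Kcases[of n] KG[of "K n"] assms(4) by auto
    show "T \<subseteq> (\<Union>n. K n)"
    proof
      fix x assume "x \<in> T"
      then obtain k where "k \<in> \<D>" "x \<in> k" using \<D>(6) by blast
      then show "x \<in> (\<Union>n. K n)" using Kto by (metis UNIV_I UN_I)
    qed
    have "(\<Sum>n. ennreal ((diameter (K n)) ^ 3)) \<le> (\<Sum>n. 27 * emeasure lborel (interior (K n)))"
    proof (intro suminf_le)
      show "ennreal ((diameter (K n)) ^ 3) \<le> 27 * emeasure lborel (interior (K n))" for n
        using Kcases[of n] vol[of "K n"] by auto
    qed auto
    also have "\<dots> = 27 * (\<Sum>n. emeasure lborel (interior (K n)))"
      by (simp add: ennreal_suminf_cmult)
    also have "(\<Sum>n. emeasure lborel (interior (K n))) = emeasure lborel (\<Union>n. interior (K n))"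
    proof (rule suminf_emeasure)
      show "disjoint_family (\<lambda>n. interior (K n))"
        unfolding disjoint_family_on_def
      proof (intro ballI impI)
        fix i j :: nat assume ij: "i \<noteq> j"
        show "interior (K i) \<inter> interior (K j) = {}"
          using Kcases[of i] Kcases[of j] \<D>(3) ij unfolding pairwise_def by (metis interior_empty inf_bot_left inf_bot_right)
      qed
    qed auto
    also have "\<dots> \<le> emeasure lborel G"
    proof (rule emeasure_mono)
      show "(\<Union>n. interior (K n)) \<subseteq> G"
      proof (rule UN_least)
        show "interior (K n) \<subseteq> G" for n
          using Kcases[of n] KG(1)[of "K n"] interior_subset[of "K n"] by auto
      qed
    qed (use assms in auto)
    finally show "(\<Sum>n. ennreal ((diameter (K n)) ^ 3)) \<le> 27 * emeasure lborel G"
      by (simp add: mult_left_mono)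
  qed
qed

text \<open>\<open>measure_of\<close> yields the given set function if that is a measure on the
  generated sigma algebra, and zero otherwise; the inequality covers both outcomes.\<close>

lemma emeasure_hausdorff2_le: "emeasure hausdorff2 A \<le> hausdorff2_outer A"
  unfolding hausdorff2_def by (subst emeasure_measure_of_conv) auto

lemma sets_hausdorff2 [measurable_cong, simp]: "sets hausdorff2 = sets borel"
  unfolding hausdorff2_def by (metis sets_measure_of sets.space_closed sets.sigma_sets_eq space_borel)

lemma space_hausdorff2 [simp]: "space hausdorff2 = UNIV"
  unfolding hausdorff2_def by (simp add: space_measure_of_conv)

section \<open>Comparison of Hausdorff measure on the surface with volume\<close>

context boundary_chart
begin

text \<open>The points of the cylinder above, on and below \<open>A\<close>: the set whose volume is
  to control the area of \<open>A\<close>.\<close>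

definition slab :: "R3 set \<Rightarrow> R3 set" where
  "slab A = {x. P x \<in> A \<and> ht x \<in> {- \<delta>..<\<delta>}}"

lemma slab_borel: "A \<in> sets borel \<Longrightarrow> slab A \<in> sets borel"
proof -
  assume "A \<in> sets borel"
  then have "P -` A \<inter> space borel \<in> sets borel" "ht -` {- \<delta>..<\<delta>} \<inter> space borel \<in> sets borel"
    using measurable_sets[OF borel_P, of A] measurable_sets[OF borel_ht, of "{- \<delta>..<\<delta>}"] by auto
  moreover have "slab A = (P -` A \<inter> space borel) \<inter> (ht -` {- \<delta>..<\<delta>} \<inter> space borel)" by (auto simp: slab_def)
  ultimately show ?thesis by auto
qed

lemma slab_bounded: "A \<subseteq> \<Gamma> \<Longrightarrow> bounded (slab A)"
proof -
  assume A: "A \<subseteq> \<Gamma>"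
  have "norm x \<le> norm x0 + r + \<delta>" if "x \<in> slab A" for x
  proof (rule ccontr)
    assume "\<not> norm x \<le> norm x0 + r + \<delta>"
    moreover have "norm (ft x - x0) \<le> r"
      using that A K_tube[of "P x"] by (auto simp: slab_def \<Gamma>_def)
    ultimately have "\<bar>ht x\<bar> > \<delta>" by (intro bounded_tube_weight) auto
    then show False using that by (auto simp: slab_def)
  qed
  then show ?thesis by (auto simp: bounded_iff)
qed

text \<open>The factor 27 comes from \<open>cube_cover\<close>; \<pi>/2 is the normalisation \<pi>/4
  times 2, for the length of the height interval met by a cover element; the square is the
  distortion of areas by \<open>P\<close>; the division averages over the heights.\<close>

definition haus_const :: real where
  "haus_const = 27 * (pi / 2) * (1 + M / m)\<^sup>2 / (2 * \<delta>)"

text \<open>A cover of the slab by cubes induces, for every height \<open>t\<close>, a cover of \<open>A\<close> by the projections of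
  the slices at height \<open>t\<close>; the claim follows by averaging over \<open>t\<close>.\<close>

lemma hausdorff2_outer_le:
  assumes A: "A \<in> sets borel" "A \<subseteq> \<Gamma>"
  shows "hausdorff2_outer A \<le> ennreal haus_const * emeasure lborel (slab A)"
proof -
  let ?L = "1 + M / m"
  have L: "?L > 0" using slope_nonneg by linarith
  define H where "H d = (INF E\<in>{E :: nat \<Rightarrow> R3 set. A \<subseteq> (\<Union>i. E i) \<and>
        (\<forall>i. bounded (E i) \<and> diameter (E i) \<le> d)}. \<Sum>i. ennreal (pi / 4 * (diameter (E i))\<^sup>2))" for d
  have main: "ennreal (2 * \<delta>) * H d \<le> ennreal (27 * (pi / 2) * ?L\<^sup>2) * emeasure lborel G"
    if d: "d > 0" and G: "open G" "slab A \<subseteq> G" for d G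
  proof -
    obtain K :: "nat \<Rightarrow> R3 set" where K: "\<And>n. bounded (K n)" "\<And>n. diameter (K n) \<le> d / ?L" "slab A \<subseteq> (\<Union>n. K n)"
      "(\<Sum>n. ennreal ((diameter (K n)) ^ 3)) \<le> 27 * emeasure lborel G"
      using cube_cover[OF slab_bounded[OF A(2)] G, of "d / ?L"] d L by auto
    define D where "D n = diameter (K n)" for n
    have D0: "0 \<le> D n" for n using diameter_ge_0[OF K(1)] by (simp add: D_def)
    define z where "z n = (SOME x. x \<in> K n)" for n
    have z: "z n \<in> K n" if "K n \<noteq> {}" for n unfolding z_def using that by (simp add: some_in_eq)
    \<comment> \<open>Contains all heights occurring in \<open>K n\<close>, since heights change no
      faster than distances; its length is twice the diameter.\<close>
    define I where "I n = {ht (z n) - D n..ht (z n) + D n}" for n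
    define E where "E t n = P ` {x \<in> K n. ht x = t}" for t n
    have dist: "norm (x - y) \<le> D n" if "x \<in> K n" "y \<in> K n" for x y n
      using diameter_bounded_bound[OF K(1) that] by (simp add: D_def dist_norm)
    have PL: "norm (P x - P y) \<le> ?L * norm (x - y)" for x y
      using P_lipschitz[of x y] mult_left_mono[OF norm_ft_diff[of x y], of ?L] L by linarith
    have Ediam: "diameter (E t n) \<le> ?L * D n" for t n
    proof (rule diameter_le)
      fix x y assume "x \<in> E t n" "y \<in> E t n"
      then obtain x' y' where *: "x = P x'" "y = P y'" "x' \<in> K n" "y' \<in> K n" by (auto simp: E_def)
      have "norm (x - y) \<le> ?L * norm (x' - y')" using PL * by simp
      also have "\<dots> \<le> ?L * D n" using dist[OF *(3,4)] L by (intro mult_left_mono) auto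
      finally show "norm (x - y) \<le> ?L * D n" .
    qed (use L D0 in auto)
    have Ebdd: "bounded (E t n)" for t n
    proof -
      have "bounded {x \<in> K n. ht x = t}" using K(1) by (rule bounded_subset) auto
      then have "compact (P ` closure {x \<in> K n. ht x = t})"
        by (intro compact_continuous_image continuous_P) (simp add: compact_closure)
      then show ?thesis unfolding E_def
        by (meson bounded_subset closure_subset compact_imp_bounded image_mono)
    qed
    have Eempty: "E t n = {}" if "t \<notin> I n" for t n
    proof (rule ccontr)
      assume "E t n \<noteq> {}"
      then obtain x where x: "x \<in> K n" "ht x = t" by (auto simp: E_def)
      then have "z n \<in> K n" using z by blast
      then have "\<bar>ht x - ht (z n)\<bar> \<le> D n" using ht_diff dist[OF x(1)] order_trans by blast
      then show False using that x(2) by (auto simp: I_def abs_le_iff)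
    qed
    have Ht: "H d \<le> (\<Sum>n. ennreal (pi / 4 * (?L * D n)\<^sup>2) * indicator (I n) t)" if t: "t \<in> {- \<delta>..<\<delta>}" for t
    proof -
      have "A \<subseteq> (\<Union>n. E t n)"
      proof
        fix y assume y: "y \<in> A"
        let ?x = "ft y + t *\<^sub>R b"
        have "P ?x = P y" by (rule P_cong) simp
        also have "P y = y" using y A(2) P_eq by blast
        finally have Px: "P ?x = y" .
        then have "?x \<in> slab A" using y t by (simp add: slab_def)
        then obtain n where "?x \<in> K n" using K(3) by blast
        then have "P ?x \<in> E t n" unfolding E_def by (intro imageI) simp
        then show "y \<in> (\<Union>n. E t n)" using Px by auto
      qed
      moreover have "diameter (E t n) \<le> d" for n
        using Ediam[of t n] K(2)[of n] L by (simp add: D_def field_simps)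
      ultimately have "H d \<le> (\<Sum>n. ennreal (pi / 4 * (diameter (E t n))\<^sup>2))"
        unfolding H_def using Ebdd by (intro INF_lower) auto
      also have "\<dots> \<le> (\<Sum>n. ennreal (pi / 4 * (?L * D n)\<^sup>2) * indicator (I n) t)"
      proof (intro suminf_le)
        fix n
        show "ennreal (pi / 4 * (diameter (E t n))\<^sup>2) \<le> ennreal (pi / 4 * (?L * D n)\<^sup>2) * indicator (I n) t"
        proof (cases "t \<in> I n")
          case True
          have "(diameter (E t n))\<^sup>2 \<le> (?L * D n)\<^sup>2"
            using Ediam diameter_ge_0[OF Ebdd] by (intro power_mono) auto
          then show ?thesis using True by (auto intro!: ennreal_leI mult_left_mono)
        qed (simp add: Eempty)
      qed auto
      finally show ?thesis .
    qed
    \<comment> \<open>Integrating over the height turns squared diameters into cubes, because each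
      cover element contributes only on an interval proportional to its diameter. The sum of cubes
      is what \<open>cube_cover\<close> bounds by volume.\<close>
    have "ennreal (2 * \<delta>) * H d = (\<integral>\<^sup>+t. H d * indicator {- \<delta>..<\<delta>} t \<partial>lborel)"
      using \<delta>_pos by (simp add: nn_integral_cmult_indicator mult.commute)
    also have "\<dots> \<le> (\<integral>\<^sup>+t. (\<Sum>n. ennreal (pi / 4 * (?L * D n)\<^sup>2) * indicator (I n) t) \<partial>lborel)"
      using Ht by (intro nn_integral_mono) (auto split: split_indicator)
    also have "\<dots> = (\<Sum>n. \<integral>\<^sup>+t. ennreal (pi / 4 * (?L * D n)\<^sup>2) * indicator (I n) t \<partial>lborel)"
      by (rule nn_integral_suminf) (auto simp: I_def)
    also have "\<dots> = (\<Sum>n. ennreal (pi / 2 * ?L\<^sup>2) * ennreal (D n ^ 3))"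
    proof (rule suminf_cong)
      fix n
      have "(\<integral>\<^sup>+t. ennreal (pi / 4 * (?L * D n)\<^sup>2) * indicator (I n) t \<partial>lborel)
          = ennreal (pi / 4 * (?L * D n)\<^sup>2) * ennreal (2 * D n)"
        using D0[of n] by (subst nn_integral_cmult_indicator) (auto simp: I_def)
      also have "\<dots> = ennreal (pi / 4 * (?L * D n)\<^sup>2 * (2 * D n))"
        using D0[of n] by (intro ennreal_mult[symmetric]) auto
      also have "pi / 4 * (?L * D n)\<^sup>2 * (2 * D n) = pi / 2 * ?L\<^sup>2 * D n ^ 3"
        by (simp add: power_mult_distrib power2_eq_square power3_eq_cube)
      also have "ennreal \<dots> = ennreal (pi / 2 * ?L\<^sup>2) * ennreal (D n ^ 3)"
        using D0[of n] by (intro ennreal_mult) auto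
      finally show "(\<integral>\<^sup>+t. ennreal (pi / 4 * (?L * D n)\<^sup>2) * indicator (I n) t \<partial>lborel)
        = ennreal (pi / 2 * ?L\<^sup>2) * ennreal (D n ^ 3)" .
    qed
    also have "\<dots> = ennreal (pi / 2 * ?L\<^sup>2) * (\<Sum>n. ennreal (D n ^ 3))"
      by (rule ennreal_suminf_cmult)
    also have "\<dots> \<le> ennreal (pi / 2 * ?L\<^sup>2) * (27 * emeasure lborel G)"
      using K(4) by (intro mult_left_mono) (auto simp: D_def)
    also have "\<dots> = ennreal (27 * (pi / 2) * ?L\<^sup>2) * emeasure lborel G"
    proof -
      have "ennreal (27 * (pi / 2) * ?L\<^sup>2) = 27 * ennreal (pi / 2 * ?L\<^sup>2)"
        by (subst ennreal_numeral[symmetric], subst ennreal_mult[symmetric]) (auto simp: mult.assoc)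
      then show ?thesis by (simp add: mult_ac)
    qed
    finally show ?thesis .
  qed
  have "H d \<le> ennreal haus_const * emeasure lborel (slab A)" if d: "d > 0" for d
  proof (rule ennreal_le_epsilon)
    fix e :: real assume e: "0 < e"
    have hc: "haus_const > 0" using \<delta>_pos L by (simp add: haus_const_def)
    \<comment> \<open>The excess volume is divided by \<open>haus_const\<close> so that it
      contributes exactly \<open>e\<close> in the end.\<close>
    obtain G where G: "open G" "slab A \<subseteq> G" "emeasure lebesgue (G - slab A) < ennreal (e / haus_const)"
      using sets_lebesgue_outer_open[of "slab A" "e / haus_const"] slab_borel[OF A(1)] e hc by (metis divide_pos_pos sets_completionI_sets sets_lborel)
    have "emeasure lborel G = emeasure lborel (slab A \<union> (G - slab A))" using G(2) by (simp add: Un_absorb1)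
    also have "\<dots> \<le> emeasure lborel (slab A) + emeasure lborel (G - slab A)"
      using slab_borel[OF A(1)] G(1) by (intro emeasure_subadditive) auto
    also have "emeasure lborel (G - slab A) = emeasure lebesgue (G - slab A)"
    proof -
      have "G - slab A \<in> sets lborel" using slab_borel[OF A(1)] G(1) by auto
      then show ?thesis by simp
    qed
    finally have GA: "emeasure lborel G \<le> emeasure lborel (slab A) + ennreal (e / haus_const)"
      using G(3) by (meson add_left_mono less_imp_le order_trans)
    have "ennreal (2 * \<delta>) * H d \<le> ennreal (2 * \<delta> * haus_const) * emeasure lborel G"
    proof -
      have "27 * (pi / 2) * ?L\<^sup>2 = 2 * \<delta> * haus_const" using \<delta>_pos by (simp add: haus_const_def)
      then show ?thesis using main[OF d G(1,2)] by (simp only:)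
    qed
    also have "\<dots> = ennreal (2 * \<delta>) * (ennreal haus_const * emeasure lborel G)"
      using \<delta>_pos hc by (simp add: ennreal_mult mult.assoc)
    finally have "H d \<le> ennreal haus_const * emeasure lborel G"
      using \<delta>_pos by (subst (asm) ennreal_mult_le_mult_iff) auto
    also have "\<dots> \<le> ennreal haus_const * (emeasure lborel (slab A) + ennreal (e / haus_const))"
      using GA by (rule mult_left_mono) simp
    also have "\<dots> = ennreal haus_const * emeasure lborel (slab A) + ennreal e"
      using hc e by (simp add: distrib_left ennreal_mult[symmetric])
    finally show "H d \<le> ennreal haus_const * emeasure lborel (slab A) + ennreal e" .
  qed
  then show ?thesis
    unfolding hausdorff2_outer_def H_def by (intro SUP_least) auto
qed

lemma closed_\<Gamma>: "closed \<Gamma>"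
proof -
  have "closed K"
  proof -
    have "K = {x. norm (ft x - x0) \<le> r} \<inter> {x. \<bar>ht x\<bar> \<le> \<delta>}" by (auto simp: cylinder_def)
    moreover have "closed {x. norm (ft x - x0) \<le> r}" "closed {x. \<bar>ht x\<bar> \<le> \<delta>}"
      by (intro closed_Collect_le continuous_intros)+
    ultimately show ?thesis by (simp only: closed_Int)
  qed
  then have "closed (K \<inter> \<rho> -` {0})"
    by (intro continuous_closed_preimage continuous_on_subset[OF C1_on_D(3)[OF C1_\<rho>] cyl_U]) auto
  moreover have "\<Gamma> = K \<inter> \<rho> -` {0}" by (auto simp: \<Gamma>_def)
  ultimately show ?thesis by simp
qed

text \<open>The estimate for sets says that Hausdorff measure restricted to \<open>A\<close> is
  dominated by a multiple of the image under \<open>P\<close> of Lebesgue measure on the cylinder;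
  integrals of nonnegative functions inherit this.\<close>

lemma nn_integral_hausdorff2_le:
  assumes f: "f \<in> borel_measurable borel" and A: "A \<in> sets borel" "A \<subseteq> \<Gamma>"
  shows "(\<integral>\<^sup>+y. f y * indicator A y \<partial>hausdorff2)
    \<le> ennreal (2 * \<delta> * haus_const) * (\<integral>\<^sup>+x. f (P x) * indicator A (P x) * ennreal (weight x) \<partial>lborel)"
proof -
  define S where "S = ht -` {- \<delta>..<\<delta>}"
  have S: "S \<in> sets borel" unfolding S_def using measurable_sets[OF borel_ht, of "{- \<delta>..<\<delta>}"] by simp
  let ?M = "density hausdorff2 (indicator A)"
  let ?N = "scale_measure (ennreal haus_const) (distr (density lborel (indicator S)) borel P)"
  have "emeasure ?M B \<le> emeasure (density ?N (indicator A)) B" if B: "B \<in> sets borel" for B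
  proof -
    have "emeasure ?M B = emeasure hausdorff2 (A \<inter> B)"
      using A B by (subst emeasure_density) (auto simp: indicator_inter_arith[symmetric] nn_integral_indicator)
    also have "\<dots> \<le> ennreal haus_const * emeasure lborel (slab (A \<inter> B))"
      using emeasure_hausdorff2_le hausdorff2_outer_le[of "A \<inter> B"] A B by (meson inf.coboundedI1 order_trans sets.Int)
    also have "slab (A \<inter> B) = S \<inter> (P -` (A \<inter> B))" by (auto simp: slab_def S_def)
    also have "ennreal haus_const * emeasure lborel (S \<inter> (P -` (A \<inter> B))) = emeasure ?N (A \<inter> B)"
    proof -
      have PB: "P -` (A \<inter> B) \<in> sets borel" using measurable_sets[OF borel_P, of "A \<inter> B"] A B by simp
      have "emeasure (distr (density lborel (indicator S)) borel P) (A \<inter> B) = emeasure (density lborel (indicator S)) (P -` (A \<inter> B))"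
        using A B by (subst emeasure_distr) auto
      also have "\<dots> = emeasure lborel (S \<inter> (P -` (A \<inter> B)))"
        using S PB by (subst emeasure_density) (auto simp: indicator_inter_arith[symmetric] nn_integral_indicator)
      finally show ?thesis by simp
    qed
    also have "\<dots> = emeasure (density ?N (indicator A)) B"
      using A B by (subst emeasure_density) (auto simp: indicator_inter_arith[symmetric] nn_integral_indicator)
    finally show ?thesis .
  qed
  then have "?M \<le> density ?N (indicator A)"
    by (subst le_measure) auto
  then have "nn_integral ?M f \<le> nn_integral (density ?N (indicator A)) f"
    by (intro nn_integral_mono_measure) auto
  also have "nn_integral ?M f = (\<integral>\<^sup>+y. f y * indicator A y \<partial>hausdorff2)"
    using f A by (subst nn_integral_density) (auto simp: mult.commute)
  also have "nn_integral (density ?N (indicator A)) f = (\<integral>\<^sup>+y. indicator A y * f y \<partial>?N)"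
    using f A by (subst nn_integral_density) auto
  also have "\<dots> = ennreal haus_const * (\<integral>\<^sup>+y. indicator A y * f y \<partial>distr (density lborel (indicator S)) borel P)"
    using f A by (subst nn_integral_scale_measure) auto
  also have "(\<integral>\<^sup>+y. indicator A y * f y \<partial>distr (density lborel (indicator S)) borel P)
      = (\<integral>\<^sup>+x. indicator A (P x) * f (P x) \<partial>density lborel (indicator S))"
    using f A by (subst nn_integral_distr) auto
  also have "\<dots> = (\<integral>\<^sup>+x. indicator S x * (indicator A (P x) * f (P x)) \<partial>lborel)"
    using f A S by (subst nn_integral_density) auto
  also have "\<dots> = (\<integral>\<^sup>+x. ennreal (2 * \<delta>) * (f (P x) * indicator A (P x) * ennreal (weight x)) \<partial>lborel)"
  proof (rule nn_integral_cong)
    \<comment> \<open>The function \<open>weight\<close> is the normalised indicator of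
      \<open>S\<close>, which accounts for the factor \<open>2 * \<delta>\<close>.\<close>
    fix x
    have "ennreal (2 * \<delta>) * ennreal (weight x) = indicator S x"
      using \<delta>_pos by (auto simp: ennreal_mult[symmetric] weight_def S_def indicator_def)
    then show "indicator S x * (indicator A (P x) * f (P x)) = ennreal (2 * \<delta>) * (f (P x) * indicator A (P x) * ennreal (weight x))"
      unfolding \<open>ennreal (2 * \<delta>) * ennreal (weight x) = indicator S x\<close>[symmetric] by (simp only: mult_ac)
  qed
  also have "\<dots> = ennreal (2 * \<delta>) * (\<integral>\<^sup>+x. f (P x) * indicator A (P x) * ennreal (weight x) \<partial>lborel)"
    by (intro nn_integral_cmult borel_measurable_times_ennreal)
      (use measurable_compose[OF borel_P f] measurable_compose[OF borel_P borel_measurable_indicator[OF A(1)]]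
          measurable_compose[OF borel_weight measurable_ennreal] in auto)
  also have "ennreal haus_const * (ennreal (2 * \<delta>) * (\<integral>\<^sup>+x. f (P x) * indicator A (P x) * ennreal (weight x) \<partial>lborel))
      = ennreal (2 * \<delta> * haus_const) * (\<integral>\<^sup>+x. f (P x) * indicator A (P x) * ennreal (weight x) \<partial>lborel)"
  proof -
    have "0 \<le> haus_const" using \<delta>_pos slope_nonneg by (simp add: haus_const_def)
    then show ?thesis using \<delta>_pos by (simp add: ennreal_mult mult_ac)
  qed
  finally show ?thesis .
qed

end

section \<open>The outward normal and the existence of charts\<close>

lemma gradient_inner:
  assumes "f differentiable (at x)" shows "gradient f x \<bullet> v = dirderiv f v x"
  by (subst dirderiv_axis[OF assms]) (simp add: inner_vec_def gradient_nth mult.commute)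

lemma defining_function_C1: "defining_function \<Omega> U \<rho> \<Longrightarrow> C1_on U \<rho>"
  by (simp add: defining_function_def smooth_on_imp_C1_on)

text \<open>If the unit gradients p and q differ, then \<rho> decreases and \<sigma> increases in
  the direction q - p. As both vanish at \<open>x\<close>, a short step leads to a point that is in
  \<Omega> according to \<rho> and outside according to \<sigma>.\<close>

lemma defining_function_normal_unique:
  assumes "open \<Omega>" "x \<in> frontier \<Omega>" and 1: "x \<in> U" "defining_function \<Omega> U \<rho>" and 2: "x \<in> V" "defining_function \<Omega> V \<sigma>"
  shows "gradient \<rho> x /\<^sub>R norm (gradient \<rho> x) = gradient \<sigma> x /\<^sub>R norm (gradient \<sigma> x)"
proof (rule ccontr)
  define p where "p = gradient \<rho> x /\<^sub>R norm (gradient \<rho> x)"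
  define q where "q = gradient \<sigma> x /\<^sub>R norm (gradient \<sigma> x)"
  assume "\<not> ?thesis"
  then have pq: "p \<noteq> q" by (simp add: p_def q_def)
  have g: "gradient \<rho> x \<noteq> 0" "gradient \<sigma> x \<noteq> 0" using 1 2 by (auto simp: defining_function_def)
  then have n: "norm p = 1" "norm q = 1" by (auto simp: p_def q_def)
  have lt: "p \<bullet> q < 1"
  proof -
    have "(norm (p - q))\<^sup>2 = 2 - 2 * (p \<bullet> q)"
      using n by (simp add: power2_norm_eq_inner inner_diff_left inner_diff_right inner_commute norm_eq_1)
    moreover have "0 < (norm (p - q))\<^sup>2" using pq by simp
    ultimately show ?thesis by linarith
  qed
  have "\<tau> x = 0" if "x \<in> W" "defining_function \<Omega> W \<tau>" for W \<tau>
    by (rule frontier_level_set[OF assms(1) _ C1_on_D(3)[OF defining_function_C1[OF that(2)]] _ assms(2) that(1)])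
      (use that(2) in \<open>auto simp: defining_function_def\<close>)
  then have zero: "\<rho> x = 0" "\<sigma> x = 0" using 1 2 by auto
  have dif: "\<rho> differentiable (at x)" "\<sigma> differentiable (at x)"
    using C1_on_D(1)[OF defining_function_C1[OF 1(2)] 1(1)] C1_on_D(1)[OF defining_function_C1[OF 2(2)] 2(1)] by auto
  define v where "v = q - p"
  have sgn: "dirderiv \<rho> v x < 0" "dirderiv \<sigma> v x > 0"
  proof -
    have e: "gradient \<rho> x = norm (gradient \<rho> x) *\<^sub>R p" "gradient \<sigma> x = norm (gradient \<sigma> x) *\<^sub>R q"
      using g by (simp_all add: p_def q_def)
    have pv: "p \<bullet> v = p \<bullet> q - 1" "q \<bullet> v = 1 - p \<bullet> q"
      using n by (simp_all add: v_def inner_diff_right norm_eq_1 inner_commute)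
    have "gradient \<rho> x \<bullet> v = norm (gradient \<rho> x) * (p \<bullet> v)" "gradient \<sigma> x \<bullet> v = norm (gradient \<sigma> x) * (q \<bullet> v)"
      by (subst e, rule inner_scaleR_left)+
    then have "dirderiv \<rho> v x = norm (gradient \<rho> x) * (p \<bullet> q - 1)" "dirderiv \<sigma> v x = norm (gradient \<sigma> x) * (1 - p \<bullet> q)"
      unfolding gradient_inner[OF dif(1)] gradient_inner[OF dif(2)] pv .
    then show "dirderiv \<rho> v x < 0" "dirderiv \<sigma> v x > 0"
      using lt g by (simp_all add: mult_pos_neg)
  qed
  have quot: "\<forall>\<^sub>F h in at_right 0. (f (x + h *\<^sub>R v) - f x) / h \<in> S"
    if "f differentiable (at x)" "open S" "dirderiv f v x \<in> S" for f S
  proof -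
    have "((\<lambda>h. (f (x + h *\<^sub>R v) - f x) / h) \<longlongrightarrow> dirderiv f v x) (at_right 0)"
      using dirderiv_tendsto[OF that(1)] by (meson filterlim_at_split)
    then show ?thesis using that(2,3) by (rule topological_tendstoD)
  qed
  have "((\<lambda>h. x + h *\<^sub>R v) \<longlongrightarrow> x + 0 *\<^sub>R v) (at_right 0)" by (intro tendsto_intros)
  moreover have "open (U \<inter> V)" "x \<in> U \<inter> V" using 1 2 by (auto simp: defining_function_def)
  ultimately have inUV: "\<forall>\<^sub>F h in at_right 0. x + h *\<^sub>R v \<in> U \<inter> V" by (auto dest: topological_tendstoD)
  have neg: "\<forall>\<^sub>F h in at_right 0. (\<rho> (x + h *\<^sub>R v) - \<rho> x) / h < 0"
    using quot[OF dif(1) open_lessThan[of 0]] sgn(1) by (simp only: lessThan_iff)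
  have pos: "\<forall>\<^sub>F h in at_right 0. (\<sigma> (x + h *\<^sub>R v) - \<sigma> x) / h > 0"
    using quot[OF dif(2) open_greaterThan[of 0]] sgn(2) by (simp only: greaterThan_iff)
  have "\<forall>\<^sub>F h::real in at_right 0. 0 < h \<and> x + h *\<^sub>R v \<in> U \<inter> V \<and> (\<rho> (x + h *\<^sub>R v) - \<rho> x) / h < 0 \<and> (\<sigma> (x + h *\<^sub>R v) - \<sigma> x) / h > 0"
    by (intro eventually_conj eventually_at_right_less inUV neg pos)
  then obtain h :: real where h: "0 < h" "x + h *\<^sub>R v \<in> U \<inter> V" "(\<rho> (x + h *\<^sub>R v) - \<rho> x) / h < 0" "(\<sigma> (x + h *\<^sub>R v) - \<sigma> x) / h > 0"
    using eventually_happens'[OF trivial_limit_at_right_real] by blast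
  then have "\<rho> (x + h *\<^sub>R v) < 0" "\<sigma> (x + h *\<^sub>R v) > 0"
    using zero by (auto simp: divide_less_0_iff zero_less_divide_iff)
  moreover have "\<Omega> \<inter> U = {x\<in>U. \<rho> x < 0}" "\<Omega> \<inter> V = {x\<in>V. \<sigma> x < 0}"
    using 1 2 by (auto simp only: defining_function_def)
  ultimately have "x + h *\<^sub>R v \<in> \<Omega> \<inter> U" "x + h *\<^sub>R v \<notin> \<Omega> \<inter> V" using h(2) by simp_all
  then show False using h(2) by simp
qed

text \<open>Uniqueness resolves the definite description, so the normal may be computed from any
  local defining function.\<close>

lemma outward_normal_eq:
  assumes "open \<Omega>" "x \<in> frontier \<Omega>" "x \<in> U" "defining_function \<Omega> U \<rho>"
  shows "outward_normal \<Omega> x = gradient \<rho> x /\<^sub>R norm (gradient \<rho> x)"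
  unfolding outward_normal_def
proof (rule the_equality)
  show "\<exists>U \<rho>'. x \<in> U \<and> defining_function \<Omega> U \<rho>' \<and> gradient \<rho> x /\<^sub>R norm (gradient \<rho> x) = gradient \<rho>' x /\<^sub>R norm (gradient \<rho>' x)"
    using assms by blast
  show "n = gradient \<rho> x /\<^sub>R norm (gradient \<rho> x)"
    if "\<exists>U \<rho>'. x \<in> U \<and> defining_function \<Omega> U \<rho>' \<and> n = gradient \<rho>' x /\<^sub>R norm (gradient \<rho>' x)" for n
    using that defining_function_normal_unique[OF assms(1,2)] assms(3,4) by metis
qed

lemma Ck_on_subset: "Ck_on k U f \<Longrightarrow> V \<subseteq> U \<Longrightarrow> Ck_on k V f"
proof (induction k arbitrary: f)
  case 0
  then show ?case by (auto intro: continuous_on_subset)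
next
  case (Suc k)
  then show ?case by (auto simp: subset_eq)
qed

lemma dirderiv_abs_le:
  fixes f :: "R3 \<Rightarrow> real"
  assumes "f differentiable (at x)" "\<And>i. \<bar>dirderiv f (axis i 1) x\<bar> \<le> B"
  shows "\<bar>dirderiv f v x\<bar> \<le> 3 * B * norm v"
proof -
  have "\<bar>dirderiv f v x\<bar> \<le> (\<Sum>i\<in>UNIV. \<bar>v $ i * dirderiv f (axis i 1) x\<bar>)"
    unfolding dirderiv_axis[OF assms(1), of v] by (rule sum_abs)
  also have "\<dots> \<le> (\<Sum>i\<in>(UNIV::3 set). norm v * B)"
    using assms(2) component_le_norm_cart[of v] by (intro sum_mono) (auto simp: abs_mult intro!: mult_mono)
  finally show ?thesis by (simp add: mult_ac)
qed

text \<open>The axis is the unit gradient at \<open>x0\<close>; there the slope equals the length of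
  the gradient, and by continuity it stays above half of it on a ball into which the cylinder is
  then fitted.\<close>

lemma boundary_chart_exists:
  assumes "open \<Omega>" "smooth_boundary \<Omega>" "x0 \<in> frontier \<Omega>"
  obtains U \<rho> b r \<delta> m M where "boundary_chart \<Omega> U \<rho> x0 b r \<delta> m M"
proof -
  obtain U \<rho> where U: "x0 \<in> U" "defining_function \<Omega> U \<rho>" using assms(2,3) unfolding smooth_boundary_def by blast
  have oU: "open U" and sm: "smooth_on U \<rho>" and ins: "\<Omega> \<inter> U = {x\<in>U. \<rho> x < 0}" and g0: "gradient \<rho> x0 \<noteq> 0"
    using U by (auto simp: defining_function_def)
  note C1 = smooth_on_imp_C1_on[OF sm]
  have \<rho>0: "\<rho> x0 = 0" by (rule frontier_level_set[OF assms(1) oU C1_on_D(3)[OF C1] ins assms(3) U(1)])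
  define b where "b = gradient \<rho> x0 /\<^sub>R norm (gradient \<rho> x0)"
  have nb: "norm b = 1" using g0 by (simp add: b_def)
  define m where "m = norm (gradient \<rho> x0) / 2"
  have m: "m > 0" using g0 by (simp add: m_def)
  have "dirderiv \<rho> b x0 = norm (gradient \<rho> x0)"
    unfolding gradient_inner[OF C1_on_D(1)[OF C1 U(1)], symmetric] b_def
    using g0 by (simp add: power2_norm_eq_inner[symmetric] power2_eq_square)
  then have "x0 \<in> U \<inter> dirderiv \<rho> b -` {m<..}" using U(1) g0 by (simp add: m_def)
  moreover have "open (U \<inter> dirderiv \<rho> b -` {m<..})"
    by (rule continuous_open_preimage[OF C1_on_D(2)[OF C1] oU]) simp
  ultimately obtain R where R: "R > 0" "cball x0 R \<subseteq> U \<inter> dirderiv \<rho> b -` {m<..}"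
    using open_contains_cball by metis
  have "\<exists>B. \<forall>x\<in>cball x0 R. \<bar>dirderiv \<rho> (axis i 1) x\<bar> \<le> B" for i :: 3
  proof -
    have "continuous_on (cball x0 R) (dirderiv \<rho> (axis i 1))"
      using C1_on_D(2)[OF C1] R(2) by (meson continuous_on_subset le_infE)
    then have "bounded (dirderiv \<rho> (axis i 1) ` cball x0 R)"
      using compact_continuous_image compact_cball compact_imp_bounded by blast
    then show ?thesis by (auto simp: bounded_iff)
  qed
  then obtain B where B: "\<And>i x. x \<in> cball x0 R \<Longrightarrow> \<bar>dirderiv \<rho> (axis i 1) x\<bar> \<le> B i" by metis
  \<comment> \<open>The factor 3 is that of \<open>dirderiv_abs_le\<close>, which sums the three
    partial derivatives.\<close>
  define M where "M = 3 * Max (range (\<lambda>i::3. \<bar>B i\<bar>))"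
  have Bmax: "\<bar>B i\<bar> \<le> Max (range (\<lambda>i::3. \<bar>B i\<bar>))" for i by (rule Max_ge) auto
  have M0: "M \<ge> 0" using Bmax[of 1] abs_ge_zero[of "B 1"] unfolding M_def by linarith
  have lip: "\<bar>\<rho> x - \<rho> y\<bar> \<le> M * norm (x - y)" if "x \<in> cball x0 R" "y \<in> cball x0 R" for x y
  proof -
    have "norm (\<rho> x - \<rho> y) \<le> M * norm (x - y)"
    proof (rule differentiable_bound[where S="cball x0 R" and f'="\<lambda>x v. dirderiv \<rho> v x"])
      show "(\<rho> has_derivative (\<lambda>v. dirderiv \<rho> v z)) (at z within cball x0 R)" if "z \<in> cball x0 R" for z
        using has_derivative_dirderiv[OF C1_on_D(1)[OF C1]] that R(2) has_derivative_at_withinI by blast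
      show "onorm (\<lambda>v. dirderiv \<rho> v z) \<le> M" if z: "z \<in> cball x0 R" for z
      proof (rule onorm_le)
        fix v
        have "\<bar>dirderiv \<rho> (axis i 1) z\<bar> \<le> Max (range (\<lambda>i::3. \<bar>B i\<bar>))" for i
          using B[OF z, of i] Bmax[of i] by linarith
        from dirderiv_abs_le[OF C1_on_D(1)[OF C1] this, of v]
        show "norm (dirderiv \<rho> v z) \<le> M * norm v" using z R(2) by (auto simp: M_def)
      qed
    qed (use that in auto)
    then show ?thesis by simp
  qed
  define \<delta> where "\<delta> = R / 2"
  \<comment> \<open>The second bound gives M r <= m \<delta> / 4, half of what \<open>small\<close>
    allows; \<open>M + 1\<close> excludes a zero denominator.\<close>
  define r where "r = min (R / 2) (m * \<delta> / (4 * (M + 1)))"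
  have d: "\<delta> > 0" using R by (simp add: \<delta>_def)
  have r: "r > 0" using R d m M0 by (simp add: r_def)
  have cyl: "cylinder x0 b r \<delta> \<subseteq> cball x0 R"
  proof
    fix x assume "x \<in> cylinder x0 b r \<delta>"
    then have *: "norm (foot x0 b x - x0) \<le> R / 2" "\<bar>height x0 b x\<bar> \<le> R / 2"
      by (auto simp: cylinder_def \<delta>_def r_def)
    have "x - x0 = (foot x0 b x - x0) + height x0 b x *\<^sub>R b" by (simp add: foot_def)
    then have "norm (x - x0) \<le> norm (foot x0 b x - x0) + norm (height x0 b x *\<^sub>R b)" by (metis norm_triangle_ineq)
    then show "x \<in> cball x0 R" using * nb by (simp add: dist_norm norm_minus_commute)
  qed
  have "boundary_chart \<Omega> U \<rho> x0 b r \<delta> m M"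
  proof
    show "m \<le> dirderiv \<rho> b x" if "x \<in> cylinder x0 b r \<delta>" for x using that cyl R(2) by force
    show "\<bar>\<rho> x - \<rho> y\<bar> \<le> M * norm (x - y)" if "x \<in> cylinder x0 b r \<delta>" "y \<in> cylinder x0 b r \<delta>" for x y
      using lip that cyl by blast
    have "M * r \<le> M * (m * \<delta> / (4 * (M + 1)))" using M0 by (intro mult_left_mono) (auto simp: r_def)
    also have "\<dots> = (m * \<delta> / 4) * (M / (M + 1))" by simp
    also have "\<dots> \<le> (m * \<delta> / 4) * 1" using M0 m d by (intro mult_left_mono) auto
    also have "\<dots> < m * \<delta> / 2" using m d by simp
    finally show "M * r < m * \<delta> / 2" .
  qed (use assms oU sm ins nb r d m M0 cyl R(2) \<rho>0 in auto)
  then show thesis by (rule that)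
qed

section \<open>The trace inequality\<close>

lemma jac_nth: "jac W x $ i $ j = dirderiv (\<lambda>y. W y $ i) (axis j 1) x"
  by (simp add: jac_def)

lemma matrix_entry_le_norm: "\<bar>(A :: real^3^3) $ i $ j\<bar> \<le> norm A"
  using component_le_norm_cart[of "A $ i" j] Finite_Cartesian_Product.norm_nth_le[of A i] by linarith

lemma dirderiv_component_le:
  assumes "smooth_on UNIV W" "norm v \<le> 1"
  shows "\<bar>dirderiv (\<lambda>y. W y $ i) v x\<bar> \<le> 3 * norm (jac W x)"
proof -
  have "\<bar>dirderiv (\<lambda>y. W y $ i) v x\<bar> \<le> 3 * norm (jac W x) * norm v"
    using matrix_entry_le_norm[of "jac W x"] C1_on_D(1)[OF smooth_on_nth[OF assms(1)], of x]
    by (intro dirderiv_abs_le) (auto simp: jac_nth)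
  also have "\<dots> \<le> 3 * norm (jac W x) * 1" using assms(2) by (intro mult_left_mono) auto
  finally show ?thesis by simp
qed

lemma integral_square_lborel:
  fixes f :: "R3 \<Rightarrow> 'b::euclidean_space"
  assumes "open \<Omega>" "bounded \<Omega>" "continuous_on UNIV f"
  shows "(L2_norm (lebesgue_on \<Omega>) f)\<^sup>2 = (\<integral>x. indicator \<Omega> x * (norm (f x))\<^sup>2 \<partial>lborel)"
    and "integrable lborel (\<lambda>x. indicator \<Omega> x * (norm (f x))\<^sup>2)"
proof -
  have m: "f \<in> borel_measurable borel" using assms(3) by (rule borel_measurable_continuous_onI)
  show "(L2_norm (lebesgue_on \<Omega>) f)\<^sup>2 = (\<integral>x. indicator \<Omega> x * (norm (f x))\<^sup>2 \<partial>lborel)"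
    unfolding L2_norm_power2 using m by (intro integral_lebesgue_on_open assms) measurable
  have "integrable (lebesgue_on \<Omega>) (\<lambda>x. (norm (f x))\<^sup>2)"
    using continuous_on_closure_L2[OF assms(1,2)] assms(3) continuous_on_subset L2_integrable_square by blast
  then have "integrable lebesgue (\<lambda>x. indicator \<Omega> x *\<^sub>R (norm (f x))\<^sup>2)"
    using assms(1) by (subst (asm) integrable_restrict_space) auto
  then show "integrable lborel (\<lambda>x. indicator \<Omega> x * (norm (f x))\<^sup>2)"
    using m assms(1) by (subst (asm) integrable_completion) auto
qed

context boundary_chart
begin

text \<open>A C^1 function supported in the ball of radius \<open>s\<close>; using the squared
  distance keeps it differentiable at the centre.\<close>

definition bump :: "real \<Rightarrow> R3 \<Rightarrow> real" where
  "bump s x = neg_square ((x - x0) \<bullet> (x - x0) - s\<^sup>2)"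

lemma cball_V: "s < r \<Longrightarrow> s < \<delta> \<Longrightarrow> cball x0 s \<subseteq> V"
proof
  fix x assume s: "s < r" "s < \<delta>" and "x \<in> cball x0 s"
  then have "norm (x - x0) \<le> s" by (simp add: dist_norm norm_minus_commute)
  then show "x \<in> V" using norm_ft_diff[of x x0] ht_diff[of x x0] s by (simp add: open_cylinder_def)
qed

lemma bump_has_derivative:
  "(bump s has_derivative (\<lambda>v. 2 * min 0 ((x - x0) \<bullet> (x - x0) - s\<^sup>2) * (2 * ((x - x0) \<bullet> v)))) (at x)"
proof -
  have "((\<lambda>x. (x - x0) \<bullet> (x - x0) - s\<^sup>2) has_derivative (\<lambda>v. 2 * ((x - x0) \<bullet> v))) (at x)"
    by (auto intro!: derivative_eq_intros simp: inner_commute)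
  from has_derivative_compose[OF this neg_square_has_derivative[unfolded has_field_derivative_def]]
  show ?thesis by (simp add: bump_def[abs_def])
qed

lemma bump_C1c:
  assumes "s > 0" "s < r" "s < \<delta>" shows "C1c V (bump s)"
  unfolding C1c_def
proof (intro conjI allI exI[of _ "cball x0 s"] impI)
  show "bump s differentiable (at x)" for x using bump_has_derivative by (auto simp: differentiable_def)
  show "continuous_on UNIV (dirderiv (bump s) v)" for v
    by (subst continuous_on_cong[OF refl dirderiv_eqI[OF bump_has_derivative]]) (auto intro!: continuous_intros)
  show "compact (cball x0 s)" "cball x0 s \<subseteq> V" using cball_V assms by auto
  show "bump s x = 0" if "x \<notin> cball x0 s" for x
  proof -
    have "s < norm (x - x0)" using that by (simp add: dist_norm norm_minus_commute)
    then have "s\<^sup>2 \<le> (norm (x - x0))\<^sup>2" using assms by (intro power_mono) auto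
    then show ?thesis by (simp add: bump_def neg_square_def power2_norm_eq_inner)
  qed
qed

lemma bump_nonneg: "0 \<le> bump s x"
  by (simp add: bump_def neg_square_nonneg)

text \<open>On the half ball s^2 - |x - x0|^2 is at least 3/4 s^2, and the square of 3/4 exceeds
  1/2. This is the origin of the constants with \<open>2 / s ^ 4\<close>.\<close>

lemma bump_ge:
  assumes "x \<in> cball x0 (s / 2)"
  shows "s ^ 4 / 2 \<le> bump s x"
proof -
  have "(norm (x - x0))\<^sup>2 \<le> (s / 2)\<^sup>2"
    using assms by (intro power_mono) (auto simp: dist_norm norm_minus_commute)
  then have "3 / 4 * s\<^sup>2 \<le> s\<^sup>2 - (x - x0) \<bullet> (x - x0)"
    by (simp add: power2_norm_eq_inner power_divide)
  then have "(3 / 4 * s\<^sup>2)\<^sup>2 \<le> (s\<^sup>2 - (x - x0) \<bullet> (x - x0))\<^sup>2"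
    by (intro power_mono) auto
  moreover have "bump s x = (s\<^sup>2 - (x - x0) \<bullet> (x - x0))\<^sup>2"
  proof -
    have "(x - x0) \<bullet> (x - x0) - s\<^sup>2 \<le> 0"
      using \<open>3 / 4 * s\<^sup>2 \<le> s\<^sup>2 - (x - x0) \<bullet> (x - x0)\<close> zero_le_power2[of s] by linarith
    then show ?thesis by (simp only: bump_def neg_square_def min_absorb2 power2_commute)
  qed
  moreover have "(3 / 4 * s\<^sup>2)\<^sup>2 = 9 / 16 * s ^ 4" by (simp add: power_mult_distrib power2_eq_square power4_eq_xxxx)
  moreover have "0 \<le> s ^ 4" by simp
  ultimately show ?thesis by linarith
qed

lemma haus_const_nonneg: "0 \<le> haus_const"
  using \<delta>_pos slope_nonneg by (simp add: haus_const_def)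

text \<open>Combines the comparison of measures with a localised majorant: \<open>f\<close> has
  support in the chart and dominates \<open>h\<close> on the smaller piece \<open>A\<close>.\<close>

lemma surface_integral_le:
  assumes s: "s > 0" "s < r" "s < \<delta>" and A: "A = \<Gamma> \<inter> cball x0 (s / 2)"
    and f: "C1c V f" "\<And>x. 0 \<le> f x" and h: "h \<in> borel_measurable borel"
    and le: "\<And>x. x \<in> A \<Longrightarrow> h x \<le> ennreal (c * f x)" and c: "c \<ge> 0"
  shows "(\<integral>\<^sup>+y. h y * indicator A y \<partial>hausdorff2)
    \<le> ennreal (c * (2 * \<delta> * haus_const) * (\<integral>x. f (P x) * weight x \<partial>lborel))"
proof -
  have Ab: "A \<in> sets borel" "A \<subseteq> \<Gamma>" using closed_\<Gamma> A by auto
  have "(\<integral>\<^sup>+y. h y * indicator A y \<partial>hausdorff2) \<le> (\<integral>\<^sup>+y. ennreal (c * f y) * indicator A y \<partial>hausdorff2)"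
    by (intro nn_integral_mono) (auto split: split_indicator intro: le)
  also have "\<dots> \<le> ennreal (2 * \<delta> * haus_const) * (\<integral>\<^sup>+x. ennreal (c * f (P x)) * indicator A (P x) * ennreal (weight x) \<partial>lborel)"
    using C1c_borel(1)[OF f(1)] by (intro nn_integral_hausdorff2_le Ab) measurable
  also have "\<dots> \<le> ennreal (2 * \<delta> * haus_const) * (\<integral>\<^sup>+x. ennreal (c * (f (P x) * weight x)) \<partial>lborel)"
  proof (intro mult_left_mono nn_integral_mono)
    show "ennreal (c * f (P x)) * indicator A (P x) * ennreal (weight x) \<le> ennreal (c * (f (P x) * weight x))" for x
      using c f(2)[of "P x"] weight_nonneg[of x]
      by (auto split: split_indicator simp: ennreal_mult[symmetric] mult.assoc)
  qed simp
  also have "(\<integral>\<^sup>+x. ennreal (c * (f (P x) * weight x)) \<partial>lborel) = ennreal (\<integral>x. c * (f (P x) * weight x) \<partial>lborel)"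
    using vertical_divergence(2)[OF f(1)] c f(2) weight_nonneg
    by (intro nn_integral_eq_integral) (auto intro!: mult_nonneg_nonneg)
  also have "ennreal (2 * \<delta> * haus_const) * \<dots> = ennreal (c * (2 * \<delta> * haus_const) * (\<integral>x. f (P x) * weight x \<partial>lborel))"
    using \<delta>_pos haus_const_nonneg by (subst ennreal_mult'[symmetric]) (auto simp: mult_ac)
  finally show ?thesis .
qed

text \<open>The vertical theorem is applied to \<open>bump s\<close> times |W|^2: the boundary
  values become the integral over \<Omega> of a derivative along \<open>b\<close>, which the product
  rule bounds by |W|^2 + |DW|^2.\<close>

lemma chart_trace_inequality:
  assumes "bounded \<Omega>" and s: "s > 0" "s < r" "s < \<delta>"
  obtains C where "C \<ge> 0" "\<And>W. smooth_on UNIV W \<Longrightarrow>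
    (\<integral>\<^sup>+y. ennreal ((norm (W y))\<^sup>2) * indicator (\<Gamma> \<inter> cball x0 (s / 2)) y \<partial>hausdorff2)
      \<le> ennreal (C * ((L2_norm (lebesgue_on \<Omega>) W)\<^sup>2 + (L2_norm (lebesgue_on \<Omega>) (jac W))\<^sup>2))"
proof -
  note bc = bump_C1c[OF s]
  obtain B L where B: "\<And>x. \<bar>bump s x\<bar> \<le> B" and L: "\<And>x. \<bar>dirderiv (bump s) b x\<bar> \<le> L"
    using C1c_bounds[OF bc, of b] by metis
  have B0: "B \<ge> 0" "L \<ge> 0" using B[of x0] L[of x0] by linarith+
  define c where "c = 2 / s ^ 4"
  \<comment> \<open>In \<open>9 * B\<close>, one factor 3 counts the components and the other comes
    from \<open>dirderiv_component_le\<close>; \<open>L\<close> belongs to the derivative of the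
    bump.\<close>
  define C where "C = c * (2 * \<delta> * haus_const) * (9 * B + L)"
  have c0: "c \<ge> 0" using s by (simp add: c_def)
  have C0: "C \<ge> 0" using c0 B0 haus_const_nonneg \<delta>_pos by (simp add: C_def)
  have "(\<integral>\<^sup>+y. ennreal ((norm (W y))\<^sup>2) * indicator (\<Gamma> \<inter> cball x0 (s / 2)) y \<partial>hausdorff2)
      \<le> ennreal (C * ((L2_norm (lebesgue_on \<Omega>) W)\<^sup>2 + (L2_norm (lebesgue_on \<Omega>) (jac W))\<^sup>2))" if W: "smooth_on UNIV W" for W
  proof -
    define q where "q x = (\<Sum>i\<in>UNIV. W x $ i * W x $ i)" for x
    define f where "f x = bump s x * q x" for x
    have qn: "q x = (norm (W x))\<^sup>2" for x
      unfolding q_def power2_norm_eq_inner inner_vec_def by simp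
    have Wi: "C1_on UNIV (\<lambda>x. W x $ i)" for i by (rule smooth_on_nth[OF W])
    have q1: "C1_on UNIV q" unfolding q_def by (intro C1_on_sum C1_on_mult Wi)
    have f: "C1c V f" unfolding f_def by (rule C1c_mult_C1_on[OF bc C1_on_subset[OF q1] open_V]) simp
    have qd: "\<bar>dirderiv q b x\<bar> \<le> 9 * ((norm (W x))\<^sup>2 + (norm (jac W x))\<^sup>2)" for x
    proof -
      have D: "(q has_derivative (\<lambda>v. \<Sum>i\<in>UNIV. W x $ i * dirderiv (\<lambda>y. W y $ i) v x + dirderiv (\<lambda>y. W y $ i) v x * W x $ i)) (at x)"
        unfolding q_def using has_derivative_dirderiv[OF C1_on_D(1)[OF Wi, of x]]
        by (intro has_derivative_sum has_derivative_mult) auto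
      have "\<bar>dirderiv q b x\<bar> \<le> (\<Sum>i\<in>UNIV. \<bar>W x $ i * dirderiv (\<lambda>y. W y $ i) b x + dirderiv (\<lambda>y. W y $ i) b x * W x $ i\<bar>)"
        unfolding dirderiv_eqI[OF D] by (rule sum_abs)
      also have "\<dots> \<le> (\<Sum>i\<in>(UNIV::3 set). 3 * ((norm (W x))\<^sup>2 + (norm (jac W x))\<^sup>2))"
      proof (rule sum_mono)
        fix i :: 3
        have "\<bar>W x $ i\<bar> * \<bar>dirderiv (\<lambda>y. W y $ i) b x\<bar> \<le> norm (W x) * (3 * norm (jac W x))"
          using dirderiv_component_le[OF W, of b i x] norm_b component_le_norm_cart[of "W x" i] by (intro mult_mono) auto
        moreover have "2 * (norm (W x) * norm (jac W x)) \<le> (norm (W x))\<^sup>2 + (norm (jac W x))\<^sup>2"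
          using sum_squares_bound[of "norm (W x)" "norm (jac W x)"] by simp
        ultimately show "\<bar>W x $ i * dirderiv (\<lambda>y. W y $ i) b x + dirderiv (\<lambda>y. W y $ i) b x * W x $ i\<bar>
            \<le> 3 * ((norm (W x))\<^sup>2 + (norm (jac W x))\<^sup>2)"
          unfolding mult.commute[of "dirderiv (\<lambda>y. W y $ i) b x"] mult_2[symmetric] abs_mult by simp
      qed
      also have "\<dots> = 9 * ((norm (W x))\<^sup>2 + (norm (jac W x))\<^sup>2)" by simp
      finally show ?thesis .
    qed
    have fd: "dirderiv f b x \<le> (9 * B + L) * ((norm (W x))\<^sup>2 + (norm (jac W x))\<^sup>2)" for x
    proof -
      have "dirderiv f b x = bump s x * dirderiv q b x + dirderiv (bump s) b x * q x"
        unfolding f_def using bc C1_on_D(1)[OF q1, of x] by (intro dirderiv_mult) (auto simp: C1c_def)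
      also have "\<dots> \<le> \<bar>bump s x\<bar> * \<bar>dirderiv q b x\<bar> + \<bar>dirderiv (bump s) b x\<bar> * \<bar>q x\<bar>"
        unfolding abs_mult[symmetric] by (intro add_mono abs_ge_self)
      also have "\<dots> \<le> B * (9 * ((norm (W x))\<^sup>2 + (norm (jac W x))\<^sup>2)) + L * ((norm (W x))\<^sup>2 + (norm (jac W x))\<^sup>2)"
        using B[of x] L[of x] B0 qd[of x] by (intro add_mono mult_mono) (auto simp: qn)
      finally show ?thesis by (simp add: algebra_simps)
    qed
    note I1 = integral_square_lborel[OF open_\<Omega> assms(1) continuous_smooth[OF W, of UNIV]]
    note I2 = integral_square_lborel[OF open_\<Omega> assms(1) continuous_jac[OF W, of UNIV]]
    have "(\<integral>x. f (P x) * weight x \<partial>lborel) = (\<integral>x. indicator \<Omega> x * dirderiv f b x \<partial>lborel)"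
      using vertical_divergence(3)[OF f] by simp
    also have "\<dots> \<le> (\<integral>x. (9 * B + L) * (indicator \<Omega> x * (norm (W x))\<^sup>2 + indicator \<Omega> x * (norm (jac W x))\<^sup>2) \<partial>lborel)"
      using I1(2) I2(2) vertical_divergence(1)[OF f] fd by (intro integral_mono) (auto split: split_indicator)
    also have "\<dots> = (9 * B + L) * ((L2_norm (lebesgue_on \<Omega>) W)\<^sup>2 + (L2_norm (lebesgue_on \<Omega>) (jac W))\<^sup>2)"
      using I1 I2 by simp
    finally have "(\<integral>x. f (P x) * weight x \<partial>lborel) \<le> (9 * B + L) * ((L2_norm (lebesgue_on \<Omega>) W)\<^sup>2 + (L2_norm (lebesgue_on \<Omega>) (jac W))\<^sup>2)" .
    then have "c * (2 * \<delta> * haus_const) * (\<integral>x. f (P x) * weight x \<partial>lborel)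
        \<le> c * (2 * \<delta> * haus_const) * ((9 * B + L) * ((L2_norm (lebesgue_on \<Omega>) W)\<^sup>2 + (L2_norm (lebesgue_on \<Omega>) (jac W))\<^sup>2))"
      using c0 \<delta>_pos haus_const_nonneg by (intro mult_left_mono) auto
    then have le: "c * (2 * \<delta> * haus_const) * (\<integral>x. f (P x) * weight x \<partial>lborel)
        \<le> C * ((L2_norm (lebesgue_on \<Omega>) W)\<^sup>2 + (L2_norm (lebesgue_on \<Omega>) (jac W))\<^sup>2)"
      by (simp add: C_def mult.assoc)
    have "(\<integral>\<^sup>+y. ennreal ((norm (W y))\<^sup>2) * indicator (\<Gamma> \<inter> cball x0 (s / 2)) y \<partial>hausdorff2)
        \<le> ennreal (c * (2 * \<delta> * haus_const) * (\<integral>x. f (P x) * weight x \<partial>lborel))"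
    proof (rule surface_integral_le[OF s refl f])
      show "0 \<le> f x" for x using bump_nonneg by (simp add: f_def qn)
      have "continuous_on UNIV W" by (rule continuous_smooth[OF W])
      then show "(\<lambda>y. ennreal ((norm (W y))\<^sup>2)) \<in> borel_measurable borel"
        using borel_measurable_continuous_onI[of W] by measurable
      show "ennreal ((norm (W x))\<^sup>2) \<le> ennreal (c * f x)" if "x \<in> \<Gamma> \<inter> cball x0 (s / 2)" for x
      proof (rule ennreal_leI)
        have "1 \<le> c * bump s x" using bump_ge[of x s] that s by (simp add: c_def field_simps)
        from mult_right_mono[OF this, of "q x"] show "(norm (W x))\<^sup>2 \<le> c * f x"
          by (simp add: f_def qn mult.assoc)
      qed
    qed (use c0 in auto)
    also have "\<dots> \<le> ennreal (C * ((L2_norm (lebesgue_on \<Omega>) W)\<^sup>2 + (L2_norm (lebesgue_on \<Omega>) (jac W))\<^sup>2))"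
      by (rule ennreal_leI[OF le])
    finally show ?thesis .
  qed
  with C0 show thesis by (rule that)
qed

end

section \<open>From charts to the whole boundary\<close>

lemma smooth_on_scaleR:
  fixes f :: "'a::euclidean_space \<Rightarrow> 'b::real_normed_vector"
  assumes "smooth_on UNIV f" shows "smooth_on UNIV (\<lambda>x. c *\<^sub>R f x)"
proof -
  have "Ck_on k UNIV g \<Longrightarrow> Ck_on k UNIV (\<lambda>x. c *\<^sub>R g x)" for k and g :: "'a \<Rightarrow> 'b"
  proof (induction k arbitrary: g)
    case 0
    then show ?case by (auto intro: continuous_intros)
  next
    case (Suc k)
    have "frechet_derivative (\<lambda>x. c *\<^sub>R g x) (at x) = (\<lambda>b. c *\<^sub>R frechet_derivative g (at x) b)" for x
      using Suc.prems by (intro frechet_derivative_at[symmetric] has_derivative_scaleR_right)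
        (simp_all add: frechet_derivative_works[symmetric])
    then show ?case using Suc by auto
  qed
  then show ?thesis using assms by (auto simp: smooth_on_def)
qed

lemma smooth_closure_lincomb:
  assumes "u \<in> smooth_closure \<Omega>" "v \<in> smooth_closure \<Omega>"
  shows "(\<lambda>x. u x + c *\<^sub>R v x) \<in> smooth_closure \<Omega>"
proof -
  obtain U V where "smooth_on UNIV U" "\<And>x. x \<in> closure \<Omega> \<Longrightarrow> u x = U x"
    "smooth_on UNIV V" "\<And>x. x \<in> closure \<Omega> \<Longrightarrow> v x = V x"
    using assms by (auto simp: smooth_closure_def)
  then show ?thesis unfolding smooth_closure_def
    using smooth_on_scaleR[of V c] by (auto intro!: exI[of _ "\<lambda>x. U x + c *\<^sub>R V x"] Ck_on_add simp: smooth_on_def)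
qed

lemma L2_norm_cong: "(\<And>x. x \<in> space M \<Longrightarrow> f x = g x) \<Longrightarrow> L2_norm M f = L2_norm M g"
  unfolding L2_norm_def by (intro arg_cong[where f=sqrt] Bochner_Integration.integral_cong) auto

lemma H1_norm_smooth_closure:
  assumes "open \<Omega>" "bounded \<Omega>" "smooth_on UNIV W" "\<And>x. x \<in> closure \<Omega> \<Longrightarrow> w x = W x"
  shows "(H1_norm \<Omega> w)\<^sup>2 = (L2_norm (lebesgue_on \<Omega>) W)\<^sup>2 + (L2_norm (lebesgue_on \<Omega>) (jac W))\<^sup>2"
proof -
  note * = smooth_closure_weak_gradient[OF assms]
  have "L2_norm (lebesgue_on \<Omega>) w = L2_norm (lebesgue_on \<Omega>) W"
    using assms(4) closure_subset by (intro L2_norm_cong) (auto simp: subset_eq)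
  moreover have "L2_norm (lebesgue_on \<Omega>) (weak_grad \<Omega> w) = L2_norm (lebesgue_on \<Omega>) (jac W)"
    using H1_D(2)[OF *(2)] *(1) by (intro L2_norm_cong_AE *(3)) (auto simp: has_weak_gradient_def L2_def)
  ultimately show ?thesis by (simp add: H1_norm_def)
qed

lemma smooth_closure_H1: "open \<Omega> \<Longrightarrow> bounded \<Omega> \<Longrightarrow> w \<in> smooth_closure \<Omega> \<Longrightarrow> w \<in> H1 \<Omega>"
  by (metis smooth_closureE smooth_closure_weak_gradient(2))

lemma local_trace_inequality:
  assumes "open \<Omega>" "bounded \<Omega>" "smooth_boundary \<Omega>" "x0 \<in> frontier \<Omega>"
  obtains s C where "s > 0" "C \<ge> 0" "\<And>W. smooth_on UNIV W \<Longrightarrow>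
    (\<integral>\<^sup>+y. ennreal ((norm (W y))\<^sup>2) * indicator (frontier \<Omega> \<inter> ball x0 s) y \<partial>hausdorff2)
      \<le> ennreal (C * ((L2_norm (lebesgue_on \<Omega>) W)\<^sup>2 + (L2_norm (lebesgue_on \<Omega>) (jac W))\<^sup>2))"
proof -
  obtain U \<rho> b r \<delta> m M where "boundary_chart \<Omega> U \<rho> x0 b r \<delta> m M"
    using boundary_chart_exists[OF assms(1,3,4)] .
  then interpret boundary_chart \<Omega> U \<rho> x0 b r \<delta> m M .
  define s where "s = min r \<delta> / 2"
  have s: "s > 0" "s < r" "s < \<delta>" using r_pos \<delta>_pos by (auto simp: s_def)
  obtain C where C: "C \<ge> 0" "\<And>W. smooth_on UNIV W \<Longrightarrow>
    (\<integral>\<^sup>+y. ennreal ((norm (W y))\<^sup>2) * indicator (\<Gamma> \<inter> cball x0 (s / 2)) y \<partial>hausdorff2)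
      \<le> ennreal (C * ((L2_norm (lebesgue_on \<Omega>) W)\<^sup>2 + (L2_norm (lebesgue_on \<Omega>) (jac W))\<^sup>2))"
    using chart_trace_inequality[OF assms(2) s] by blast
  have sub: "frontier \<Omega> \<inter> ball x0 (s / 2) \<subseteq> \<Gamma> \<inter> cball x0 (s / 2)"
  proof
    fix x assume x: "x \<in> frontier \<Omega> \<inter> ball x0 (s / 2)"
    then have "x \<in> cball x0 s" using s by auto
    then have "x \<in> K" using cball_V[OF s(2,3)] V_subset_K by blast
    then show "x \<in> \<Gamma> \<inter> cball x0 (s / 2)" using x frontier_K by auto
  qed
  show thesis
  proof (rule that)
    show "s / 2 > 0" using s by simp
    show "C \<ge> 0" by fact
    fix W :: vfield assume W: "smooth_on UNIV W"
    have "(\<integral>\<^sup>+y. ennreal ((norm (W y))\<^sup>2) * indicator (frontier \<Omega> \<inter> ball x0 (s / 2)) y \<partial>hausdorff2)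
      \<le> (\<integral>\<^sup>+y. ennreal ((norm (W y))\<^sup>2) * indicator (\<Gamma> \<inter> cball x0 (s / 2)) y \<partial>hausdorff2)"
      using sub by (intro nn_integral_mono mult_left_mono) (auto split: split_indicator)
    also note C(2)[OF W]
    finally show "(\<integral>\<^sup>+y. ennreal ((norm (W y))\<^sup>2) * indicator (frontier \<Omega> \<inter> ball x0 (s / 2)) y \<partial>hausdorff2)
      \<le> ennreal (C * ((L2_norm (lebesgue_on \<Omega>) W)\<^sup>2 + (L2_norm (lebesgue_on \<Omega>) (jac W))\<^sup>2))" .
  qed
qed

text \<open>The frontier of a bounded set is compact, so finitely many local estimates are
  added.\<close>

lemma smooth_trace_inequality:
  assumes "open \<Omega>" "bounded \<Omega>" "smooth_boundary \<Omega>"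
  obtains C where "C \<ge> 0" "\<And>W. smooth_on UNIV W \<Longrightarrow>
    (\<integral>\<^sup>+y. ennreal ((norm (W y))\<^sup>2) * indicator (frontier \<Omega>) y \<partial>hausdorff2)
      \<le> ennreal (C * ((L2_norm (lebesgue_on \<Omega>) W)\<^sup>2 + (L2_norm (lebesgue_on \<Omega>) (jac W))\<^sup>2))"
proof -
  \<comment> \<open>Packs the quantification over \<open>W\<close> into a predicate, so that radii
    and constants can be chosen as functions of the centre.\<close>
  define Q where "Q x s C \<longleftrightarrow> (\<forall>W. smooth_on UNIV W \<longrightarrow>
    (\<integral>\<^sup>+y. ennreal ((norm (W y))\<^sup>2) * indicator (frontier \<Omega> \<inter> ball x s) y \<partial>hausdorff2)
      \<le> ennreal (C * ((L2_norm (lebesgue_on \<Omega>) W)\<^sup>2 + (L2_norm (lebesgue_on \<Omega>) (jac W))\<^sup>2)))" for x s C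
  have "\<exists>s C. s > 0 \<and> C \<ge> 0 \<and> Q x0 s C" if x0: "x0 \<in> frontier \<Omega>" for x0
    unfolding Q_def by (rule local_trace_inequality[OF assms x0]) blast
  then obtain s C where sC: "\<And>x. x \<in> frontier \<Omega> \<Longrightarrow> s x > 0" "\<And>x. x \<in> frontier \<Omega> \<Longrightarrow> C x \<ge> 0"
    and Q: "\<And>x. x \<in> frontier \<Omega> \<Longrightarrow> Q x (s x) (C x)"
    by metis
  obtain X where X: "X \<subseteq> frontier \<Omega>" "finite X" "frontier \<Omega> \<subseteq> (\<Union>x\<in>X. ball x (s x))"
    by (rule compactE_image[OF compact_frontier_bounded[OF assms(2)], of "frontier \<Omega>" "\<lambda>x. ball x (s x)"])
      (use sC(1) in auto)
  show thesis
  proof (rule that)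
    show "sum C X \<ge> 0" using X sC(2) by (auto intro: sum_nonneg)
    fix W :: vfield assume W: "smooth_on UNIV W"
    have m: "W \<in> borel_measurable borel" by (rule borel_measurable_continuous_onI[OF continuous_smooth[OF W]])
    let ?h = "(L2_norm (lebesgue_on \<Omega>) W)\<^sup>2 + (L2_norm (lebesgue_on \<Omega>) (jac W))\<^sup>2"
    have "(\<integral>\<^sup>+y. ennreal ((norm (W y))\<^sup>2) * indicator (frontier \<Omega>) y \<partial>hausdorff2)
      \<le> (\<integral>\<^sup>+y. (\<Sum>x\<in>X. ennreal ((norm (W y))\<^sup>2) * indicator (frontier \<Omega> \<inter> ball x (s x)) y) \<partial>hausdorff2)"
    proof (intro nn_integral_mono)
      fix y
      show "ennreal ((norm (W y))\<^sup>2) * indicator (frontier \<Omega>) y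
        \<le> (\<Sum>x\<in>X. ennreal ((norm (W y))\<^sup>2) * indicator (frontier \<Omega> \<inter> ball x (s x)) y)"
      proof (cases "y \<in> frontier \<Omega>")
        case True
        then obtain x where x: "x \<in> X" "y \<in> ball x (s x)" using X(3) by blast
        then show ?thesis using True X(2)
          by (intro order_trans[OF _ member_le_sum[of x X]]) (auto simp: indicator_def)
      qed simp
    qed
    also have "\<dots> = (\<Sum>x\<in>X. \<integral>\<^sup>+y. ennreal ((norm (W y))\<^sup>2) * indicator (frontier \<Omega> \<inter> ball x (s x)) y \<partial>hausdorff2)"
    proof (rule nn_integral_sum)
      have "frontier \<Omega> \<inter> ball x (s x) \<in> sets borel" for x by auto
      then show "(\<lambda>y. ennreal ((norm (W y))\<^sup>2) * indicator (frontier \<Omega> \<inter> ball x (s x)) y) \<in> borel_measurable hausdorff2" for x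
        using m by measurable
    qed
    also have "\<dots> \<le> (\<Sum>x\<in>X. ennreal (C x * ?h))"
      using X(1) Q W unfolding Q_def by (intro sum_mono) blast
    also have "\<dots> = ennreal (\<Sum>x\<in>X. C x * ?h)"
      using X(1) sC(2) by (intro sum_ennreal) auto
    also have "(\<Sum>x\<in>X. C x * ?h) = sum C X * ?h" by (simp add: sum_distrib_right)
    finally show "(\<integral>\<^sup>+y. ennreal ((norm (W y))\<^sup>2) * indicator (frontier \<Omega>) y \<partial>hausdorff2) \<le> ennreal (sum C X * ?h)" .
  qed
qed

section \<open>Surface measure on the whole boundary\<close>

lemma space_surface [simp]: "space (surface_measure \<Omega>) = frontier \<Omega>"
  by (simp add: surface_measure_def space_restrict_space)

lemma nn_integral_surface:
  assumes "f \<in> borel_measurable borel"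
  shows "(\<integral>\<^sup>+y. f y \<partial>surface_measure \<Omega>) = (\<integral>\<^sup>+y. f y * indicator (frontier \<Omega>) y \<partial>hausdorff2)"
  unfolding surface_measure_def nn_integral_completion
  by (subst nn_integral_restrict_space) auto

lemma borel_measurable_surface: "f \<in> borel_measurable borel \<Longrightarrow> f \<in> borel_measurable (surface_measure \<Omega>)"
  unfolding surface_measure_def
  by (intro measurable_completion measurable_restrict_space1) (simp cong: measurable_cong_sets)

text \<open>Finiteness of the nonnegative integral also provides membership in \<open>L2\<close>.
  The constant is a square root because the previous estimate is one of squares.\<close>

lemma smooth_closure_trace_inequality:
  assumes "open \<Omega>" "bounded \<Omega>" "smooth_boundary \<Omega>"
  obtains C where "C \<ge> 0" "\<And>w. w \<in> smooth_closure \<Omega> \<Longrightarrow> w \<in> L2 (surface_measure \<Omega>)"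
    "\<And>w. w \<in> smooth_closure \<Omega> \<Longrightarrow> L2_norm (surface_measure \<Omega>) w \<le> C * H1_norm \<Omega> w"
proof -
  obtain C where C: "C \<ge> 0" "\<And>W. smooth_on UNIV W \<Longrightarrow>
    (\<integral>\<^sup>+y. ennreal ((norm (W y))\<^sup>2) * indicator (frontier \<Omega>) y \<partial>hausdorff2)
      \<le> ennreal (C * ((L2_norm (lebesgue_on \<Omega>) W)\<^sup>2 + (L2_norm (lebesgue_on \<Omega>) (jac W))\<^sup>2))"
    using smooth_trace_inequality[OF assms] by blast
  let ?S = "surface_measure \<Omega>"
  have *: "w \<in> L2 ?S \<and> L2_norm ?S w \<le> sqrt C * H1_norm \<Omega> w" if w: "w \<in> smooth_closure \<Omega>" for w
  proof -
    obtain W where W: "smooth_on UNIV W" "\<And>x. x \<in> closure \<Omega> \<Longrightarrow> w x = W x" using smooth_closureE[OF w] by metis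
    have Wm: "W \<in> borel_measurable borel" by (rule borel_measurable_continuous_onI[OF continuous_smooth[OF W(1)]])
    have wW: "w x = W x" if "x \<in> space ?S" for x using W(2) that by (simp add: frontier_def)
    have wm: "w \<in> borel_measurable ?S"
      using borel_measurable_surface[OF Wm] measurable_cong[of ?S w W borel] wW by blast
    have "(\<integral>\<^sup>+y. ennreal ((norm (w y))\<^sup>2) \<partial>?S) = (\<integral>\<^sup>+y. ennreal ((norm (W y))\<^sup>2) \<partial>?S)"
      by (rule nn_integral_cong) (simp add: wW)
    also have "\<dots> = (\<integral>\<^sup>+y. ennreal ((norm (W y))\<^sup>2) * indicator (frontier \<Omega>) y \<partial>hausdorff2)"
      using Wm by (intro nn_integral_surface) measurable
    also have "\<dots> \<le> ennreal (C * (H1_norm \<Omega> w)\<^sup>2)"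
      using C(2)[OF W(1)] H1_norm_smooth_closure[OF assms(1,2) W] by simp
    finally have le: "(\<integral>\<^sup>+y. ennreal ((norm (w y))\<^sup>2) \<partial>?S) \<le> ennreal (C * (H1_norm \<Omega> w)\<^sup>2)" .
    have int: "integrable ?S (\<lambda>y. (norm (w y))\<^sup>2)"
      by (rule integrableI_bounded) (use wm le in \<open>auto intro: le_less_trans\<close>)
    then have L2: "w \<in> L2 ?S" using wm by (simp add: L2_def)
    have "ennreal ((L2_norm ?S w)\<^sup>2) \<le> ennreal (C * (H1_norm \<Omega> w)\<^sup>2)"
      using nn_integral_eq_integral[OF int] le by (simp add: L2_norm_power2)
    then have "(L2_norm ?S w)\<^sup>2 \<le> C * (H1_norm \<Omega> w)\<^sup>2"
      using C(1) by (simp add: ennreal_le_iff)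
    then have "(L2_norm ?S w)\<^sup>2 \<le> (sqrt C * H1_norm \<Omega> w)\<^sup>2" using C(1) by (simp add: power_mult_distrib)
    then have "L2_norm ?S w \<le> sqrt C * H1_norm \<Omega> w"
      using C(1) by (intro power2_le_imp_le[OF _ mult_nonneg_nonneg]) auto
    with L2 show ?thesis by simp
  qed
  then show thesis using C(1) by (intro that[of "sqrt C"]) auto
qed

section \<open>Traces as limits of smooth boundary values\<close>

lemma nonneg_tendsto_0_le:
  fixes f g :: "nat \<Rightarrow> real"
  assumes "g \<longlonglongrightarrow> 0" "\<And>n. 0 \<le> f n" "\<And>n. f n \<le> g n"
  shows "f \<longlonglongrightarrow> 0"
  by (rule tendsto_sandwich[OF always_eventually always_eventually tendsto_const assms(1)]) (use assms in auto)

lemma has_traceE: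
  assumes "has_trace \<Omega> u g"
  obtains w where "\<And>n::nat. w n \<in> smooth_closure \<Omega>" "(\<lambda>n. H1_norm \<Omega> (w n - u)) \<longlonglongrightarrow> 0"
    "(\<lambda>n. L2_norm (surface_measure \<Omega>) (w n - g)) \<longlonglongrightarrow> 0"
  using assms unfolding has_trace_def by blast

lemma has_trace_D: "has_trace \<Omega> u g \<Longrightarrow> u \<in> H1 \<Omega>" "has_trace \<Omega> u g \<Longrightarrow> g \<in> L2 (surface_measure \<Omega>)"
  by (auto simp: has_trace_def)

lemma has_trace_lincomb:
  assumes \<Omega>: "open \<Omega>" "bounded \<Omega>" "smooth_boundary \<Omega>" and t: "has_trace \<Omega> u g" "has_trace \<Omega> v h"
  shows "has_trace \<Omega> (\<lambda>x. u x + c *\<^sub>R v x) (\<lambda>x. g x + c *\<^sub>R h x)"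
proof -
  let ?S = "surface_measure \<Omega>"
  obtain C where sm: "\<And>w. w \<in> smooth_closure \<Omega> \<Longrightarrow> w \<in> L2 ?S"
    using smooth_closure_trace_inequality[OF \<Omega>] by metis
  obtain w where w: "\<And>n::nat. w n \<in> smooth_closure \<Omega>" "(\<lambda>n. H1_norm \<Omega> (w n - u)) \<longlonglongrightarrow> 0"
    "(\<lambda>n. L2_norm ?S (w n - g)) \<longlonglongrightarrow> 0" using has_traceE[OF t(1)] by metis
  obtain z where z: "\<And>n::nat. z n \<in> smooth_closure \<Omega>" "(\<lambda>n. H1_norm \<Omega> (z n - v)) \<longlonglongrightarrow> 0"
    "(\<lambda>n. L2_norm ?S (z n - h)) \<longlonglongrightarrow> 0" using has_traceE[OF t(2)] by metis
  note H = has_trace_D[OF t(1)] has_trace_D[OF t(2)]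
  let ?y = "\<lambda>n x. w n x + c *\<^sub>R z n x"
  have y: "?y n \<in> smooth_closure \<Omega>" for n by (intro smooth_closure_lincomb w z)
  have le1: "H1_norm \<Omega> (?y n - (\<lambda>x. u x + c *\<^sub>R v x)) \<le> H1_norm \<Omega> (w n - u) + \<bar>c\<bar> * H1_norm \<Omega> (z n - v)" for n
  proof -
    have d: "w n - u \<in> H1 \<Omega>" "z n - v \<in> H1 \<Omega>"
      by (intro H1_diff(1) \<Omega> smooth_closure_H1 H w(1) z(1))+
    have "?y n - (\<lambda>x. u x + c *\<^sub>R v x) = (\<lambda>x. (w n - u) x + c *\<^sub>R (z n - v) x)"
      by (auto simp: algebra_simps)
    then show ?thesis
      using H1_norm_add_le[OF \<Omega>(1,2) d(1) H1_scaleR(1)[OF \<Omega>(1,2) d(2)], of c] H1_norm_scaleR[OF \<Omega>(1,2) d(2), of c] by simp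
  qed
  have lim1: "(\<lambda>n. H1_norm \<Omega> (w n - u) + \<bar>c\<bar> * H1_norm \<Omega> (z n - v)) \<longlonglongrightarrow> 0"
    using tendsto_add[OF w(2) tendsto_mult_right_zero[OF z(2), of "\<bar>c\<bar>"]] by simp
  have 1: "(\<lambda>n. H1_norm \<Omega> (?y n - (\<lambda>x. u x + c *\<^sub>R v x))) \<longlonglongrightarrow> 0"
    by (rule nonneg_tendsto_0_le[OF lim1 H1_norm_nonneg le1])
  have le2: "L2_norm ?S (?y n - (\<lambda>x. g x + c *\<^sub>R h x)) \<le> L2_norm ?S (w n - g) + \<bar>c\<bar> * L2_norm ?S (z n - h)" for n
  proof -
    have d: "w n - g \<in> L2 ?S" "z n - h \<in> L2 ?S"
      unfolding fun_diff_def using H sm w z by (auto intro!: L2_diff)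
    have "?y n - (\<lambda>x. g x + c *\<^sub>R h x) = (\<lambda>x. (w n - g) x + c *\<^sub>R (z n - h) x)"
      by (auto simp: algebra_simps)
    then show ?thesis
      using L2_norm_add_le[OF d(1) L2_scaleR[OF d(2)], of c] L2_norm_scaleR[of ?S c "z n - h"] by simp
  qed
  have lim2: "(\<lambda>n. L2_norm ?S (w n - g) + \<bar>c\<bar> * L2_norm ?S (z n - h)) \<longlonglongrightarrow> 0"
    using tendsto_add[OF w(3) tendsto_mult_right_zero[OF z(3), of "\<bar>c\<bar>"]] by simp
  have 2: "(\<lambda>n. L2_norm ?S (?y n - (\<lambda>x. g x + c *\<^sub>R h x))) \<longlonglongrightarrow> 0"
    by (rule nonneg_tendsto_0_le[OF lim2 L2_norm_nonneg le2])
  show ?thesis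
    unfolding has_trace_def using H1_lincomb(1)[OF \<Omega>(1,2) H(1,3)] L2_add[OF H(2) L2_scaleR[OF H(4)]] y 1 2
    by (auto intro!: exI[of _ ?y])
qed

lemma has_trace_diff:
  assumes "open \<Omega>" "bounded \<Omega>" "smooth_boundary \<Omega>" "has_trace \<Omega> u g" "has_trace \<Omega> v h"
  shows "has_trace \<Omega> (u - v) (g - h)"
  using has_trace_lincomb[OF assms, of "-1"] by (simp add: fun_diff_def)

lemma has_trace_scaleR:
  assumes "open \<Omega>" "bounded \<Omega>" "smooth_boundary \<Omega>" "has_trace \<Omega> u g"
  shows "has_trace \<Omega> (\<lambda>x. c *\<^sub>R u x) (\<lambda>x. c *\<^sub>R g x)"
  using has_trace_lincomb[OF assms(1-4) assms(4), of "c - 1"] by (simp add: scaleR_left_diff_distrib)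

text \<open>The bound passes to the limit along the approximating smooth fields. Together with
  \<open>has_trace_diff\<close> it shows that a field determines its trace up to null sets.\<close>

lemma trace_inequality:
  assumes \<Omega>: "open \<Omega>" "bounded \<Omega>" "smooth_boundary \<Omega>"
  obtains C where "C \<ge> 0" "\<And>u g. has_trace \<Omega> u g \<Longrightarrow> L2_norm (surface_measure \<Omega>) g \<le> C * H1_norm \<Omega> u"
proof -
  let ?S = "surface_measure \<Omega>"
  obtain C where C: "C \<ge> 0" and sm: "\<And>w. w \<in> smooth_closure \<Omega> \<Longrightarrow> w \<in> L2 ?S"
    "\<And>w. w \<in> smooth_closure \<Omega> \<Longrightarrow> L2_norm ?S w \<le> C * H1_norm \<Omega> w"
    using smooth_closure_trace_inequality[OF \<Omega>] by metis
  have "L2_norm ?S g \<le> C * H1_norm \<Omega> u" if t: "has_trace \<Omega> u g" for u g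
  proof -
    obtain w where w: "\<And>n::nat. w n \<in> smooth_closure \<Omega>" "(\<lambda>n. H1_norm \<Omega> (w n - u)) \<longlonglongrightarrow> 0"
      "(\<lambda>n. L2_norm ?S (w n - g)) \<longlonglongrightarrow> 0" using has_traceE[OF t] by metis
    have "L2_norm ?S g \<le> L2_norm ?S (w n - g) + C * (H1_norm \<Omega> (w n - u) + H1_norm \<Omega> u)" for n
    proof -
      have wH: "w n \<in> H1 \<Omega>" using w(1) by (intro smooth_closure_H1 \<Omega>)
      have "H1_norm \<Omega> (w n) \<le> H1_norm \<Omega> (w n - u) + H1_norm \<Omega> u"
        using H1_norm_add_le[OF \<Omega>(1,2) H1_diff(1)[OF \<Omega>(1,2) wH has_trace_D(1)[OF t]] has_trace_D(1)[OF t]] by simp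
      then have "L2_norm ?S (w n) \<le> C * (H1_norm \<Omega> (w n - u) + H1_norm \<Omega> u)"
        using sm(2)[OF w(1), of n] C by (meson mult_left_mono order_trans)
      moreover have "\<bar>L2_norm ?S (w n) - L2_norm ?S g\<bar> \<le> L2_norm ?S (w n - g)"
        using L2_norm_diff_ge[OF sm(1)[OF w(1)] has_trace_D(2)[OF t], of n] by (simp add: fun_diff_def)
      ultimately show ?thesis by linarith
    qed
    moreover have "(\<lambda>n. L2_norm ?S (w n - g) + C * (H1_norm \<Omega> (w n - u) + H1_norm \<Omega> u)) \<longlonglongrightarrow> 0 + C * (0 + H1_norm \<Omega> u)"
      by (intro tendsto_intros w)
    ultimately show ?thesis
      by (intro LIMSEQ_le_const[of _ _ "L2_norm ?S g"]) auto
  qed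
  with C show thesis by (rule that)
qed

section \<open>Traces of solenoidal tangential fields are tangential\<close>

lemma has_derivative_smooth_nth:
  assumes "smooth_on UNIV (W :: vfield)"
  shows "((\<lambda>y. W y $ i) has_derivative (\<lambda>v. frechet_derivative W (at x) v $ i)) (at x)"
proof -
  have "Ck_on (Suc 0) UNIV W" using assms by (metis smooth_on_def)
  then show ?thesis
    by (intro bounded_linear.has_derivative[OF bounded_linear_vec_nth])
      (simp add: frechet_derivative_works[symmetric])
qed

lemma abs_trace_le: "\<bar>trace A\<bar> \<le> 3 * norm (A :: real^3^3)"
proof -
  have "\<bar>trace A\<bar> \<le> (\<Sum>i\<in>UNIV. \<bar>A $ i $ i\<bar>)" unfolding trace_def by (rule sum_abs)
  also have "\<dots> \<le> (\<Sum>i\<in>(UNIV::3 set). norm A)" by (intro sum_mono matrix_entry_le_norm)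
  finally show ?thesis by simp
qed

lemma continuous_on_trace:
  fixes f :: "'a::topological_space \<Rightarrow> real^3^3"
  shows "continuous_on S f \<Longrightarrow> continuous_on S (\<lambda>x. trace (f x))"
  unfolding trace_def by (intro continuous_intros)

lemma L2_trace:
  fixes G :: "'a \<Rightarrow> real^3^3"
  assumes "G \<in> L2 M" shows "(\<lambda>x. trace (G x)) \<in> L2 M"
proof (rule L2_mono[OF _ assms, where c=3])
  show "(\<lambda>x. trace (G x)) \<in> borel_measurable M"
    unfolding trace_def by (intro borel_measurable_sum L2_borel[OF L2_nth_nth[OF assms]])
  show "AE x in M. norm (trace (G x)) \<le> 3 * norm (G x)" using abs_trace_le by simp
qed

text \<open>Values of \<open>v\<close> outside \<Omega> are arbitrary, but \<Omega> is open, so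
  derivatives at its points are those of \<open>W\<close>.\<close>

lemma divergence_eq_trace_jac:
  assumes "open \<Omega>" "x \<in> \<Omega>" "smooth_on UNIV W" "\<And>y. y \<in> \<Omega> \<Longrightarrow> v y = W y"
  shows "divergence v x = trace (jac W x)"
proof -
  have "Ck_on (Suc 0) UNIV W" using assms(3) by (metis smooth_on_def)
  then have D: "(W has_derivative frechet_derivative W (at x)) (at x)"
    by (simp add: frechet_derivative_works[symmetric])
  have "(v has_derivative frechet_derivative W (at x)) (at x)"
    by (rule has_derivative_transform_within_open[OF D assms(1,2)]) (simp add: assms(4))
  then have "frechet_derivative v (at x) = frechet_derivative W (at x)"
    by (metis frechet_derivative_at)
  then show ?thesis
    by (simp add: divergence_def trace_def jac_nth dirderiv_eqI[OF has_derivative_smooth_nth[OF assms(3)]])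
qed

lemma gradient_inner_vec: "gradient \<phi> x \<bullet> w = (\<Sum>i\<in>UNIV. w $ i * dirderiv \<phi> (axis i 1) x)"
  by (simp add: inner_vec_def gradient_nth mult.commute)

lemma C1c_gradient_continuous: "C1c U \<phi> \<Longrightarrow> continuous_on S (gradient \<phi>)"
  unfolding C1c_def gradient_def[abs_def] dirderiv_def[abs_def]
  by (intro continuous_intros) (auto intro: continuous_on_subset)

lemma gradient_norm_le: "norm (gradient \<phi> x) \<le> (\<Sum>i\<in>UNIV. \<bar>dirderiv \<phi> (axis i 1) x\<bar>)"
  using norm_le_l1_cart[of "gradient \<phi> x"] by (simp add: gradient_nth)

lemma C1c_divergence_product:
  assumes "C1c U \<phi>" "smooth_on UNIV W"
  shows "(\<Sum>i\<in>UNIV. dirderiv (\<lambda>y. \<phi> y * W y $ i) (axis i 1) x) = W x \<bullet> gradient \<phi> x + \<phi> x * trace (jac W x)"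
proof -
  have "dirderiv (\<lambda>y. \<phi> y * W y $ i) (axis i 1) x = \<phi> x * jac W x $ i $ i + W x $ i * dirderiv \<phi> (axis i 1) x" for i
    using assms(1) C1_on_D(1)[OF smooth_on_nth[OF assms(2)], of x]
    by (subst dirderiv_mult) (auto simp: C1c_def jac_nth)
  then show ?thesis
    by (simp add: inner_commute[of "W x"] gradient_inner_vec trace_def sum.distrib sum_distrib_left)
qed

lemma smooth_sigma_tanE:
  assumes "v \<in> smooth_sigma_tan \<Omega>" "open \<Omega>"
  obtains W where "smooth_on UNIV W" "\<And>x. x \<in> closure \<Omega> \<Longrightarrow> v x = W x"
    "\<And>x. x \<in> \<Omega> \<Longrightarrow> trace (jac W x) = 0" "\<And>x. x \<in> frontier \<Omega> \<Longrightarrow> W x \<bullet> outward_normal \<Omega> x = 0"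
proof -
  obtain W where W: "smooth_on UNIV W" "\<And>x. x \<in> closure \<Omega> \<Longrightarrow> v x = W x"
    using assms by (auto simp: smooth_sigma_tan_def smooth_closure_def)
  have "divergence v x = trace (jac W x)" if "x \<in> \<Omega>" for x
    by (rule divergence_eq_trace_jac[OF assms(2) that W(1)]) (use W(2) closure_subset in auto)
  then show thesis
    using assms W by (intro that[of W]) (auto simp: smooth_sigma_tan_def frontier_def)
qed

lemma L2_inner_continuous_closure:
  assumes "open \<Omega>" "continuous_on UNIV W" "continuous_on UNIV (h :: vfield)" "\<And>x. x \<in> closure \<Omega> \<Longrightarrow> v x = W x"
  shows "L2_inner (lebesgue_on \<Omega>) v h = (\<integral>x. indicator \<Omega> x * (W x \<bullet> h x) \<partial>lborel)"
proof -
  have "L2_inner (lebesgue_on \<Omega>) v h = (\<integral>x. W x \<bullet> h x \<partial>lebesgue_on \<Omega>)"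
    unfolding L2_inner_def
    by (rule Bochner_Integration.integral_cong) (use assms(4) closure_subset[of \<Omega>] in auto)
  also have "\<dots> = (\<integral>x. indicator \<Omega> x * (W x \<bullet> h x) \<partial>lborel)"
    using assms by (intro integral_lebesgue_on_open borel_measurable_continuous_onI continuous_intros)
  finally show ?thesis .
qed

lemma solenoidal_test_function:
  assumes "open \<Omega>" "v \<in> smooth_sigma_tan \<Omega>" "\<phi> \<in> test_functions \<Omega>"
  shows "L2_inner (lebesgue_on \<Omega>) v (gradient \<phi>) = 0"
proof -
  obtain W where W: "smooth_on UNIV W" "\<And>x. x \<in> closure \<Omega> \<Longrightarrow> v x = W x" "\<And>x. x \<in> \<Omega> \<Longrightarrow> trace (jac W x) = 0"
    using smooth_sigma_tanE[OF assms(2,1)] by metis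
  note c = test_function_C1c[OF assms(3)]
  have f: "C1c \<Omega> (\<lambda>y. \<phi> y * W y $ i)" for i
    by (rule C1c_mult_C1_on[OF c C1_on_subset[OF smooth_on_nth[OF W(1)]] assms(1)]) simp
  have int: "integrable lborel (\<lambda>x. indicator \<Omega> x * dirderiv (\<lambda>y. \<phi> y * W y $ i) (axis i 1) x)" for i
    using integrable_mult_indicator[OF _ C1c_integral(1)[OF f[of i], of "axis i 1"], of \<Omega>] assms(1) by simp
  have "L2_inner (lebesgue_on \<Omega>) v (gradient \<phi>) = (\<integral>x. indicator \<Omega> x * (W x \<bullet> gradient \<phi> x) \<partial>lborel)"
    by (rule L2_inner_continuous_closure[OF assms(1) continuous_smooth[OF W(1)] C1c_gradient_continuous[OF c] W(2)])
  also have "\<dots> = (\<integral>x. (\<Sum>i\<in>UNIV. indicator \<Omega> x * dirderiv (\<lambda>y. \<phi> y * W y $ i) (axis i 1) x) \<partial>lborel)"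
    by (rule Bochner_Integration.integral_cong)
      (use W(3) in \<open>auto simp: sum_distrib_left[symmetric] C1c_divergence_product[OF c W(1)] indicator_def\<close>)
  also have "\<dots> = (\<Sum>i\<in>UNIV. \<integral>x. indicator \<Omega> x * dirderiv (\<lambda>y. \<phi> y * W y $ i) (axis i 1) x \<partial>lborel)"
    by (rule Bochner_Integration.integral_sum[OF int])
  also have "\<dots> = (\<Sum>i\<in>UNIV. \<integral>x. dirderiv (\<lambda>y. \<phi> y * W y $ i) (axis i 1) x \<partial>lebesgue_on \<Omega>)"
    using C1c_borel(2)[OF f] by (intro sum.cong refl integral_lebesgue_on_open[symmetric] assms)
  also have "\<dots> = 0" using C1c_inside_integral[OF assms(1) f] by simp
  finally show ?thesis .
qed

text \<open>Orthogonality to a fixed square-integrable field passes to the closure by the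
  Cauchy-Schwarz inequality.\<close>

lemma L2_sigma_tan_orthogonal:
  assumes h: "h \<in> L2 (lebesgue_on \<Omega>)" and sm: "\<And>v. v \<in> smooth_sigma_tan \<Omega> \<Longrightarrow> v \<in> L2 (lebesgue_on \<Omega>)"
    and 0: "\<And>v. v \<in> smooth_sigma_tan \<Omega> \<Longrightarrow> L2_inner (lebesgue_on \<Omega>) v h = 0"
    and u: "u \<in> L2_sigma_tan \<Omega>"
  shows "L2_inner (lebesgue_on \<Omega>) u h = 0"
proof -
  let ?M = "lebesgue_on \<Omega>"
  obtain w where w: "\<And>n::nat. w n \<in> smooth_sigma_tan \<Omega>" "(\<lambda>n. L2_norm ?M (w n - u)) \<longlonglongrightarrow> 0"
    and uL: "u \<in> L2 ?M" using u by (auto simp: L2_sigma_tan_def)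
  have "\<bar>L2_inner ?M u h\<bar> \<le> L2_norm ?M (w n - u) * L2_norm ?M h" for n
    using L2_Cauchy_Schwarz[OF L2_diff[OF sm[OF w(1)] uL] h, of n] L2_inner_diff_left[OF sm[OF w(1)] uL h, of n] 0[OF w(1)]
    by (simp add: fun_diff_def)
  moreover have "(\<lambda>n. L2_norm ?M (w n - u) * L2_norm ?M h) \<longlonglongrightarrow> 0 * L2_norm ?M h" by (intro tendsto_intros w)
  ultimately have "\<bar>L2_inner ?M u h\<bar> \<le> 0" by (intro LIMSEQ_le_const[of _ _ "\<bar>L2_inner ?M u h\<bar>"]) auto
  then show ?thesis by simp
qed

lemma smooth_sigma_tan_L2:
  assumes "open \<Omega>" "bounded \<Omega>" "v \<in> smooth_sigma_tan \<Omega>"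
  shows "v \<in> L2 (lebesgue_on \<Omega>)"
proof -
  have "v \<in> smooth_closure \<Omega>" using assms(3) by (simp add: smooth_sigma_tan_def)
  from smooth_closure_H1[OF assms(1,2) this] show ?thesis by (rule H1_D(1))
qed

lemma H1_sigma_tan_D: "u \<in> H1_sigma_tan \<Omega> \<Longrightarrow> u \<in> H1 \<Omega>" "u \<in> H1_sigma_tan \<Omega> \<Longrightarrow> u \<in> L2_sigma_tan \<Omega>"
  by (auto simp: H1_sigma_tan_def)

text \<open>Integration by parts moves the divergence onto the test function, where orthogonality to
  gradients applies; the fundamental lemma concludes.\<close>

lemma H1_sigma_tan_divergence_free:
  assumes "open \<Omega>" "bounded \<Omega>" "u \<in> H1_sigma_tan \<Omega>"
  shows "AE x in lebesgue_on \<Omega>. trace (weak_grad \<Omega> u x) = 0"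
proof (rule fundamental_lemma_variations[OF assms(1)])
  note G = H1_D(2)[OF H1_sigma_tan_D(1)[OF assms(3)]] and u = H1_D(1)[OF H1_sigma_tan_D(1)[OF assms(3)]]
  show "integrable (lebesgue_on \<Omega>) (\<lambda>x. trace (weak_grad \<Omega> u x))"
    by (rule L2_imp_integrable[OF finite_measure_bounded_open[OF assms(2,1)] L2_trace[OF G]])
  fix \<phi> assume \<phi>: "\<phi> \<in> test_functions \<Omega>"
  note phiL = test_function_L2[OF assms(1,2) \<phi>]
  have gL: "gradient \<phi> \<in> L2 (lebesgue_on \<Omega>)"
    using C1c_gradient_continuous[OF test_function_C1c[OF \<phi>]] by (intro continuous_on_closure_L2 assms)
  have i1: "integrable (lebesgue_on \<Omega>) (\<lambda>x. weak_grad \<Omega> u x $ i $ i * \<phi> x)" for i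
    using integrable_L2_inner[OF L2_nth_nth[OF G] phiL(1)] by simp
  have i2: "integrable (lebesgue_on \<Omega>) (\<lambda>x. u x $ i * gradient \<phi> x $ i)" for i
    using integrable_L2_inner[OF L2_nth[OF u] phiL(2)] by simp
  have "(\<integral>x. trace (weak_grad \<Omega> u x) * \<phi> x \<partial>lebesgue_on \<Omega>) = (\<Sum>i\<in>UNIV. \<integral>x. weak_grad \<Omega> u x $ i $ i * \<phi> x \<partial>lebesgue_on \<Omega>)"
    unfolding trace_def sum_distrib_right by (rule Bochner_Integration.integral_sum[OF i1])
  also have "\<dots> = (\<Sum>i\<in>UNIV. - (\<integral>x. u x $ i * gradient \<phi> x $ i \<partial>lebesgue_on \<Omega>))"
  proof (rule sum.cong[OF refl])
    fix i
    have "(\<integral>x. u x $ i * gradient \<phi> x $ i \<partial>lebesgue_on \<Omega>) = - (\<integral>x. weak_grad \<Omega> u x $ i $ i * \<phi> x \<partial>lebesgue_on \<Omega>)"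
      using weak_grad_has_weak_gradient[OF H1_sigma_tan_D(1)[OF assms(3)]] \<phi> unfolding has_weak_gradient_def by blast
    then show "(\<integral>x. weak_grad \<Omega> u x $ i $ i * \<phi> x \<partial>lebesgue_on \<Omega>) = - (\<integral>x. u x $ i * gradient \<phi> x $ i \<partial>lebesgue_on \<Omega>)" by simp
  qed
  also have "\<dots> = - (\<integral>x. (\<Sum>i\<in>UNIV. u x $ i * gradient \<phi> x $ i) \<partial>lebesgue_on \<Omega>)"
    by (subst Bochner_Integration.integral_sum[OF i2]) (simp add: sum_negf)
  also have "(\<integral>x. (\<Sum>i\<in>UNIV. u x $ i * gradient \<phi> x $ i) \<partial>lebesgue_on \<Omega>) = L2_inner (lebesgue_on \<Omega>) u (gradient \<phi>)"
    by (simp add: L2_inner_def inner_vec_def)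
  also have "\<dots> = 0"
    by (rule L2_sigma_tan_orthogonal[OF gL _ _ H1_sigma_tan_D(2)[OF assms(3)]])
      (use assms smooth_sigma_tan_L2 solenoidal_test_function[OF assms(1) _ \<phi>] in auto)
  finally show "(\<integral>x. trace (weak_grad \<Omega> u x) * \<phi> x \<partial>lebesgue_on \<Omega>) = 0" by simp
qed

lemma L2_norm_norm: "L2_norm M (\<lambda>x. norm (f x)) = L2_norm M f"
  by (simp add: L2_norm_def)

lemma L2_norm_fun: "f \<in> L2 M \<Longrightarrow> (\<lambda>x. norm (f x)) \<in> L2 M"
  by (auto simp: L2_def)

section \<open>The normal component of a field in a chart\<close>

context boundary_chart
begin

lemma gradient_b: "x \<in> V \<Longrightarrow> gradient \<rho> x \<bullet> b = dirderiv \<rho> b x"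
  using C1_on_D(1)[OF C1_\<rho>_V] gradient_inner by blast

lemma slope_V: "x \<in> V \<Longrightarrow> m \<le> dirderiv \<rho> b x"
  using slope V_subset_K by blast

text \<open>Allows the normal at frontier points of the chart to be expressed by the gradient of
  \<rho>.\<close>

lemma defining_function_V: "defining_function \<Omega> V \<rho>"
  unfolding defining_function_def
proof (intro conjI ballI)
  show "smooth_on V \<rho>" using smooth Ck_on_subset[OF _ V_U] by (auto simp: smooth_on_def)
  show "gradient \<rho> x \<noteq> 0" if "x \<in> V" for x
    using gradient_b[OF that] slope_V[OF that] m_pos by auto
  show "\<Omega> \<inter> V = {x \<in> V. \<rho> x < 0}" using inside V_U by blast
qed (rule open_V)

lemma normal_iff:
  assumes "x \<in> frontier \<Omega>" "x \<in> V"
  shows "w \<bullet> outward_normal \<Omega> x = 0 \<longleftrightarrow> w \<bullet> gradient \<rho> x = 0"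
proof -
  have "gradient \<rho> x \<noteq> 0" using defining_function_V assms(2) by (simp add: defining_function_def)
  then show ?thesis by (simp add: outward_normal_eq[OF open_\<Omega> assms defining_function_V])
qed

text \<open>Summing the scalar theorem over the coordinates collects the conormal components into
  \<open>W \<bullet> gradient \<rho>\<close> divided by the slope along \<open>b\<close>.\<close>

lemma chart_divergence_field:
  assumes \<phi>: "C1c V \<phi>" and W: "smooth_on UNIV W"
  shows "(\<integral>x. indicator \<Omega> x * (W x \<bullet> gradient \<phi> x + \<phi> x * trace (jac W x)) \<partial>lborel)
    = (\<integral>x. \<phi> (P x) * (W (P x) \<bullet> gradient \<rho> (P x)) * inverse (dirderiv \<rho> b (P x)) * weight x \<partial>lborel)"
proof -
  have f: "C1c V (\<lambda>y. \<phi> y * W y $ i)" for i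
    by (rule C1c_mult_C1_on[OF \<phi> C1_on_subset[OF smooth_on_nth[OF W]] open_V]) simp
  have int: "integrable lborel (\<lambda>x. indicator \<Omega> x * dirderiv (\<lambda>y. \<phi> y * W y $ i) (axis i 1) x)" for i
    using integrable_mult_indicator[OF _ C1c_integral(1)[OF f[of i], of "axis i 1"], of \<Omega>] open_\<Omega> by simp
  have "(\<integral>x. indicator \<Omega> x * (W x \<bullet> gradient \<phi> x + \<phi> x * trace (jac W x)) \<partial>lborel)
      = (\<integral>x. (\<Sum>i\<in>UNIV. indicator \<Omega> x * dirderiv (\<lambda>y. \<phi> y * W y $ i) (axis i 1) x) \<partial>lborel)"
    unfolding C1c_divergence_product[OF \<phi> W, symmetric] sum_distrib_left ..
  also have "\<dots> = (\<Sum>i\<in>UNIV. \<integral>x. indicator \<Omega> x * dirderiv (\<lambda>y. \<phi> y * W y $ i) (axis i 1) x \<partial>lborel)"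
    by (rule Bochner_Integration.integral_sum[OF int])
  also have "\<dots> = (\<Sum>i\<in>UNIV. \<integral>x. \<phi> (P x) * W (P x) $ i * conormal (axis i 1) (P x) * weight x \<partial>lborel)"
    using chart_divergence_theorem(2)[OF f] by simp
  also have "\<dots> = (\<integral>x. (\<Sum>i\<in>UNIV. \<phi> (P x) * W (P x) $ i * conormal (axis i 1) (P x) * weight x) \<partial>lborel)"
    by (rule Bochner_Integration.integral_sum[symmetric, OF chart_divergence_theorem(1)[OF f]])
  also have "\<dots> = (\<integral>x. \<phi> (P x) * (W (P x) \<bullet> gradient \<rho> (P x)) * inverse (dirderiv \<rho> b (P x)) * weight x \<partial>lborel)"
  proof (rule Bochner_Integration.integral_cong[OF refl])
    fix x
    show "(\<Sum>i\<in>UNIV. \<phi> (P x) * W (P x) $ i * conormal (axis i 1) (P x) * weight x)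
        = \<phi> (P x) * (W (P x) \<bullet> gradient \<rho> (P x)) * inverse (dirderiv \<rho> b (P x)) * weight x"
      unfolding inner_commute[of "W (P x)"] gradient_inner_vec conormal_def
      by (simp add: sum_distrib_left sum_distrib_right mult_ac)
  qed
  finally show ?thesis .
qed

text \<open>The function \<phi> need not vanish on the boundary. For smooth solenoidal tangential
  fields the volume term and the boundary term both vanish; thus the weak condition on
  \<open>u\<close> encodes tangentiality as well.\<close>

lemma solenoidal_chart_function:
  assumes "bounded \<Omega>" "C1c V \<phi>" "u \<in> L2_sigma_tan \<Omega>"
  shows "L2_inner (lebesgue_on \<Omega>) u (gradient \<phi>) = 0"
proof (rule L2_sigma_tan_orthogonal[OF _ _ _ assms(3)])
  show "gradient \<phi> \<in> L2 (lebesgue_on \<Omega>)"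
    by (intro continuous_on_closure_L2 open_\<Omega> assms C1c_gradient_continuous[OF assms(2)])
  show "v \<in> L2 (lebesgue_on \<Omega>)" if "v \<in> smooth_sigma_tan \<Omega>" for v
    by (rule smooth_sigma_tan_L2[OF open_\<Omega> assms(1) that])
  fix v assume v: "v \<in> smooth_sigma_tan \<Omega>"
  obtain W where W: "smooth_on UNIV W" "\<And>x. x \<in> closure \<Omega> \<Longrightarrow> v x = W x" "\<And>x. x \<in> \<Omega> \<Longrightarrow> trace (jac W x) = 0"
    "\<And>x. x \<in> frontier \<Omega> \<Longrightarrow> W x \<bullet> outward_normal \<Omega> x = 0"
    using smooth_sigma_tanE[OF v open_\<Omega>] by metis
  obtain C where C: "compact C" "C \<subseteq> V" "\<And>x. x \<notin> C \<Longrightarrow> \<phi> x = 0" using assms(2) unfolding C1c_def by blast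
  have z: "\<phi> (P x) * (W (P x) \<bullet> gradient \<rho> (P x)) = 0" for x
  proof (cases "P x \<in> V")
    case True
    then have fr: "P x \<in> frontier \<Omega>" using P_in_V_tube[OF True] by (intro P_frontier) simp
    show ?thesis using W(4)[OF fr] unfolding normal_iff[OF fr True] by simp
  qed (use C in auto)
  have "L2_inner (lebesgue_on \<Omega>) v (gradient \<phi>) = (\<integral>x. indicator \<Omega> x * (W x \<bullet> gradient \<phi> x) \<partial>lborel)"
    by (rule L2_inner_continuous_closure[OF open_\<Omega> continuous_smooth[OF W(1)] C1c_gradient_continuous[OF assms(2)] W(2)])
  also have "\<dots> = (\<integral>x. indicator \<Omega> x * (W x \<bullet> gradient \<phi> x + \<phi> x * trace (jac W x)) \<partial>lborel)"
    by (rule Bochner_Integration.integral_cong) (use W(3) in \<open>auto simp: indicator_def\<close>)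
  also have "\<dots> = 0" unfolding chart_divergence_field[OF assms(2) W(1)] z by simp
  finally show "L2_inner (lebesgue_on \<Omega>) v (gradient \<phi>) = 0" .
qed

text \<open>Chosen so that multiplying once more by the normal component gives its square. The
  gradient of \<rho> replaces the unit normal because it is C^1 on the open cylinder and not only
  defined on the surface.\<close>

definition normal_test :: "real \<Rightarrow> vfield \<Rightarrow> R3 \<Rightarrow> real" where
  "normal_test s W x = bump s x * (W x \<bullet> gradient \<rho> x)"

text \<open>The bound is uniform in \<open>W\<close>: the function is a linear combination of the
  components of \<open>W\<close> with fixed coefficients, namely the bump times the partial
  derivatives of \<rho>.\<close>

lemma normal_test_bounds:
  assumes s: "s > 0" "s < r" "s < \<delta>"
  obtains B where "B \<ge> 0" "\<And>W. smooth_on UNIV W \<Longrightarrow> C1c V (normal_test s W)"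
    "\<And>W x. smooth_on UNIV W \<Longrightarrow> \<bar>normal_test s W x\<bar> \<le> B * norm (W x)"
    "\<And>W x. smooth_on UNIV W \<Longrightarrow> norm (gradient (normal_test s W) x) \<le> B * (norm (W x) + norm (jac W x))"
proof -
  define a where "a i x = bump s x * dirderiv \<rho> (axis i 1) x" for i :: 3 and x
  have a: "C1c V (a i)" for i
    unfolding a_def
    by (rule C1c_mult_C1_on[OF bump_C1c[OF s] C1_on_subset[OF smooth_on_dirderiv_C1_on[OF smooth open_U] V_U] open_V])
  have "\<exists>B. \<forall>x. \<bar>a i x\<bar> \<le> B \<and> \<bar>dirderiv (a i) (axis j 1) x\<bar> \<le> B" for i j :: 3
  proof -
    obtain B L where "\<And>x. \<bar>a i x\<bar> \<le> B" "\<And>x. \<bar>dirderiv (a i) (axis j 1) x\<bar> \<le> L"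
      using C1c_bounds[OF a[of i], of "axis j 1"] by metis
    then show ?thesis by (intro exI[of _ "max B L"]) (auto simp: le_max_iff_disj)
  qed
  then obtain b0 where b0: "\<And>i j x. \<bar>a i x\<bar> \<le> b0 i j" "\<And>i j x. \<bar>dirderiv (a i) (axis j 1) x\<bar> \<le> b0 i j"
    by metis
  define B where "B = (\<Sum>i\<in>UNIV. \<Sum>j\<in>UNIV. \<bar>b0 i j\<bar>)"
  have "b0 i j \<le> B" for i j
  proof -
    have "\<bar>b0 i j\<bar> \<le> (\<Sum>j\<in>UNIV. \<bar>b0 i j\<bar>)" by (rule member_le_sum[of j UNIV "\<lambda>j. \<bar>b0 i j\<bar>"]) auto
    also have "\<dots> \<le> B" unfolding B_def
      by (rule member_le_sum[of i UNIV "\<lambda>i. \<Sum>j\<in>UNIV. \<bar>b0 i j\<bar>"]) (auto intro: sum_nonneg)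
    finally show ?thesis by linarith
  qed
  then have B: "\<bar>a i x\<bar> \<le> B" "\<bar>dirderiv (a i) (axis j 1) x\<bar> \<le> B" for i j x
    using b0 order_trans by blast+
  have B0: "0 \<le> B" using B(1)[of 1 x0] by linarith
  have expand: "normal_test s W = (\<lambda>x. \<Sum>i\<in>UNIV. a i x * W x $ i)" for W
    by (rule ext) (simp add: normal_test_def inner_commute[of "W _"] gradient_inner_vec a_def sum_distrib_left mult_ac)
  show thesis
  proof (rule that)
    show "0 \<le> 9 * B" using B0 by simp
    fix W :: vfield assume W: "smooth_on UNIV W"
    have Wi: "C1_on UNIV (\<lambda>x. W x $ i)" for i by (rule smooth_on_nth[OF W])
    have "C1_on V (\<lambda>x. \<Sum>i\<in>UNIV. W x $ i * dirderiv \<rho> (axis i 1) x)"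
      by (intro C1_on_sum C1_on_mult C1_on_subset[OF Wi] C1_on_subset[OF smooth_on_dirderiv_C1_on[OF smooth open_U] V_U]) simp
    from C1c_mult_C1_on[OF bump_C1c[OF s] this open_V]
    show "C1c V (normal_test s W)"
      by (simp add: normal_test_def[abs_def] inner_commute[of "W _"] gradient_inner_vec)
    fix x
    have le: "\<bar>a i x * W x $ i\<bar> \<le> B * norm (W x)" for i
      unfolding abs_mult using B component_le_norm_cart[of "W x" i] B0 by (intro mult_mono) auto
    have "\<bar>normal_test s W x\<bar> \<le> (\<Sum>i\<in>UNIV. \<bar>a i x * W x $ i\<bar>)" unfolding expand by (rule sum_abs)
    also have "\<dots> \<le> (\<Sum>i\<in>(UNIV::3 set). B * norm (W x))" by (intro sum_mono le)
    also have "\<dots> \<le> 9 * B * norm (W x)" using B0 by simp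
    finally show "\<bar>normal_test s W x\<bar> \<le> 9 * B * norm (W x)" .
    have d: "\<bar>dirderiv (normal_test s W) (axis j 1) x\<bar> \<le> 3 * (B * (norm (W x) + norm (jac W x)))" for j
    proof -
      have D: "(normal_test s W has_derivative (\<lambda>v. \<Sum>i\<in>UNIV. a i x * dirderiv (\<lambda>y. W y $ i) v x + dirderiv (a i) v x * W x $ i)) (at x)"
        unfolding expand using has_derivative_dirderiv[OF C1_on_D(1)[OF Wi, of x]] has_derivative_dirderiv[of "a _" x] a
        by (intro has_derivative_sum has_derivative_mult) (auto simp: C1c_def)
      have "\<bar>dirderiv (normal_test s W) (axis j 1) x\<bar>
          \<le> (\<Sum>i\<in>UNIV. \<bar>a i x * dirderiv (\<lambda>y. W y $ i) (axis j 1) x + dirderiv (a i) (axis j 1) x * W x $ i\<bar>)"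
        unfolding dirderiv_eqI[OF D] by (rule sum_abs)
      also have "\<dots> \<le> (\<Sum>i\<in>(UNIV::3 set). B * (norm (W x) + norm (jac W x)))"
      proof (rule sum_mono)
        fix i
        have "\<bar>a i x * dirderiv (\<lambda>y. W y $ i) (axis j 1) x\<bar> \<le> B * norm (jac W x)"
          unfolding abs_mult jac_nth[symmetric] using B B0 matrix_entry_le_norm by (intro mult_mono) auto
        moreover have "\<bar>dirderiv (a i) (axis j 1) x * W x $ i\<bar> \<le> B * norm (W x)"
          unfolding abs_mult using B component_le_norm_cart[of "W x" i] B0 by (intro mult_mono) auto
        ultimately show "\<bar>a i x * dirderiv (\<lambda>y. W y $ i) (axis j 1) x + dirderiv (a i) (axis j 1) x * W x $ i\<bar>
            \<le> B * (norm (W x) + norm (jac W x))"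
          unfolding distrib_left by linarith
      qed
      finally show ?thesis by simp
    qed
    have "norm (gradient (normal_test s W) x) \<le> (\<Sum>j\<in>UNIV. \<bar>dirderiv (normal_test s W) (axis j 1) x\<bar>)"
      by (rule gradient_norm_le)
    also have "\<dots> \<le> (\<Sum>j\<in>(UNIV::3 set). 3 * (B * (norm (W x) + norm (jac W x))))" by (intro sum_mono d)
    finally show "norm (gradient (normal_test s W) x) \<le> 9 * B * (norm (W x) + norm (jac W x))" by simp
  qed
qed

text \<open>The square of the normal component, integrated over the surface, equals
  \<open>\<integral> W \<bullet> \<nabla>\<phi> + \<phi> div W\<close> for a test function \<open>\<phi>\<close> which is linear in \<open>W\<close>; both terms vanish for
  \<open>u\<close>.\<close>

lemma normal_component_estimate:
  assumes bdd: "bounded \<Omega>" and s: "s > 0" "s < r" "s < \<delta>"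
  obtains C where "C \<ge> 0" "\<And>u w W. u \<in> H1_sigma_tan \<Omega> \<Longrightarrow> smooth_on UNIV W \<Longrightarrow> (\<And>x. x \<in> closure \<Omega> \<Longrightarrow> w x = W x) \<Longrightarrow>
    (\<integral>x. normal_test s W (P x) * (W (P x) \<bullet> gradient \<rho> (P x)) * inverse (dirderiv \<rho> b (P x)) * weight x \<partial>lborel)
      \<le> C * H1_norm \<Omega> (w - u) * H1_norm \<Omega> w"
proof -
  let ?M = "lebesgue_on \<Omega>"
  obtain B where B: "B \<ge> 0" "\<And>W. smooth_on UNIV W \<Longrightarrow> C1c V (normal_test s W)"
    "\<And>W x. smooth_on UNIV W \<Longrightarrow> \<bar>normal_test s W x\<bar> \<le> B * norm (W x)"
    "\<And>W x. smooth_on UNIV W \<Longrightarrow> norm (gradient (normal_test s W) x) \<le> B * (norm (W x) + norm (jac W x))"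
    using normal_test_bounds[OF s] by metis
  have "(\<integral>x. normal_test s W (P x) * (W (P x) \<bullet> gradient \<rho> (P x)) * inverse (dirderiv \<rho> b (P x)) * weight x \<partial>lborel)
      \<le> 5 * B * H1_norm \<Omega> (w - u) * H1_norm \<Omega> w"
    if u: "u \<in> H1_sigma_tan \<Omega>" and W: "smooth_on UNIV W" "\<And>x. x \<in> closure \<Omega> \<Longrightarrow> w x = W x" for u w W
  proof -
    define \<phi> where "\<phi> = normal_test s W"
    have \<phi>: "C1c V \<phi>" unfolding \<phi>_def by (rule B(2)[OF W(1)])
    have w: "has_weak_gradient \<Omega> w (jac W)" "w \<in> H1 \<Omega>" "AE x in lebesgue_on \<Omega>. weak_grad \<Omega> w x = jac W x"
      by (rule smooth_closure_weak_gradient[OF open_\<Omega> bdd W]; assumption)+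
    have uH: "u \<in> H1 \<Omega>" by (rule H1_sigma_tan_D(1)[OF u])
    have WL: "W \<in> L2 ?M" and JL: "jac W \<in> L2 ?M" and pL: "\<phi> \<in> L2 ?M" and gL: "gradient \<phi> \<in> L2 ?M"
      by (intro continuous_on_closure_L2 open_\<Omega> bdd continuous_smooth continuous_jac W C1c_continuous[OF \<phi>] C1c_gradient_continuous[OF \<phi>])+
    have tJ: "(\<lambda>x. trace (jac W x)) \<in> L2 ?M" and tu: "(\<lambda>x. trace (weak_grad \<Omega> u x)) \<in> L2 ?M"
      by (intro L2_trace JL H1_D(2)[OF uH])+
    have "(\<integral>x. \<phi> (P x) * (W (P x) \<bullet> gradient \<rho> (P x)) * inverse (dirderiv \<rho> b (P x)) * weight x \<partial>lborel)
        = (\<integral>x. indicator \<Omega> x * (W x \<bullet> gradient \<phi> x + \<phi> x * trace (jac W x)) \<partial>lborel)"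
      by (rule chart_divergence_field[OF \<phi> W(1), symmetric])
    also have "\<dots> = (\<integral>x. W x \<bullet> gradient \<phi> x + \<phi> x * trace (jac W x) \<partial>?M)"
      by (intro integral_lebesgue_on_open[symmetric] open_\<Omega> borel_measurable_continuous_onI continuous_intros
          continuous_smooth C1c_gradient_continuous[OF \<phi>] C1c_continuous[OF \<phi>] continuous_on_trace continuous_jac W)
    also have "\<dots> = L2_inner ?M W (gradient \<phi>) + L2_inner ?M (\<lambda>x. trace (jac W x)) \<phi>"
      using integrable_L2_inner[OF WL gL] integrable_L2_inner[OF tJ pL]
      by (simp add: L2_inner_def mult.commute)
    \<comment> \<open>Subtracting \<open>u\<close> is free because \<open>u\<close> is orthogonal to
      this gradient, and it makes the factor small.\<close>
    also have "L2_inner ?M W (gradient \<phi>) = L2_inner ?M (\<lambda>x. W x - u x) (gradient \<phi>)"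
      using L2_inner_diff_left[OF WL H1_D(1)[OF uH] gL] solenoidal_chart_function[OF bdd \<phi> H1_sigma_tan_D(2)[OF u]] by simp
    \<comment> \<open>Likewise the weak divergence of \<open>u\<close>, which is zero, is subtracted
      from that of \<open>W\<close>.\<close>
    also have "L2_inner ?M (\<lambda>x. trace (jac W x)) \<phi> = L2_inner ?M (\<lambda>x. trace (jac W x) - trace (weak_grad \<Omega> u x)) \<phi>"
    proof -
      have "L2_inner ?M (\<lambda>x. trace (weak_grad \<Omega> u x)) \<phi> = 0"
        unfolding L2_inner_def
        by (rule integral_eq_zero_AE) (use H1_sigma_tan_divergence_free[OF open_\<Omega> bdd u] in auto)
      then show ?thesis using L2_inner_diff_left[OF tJ tu pL] by simp
    qed
    also have "L2_inner ?M (\<lambda>x. W x - u x) (gradient \<phi>) \<le> H1_norm \<Omega> (w - u) * (2 * B * H1_norm \<Omega> w)"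
    proof -
      have "L2_norm ?M (\<lambda>x. W x - u x) = L2_norm ?M (w - u)"
        by (rule L2_norm_cong) (use W(2) closure_subset[of \<Omega>] in auto)
      then have 1: "L2_norm ?M (\<lambda>x. W x - u x) \<le> H1_norm \<Omega> (w - u)" using L2_norm_le_H1_norm(1) by simp
      have sq: "(L2_norm ?M W)\<^sup>2 + (L2_norm ?M (jac W))\<^sup>2 = (H1_norm \<Omega> w)\<^sup>2"
        by (rule H1_norm_smooth_closure[OF open_\<Omega> bdd W, symmetric])
      have 2: "L2_norm ?M W \<le> H1_norm \<Omega> w" "L2_norm ?M (jac W) \<le> H1_norm \<Omega> w"
      proof -
        have "(L2_norm ?M W)\<^sup>2 \<le> (H1_norm \<Omega> w)\<^sup>2" "(L2_norm ?M (jac W))\<^sup>2 \<le> (H1_norm \<Omega> w)\<^sup>2"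
          unfolding sq[symmetric] by simp_all
        then show "L2_norm ?M W \<le> H1_norm \<Omega> w" "L2_norm ?M (jac W) \<le> H1_norm \<Omega> w"
          by (auto intro: power2_le_imp_le)
      qed
      have "L2_norm ?M (gradient \<phi>) \<le> B * L2_norm ?M (\<lambda>x. norm (W x) + norm (jac W x))"
        using B(4)[OF W(1)] B(1)
        by (intro L2_norm_mono L2_borel[OF gL] L2_add L2_norm_fun WL JL) (auto simp: \<phi>_def)
      also have "\<dots> \<le> B * (L2_norm ?M W + L2_norm ?M (jac W))"
        using L2_norm_add_le[OF L2_norm_fun[OF WL] L2_norm_fun[OF JL]] B(1)
        by (intro mult_left_mono) (auto simp: L2_norm_norm)
      also have "\<dots> \<le> B * (H1_norm \<Omega> w + H1_norm \<Omega> w)" using 2 B(1) by (intro mult_left_mono add_mono)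
      finally have 3: "L2_norm ?M (gradient \<phi>) \<le> 2 * B * H1_norm \<Omega> w" by simp
      have "L2_inner ?M (\<lambda>x. W x - u x) (gradient \<phi>) \<le> L2_norm ?M (\<lambda>x. W x - u x) * L2_norm ?M (gradient \<phi>)"
        using L2_Cauchy_Schwarz[OF L2_diff[OF WL H1_D(1)[OF uH]] gL] by linarith
      also have "\<dots> \<le> H1_norm \<Omega> (w - u) * (2 * B * H1_norm \<Omega> w)" using 1 3 by (intro mult_mono) auto
      finally show ?thesis .
    qed
    also have "L2_inner ?M (\<lambda>x. trace (jac W x) - trace (weak_grad \<Omega> u x)) \<phi> \<le> (3 * H1_norm \<Omega> (w - u)) * (B * H1_norm \<Omega> w)"
    proof -
      have "L2_norm ?M (\<lambda>x. trace (jac W x) - trace (weak_grad \<Omega> u x)) \<le> 3 * L2_norm ?M (weak_grad \<Omega> (w - u))"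
      proof (rule L2_norm_mono)
        show "(\<lambda>x. trace (jac W x) - trace (weak_grad \<Omega> u x)) \<in> borel_measurable ?M"
          by (intro borel_measurable_diff L2_borel tJ tu)
        show "weak_grad \<Omega> (w - u) \<in> L2 ?M" by (intro H1_D(2) H1_diff(1) open_\<Omega> bdd w(2) uH)
        show "AE x in ?M. norm (trace (jac W x) - trace (weak_grad \<Omega> u x)) \<le> 3 * norm (weak_grad \<Omega> (w - u) x)"
          using w(3) H1_diff(2)[OF open_\<Omega> bdd w(2) uH]
        proof eventually_elim
          case (elim x)
          then show ?case using abs_trace_le[of "jac W x - weak_grad \<Omega> u x"] by (simp add: trace_sub)
        qed
      qed simp
      also have "\<dots> \<le> 3 * H1_norm \<Omega> (w - u)" using L2_norm_le_H1_norm(2) by simp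
      finally have 1: "L2_norm ?M (\<lambda>x. trace (jac W x) - trace (weak_grad \<Omega> u x)) \<le> 3 * H1_norm \<Omega> (w - u)" .
      have "L2_norm ?M \<phi> \<le> B * L2_norm ?M w"
        using B(1,3) W closure_subset[of \<Omega>]
        by (intro L2_norm_mono L2_borel[OF pL] H1_D(1)[OF w(2)]) (auto simp: \<phi>_def intro!: AE_I2)
      also have "\<dots> \<le> B * H1_norm \<Omega> w" using L2_norm_le_H1_norm(1) B(1) by (intro mult_left_mono)
      finally have 2: "L2_norm ?M \<phi> \<le> B * H1_norm \<Omega> w" .
      have "L2_inner ?M (\<lambda>x. trace (jac W x) - trace (weak_grad \<Omega> u x)) \<phi>
          \<le> L2_norm ?M (\<lambda>x. trace (jac W x) - trace (weak_grad \<Omega> u x)) * L2_norm ?M \<phi>"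
        using L2_Cauchy_Schwarz[OF L2_diff[OF tJ tu] pL] by linarith
      also have "\<dots> \<le> (3 * H1_norm \<Omega> (w - u)) * (B * H1_norm \<Omega> w)" using 1 2 by (intro mult_mono) auto
      finally show ?thesis .
    qed
    also have "H1_norm \<Omega> (w - u) * (2 * B * H1_norm \<Omega> w) + (3 * H1_norm \<Omega> (w - u)) * (B * H1_norm \<Omega> w)
        = 5 * B * H1_norm \<Omega> (w - u) * H1_norm \<Omega> w"
    proof -
      have "e * (2 * B * h) + (3 * e) * (B * h) = 5 * B * e * h" for e h :: real by (simp add: algebra_simps)
      then show ?thesis .
    qed
    finally show ?thesis unfolding \<phi>_def by simp
  qed
  with B(1) show thesis by (intro that[of "5 * B"]) auto
qed

end

context boundary_chart
begin

text \<open>Write \<open>g\<close> as the negative of \<open>w n - g\<close> plus \<open>w n\<close>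
  and take normal components. The first part tends to zero by convergence of the boundary values,
  the second by \<open>normal_component_estimate\<close>, whose right-hand side contains the
  distance from \<open>w n\<close> to \<open>u\<close>.\<close>

lemma chart_trace_tangential:
  assumes bdd: "bounded \<Omega>" and sb: "smooth_boundary \<Omega>" and s: "s > 0" "s < r" "s < \<delta>"
    and u: "u \<in> H1_sigma_tan \<Omega>" and t: "has_trace \<Omega> u g"
  shows "AE x in surface_measure \<Omega>. x \<in> cball x0 (s / 2) \<longrightarrow> g x \<bullet> outward_normal \<Omega> x = 0"
proof -
  let ?S = "surface_measure \<Omega>"
  define A where "A = \<Gamma> \<inter> cball x0 (s / 2)"
  have AV: "A \<subseteq> cball x0 s" "cball x0 s \<subseteq> V" using cball_V[OF s(2,3)] s(1) by (auto simp: A_def)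
  have Ab: "A \<in> sets borel" using closed_\<Gamma> by (auto simp: A_def)
  have gc: "continuous_on V (gradient \<rho>)"
    unfolding gradient_def[abs_def] dirderiv_def[symmetric]
    using C1_on_D(2)[OF C1_\<rho>_V] by (intro continuous_intros) (simp add: dirderiv_def[abs_def])
  obtain M1 where M1: "\<And>x. x \<in> cball x0 s \<Longrightarrow> norm (gradient \<rho> x) \<le> M1"
  proof -
    have "bounded (gradient \<rho> ` cball x0 s)"
      using compact_continuous_image[OF continuous_on_subset[OF gc AV(2)] compact_cball] by (rule compact_imp_bounded)
    then obtain a where a: "\<forall>y\<in>gradient \<rho> ` cball x0 s. norm y \<le> a" unfolding bounded_iff by blast
    show thesis by (rule that[of a]) (use a in blast)
  qed
  have M10: "M1 \<ge> 0" using order_trans[OF norm_ge_zero M1[of x0]] s(1) by simp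
  have slope_le: "dirderiv \<rho> b x \<le> M1 + 1" if "x \<in> cball x0 s" for x
  proof -
    have "dirderiv \<rho> b x = gradient \<rho> x \<bullet> b" using gradient_b that AV(2) by auto
    also have "\<dots> \<le> norm (gradient \<rho> x) * norm b" by (rule norm_cauchy_schwarz)
    finally show ?thesis using M1[OF that] norm_b by simp
  qed
  obtain w where w: "\<And>n::nat. w n \<in> smooth_closure \<Omega>" "(\<lambda>n. H1_norm \<Omega> (w n - u)) \<longlonglongrightarrow> 0"
    "(\<lambda>n. L2_norm ?S (w n - g)) \<longlonglongrightarrow> 0" using has_traceE[OF t] by metis
  have uH: "u \<in> H1 \<Omega>" and gL: "g \<in> L2 ?S" using has_trace_D[OF t] by auto
  have "\<exists>W. smooth_on UNIV W \<and> (\<forall>x\<in>closure \<Omega>. w n x = W x)" for n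
    using w(1)[of n] by (auto simp: smooth_closure_def)
  then obtain W where W: "\<And>n. smooth_on UNIV (W n)" "\<And>n x. x \<in> closure \<Omega> \<Longrightarrow> w n x = W n x" by metis
  have wH: "w n \<in> H1 \<Omega>" for n by (intro smooth_closure_H1 open_\<Omega> bdd w(1))
  have wS: "w n \<in> L2 ?S" for n using smooth_closure_trace_inequality[OF open_\<Omega> bdd sb] w(1) by metis
  obtain C where C: "C \<ge> 0" "\<And>u w W. u \<in> H1_sigma_tan \<Omega> \<Longrightarrow> smooth_on UNIV W \<Longrightarrow> (\<And>x. x \<in> closure \<Omega> \<Longrightarrow> w x = W x) \<Longrightarrow>
    (\<integral>x. normal_test s W (P x) * (W (P x) \<bullet> gradient \<rho> (P x)) * inverse (dirderiv \<rho> b (P x)) * weight x \<partial>lborel)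
      \<le> C * H1_norm \<Omega> (w - u) * H1_norm \<Omega> w"
  proof (rule normal_component_estimate[OF bdd s], goal_cases)
    case (1 C)
    show ?case by (rule 1(1)[OF 1(2) 1(3)])
  qed
  obtain B where B: "\<And>W. smooth_on UNIV W \<Longrightarrow> C1c V (normal_test s W)"
    by (rule normal_test_bounds[OF s]) (rule that)
  define f where "f n x = normal_test s (W n) x * (W n x \<bullet> gradient \<rho> x) * inverse (dirderiv \<rho> b x)" for n x
  \<comment> \<open>On \<open>A\<close> the bump is at least \<open>s ^ 4 / 2\<close> and the slope
    at most \<open>M1 + 1\<close>; \<open>c\<close> compensates for both, so \<open>c * f n\<close>
    majorises the square of the normal component.\<close>
  define c where "c = 2 * (M1 + 1) / s ^ 4"
  have c0: "c \<ge> 0" using M10 s by (simp add: c_def)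
  have fC: "C1c V (f n)" for n
  proof -
    have 1: "C1_on V (\<lambda>x. W n x \<bullet> gradient \<rho> x)"
      unfolding inner_commute[of "W n _"] gradient_inner_vec
      by (intro C1_on_sum C1_on_mult C1_on_subset[OF smooth_on_nth[OF W(1)]]
          C1_on_subset[OF smooth_on_dirderiv_C1_on[OF smooth open_U] V_U]) simp
    have "C1_on V (\<lambda>x. inverse (dirderiv \<rho> b x))"
      using slope_V m_pos
      by (intro C1_on_inverse C1_on_subset[OF smooth_on_dirderiv_C1_on[OF smooth open_U] V_U]) force
    then show ?thesis unfolding f_def
      by (intro C1c_mult_C1_on[OF C1c_mult_C1_on[OF B[OF W(1)] 1 open_V] _ open_V])
  qed
  have f_alt: "f n x = bump s x * (W n x \<bullet> gradient \<rho> x)\<^sup>2 * inverse (dirderiv \<rho> b x)" for n x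
    by (simp add: f_def normal_test_def power2_eq_square)
  have f0: "0 \<le> f n x" for n x
  proof (cases "x \<in> V")
    case True
    then have "0 \<le> inverse (dirderiv \<rho> b x)" using slope_V m_pos by (smt (verit) inverse_nonnegative_iff_nonnegative)
    then show ?thesis unfolding f_alt using bump_nonneg by (intro mult_nonneg_nonneg) auto
  next
    case False
    obtain K' where "K' \<subseteq> V" "\<And>x. x \<notin> K' \<Longrightarrow> f n x = 0" using fC[of n] unfolding C1c_def by blast
    then show ?thesis using False by (metis order_refl subsetD)
  qed
  have fA: "(W n x \<bullet> gradient \<rho> x)\<^sup>2 \<le> c * f n x" if x: "x \<in> A" for n x
  proof -
    have xs: "x \<in> cball x0 s" "x \<in> V" using AV x by auto
    have pos: "0 < dirderiv \<rho> b x" using slope_V[OF xs(2)] m_pos by linarith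
    have "1 \<le> c * bump s x * inverse (dirderiv \<rho> b x)"
    proof -
      have "(M1 + 1) * 1 \<le> (M1 + 1) * (2 / s ^ 4 * bump s x)"
        using bump_ge[of x s] x s M10 by (intro mult_left_mono) (auto simp: A_def field_simps)
      moreover have "(M1 + 1) * (2 / s ^ 4 * bump s x) = c * bump s x"
        by (simp only: c_def times_divide_eq_right times_divide_eq_left mult_ac)
      ultimately have "M1 + 1 \<le> c * bump s x" by (simp only: mult_1_right)
      then have "dirderiv \<rho> b x \<le> c * bump s x" using slope_le[OF xs(1)] by linarith
      then show ?thesis using pos by (simp add: field_simps)
    qed
    from mult_right_mono[OF this, of "(W n x \<bullet> gradient \<rho> x)\<^sup>2"] show ?thesis
      by (simp add: f_alt mult_ac)
  qed
  \<comment> \<open>The gradient is controlled only inside the chart; cutting it off outside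
    \<open>A\<close> makes it bounded and Borel measurable on the whole space.\<close>
  define N where "N x = indicator A x *\<^sub>R gradient \<rho> x" for x
  have Nb: "N \<in> borel_measurable borel"
    unfolding N_def using Ab AV by (intro borel_measurable_continuous_on_indicator continuous_on_subset[OF gc]) auto
  have NM: "norm (N x) \<le> M1" for x
    using M1[of x] M10 AV(1) by (auto simp: N_def indicator_def)
  define J where "J = (\<integral>\<^sup>+x. ennreal ((g x \<bullet> N x)\<^sup>2) \<partial>?S)"
  define e2 where "e2 n = L2_norm ?S (w n - g)" for n
  \<comment> \<open>Both parts carry the factor 2 of (a + b)^2 <= 2 a^2 + 2 b^2.\<close>
  define E where "E n = 2 * M1\<^sup>2 * (e2 n)\<^sup>2
      + 2 * (c * (2 * \<delta> * haus_const) * (C * H1_norm \<Omega> (w n - u) * H1_norm \<Omega> (w n)))" for n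
  have JE: "J \<le> ennreal (E n)" for n
  proof -
    have dL: "(\<lambda>x. w n x - g x) \<in> L2 ?S" by (rule L2_diff[OF wS gL])
    have cf: "(\<lambda>x. ennreal (c * f n x)) \<in> borel_measurable borel" using C1c_borel(1)[OF fC[of n]] by measurable
    have cfA: "(\<lambda>x. ennreal (c * f n x) * indicator A x) \<in> borel_measurable borel"
      using cf Ab by (intro borel_measurable_times_ennreal borel_measurable_indicator)
    have "J \<le> (\<integral>\<^sup>+x. ennreal (2 * M1\<^sup>2) * ennreal ((norm (w n x - g x))\<^sup>2) + 2 * (ennreal (c * f n x) * indicator A x) \<partial>?S)"
      unfolding J_def
    proof (rule nn_integral_mono)
      fix x assume "x \<in> space ?S"
      then have xc: "w n x = W n x" using W(2) by (simp add: frontier_def)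
      show "ennreal ((g x \<bullet> N x)\<^sup>2) \<le> ennreal (2 * M1\<^sup>2) * ennreal ((norm (w n x - g x))\<^sup>2) + 2 * (ennreal (c * f n x) * indicator A x)"
      proof (cases "x \<in> A")
        case True
        define d where "d = (w n x - g x) \<bullet> N x"
        have "g x \<bullet> N x = - d + w n x \<bullet> N x" by (simp add: d_def inner_diff_left)
        then have "(g x \<bullet> N x)\<^sup>2 \<le> 2 * d\<^sup>2 + 2 * (w n x \<bullet> N x)\<^sup>2"
          using square_sum_le[of "- d" "w n x \<bullet> N x"] by simp
        moreover have "d\<^sup>2 \<le> M1\<^sup>2 * (norm (w n x - g x))\<^sup>2"
        proof -
          have "\<bar>(w n x - g x) \<bullet> N x\<bar> \<le> norm (w n x - g x) * norm (N x)" by (rule Cauchy_Schwarz_ineq2)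
          also have "\<dots> \<le> norm (w n x - g x) * M1" using NM by (intro mult_left_mono) auto
          finally have "\<bar>(w n x - g x) \<bullet> N x\<bar>\<^sup>2 \<le> (norm (w n x - g x) * M1)\<^sup>2" by (intro power_mono) auto
          then show ?thesis by (simp add: d_def power_mult_distrib mult.commute)
        qed
        moreover have "(w n x \<bullet> N x)\<^sup>2 \<le> c * f n x" using fA[OF True, of n] True by (simp add: N_def xc)
        ultimately have "(g x \<bullet> N x)\<^sup>2 \<le> 2 * M1\<^sup>2 * (norm (w n x - g x))\<^sup>2 + 2 * (c * f n x)" by linarith
        then have "ennreal ((g x \<bullet> N x)\<^sup>2) \<le> ennreal (2 * M1\<^sup>2 * (norm (w n x - g x))\<^sup>2 + 2 * (c * f n x))" by (rule ennreal_leI)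
        also have "\<dots> = ennreal (2 * M1\<^sup>2) * ennreal ((norm (w n x - g x))\<^sup>2) + ennreal 2 * ennreal (c * f n x)"
        proof -
          have "0 \<le> 2 * M1\<^sup>2 * (norm (w n x - g x))\<^sup>2" "0 \<le> 2 * (c * f n x)" using c0 f0[of n x] by simp_all
          then have "ennreal (2 * M1\<^sup>2 * (norm (w n x - g x))\<^sup>2 + 2 * (c * f n x))
              = ennreal (2 * M1\<^sup>2 * (norm (w n x - g x))\<^sup>2) + ennreal (2 * (c * f n x))" by (rule ennreal_plus)
          then show ?thesis
            using c0 f0[of n x] by (simp only: ennreal_mult[of "2 * M1\<^sup>2"] ennreal_mult[of 2] zero_le_power2 zero_le_mult_iff mult_nonneg_nonneg zero_le_numeral simp_thms)
        qed
        finally show ?thesis using True by simp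
      qed (simp add: N_def)
    qed
    also have "\<dots> = (\<integral>\<^sup>+x. ennreal (2 * M1\<^sup>2) * ennreal ((norm (w n x - g x))\<^sup>2) \<partial>?S)
        + (\<integral>\<^sup>+x. 2 * (ennreal (c * f n x) * indicator A x) \<partial>?S)"
    proof (rule nn_integral_add)
      show "(\<lambda>x. ennreal (2 * M1\<^sup>2) * ennreal ((norm (w n x - g x))\<^sup>2)) \<in> borel_measurable ?S"
        using L2_borel[OF dL] by measurable
      show "(\<lambda>x. 2 * (ennreal (c * f n x) * indicator A x)) \<in> borel_measurable ?S"
        by (rule borel_measurable_times_ennreal[OF borel_measurable_const borel_measurable_surface[OF cfA]])
    qed
    also have "(\<integral>\<^sup>+x. ennreal (2 * M1\<^sup>2) * ennreal ((norm (w n x - g x))\<^sup>2) \<partial>?S) = ennreal (2 * M1\<^sup>2) * ennreal ((e2 n)\<^sup>2)"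
      using L2_borel[OF dL] nn_integral_eq_integral[OF L2_integrable_square[OF dL]]
      by (subst nn_integral_cmult) (auto simp: L2_norm_power2 fun_diff_def e2_def)
    also have "\<dots> = ennreal (2 * M1\<^sup>2 * (e2 n)\<^sup>2)" by (simp add: ennreal_mult)
    also have "(\<integral>\<^sup>+x. 2 * (ennreal (c * f n x) * indicator A x) \<partial>?S) = 2 * (\<integral>\<^sup>+x. ennreal (c * f n x) * indicator A x \<partial>?S)"
      using borel_measurable_surface[OF cfA] by (intro nn_integral_cmult)
    also have "(\<integral>\<^sup>+x. ennreal (c * f n x) * indicator A x \<partial>?S) \<le> (\<integral>\<^sup>+x. ennreal (c * f n x) * indicator A x \<partial>hausdorff2)"
      unfolding nn_integral_surface[OF cfA] by (intro nn_integral_mono) (auto split: split_indicator)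
    also have "\<dots> \<le> ennreal (c * (2 * \<delta> * haus_const) * (\<integral>x. f n (P x) * weight x \<partial>lborel))"
      by (rule surface_integral_le[OF s A_def fC f0 cf _ c0]) simp
    also have "\<dots> \<le> ennreal (c * (2 * \<delta> * haus_const) * (C * H1_norm \<Omega> (w n - u) * H1_norm \<Omega> (w n)))"
      using C(2)[OF u W(1)[of n], of "w n"] W(2)[of _ n] c0 haus_const_nonneg \<delta>_pos
      by (intro ennreal_leI mult_left_mono) (auto simp: f_def)
    also have "2 * ennreal (c * (2 * \<delta> * haus_const) * (C * H1_norm \<Omega> (w n - u) * H1_norm \<Omega> (w n)))
        = ennreal (2 * (c * (2 * \<delta> * haus_const) * (C * H1_norm \<Omega> (w n - u) * H1_norm \<Omega> (w n))))"
      by (subst ennreal_mult) (use c0 haus_const_nonneg \<delta>_pos C(1) in auto)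
    finally show "J \<le> ennreal (E n)"
      unfolding E_def using c0 haus_const_nonneg \<delta>_pos C(1)
      by (subst ennreal_plus) (auto simp: mult_left_mono intro!: mult_nonneg_nonneg)
  qed
  have "E \<longlonglongrightarrow> 0"
  proof -
    have "\<bar>H1_norm \<Omega> (w n) - H1_norm \<Omega> u\<bar> \<le> H1_norm \<Omega> (w n - u)" for n
      using H1_norm_add_le[OF open_\<Omega> bdd H1_diff(1)[OF open_\<Omega> bdd wH[of n] uH] uH]
        H1_norm_add_le[OF open_\<Omega> bdd H1_diff(1)[OF open_\<Omega> bdd uH wH[of n]] wH[of n]]
        H1_norm_diff_commute[OF open_\<Omega> bdd uH wH, of n] by simp
    then have "(\<lambda>n. \<bar>H1_norm \<Omega> (w n) - H1_norm \<Omega> u\<bar>) \<longlonglongrightarrow> 0" by (intro nonneg_tendsto_0_le[OF w(2)]) auto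
    then have "(\<lambda>n. H1_norm \<Omega> (w n)) \<longlonglongrightarrow> H1_norm \<Omega> u"
      using tendsto_rabs_zero_cancel Lim_null by blast
    then have "E \<longlonglongrightarrow> 2 * M1\<^sup>2 * 0\<^sup>2 + 2 * (c * (2 * \<delta> * haus_const) * (C * 0 * H1_norm \<Omega> u))"
      unfolding E_def e2_def by (intro tendsto_intros w)
    then show ?thesis by simp
  qed
  then have "(\<lambda>n. ennreal (E n)) \<longlonglongrightarrow> ennreal 0" by (intro tendsto_ennrealI)
  then have "J \<le> ennreal 0" using JE by (intro LIMSEQ_le_const[of _ _ J]) auto
  then have "J = 0" by simp
  moreover have "(\<lambda>x. ennreal ((g x \<bullet> N x)\<^sup>2)) \<in> borel_measurable ?S"
    using L2_borel[OF gL] borel_measurable_surface[OF Nb] by measurable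
  ultimately have "AE x in ?S. ennreal ((g x \<bullet> N x)\<^sup>2) = 0"
    unfolding J_def using nn_integral_0_iff_AE by blast
  moreover have "AE x in ?S. x \<in> frontier \<Omega>" by (rule AE_I2) simp
  ultimately show ?thesis
  proof eventually_elim
    case (elim x)
    show ?case
    proof
      assume x: "x \<in> cball x0 (s / 2)"
      then have "x \<in> cball x0 s" using s by auto
      then have xV: "x \<in> V" using AV(2) by blast
      then have "x \<in> A" using frontier_K[OF elim(2)] V_subset_K x by (auto simp: A_def)
      then have "g x \<bullet> gradient \<rho> x = 0" using elim(1) by (simp add: N_def)
      then show "g x \<bullet> outward_normal \<Omega> x = 0" using normal_iff[OF elim(2) xV] by simp
    qed
  qed
qed

end

text \<open>Finitely many chart neighbourhoods cover the compact frontier, and finitely many almost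
  everywhere statements can be combined.\<close>

theorem trace_tangential:
  assumes "open \<Omega>" "bounded \<Omega>" "smooth_boundary \<Omega>" "u \<in> H1_sigma_tan \<Omega>" "has_trace \<Omega> u g"
  shows "AE x in surface_measure \<Omega>. g x \<bullet> outward_normal \<Omega> x = 0"
proof -
  define Q where "Q x0 s \<longleftrightarrow> (AE x in surface_measure \<Omega>. x \<in> ball x0 s \<longrightarrow> g x \<bullet> outward_normal \<Omega> x = 0)" for x0 s
  have "\<exists>s>0. Q x0 s"
    if x0: "x0 \<in> frontier \<Omega>" for x0
  proof -
    obtain U \<rho> b r \<delta> m M where "boundary_chart \<Omega> U \<rho> x0 b r \<delta> m M"
      using boundary_chart_exists[OF assms(1,3) x0] .
    then interpret boundary_chart \<Omega> U \<rho> x0 b r \<delta> m M .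
    define s where "s = min r \<delta> / 2"
    have s: "s > 0" "s < r" "s < \<delta>" using r_pos \<delta>_pos by (auto simp: s_def)
    have "AE x in surface_measure \<Omega>. x \<in> ball x0 (s / 2) \<longrightarrow> g x \<bullet> outward_normal \<Omega> x = 0"
      using chart_trace_tangential[OF assms(2,3) s assms(4,5)] by eventually_elim auto
    then have "Q x0 (s / 2)" by (simp only: Q_def)
    then show ?thesis using s(1) by (intro exI[of _ "s / 2"]) simp
  qed
  then obtain s where s: "\<And>x. x \<in> frontier \<Omega> \<Longrightarrow> s x > 0" and Q: "\<And>x0. x0 \<in> frontier \<Omega> \<Longrightarrow> Q x0 (s x0)"
    by metis
  have ae: "AE x in surface_measure \<Omega>. x \<in> ball x0 (s x0) \<longrightarrow> g x \<bullet> outward_normal \<Omega> x = 0"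
    if "x0 \<in> frontier \<Omega>" for x0
    using Q[OF that] by (simp only: Q_def)
  obtain X where X: "X \<subseteq> frontier \<Omega>" "finite X" "frontier \<Omega> \<subseteq> (\<Union>x\<in>X. ball x (s x))"
    by (rule compactE_image[OF compact_frontier_bounded[OF assms(2)], of "frontier \<Omega>" "\<lambda>x. ball x (s x)"])
      (use s in auto)
  have "AE x in surface_measure \<Omega>. \<forall>x0\<in>X. x \<in> ball x0 (s x0) \<longrightarrow> g x \<bullet> outward_normal \<Omega> x = 0"
    using X(1,2) ae by (intro AE_finite_allI) auto
  moreover have "AE x in surface_measure \<Omega>. x \<in> frontier \<Omega>" by (rule AE_I2) simp
  ultimately show ?thesis by eventually_elim (use X(3) in blast)
qed

section \<open>Measurability in time\<close>

text \<open>Completeness is a hypothesis so that one lemma serves Lebesgue measure on subsets as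
  well as surface measure.\<close>

lemma borel_measurable_AE_complete:
  fixes f g :: "'a \<Rightarrow> 'b::topological_space"
  assumes complete: "\<And>N B. N \<in> null_sets M \<Longrightarrow> B \<subseteq> N \<Longrightarrow> B \<in> sets M"
    and f: "f \<in> borel_measurable M" and ae: "AE x in M. f x = g x"
  shows "g \<in> borel_measurable M"
proof -
  obtain N where N: "N \<in> null_sets M" "{x \<in> space M. f x \<noteq> g x} \<subseteq> N"
    using ae by (auto simp: eventually_ae_filter)
  show ?thesis
  proof (rule borel_measurableI)
    fix S :: "'b set" assume "open S"
    then have "f -` S \<inter> space M \<in> sets M" using f by (auto intro: measurable_sets)
    then have "(f -` S \<inter> space M - N) \<union> (g -` S \<inter> space M \<inter> N) \<in> sets M"
      using N(1) complete[OF N(1), of "g -` S \<inter> space M \<inter> N"] by auto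
    moreover have "g -` S \<inter> space M = (f -` S \<inter> space M - N) \<union> (g -` S \<inter> space M \<inter> N)"
      using N(2) by auto
    ultimately show "g -` S \<inter> space M \<in> sets M" by simp
  qed
qed

lemma lebesgue_on_complete:
  assumes "S \<in> sets lebesgue" "N \<in> null_sets (lebesgue_on S)" "B \<subseteq> N"
  shows "B \<in> sets (lebesgue_on S)"
proof -
  have "N \<in> null_sets lebesgue" "N \<subseteq> S" using assms by (auto simp: null_sets_restrict_space)
  then have "B \<in> sets lebesgue" "B \<subseteq> S"
    using assms(3) null_sets_completion_subset by (blast, blast)
  then show ?thesis using assms(1) by (auto simp: sets_restrict_space_iff)
qed

lemma surface_measure_complete:
  "N \<in> null_sets (surface_measure \<Omega>) \<Longrightarrow> B \<subseteq> N \<Longrightarrow> B \<in> sets (surface_measure \<Omega>)"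
  unfolding surface_measure_def using null_sets_completion_subset by blast

text \<open>Over a complete measure the two functions are measurable together or not at all, and in
  the latter case both integrals are zero by convention. This allows changes on null sets for
  integrands involving \<open>u t\<close> at times when nothing is known about
  \<open>u t\<close>.\<close>

lemma integral_cong_AE_complete:
  fixes f g :: "'a \<Rightarrow> real"
  assumes complete: "\<And>N B. N \<in> null_sets M \<Longrightarrow> B \<subseteq> N \<Longrightarrow> B \<in> sets M"
    and ae: "AE x in M. f x = g x"
  shows "integral\<^sup>L M f = integral\<^sup>L M g"
proof (cases "f \<in> borel_measurable M")
  case True
  have "g \<in> borel_measurable M" by (rule borel_measurable_AE_complete[OF _ True ae]) (blast intro: complete)
  then show ?thesis using True ae by (intro integral_cong_AE)
next
  case False
  have ae': "AE x in M. g x = f x" using ae by eventually_elim simp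
  have "g \<notin> borel_measurable M"
  proof
    assume g: "g \<in> borel_measurable M"
    have "f \<in> borel_measurable M" by (rule borel_measurable_AE_complete[OF _ g ae']) (blast intro: complete)
    then show False using False by blast
  qed
  then show ?thesis using False borel_measurable_integrable not_integrable_integral_eq by metis
qed

text \<open>With finitely many values, any \<phi> turns \<open>s\<close> into a finite combination
  of indicators.\<close>

lemma finite_range_measurable:
  fixes \<phi> :: "'v \<Rightarrow> real"
  assumes "I \<in> sets lebesgue" "finite (s ` I)" "\<And>y. {t\<in>I. s t = y} \<in> sets lebesgue"
  shows "(\<lambda>t. \<phi> (s t)) \<in> borel_measurable (lebesgue_on I)"
proof -
  have "(\<lambda>t. \<Sum>y\<in>s ` I. \<phi> y * indicator {t\<in>I. s t = y} t) \<in> borel_measurable (lebesgue_on I)"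
    using assms(1,3) by (intro borel_measurable_sum borel_measurable_times borel_measurable_const borel_measurable_indicator)
      (auto simp: sets_restrict_space_iff)
  moreover have "(\<lambda>t. \<Sum>y\<in>s ` I. \<phi> y * indicator {t\<in>I. s t = y} t) \<in> borel_measurable (lebesgue_on I)
      \<longleftrightarrow> (\<lambda>t. \<phi> (s t)) \<in> borel_measurable (lebesgue_on I)"
  proof (rule measurable_cong)
    fix t assume "t \<in> space (lebesgue_on I)"
    then have t: "t \<in> I" by simp
    have "(\<Sum>y\<in>s ` I. \<phi> y * indicator {t\<in>I. s t = y} t) = (\<Sum>y\<in>s ` I. if y = s t then \<phi> y else 0)"
      by (rule sum.cong) (auto simp: indicator_def t)
    also have "\<dots> = \<phi> (s t)" using assms(2) t by (simp add: sum.delta)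
    finally show "(\<Sum>y\<in>s ` I. \<phi> y * indicator {t\<in>I. s t = y} t) = \<phi> (s t)" .
  qed
  ultimately show ?thesis by blast
qed

lemma H1_norm_self: "open \<Omega> \<Longrightarrow> bounded \<Omega> \<Longrightarrow> u \<in> H1 \<Omega> \<Longrightarrow> H1_norm \<Omega> (u - u) = 0"
  using H1_norm_scaleR[of \<Omega> u 0] by (simp add: fun_diff_def)

text \<open>A Lipschitz functional on a subset \<open>D\<close> is replaced by its McShane extension, which can be applied to
  the approximating simple functions.\<close>

lemma strongly_measurable_Lipschitz_functional:
  assumes \<Omega>: "open \<Omega>" "bounded \<Omega>" and I: "I \<in> sets lebesgue"
    and f: "strongly_measurable I X (H1_norm \<Omega>) f" and X: "X \<subseteq> H1 \<Omega>" and D: "D \<subseteq> H1 \<Omega>"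
    and lip: "\<And>d e. d \<in> D \<Longrightarrow> e \<in> D \<Longrightarrow> \<bar>A d - A e\<bar> \<le> C * H1_norm \<Omega> (d - e)" and C: "C \<ge> 0"
    and fD: "AE t in lebesgue_on I. f t \<in> D"
  shows "(\<lambda>t. A (f t)) \<in> borel_measurable (lebesgue_on I)"
proof (cases "D = {}")
  case True
  \<comment> \<open>Almost every \<open>t\<close> lies in the empty set, so the function may be
    compared with any constant.\<close>
  have ae0: "AE t in lebesgue_on I. (0::real) = A (f t)" using fD by (rule eventually_mono) (use True in simp)
  show ?thesis
    by (rule borel_measurable_AE_complete[OF _ borel_measurable_const ae0]) (rule lebesgue_on_complete[OF I])
next
  case False
  let ?N = "H1_norm \<Omega>"
  \<comment> \<open>It agrees with \<open>A\<close> on \<open>D\<close> and has the Lipschitz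
    constant \<open>C\<close> on all of H^1, in particular at the values of the simple functions,
    which may lie outside \<open>D\<close>.\<close>
  define E where "E y = (SUP d\<in>D. A d - C * ?N (y - d))" for y
  obtain d0 where d0: "d0 \<in> D" using False by blast
  have tri: "?N (y - w) \<le> ?N (y - z) + ?N (z - w)" if "y \<in> H1 \<Omega>" "z \<in> H1 \<Omega>" "w \<in> H1 \<Omega>" for y z w
    by (rule H1_norm_diff_triangle[OF \<Omega> that])
  have bdd: "bdd_above ((\<lambda>d. A d - C * ?N (y - d)) ` D)" if y: "y \<in> H1 \<Omega>" for y
  proof (rule bdd_aboveI2)
    fix d assume d: "d \<in> D"
    have "A d \<le> A d0 + C * ?N (d - d0)" using lip[OF d d0] by linarith
    also have "\<dots> \<le> A d0 + C * (?N (d - y) + ?N (y - d0))"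
      using tri[of d y d0] d d0 D y C by (intro add_left_mono mult_left_mono) auto
    also have "?N (d - y) = ?N (y - d)" using H1_norm_diff_commute[OF \<Omega>] d D y by blast
    finally show "A d - C * ?N (y - d) \<le> A d0 + C * ?N (y - d0)" unfolding distrib_left by linarith
  qed
  have Ed: "E d = A d" if d: "d \<in> D" for d
  proof (rule antisym)
    show "E d \<le> A d" unfolding E_def
    proof (rule cSUP_least)
      show "A e - C * ?N (d - e) \<le> A d" if "e \<in> D" for e using lip[OF d that] by linarith
    qed fact
    have "d \<in> H1 \<Omega>" using d D by auto
    then show "A d \<le> E d"
      unfolding E_def using cSUP_upper[OF d bdd, of d] H1_norm_self[OF \<Omega>] by simp
  qed
  have El: "E y \<le> E z + C * ?N (y - z)" if y: "y \<in> H1 \<Omega>" and z: "z \<in> H1 \<Omega>" for y z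
    unfolding E_def[of y]
  proof (rule cSUP_least)
    fix d assume d: "d \<in> D"
    have "A d - C * ?N (z - d) \<le> E z" unfolding E_def by (rule cSUP_upper[OF d bdd[OF z]])
    moreover have "C * ?N (z - d) \<le> C * (?N (z - y) + ?N (y - d))"
      using tri[of z y d] d D y z C by (intro mult_left_mono) auto
    moreover have "C * ?N (z - y) = C * ?N (y - z)" by (simp only: H1_norm_diff_commute[OF \<Omega> z y])
    ultimately show "A d - C * ?N (y - d) \<le> E z + C * ?N (y - z)" unfolding distrib_left by linarith
  qed fact
  obtain s where s: "\<And>n::nat. finite (s n ` I)" "\<And>n. s n ` I \<subseteq> X" "\<And>n y. {t\<in>I. s n t = y} \<in> sets lebesgue"
    and lim: "AE t in lebesgue_on I. (\<lambda>n. ?N (f t - s n t)) \<longlonglongrightarrow> 0"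
    using f unfolding strongly_measurable_def by blast
  have m: "(\<lambda>t. E (s n t)) \<in> borel_measurable (lebesgue_on I)" for n
    by (rule finite_range_measurable[OF I s(1,3)])
  have aeL: "AE t in lebesgue_on I. lim (\<lambda>n. E (s n t)) = A (f t)"
    using lim fD AE_space
  proof eventually_elim
    case (elim t)
    have ft: "f t \<in> H1 \<Omega>" using elim D by auto
    have sn: "s n t \<in> H1 \<Omega>" for n using s(2)[of n] X elim(3) by auto
    have le: "\<bar>E (s n t) - E (f t)\<bar> \<le> C * ?N (f t - s n t)" for n
      using El[OF ft sn, of n] El[OF sn ft, of n] H1_norm_diff_commute[OF \<Omega> ft sn, of n] by simp
    have "(\<lambda>n. \<bar>E (s n t) - E (f t)\<bar>) \<longlonglongrightarrow> 0"
      by (rule nonneg_tendsto_0_le[OF tendsto_mult_right_zero[OF elim(1)] abs_ge_zero le])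
    then have "(\<lambda>n. E (s n t)) \<longlonglongrightarrow> E (f t)" using tendsto_rabs_zero_cancel Lim_null by blast
    then show ?case using limI Ed[OF elim(2)] by metis
  qed
  have mL: "(\<lambda>t. lim (\<lambda>n. E (s n t))) \<in> borel_measurable (lebesgue_on I)"
    using m by (intro borel_measurable_lim_metric) auto
  show ?thesis
    by (rule borel_measurable_AE_complete[OF _ mL aeL]) (rule lebesgue_on_complete[OF I])
qed

section \<open>A Gronwall argument\<close>

text \<open>One step of the iteration in \<open>energy_decay\<close>: integration raises every
  exponent by one and thus produces the next partial sum up to its constant term.\<close>

lemma integral_exp_partial_sum:
  fixes c s t :: real
  assumes "s \<le> t"
  shows "integrable (lebesgue_on {s..t}) (\<lambda>\<tau>. c * (\<Sum>k\<le>n. (c * (t - \<tau>)) ^ k / fact k))"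
    and "(\<integral>\<tau>. c * (\<Sum>k\<le>n. (c * (t - \<tau>)) ^ k / fact k) \<partial>lebesgue_on {s..t}) = (\<Sum>k\<le>n. (c * (t - s)) ^ Suc k / fact (Suc k))"
proof -
  let ?f = "\<lambda>\<tau>. c * (\<Sum>k\<le>n. (c * (t - \<tau>)) ^ k / fact k)"
  show int: "integrable (lebesgue_on {s..t}) ?f"
    by (intro continuous_imp_integrable_real continuous_intros) auto
  \<comment> \<open>An antiderivative that vanishes at \<tau> = t, since all exponents are
    positive.\<close>
  define F where "F \<tau> = - (\<Sum>k\<le>n. (c * (t - \<tau>)) ^ Suc k / fact (Suc k))" for \<tau>
  have "(F has_real_derivative ?f \<tau>) (at \<tau>)" for \<tau>
  proof -
    have 1: "((\<lambda>\<tau>. (c * (t - \<tau>)) ^ Suc k / fact (Suc k)) has_real_derivative - (c * ((c * (t - \<tau>)) ^ k / fact k))) (at \<tau>)" for k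
    proof -
      have "((\<lambda>\<tau>. (c * (t - \<tau>)) ^ Suc k) has_real_derivative real (Suc k) * (c * (t - \<tau>)) ^ k * (- c)) (at \<tau>)"
        by (auto intro!: derivative_eq_intros simp del: of_nat_Suc power_Suc)
      from DERIV_cdivide[OF this, of "fact (Suc k)"]
      have "((\<lambda>\<tau>. (c * (t - \<tau>)) ^ Suc k / fact (Suc k)) has_real_derivative real (Suc k) * (c * (t - \<tau>)) ^ k * (- c) / fact (Suc k)) (at \<tau>)" .
      moreover have "real (Suc k) * (c * (t - \<tau>)) ^ k * (- c) / fact (Suc k) = - (c * ((c * (t - \<tau>)) ^ k / fact k))"
        by (simp add: fact_Suc del: of_nat_Suc)
      ultimately show ?thesis by (simp only:)
    qed
    have "((\<lambda>\<tau>. - (\<Sum>k\<le>n. (c * (t - \<tau>)) ^ Suc k / fact (Suc k))) has_real_derivative - (\<Sum>k\<le>n. - (c * ((c * (t - \<tau>)) ^ k / fact k)))) (at \<tau>)"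
      by (intro DERIV_minus DERIV_sum 1)
    then show ?thesis by (simp add: F_def[abs_def] sum_negf sum_distrib_left)
  qed
  then have F: "(?f has_integral (F t - F s)) {s..t}"
    using assms by (intro fundamental_theorem_of_calculus)
      (auto simp: has_real_derivative_iff_has_vector_derivative[symmetric] intro: has_field_derivative_at_within)
  have "integral\<^sup>L (lebesgue_on {s..t}) ?f = integral {s..t} ?f"
    using int by (intro lebesgue_integral_eq_integral) auto
  moreover have "F t - F s = (\<Sum>k\<le>n. (c * (t - s)) ^ Suc k / fact (Suc k))" by (simp add: F_def)
  ultimately show "integral\<^sup>L (lebesgue_on {s..t}) ?f = (\<Sum>k\<le>n. (c * (t - s)) ^ Suc k / fact (Suc k))"
    by (simp only: integral_unique[OF F])
qed

text \<open>Iterating the integral inequality backwards from \<open>t\<close> bounds \<open>y s\<close> below by the partial sums of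
  \<open>y t exp (c (t - s))\<close>.\<close>

lemma energy_decay:
  fixes y D :: "real \<Rightarrow> real"
  assumes c: "c \<ge> 0" and y: "\<And>t. y t \<ge> 0" and S: "0 \<in> S" "S \<subseteq> {0..}"
    and aeS: "AE t in lebesgue_on {0..}. t \<in> S"
    and dissip: "AE t in lebesgue_on {0..}. c * y t \<le> D t"
    and int: "\<And>s t. 0 \<le> s \<Longrightarrow> s \<le> t \<Longrightarrow> integrable (lebesgue_on {s..t}) D"
    and energy: "\<And>s t. s \<in> S \<Longrightarrow> s \<le> t \<Longrightarrow> y t + (\<integral>\<tau>. D \<tau> \<partial>lebesgue_on {s..t}) \<le> y s"
    and t: "t \<ge> 0"
  shows "y t \<le> y 0 * exp (- c * t)"
proof -
  have ae: "AE \<tau> in lebesgue_on {s..t}. \<tau> \<in> S \<and> c * y \<tau> \<le> D \<tau>" if "0 \<le> s" for s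
  proof -
    have "AE \<tau> in lebesgue_on {0..}. \<tau> \<in> S \<and> c * y \<tau> \<le> D \<tau>" using aeS dissip by eventually_elim simp
    then have "AE \<tau> in lebesgue. \<tau> \<in> {0..} \<longrightarrow> \<tau> \<in> S \<and> c * y \<tau> \<le> D \<tau>"
      by (subst (asm) AE_restrict_space_iff) auto
    then have "AE \<tau> in lebesgue. \<tau> \<in> {s..t} \<longrightarrow> \<tau> \<in> S \<and> c * y \<tau> \<le> D \<tau>"
      by eventually_elim (use that in auto)
    then show ?thesis by (subst AE_restrict_space_iff) auto
  qed
  have iter: "y t * (\<Sum>k\<le>n. (c * (t - s)) ^ k / fact k) \<le> y s" if "s \<in> S" "s \<le> t" for n s
    using that
  proof (induction n arbitrary: s)
    case 0
    have s0: "0 \<le> s" using 0 S by auto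
    have "0 \<le> (\<integral>\<tau>. D \<tau> \<partial>lebesgue_on {s..t})"
    proof (rule integral_nonneg_AE)
      show "AE \<tau> in lebesgue_on {s..t}. 0 \<le> D \<tau>"
        using ae[OF s0] by (rule eventually_mono) (use y c in \<open>meson mult_nonneg_nonneg order_trans\<close>)
    qed
    then show ?case using energy[OF 0] by simp
  next
    case (Suc n)
    have s0: "0 \<le> s" using Suc.prems S by auto
    let ?g = "\<lambda>\<tau>. c * (\<Sum>k\<le>n. (c * (t - \<tau>)) ^ k / fact k)"
    have "y t * (\<integral>\<tau>. ?g \<tau> \<partial>lebesgue_on {s..t}) = (\<integral>\<tau>. y t * ?g \<tau> \<partial>lebesgue_on {s..t})"
      by (simp only: integral_mult_right_zero)
    also have "\<dots> \<le> (\<integral>\<tau>. D \<tau> \<partial>lebesgue_on {s..t})"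
    proof (rule integral_mono_AE)
      show "integrable (lebesgue_on {s..t}) (\<lambda>\<tau>. y t * ?g \<tau>)"
        by (rule integrable_mult_right[OF integral_exp_partial_sum(1)[OF Suc.prems(2)]])
      show "AE \<tau> in lebesgue_on {s..t}. y t * ?g \<tau> \<le> D \<tau>"
        using ae[OF s0] AE_space
      proof eventually_elim
        case (elim \<tau>)
        \<comment> \<open>The induction hypothesis is available for starting times in
          \<open>S\<close>, that is, for almost every \<tau>.\<close>
        then have "y t * (\<Sum>k\<le>n. (c * (t - \<tau>)) ^ k / fact k) \<le> y \<tau>" by (intro Suc.IH) auto
        from mult_left_mono[OF this c] have "y t * ?g \<tau> \<le> c * y \<tau>" by (simp only: mult.left_commute)
        then show ?case using elim by linarith
      qed
    qed (rule int[OF s0 Suc.prems(2)])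
    finally have "y t * (\<Sum>k\<le>n. (c * (t - s)) ^ Suc k / fact (Suc k)) \<le> (\<integral>\<tau>. D \<tau> \<partial>lebesgue_on {s..t})"
      unfolding integral_exp_partial_sum(2)[OF Suc.prems(2)] .
    \<comment> \<open>The constant term 1 corresponds to the summand \<open>y t\<close> of the
      energy inequality.\<close>
    moreover have "(\<Sum>k\<le>Suc n. (c * (t - s)) ^ k / fact k) = 1 + (\<Sum>k\<le>n. (c * (t - s)) ^ Suc k / fact (Suc k))"
      by (subst sum.atMost_Suc_shift) simp
    ultimately show ?case using energy[OF Suc.prems] by (simp only: distrib_left mult_1_right)
  qed
  have "(\<lambda>n. \<Sum>k\<le>n. (c * t) ^ k / fact k) \<longlonglongrightarrow> exp (c * t)"
    using exp_converges[of "c * t"] unfolding sums_def_le by (simp add: divide_inverse mult.commute)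
  then have "(\<lambda>n. y t * (\<Sum>k\<le>n. (c * t) ^ k / fact k)) \<longlonglongrightarrow> y t * exp (c * t)" by (intro tendsto_intros)
  then have "y t * exp (c * t) \<le> y 0"
    by (rule LIMSEQ_le_const2) (use iter[OF S(1) t] in auto)
  then show ?thesis by (simp add: exp_minus field_simps)
qed

section \<open>The initial value\<close>

lemma smooth_sigma_tan_scaleR:
  assumes "open \<Omega>" "v \<in> smooth_sigma_tan \<Omega>"
  shows "(\<lambda>x. c *\<^sub>R v x) \<in> smooth_sigma_tan \<Omega>"
proof -
  have v: "v \<in> smooth_closure \<Omega>" "\<And>x. x \<in> \<Omega> \<Longrightarrow> divergence v x = 0" "\<And>x. x \<in> frontier \<Omega> \<Longrightarrow> v x \<bullet> outward_normal \<Omega> x = 0"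
    using assms(2) by (auto simp: smooth_sigma_tan_def)
  obtain W where W: "smooth_on UNIV W" "\<And>x. x \<in> closure \<Omega> \<Longrightarrow> v x = W x" using smooth_closureE[OF v(1)] by metis
  have "Ck_on (Suc 0) UNIV W" using W(1) by (metis smooth_on_def)
  then have D: "(W has_derivative frechet_derivative W (at x)) (at x)" for x
    by (simp add: frechet_derivative_works[symmetric])
  have "divergence (\<lambda>x. c *\<^sub>R v x) x = c * divergence v x" if x: "x \<in> \<Omega>" for x
  proof -
    have Dv: "(v has_derivative frechet_derivative W (at x)) (at x)"
      by (rule has_derivative_transform_within_open[OF D assms(1) x]) (use W(2) closure_subset[of \<Omega>] in auto)
    show ?thesis
      unfolding divergence_def frechet_derivative_at[OF has_derivative_scaleR_right[OF Dv], symmetric]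
        frechet_derivative_at[OF Dv, symmetric] by (simp add: sum_distrib_left)
  qed
  moreover have "(\<lambda>x. c *\<^sub>R v x) \<in> smooth_closure \<Omega>"
    using smooth_closure_lincomb[OF v(1) v(1), of "c - 1"] by (simp add: scaleR_left_diff_distrib)
  ultimately show ?thesis using v by (simp add: smooth_sigma_tan_def)
qed

lemma H1_sigma_tan_scaleR:
  assumes "open \<Omega>" "bounded \<Omega>" "w \<in> H1_sigma_tan \<Omega>"
  shows "(\<lambda>x. c *\<^sub>R w x) \<in> H1_sigma_tan \<Omega>"
proof -
  let ?M = "lebesgue_on \<Omega>"
  obtain z where z: "\<And>n::nat. z n \<in> smooth_sigma_tan \<Omega>" "(\<lambda>n. L2_norm ?M (z n - w)) \<longlonglongrightarrow> 0"
    using H1_sigma_tan_D(2)[OF assms(3)] by (auto simp: L2_sigma_tan_def)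
  have "(\<lambda>x. c *\<^sub>R z n x) - (\<lambda>x. c *\<^sub>R w x) = (\<lambda>x. c *\<^sub>R (z n - w) x)" for n
    by (auto simp: scaleR_right_diff_distrib)
  then have "L2_norm ?M ((\<lambda>x. c *\<^sub>R z n x) - (\<lambda>x. c *\<^sub>R w x)) = \<bar>c\<bar> * L2_norm ?M (z n - w)" for n
    by (simp only: L2_norm_scaleR)
  then have "(\<lambda>n. L2_norm ?M ((\<lambda>x. c *\<^sub>R z n x) - (\<lambda>x. c *\<^sub>R w x))) \<longlonglongrightarrow> 0"
    using tendsto_mult_right_zero[OF z(2), of "\<bar>c\<bar>"] by simp
  moreover have "(\<lambda>x. c *\<^sub>R w x) \<in> L2 ?M" by (intro L2_scaleR H1_D(1) H1_sigma_tan_D(1) assms)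
  ultimately have "(\<lambda>x. c *\<^sub>R w x) \<in> L2_sigma_tan \<Omega>"
    using smooth_sigma_tan_scaleR[OF assms(1) z(1)]
    unfolding L2_sigma_tan_def by (intro CollectI conjI exI[of _ "\<lambda>n x. c *\<^sub>R z n x"]) auto
  then show ?thesis
    using H1_scaleR(1)[OF assms(1,2) H1_sigma_tan_D(1)[OF assms(3)]] by (simp add: H1_sigma_tan_def)
qed

text \<open>On [0, e] this is (1 - t/e)^2, and zero afterwards: a C^1 cutoff in time that isolates
  the initial value.\<close>

definition ramp :: "real \<Rightarrow> real \<Rightarrow> real" where
  "ramp e t = neg_square (t / e - 1)"

definition ramp_deriv :: "real \<Rightarrow> real \<Rightarrow> real" where
  "ramp_deriv e t = 2 * min 0 (t / e - 1) / e"

lemma ramp_has_derivative: "e > 0 \<Longrightarrow> (ramp e has_real_derivative ramp_deriv e t) (at t within S)"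
proof -
  assume e: "e > 0"
  have "((\<lambda>t. t / e - 1) has_real_derivative 1 / e) (at t)"
    using e by (auto intro!: derivative_eq_intros)
  from DERIV_chain2[OF neg_square_has_derivative this]
  have "(ramp e has_real_derivative ramp_deriv e t) (at t)"
    by (simp add: ramp_def[abs_def] ramp_deriv_def)
  then show ?thesis by (rule has_field_derivative_at_within)
qed

lemma continuous_ramp_deriv: "e > 0 \<Longrightarrow> continuous_on S (ramp_deriv e)"
  unfolding ramp_deriv_def[abs_def] by (intro continuous_intros) auto

lemma continuous_ramp: "e > 0 \<Longrightarrow> continuous_on S (ramp e)"
  unfolding ramp_def[abs_def] neg_square_def by (intro continuous_intros) auto

lemma ramp_0 [simp]: "ramp e 0 = 1"
  by (simp add: ramp_def neg_square_def)

lemma ramp_eq_0: "e > 0 \<Longrightarrow> t \<ge> e \<Longrightarrow> ramp e t = 0" "e > 0 \<Longrightarrow> t \<ge> e \<Longrightarrow> ramp_deriv e t = 0"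
  by (simp_all add: ramp_def ramp_deriv_def neg_square_def)

lemma ramp_bounds: assumes "e > 0" "t \<ge> 0" shows "0 \<le> ramp e t" "ramp e t \<le> 1"
proof -
  show "0 \<le> ramp e t" by (simp add: ramp_def neg_square_nonneg)
  have "\<bar>min 0 (t / e - 1)\<bar> \<le> 1" using assms by (simp add: min_def)
  then have "\<bar>min 0 (t / e - 1)\<bar>\<^sup>2 \<le> 1" by (simp add: abs_square_le_1)
  then show "ramp e t \<le> 1" by (simp add: ramp_def neg_square_def)
qed

text \<open>Keeps the quotient of a narrow ramp by a wider one bounded in
  \<open>ramp_integral_tendsto_0\<close>.\<close>

lemma ramp_ge:
  assumes "e > 0" "t \<le> e / 2" shows "1 / 4 \<le> ramp e t"
proof -
  have "t / e \<le> e / 2 / e" using assms by (intro divide_right_mono) auto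
  moreover have "e / 2 / e = 1 / 2" using assms by simp
  moreover have "min 0 (t / e - 1) \<le> t / e - 1" by (rule min.cobounded2)
  ultimately have "1 / 2 \<le> - min 0 (t / e - 1)" by linarith
  then have "(1 / 2)\<^sup>2 \<le> (- min 0 (t / e - 1))\<^sup>2" by (rule power_mono) simp
  then show ?thesis by (simp add: ramp_def neg_square_def power_divide)
qed

lemma ramp_deriv_nonpos: "e > 0 \<Longrightarrow> ramp_deriv e t \<le> 0"
  by (simp add: ramp_deriv_def divide_le_0_iff)

lemma ramp_C1c_test:
  assumes \<Omega>: "open \<Omega>" "bounded \<Omega>" and w: "w \<in> H1_sigma_tan \<Omega>" and e: "0 < e" "e < 1"
  shows "C1c_test \<Omega> 1 (\<lambda>t x. ramp e t *\<^sub>R w x) (\<lambda>t x. ramp_deriv e t *\<^sub>R w x)"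
  unfolding C1c_test_def
proof (intro conjI ballI)
  have wH: "w \<in> H1 \<Omega>" by (rule H1_sigma_tan_D(1)[OF w])
  fix t :: real assume t: "t \<in> {0..<1}"
  show "(\<lambda>x. ramp e t *\<^sub>R w x) \<in> H1_sigma_tan \<Omega>" "(\<lambda>x. ramp_deriv e t *\<^sub>R w x) \<in> H1_sigma_tan \<Omega>"
    by (intro H1_sigma_tan_scaleR \<Omega> w)+
  have "(\<lambda>x. (ramp e s *\<^sub>R w x - ramp e t *\<^sub>R w x) /\<^sub>R (s - t) - ramp_deriv e t *\<^sub>R w x)
      = (\<lambda>x. ((ramp e s - ramp e t) / (s - t) - ramp_deriv e t) *\<^sub>R w x)" for s
    by (simp add: scaleR_left_diff_distrib divide_inverse mult.commute fun_eq_iff flip: scaleR_left_diff_distrib)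
  then have eq: "H1_norm \<Omega> (\<lambda>x. (ramp e s *\<^sub>R w x - ramp e t *\<^sub>R w x) /\<^sub>R (s - t) - ramp_deriv e t *\<^sub>R w x)
      = \<bar>(ramp e s - ramp e t) / (s - t) - ramp_deriv e t\<bar> * H1_norm \<Omega> w" for s
    by (simp only: H1_norm_scaleR[OF \<Omega> wH])
  have "((\<lambda>s. (ramp e s - ramp e t) / (s - t)) \<longlongrightarrow> ramp_deriv e t) (at t within {0..<1})"
    using ramp_has_derivative[OF e(1)] unfolding has_field_derivative_iff .
  then have "((\<lambda>s. \<bar>(ramp e s - ramp e t) / (s - t) - ramp_deriv e t\<bar> * H1_norm \<Omega> w) \<longlongrightarrow> \<bar>ramp_deriv e t - ramp_deriv e t\<bar> * H1_norm \<Omega> w) (at t within {0..<1})"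
    by (intro tendsto_intros)
  then show "((\<lambda>s. H1_norm \<Omega> (\<lambda>x. (ramp e s *\<^sub>R w x - ramp e t *\<^sub>R w x) /\<^sub>R (s - t) - ramp_deriv e t *\<^sub>R w x)) \<longlongrightarrow> 0) (at t within {0..<1})"
    unfolding eq by simp
  have "(\<lambda>x. ramp_deriv e s *\<^sub>R w x) - (\<lambda>x. ramp_deriv e t *\<^sub>R w x) = (\<lambda>x. (ramp_deriv e s - ramp_deriv e t) *\<^sub>R w x)" for s
    by (auto simp: scaleR_left_diff_distrib)
  then have eq2: "H1_norm \<Omega> ((\<lambda>x. ramp_deriv e s *\<^sub>R w x) - (\<lambda>x. ramp_deriv e t *\<^sub>R w x)) = \<bar>ramp_deriv e s - ramp_deriv e t\<bar> * H1_norm \<Omega> w" for s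
    by (simp only: H1_norm_scaleR[OF \<Omega> wH])
  have "(ramp_deriv e \<longlongrightarrow> ramp_deriv e t) (at t within {0..<1})"
    using continuous_ramp_deriv[OF e(1), of "{0..<1}"] t by (simp add: continuous_on_def)
  then have "((\<lambda>s. \<bar>ramp_deriv e s - ramp_deriv e t\<bar> * H1_norm \<Omega> w) \<longlongrightarrow> \<bar>ramp_deriv e t - ramp_deriv e t\<bar> * H1_norm \<Omega> w) (at t within {0..<1})"
    by (intro tendsto_intros)
  then show "((\<lambda>s. H1_norm \<Omega> ((\<lambda>x. ramp_deriv e s *\<^sub>R w x) - (\<lambda>x. ramp_deriv e t *\<^sub>R w x))) \<longlongrightarrow> 0) (at t within {0..<1})"
    unfolding eq2 by simp
next
  have wH: "w \<in> H1 \<Omega>" by (rule H1_sigma_tan_D(1)[OF w])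
  show "\<exists>T'<1. \<forall>t\<in>{0..<1}. T' < t \<longrightarrow> H1_norm \<Omega> (\<lambda>x. ramp e t *\<^sub>R w x) = 0"
    unfolding H1_norm_scaleR[OF \<Omega> wH] using e ramp_eq_0(1)[OF e(1)] by (intro exI[of _ e]) auto
qed

lemma integrable_lebesgue_on_subset:
  fixes f :: "'a::euclidean_space \<Rightarrow> real"
  assumes "integrable (lebesgue_on A) f" "B \<subseteq> A" "A \<in> sets lebesgue" "B \<in> sets lebesgue"
  shows "integrable (lebesgue_on B) f"
proof -
  have "set_integrable lebesgue A f"
    using assms(1,3) unfolding set_integrable_def by (subst (asm) integrable_restrict_space) auto
  then have "set_integrable lebesgue B f" by (rule set_integrable_subset) (use assms in auto)
  then show ?thesis using assms(4) unfolding set_integrable_def by (subst integrable_restrict_space) auto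
qed

text \<open>Starting at 1/2 makes every ramp vanish before time 1, as a test field on [0,1)
  must.\<close>

abbreviation "ramp_width n \<equiv> 1 / real (Suc (Suc n))"

lemma ramp_width: "0 < ramp_width n" "ramp_width n < 1"
  by simp_all

lemma ramp_width_tendsto: "(\<lambda>n. ramp_width n) \<longlonglongrightarrow> 0"
  by (rule LIMSEQ_Suc[OF LIMSEQ_Suc[OF lim_1_over_n]])

text \<open>If none of the products \<open>ramp e F\<close> is integrable, then all the integrals are zero by convention;
  otherwise one of them dominates the later ones.\<close>

lemma ramp_integral_tendsto_0:
  "(\<lambda>n. \<integral>t. ramp (ramp_width n) t * F t \<partial>lebesgue_on {0<..<1}) \<longlonglongrightarrow> (0::real)"
proof (cases "\<exists>N. integrable (lebesgue_on {0<..<1}) (\<lambda>t. ramp (ramp_width N) t * F t)")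
  case False
  then show ?thesis by (simp add: not_integrable_integral_eq)
next
  case True
  then obtain N where N: "integrable (lebesgue_on {0<..<1}) (\<lambda>t. ramp (ramp_width N) t * F t)" by blast
  define G where "G t = ramp (ramp_width N) t * F t" for t
  \<comment> \<open>Where \<open>R\<close> is nonzero and its width is below half of the
    \<open>N\<close>-th one, the denominator is at least 1/4 and the numerator at most 1; hence the
    bound 4.\<close>
  define R where "R n t = (if t < ramp_width n then ramp (ramp_width n) t / ramp (ramp_width N) t else 0)" for n t
  have small: "\<forall>\<^sub>F n in sequentially. ramp_width n < ramp_width N / 2"
    using ramp_width_tendsto by (rule order_tendstoD) simp
  have lower: "1 / 4 \<le> ramp (ramp_width N) t" if "t \<le> ramp_width N / 2" for t
    by (rule ramp_ge[OF ramp_width(1) that])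
  have eq: "ramp (ramp_width n) t * F t = R n t * G t" if n: "ramp_width n < ramp_width N / 2" for n t
  proof (cases "t < ramp_width n")
    case True
    then have "ramp (ramp_width N) t \<noteq> 0" using lower[of t] n by linarith
    then show ?thesis using True by (simp add: R_def G_def)
  next
    case False
    then show ?thesis using ramp_eq_0(1)[OF ramp_width(1), of n t] by (simp add: R_def)
  qed
  have Rm: "R n \<in> borel_measurable borel" for n
  proof -
    have "ramp (ramp_width k) \<in> borel_measurable borel" for k
      by (rule borel_measurable_continuous_onI[OF continuous_ramp[OF ramp_width(1)]])
    then show ?thesis unfolding R_def by measurable
  qed
  have Gm: "G \<in> borel_measurable (lebesgue_on {0<..<1})" using N unfolding G_def by auto
  obtain n0 where n0: "\<And>n. n \<ge> n0 \<Longrightarrow> ramp_width n < ramp_width N / 2"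
    using small unfolding eventually_sequentially by blast
  have Rb: "\<bar>R n t\<bar> \<le> 4" if n: "n \<ge> n0" and t: "0 < t" for n t
  proof (cases "t < ramp_width n")
    case True
    then have l: "1 / 4 \<le> ramp (ramp_width N) t" using lower[of t] n0[OF n] by linarith
    have b: "0 \<le> ramp (ramp_width n) t" "ramp (ramp_width n) t \<le> 1" using ramp_bounds[OF ramp_width(1)] t by auto
    have "ramp (ramp_width n) t / ramp (ramp_width N) t \<le> 1 / (1 / 4)" using b l by (intro frac_le) auto
    then show ?thesis using True b l by (simp add: R_def abs_of_nonneg)
  qed (simp add: R_def)
  have "(\<lambda>n. \<integral>t. R (n + n0) t * G t \<partial>lebesgue_on {0<..<1}) \<longlonglongrightarrow> (\<integral>t. 0 \<partial>lebesgue_on {0<..<1::real})"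
  proof (rule integral_dominated_convergence[where w="\<lambda>t. 4 * \<bar>G t\<bar>"])
    have "R n \<in> borel_measurable (lebesgue_on {0<..<1})" for n
      using Rm by (intro measurable_restrict_space1 measurable_completion) simp
    then show "(\<lambda>t. R (n + n0) t * G t) \<in> borel_measurable (lebesgue_on {0<..<1})" for n
      using Gm by (intro borel_measurable_times)
    show "integrable (lebesgue_on {0<..<1}) (\<lambda>t. 4 * \<bar>G t\<bar>)" using N unfolding G_def by auto
    show "AE t in lebesgue_on {0<..<1}. (\<lambda>n. R (n + n0) t * G t) \<longlonglongrightarrow> 0"
    proof (rule AE_I2)
      fix t :: real assume "t \<in> space (lebesgue_on {0<..<1})"
      then have t: "0 < t" by simp
      have "\<forall>\<^sub>F n in sequentially. ramp_width n < t" using ramp_width_tendsto t by (rule order_tendstoD)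
      then have "\<forall>\<^sub>F n in sequentially. R n t * G t = 0" by eventually_elim (simp add: R_def)
      then have "(\<lambda>n. R n t * G t) \<longlonglongrightarrow> 0" by (rule tendsto_eventually)
      then show "(\<lambda>n. R (n + n0) t * G t) \<longlonglongrightarrow> 0" by (rule LIMSEQ_ignore_initial_segment)
    qed
    show "AE t in lebesgue_on {0<..<1}. norm (R (n + n0) t * G t) \<le> 4 * \<bar>G t\<bar>" for n
      using Rb[of "n + n0"] by (intro AE_I2) (auto simp: abs_mult intro!: mult_right_mono)
  qed simp
  then have "(\<lambda>n. \<integral>t. R (n + n0) t * G t \<partial>lebesgue_on {0<..<1}) \<longlonglongrightarrow> 0" by simp
  moreover have "(\<integral>t. R (n + n0) t * G t \<partial>lebesgue_on {0<..<1}) = (\<integral>t. ramp (ramp_width (n + n0)) t * F t \<partial>lebesgue_on {0<..<1})" for n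
    by (rule Bochner_Integration.integral_cong[OF refl]) (rule eq[symmetric, OF n0], simp)
  ultimately have "(\<lambda>n. \<integral>t. ramp (ramp_width (n + n0)) t * F t \<partial>lebesgue_on {0<..<1}) \<longlonglongrightarrow> 0" by (simp only:)
  then show ?thesis by (rule LIMSEQ_offset)
qed

text \<open>The negative derivative of a ramp is nonnegative, has integral 1 and lives on a
  shrinking interval at 0, so it acts as an approximate identity there.\<close>

lemma ramp_deriv_integral_tendsto:
  fixes p :: "real \<Rightarrow> real"
  assumes p: "continuous_on {0..1} p"
  shows "(\<lambda>n. - (\<integral>t. p t * ramp_deriv (ramp_width n) t \<partial>lebesgue_on {0<..<1})) \<longlonglongrightarrow> p 0"
proof (rule LIMSEQ_I)
  fix \<epsilon> :: real assume \<epsilon>: "\<epsilon> > 0"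
  have "(p \<longlongrightarrow> p 0) (at 0 within {0..1})" using p by (simp add: continuous_on_def)
  then obtain d where d: "d > 0" "\<And>t. t \<in> {0..1} \<Longrightarrow> t \<noteq> 0 \<Longrightarrow> t < d \<Longrightarrow> \<bar>p t - p 0\<bar> < \<epsilon> / 2"
    using \<epsilon> unfolding tendsto_iff eventually_at dist_real_def by (metis abs_of_nonneg atLeastAtMost_iff diff_zero half_gt_zero)
  obtain n0 where n0: "\<And>n. n \<ge> n0 \<Longrightarrow> ramp_width n < d"
    using order_tendstoD(2)[OF ramp_width_tendsto d(1)] unfolding eventually_sequentially by blast
  have "\<bar>- (\<integral>t. p t * ramp_deriv (ramp_width n) t \<partial>lebesgue_on {0<..<1}) - p 0\<bar> < \<epsilon>" if n: "n \<ge> n0" for n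
  proof -
    let ?e = "ramp_width n"
    let ?K = "ramp_deriv ?e"
    have e: "0 < ?e" "?e < 1" by (rule ramp_width)+
    have int: "integrable (lebesgue_on {0<..<1}) f" if "continuous_on {0..1} f" for f :: "real \<Rightarrow> real"
      by (rule integrable_lebesgue_on_subset[OF continuous_imp_integrable_real[OF that]]) auto
    have K: "continuous_on {0..1} ?K" by (rule continuous_ramp_deriv[OF e(1)])
    have "(?K has_integral (ramp ?e 1 - ramp ?e 0)) {0..1}"
      by (rule fundamental_theorem_of_calculus)
        (use ramp_has_derivative[OF e(1)] in \<open>auto simp: has_real_derivative_iff_has_vector_derivative[symmetric]\<close>)
    then have "integral {0..1} ?K = - 1"
      using ramp_eq_0(1)[OF e(1), of 1] e(2) by (simp add: integral_unique)
    moreover have "(\<integral>t. ?K t \<partial>lebesgue_on {0<..<1}) = integral {0<..<1} ?K"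
      by (rule lebesgue_integral_eq_integral[OF int[OF K]]) auto
    ultimately have K1: "(\<integral>t. ?K t \<partial>lebesgue_on {0<..<1}) = - 1" by (simp add: integral_open_interval_real)
    have Kneg: "?K t \<le> 0" for t by (rule ramp_deriv_nonpos[OF e(1)])
    have i1: "integrable (lebesgue_on {0<..<1}) (\<lambda>t. p t * ?K t)" by (intro int continuous_intros p K)
    have i2: "integrable (lebesgue_on {0<..<1}) (\<lambda>t. p 0 * ?K t)" by (intro int continuous_intros p K)
    have "- (\<integral>t. p t * ?K t \<partial>lebesgue_on {0<..<1}) - p 0 = - (\<integral>t. p t * ?K t - p 0 * ?K t \<partial>lebesgue_on {0<..<1})"
      using i1 i2 K1 by simp
    also have "\<bar>\<dots>\<bar> \<le> (\<integral>t. \<bar>p t * ?K t - p 0 * ?K t\<bar> \<partial>lebesgue_on {0<..<1})"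
      unfolding abs_minus_cancel by (rule integral_abs_bound)
    also have "\<dots> \<le> (\<integral>t. \<epsilon> / 2 * (- ?K t) \<partial>lebesgue_on {0<..<1})"
    proof (rule integral_mono)
      show "integrable (lebesgue_on {0<..<1}) (\<lambda>t. \<bar>p t * ?K t - p 0 * ?K t\<bar>)"
        by (rule integrable_abs[OF Bochner_Integration.integrable_diff[OF i1 i2]])
      show "integrable (lebesgue_on {0<..<1}) (\<lambda>t. \<epsilon> / 2 * (- ?K t))"
        by (rule integrable_mult_right[OF Bochner_Integration.integrable_minus[OF int[OF K]]])
      fix t :: real assume "t \<in> space (lebesgue_on {0<..<1})"
      then have t: "0 < t" "t < 1" by auto
      have "\<bar>p t * ?K t - p 0 * ?K t\<bar> = \<bar>p t - p 0\<bar> * (- ?K t)"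
        using Kneg[of t] by (simp add: left_diff_distrib[symmetric] abs_mult)
      also have "\<dots> \<le> \<epsilon> / 2 * (- ?K t)"
      proof (cases "t < ?e")
        case True
        then have "\<bar>p t - p 0\<bar> \<le> \<epsilon> / 2" using d(2)[of t] t n0[OF n] by simp
        then show ?thesis using Kneg[of t] by (intro mult_right_mono) auto
      next
        case False
        then have "?K t = 0" using ramp_eq_0(2)[OF e(1), of t] by simp
        then show ?thesis by simp
      qed
      finally show "\<bar>p t * ?K t - p 0 * ?K t\<bar> \<le> \<epsilon> / 2 * (- ?K t)" .
    qed
    also have "\<dots> = \<epsilon> / 2" using K1 int[OF K] by simp
    finally show ?thesis using \<epsilon> by linarith
  qed
  then show "\<exists>n0. \<forall>n\<ge>n0. norm (- (\<integral>t. p t * ramp_deriv (ramp_width n) t \<partial>lebesgue_on {0<..<1}) - p 0) < \<epsilon>"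
    by (intro exI[of _ n0]) simp
qed

lemma L2_inner_scaleR_right: "L2_inner M f (\<lambda>x. c *\<^sub>R g x) = c * L2_inner M f g"
  by (simp add: L2_inner_def)

lemma L2_inner_commute: "L2_inner M f g = L2_inner M g f"
  by (simp add: L2_inner_def inner_commute)

lemma tangential_scaleR: "tangential \<Omega> x (c *\<^sub>R v) = c *\<^sub>R tangential \<Omega> x v"
  by (simp add: tangential_def scaleR_right_diff_distrib)

text \<open>In every term except the one with the time derivative the ramp factors out of the space
  integrals, leaving ramp integrals of \<open>F1\<close> and \<open>F2\<close>. These tend to zero
  even if nothing is known about integrability of \<open>F1\<close> and \<open>F2\<close>.\<close>

lemma initial_value_weak:
  assumes \<Omega>: "open \<Omega>" "bounded \<Omega>" "smooth_boundary \<Omega>"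
    and wf: "weak_formulation \<Omega> \<nu> \<alpha> u0 1 u g" and wc: "weakly_continuous \<Omega> 1 u"
    and w: "w \<in> H1_sigma_tan \<Omega>" "has_trace \<Omega> w h"
  shows "L2_inner (lebesgue_on \<Omega>) (u 0) w = L2_inner (lebesgue_on \<Omega>) u0 w"
proof -
  let ?M = "lebesgue_on \<Omega>" and ?S = "surface_measure \<Omega>" and ?I = "lebesgue_on {0<..<1::real}"
  have meas: "\<Omega> \<in> sets lebesgue" using \<Omega> by simp
  define p where "p t = L2_inner ?M (u t) w" for t
  define F1 where "F1 t = L2_inner ?M (weak_grad \<Omega> (u t)) (weak_grad \<Omega> w)
      + (\<integral>x. \<alpha> x * (tangential \<Omega> x (g t x) \<bullet> tangential \<Omega> x (h x)) \<partial>?S)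
      - (\<integral>x. h x \<bullet> gauss_differential \<Omega> x (g t x) \<partial>?S)" for t
  define F2 where "F2 t = (\<integral>x. (weak_grad \<Omega> (u t) x *v u t x) \<bullet> w x \<partial>?M)" for t
  have id: "- (\<integral>t. p t * ramp_deriv e t \<partial>?I) + \<nu> * (\<integral>t. ramp e t * F1 t \<partial>?I) + (\<integral>t. ramp e t * F2 t \<partial>?I)
      = L2_inner ?M u0 w" if e: "0 < e" "e < 1" for e
  proof -
    have tr: "\<forall>t\<in>{0..<1}. has_trace \<Omega> (\<lambda>x. ramp e t *\<^sub>R w x) (\<lambda>x. ramp e t *\<^sub>R h x)"
      by (intro ballI has_trace_scaleR \<Omega> w)
    have "- (\<integral>t. L2_inner ?M (u t) (\<lambda>x. ramp_deriv e t *\<^sub>R w x) \<partial>?I)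
        + \<nu> * (\<integral>t. L2_inner ?M (weak_grad \<Omega> (u t)) (weak_grad \<Omega> (\<lambda>x. ramp e t *\<^sub>R w x))
                 + (\<integral>x. \<alpha> x * (tangential \<Omega> x (g t x) \<bullet> tangential \<Omega> x (ramp e t *\<^sub>R h x)) \<partial>?S)
                 - (\<integral>x. (ramp e t *\<^sub>R h x) \<bullet> gauss_differential \<Omega> x (g t x) \<partial>?S) \<partial>?I)
        + (\<integral>t. (\<integral>x. (weak_grad \<Omega> (u t) x *v u t x) \<bullet> (ramp e t *\<^sub>R w x) \<partial>?M) \<partial>?I)
        = L2_inner ?M u0 (\<lambda>x. ramp e 0 *\<^sub>R w x)"
      using wf[unfolded weak_formulation_def, rule_format, OF conjI[OF ramp_C1c_test[OF \<Omega>(1,2) w(1) e] tr]] by simp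
    moreover have "L2_inner ?M (weak_grad \<Omega> (u t)) (weak_grad \<Omega> (\<lambda>x. ramp e t *\<^sub>R w x))
        = ramp e t * L2_inner ?M (weak_grad \<Omega> (u t)) (weak_grad \<Omega> w)" for t
    proof -
      have "L2_inner ?M (weak_grad \<Omega> (u t)) (weak_grad \<Omega> (\<lambda>x. ramp e t *\<^sub>R w x))
          = L2_inner ?M (weak_grad \<Omega> (u t)) (\<lambda>x. ramp e t *\<^sub>R weak_grad \<Omega> w x)"
        unfolding L2_inner_def
      proof (rule integral_cong_AE_complete)
        show "B \<in> sets ?M" if "N \<in> null_sets ?M" "B \<subseteq> N" for N B by (rule lebesgue_on_complete[OF meas that])
        show "AE x in ?M. weak_grad \<Omega> (u t) x \<bullet> weak_grad \<Omega> (\<lambda>x. ramp e t *\<^sub>R w x) x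
            = weak_grad \<Omega> (u t) x \<bullet> (ramp e t *\<^sub>R weak_grad \<Omega> w x)"
          using H1_scaleR(2)[OF \<Omega>(1,2) H1_sigma_tan_D(1)[OF w(1)], of "ramp e t"] by eventually_elim simp
      qed
      then show ?thesis by (simp only: L2_inner_scaleR_right)
    qed
    moreover have "(\<integral>x. \<alpha> x * (tangential \<Omega> x (g t x) \<bullet> tangential \<Omega> x (ramp e t *\<^sub>R h x)) \<partial>?S)
        = ramp e t * (\<integral>x. \<alpha> x * (tangential \<Omega> x (g t x) \<bullet> tangential \<Omega> x (h x)) \<partial>?S)" for t
      by (simp only: tangential_scaleR inner_scaleR_right mult.left_commute[of "\<alpha> _"] integral_mult_right_zero)
    moreover have "(\<integral>x. (ramp e t *\<^sub>R h x) \<bullet> gauss_differential \<Omega> x (g t x) \<partial>?S)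
        = ramp e t * (\<integral>x. h x \<bullet> gauss_differential \<Omega> x (g t x) \<partial>?S)" for t
      by (simp only: inner_scaleR_left integral_mult_right_zero)
    moreover have "(\<integral>x. (weak_grad \<Omega> (u t) x *v u t x) \<bullet> (ramp e t *\<^sub>R w x) \<partial>?M) = ramp e t * F2 t" for t
      by (simp only: F2_def inner_scaleR_right integral_mult_right_zero)
    moreover have "L2_inner ?M (u t) (\<lambda>x. ramp_deriv e t *\<^sub>R w x) = p t * ramp_deriv e t" for t
      by (simp add: L2_inner_scaleR_right p_def)
    moreover have "L2_inner ?M u0 (\<lambda>x. ramp e 0 *\<^sub>R w x) = L2_inner ?M u0 w" by simp
    ultimately show ?thesis by (simp only: F1_def distrib_left right_diff_distrib)
  qed
  have cp: "continuous_on {0..1} p"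
    using wc H1_sigma_tan_D(2)[OF w(1)] by (simp add: weakly_continuous_def p_def)
  have "(\<lambda>n. - (\<integral>t. p t * ramp_deriv (ramp_width n) t \<partial>?I) + \<nu> * (\<integral>t. ramp (ramp_width n) t * F1 t \<partial>?I)
      + (\<integral>t. ramp (ramp_width n) t * F2 t \<partial>?I)) \<longlonglongrightarrow> p 0 + \<nu> * 0 + 0"
    by (intro tendsto_intros ramp_deriv_integral_tendsto[OF cp] ramp_integral_tendsto_0)
  then show ?thesis unfolding id[OF ramp_width] by (simp add: LIMSEQ_const_iff p_def)
qed

text \<open>The interval from 0 to \<open>e\<close> has positive measure, so it cannot consist of
  exceptional times.\<close>

lemma AE_near_0:
  assumes "AE t in lebesgue_on {0<..<1::real}. Q t" "0 < e" "e \<le> 1"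
  obtains t where "0 < t" "t < e" "Q t"
proof (rule ccontr)
  assume "\<not> thesis"
  then have no: "\<And>t. 0 < t \<Longrightarrow> t < e \<Longrightarrow> \<not> Q t" using that by blast
  have "AE t in lebesgue. t \<in> {0<..<1} \<longrightarrow> Q t" using assms(1) by (subst (asm) AE_restrict_space_iff) auto
  then have "AE t in lebesgue. t \<notin> {0<..<e}" by eventually_elim (use no assms in force)
  then have "{0<..<e} \<in> null_sets lebesgue" by (subst (asm) AE_iff_null_sets[symmetric]) auto
  then have "emeasure lborel {0<..<e} = 0" by (simp add: null_sets_def)
  then show False using assms(2) by simp
qed

text \<open>The field \<open>u 0\<close> is known only in L^2 and is no admissible test field, while
  \<open>u (t n)\<close> with its trace is. Weak continuity turns the inner product of
  \<open>u (t n)\<close> with \<open>u 0\<close> into the square of the norm of \<open>u 0\<close>,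
  and the Cauchy-Schwarz inequality concludes.\<close>

lemma initial_value_le:
  assumes \<Omega>: "open \<Omega>" "bounded \<Omega>" "smooth_boundary \<Omega>"
    and wf: "weak_formulation \<Omega> \<nu> \<alpha> u0 1 u g" and wc: "weakly_continuous \<Omega> 1 u" and u0: "u0 \<in> L2_sigma_tan \<Omega>"
    and ae: "AE t in lebesgue_on {0<..<1}. u t \<in> H1_sigma_tan \<Omega> \<and> has_trace \<Omega> (u t) (g t)"
  shows "L2_norm (lebesgue_on \<Omega>) (u 0) \<le> L2_norm (lebesgue_on \<Omega>) u0"
proof -
  let ?M = "lebesgue_on \<Omega>"
  have u00: "u 0 \<in> L2_sigma_tan \<Omega>" using wc by (auto simp: weakly_continuous_def)
  have L: "u 0 \<in> L2 ?M" "u0 \<in> L2 ?M" using u00 u0 by (auto simp: L2_sigma_tan_def)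
  have "\<exists>t. 0 < t \<and> t < ramp_width n \<and> u t \<in> H1_sigma_tan \<Omega> \<and> has_trace \<Omega> (u t) (g t)" for n
    using AE_near_0[OF ae ramp_width(1)[of n]] ramp_width(2)[of n] by (metis less_imp_le)
  then obtain t where t: "\<And>n. 0 < t n" "\<And>n. t n < ramp_width n"
    and good: "\<And>n. u (t n) \<in> H1_sigma_tan \<Omega>" "\<And>n. has_trace \<Omega> (u (t n)) (g (t n))" by metis
  have tlim: "t \<longlonglongrightarrow> 0"
    by (rule nonneg_tendsto_0_le[OF ramp_width_tendsto]) (use t in \<open>auto intro: less_imp_le\<close>)
  have tI: "t n \<in> {0..1}" for n using t(1)[of n] t(2)[of n] ramp_width(2)[of n] unfolding atLeastAtMost_iff by linarith
  have lim: "(\<lambda>n. L2_inner ?M (u (t n)) v) \<longlonglongrightarrow> L2_inner ?M (u 0) v" if "v \<in> L2_sigma_tan \<Omega>" for v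
  proof -
    have "continuous_on {0..1} (\<lambda>t. L2_inner ?M (u t) v)" using wc that by (simp add: weakly_continuous_def)
    from continuous_on_tendsto_compose[OF this tlim] show ?thesis using tI by simp
  qed
  have "L2_inner ?M (u (t n)) (u 0) = L2_inner ?M (u (t n)) u0" for n
    using initial_value_weak[OF \<Omega> wf wc good] by (simp add: L2_inner_commute)
  then have "L2_inner ?M (u 0) (u 0) = L2_inner ?M (u 0) u0"
    using lim[OF u00] lim[OF u0] LIMSEQ_unique by force
  moreover have "L2_inner ?M (u 0) (u 0) = (L2_norm ?M (u 0))\<^sup>2"
    by (simp add: L2_inner_def L2_norm_power2 power2_norm_eq_inner)
  ultimately have "(L2_norm ?M (u 0))\<^sup>2 \<le> L2_norm ?M (u 0) * L2_norm ?M u0"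
    using L2_Cauchy_Schwarz[OF L] by linarith
  then show ?thesis
    using L2_norm_nonneg[of ?M "u 0"] by (cases "L2_norm ?M (u 0) = 0") (auto simp: power2_eq_square)
qed

section \<open>Decay of the energy\<close>

text \<open>Writes the boundary dissipation as a squared norm, whose root is a seminorm of the
  trace. The maximum with 0 takes care of the null set on which \<alpha> may be negative.\<close>

lemma surface_integral_weighted:
  fixes \<alpha> :: "R3 \<Rightarrow> real"
  assumes \<alpha>: "\<alpha> \<in> borel_measurable (surface_measure \<Omega>)" "AE x in surface_measure \<Omega>. \<bar>\<alpha> x\<bar> \<le> B"
    "AE x in surface_measure \<Omega>. \<alpha> x \<ge> 0" and B: "B \<ge> 0" and g: "g \<in> L2 (surface_measure \<Omega>)"
  shows "(\<lambda>x. sqrt (max 0 (\<alpha> x)) *\<^sub>R g x) \<in> L2 (surface_measure \<Omega>)"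
    and "(\<integral>x. \<alpha> x * (norm (g x))\<^sup>2 \<partial>surface_measure \<Omega>) = (L2_norm (surface_measure \<Omega>) (\<lambda>x. sqrt (max 0 (\<alpha> x)) *\<^sub>R g x))\<^sup>2"
    and "L2_norm (surface_measure \<Omega>) (\<lambda>x. sqrt (max 0 (\<alpha> x)) *\<^sub>R g x) \<le> sqrt B * L2_norm (surface_measure \<Omega>) g"
proof -
  let ?S = "surface_measure \<Omega>"
  have m: "(\<lambda>x. sqrt (max 0 (\<alpha> x)) *\<^sub>R g x) \<in> borel_measurable ?S"
    using \<alpha>(1) L2_borel[OF g] by measurable
  have le: "AE x in ?S. norm (sqrt (max 0 (\<alpha> x)) *\<^sub>R g x) \<le> sqrt B * norm (g x)"
    using \<alpha>(2,3)
  proof eventually_elim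
    case (elim x)
    then have "sqrt (max 0 (\<alpha> x)) \<le> sqrt B" using B by (intro real_sqrt_le_mono) auto
    moreover have "0 \<le> sqrt (max 0 (\<alpha> x))" by simp
    ultimately show ?case by (simp add: mult_right_mono)
  qed
  show "(\<lambda>x. sqrt (max 0 (\<alpha> x)) *\<^sub>R g x) \<in> L2 ?S" by (rule L2_mono[OF m g le])
  show "L2_norm ?S (\<lambda>x. sqrt (max 0 (\<alpha> x)) *\<^sub>R g x) \<le> sqrt B * L2_norm ?S g"
    using B by (intro L2_norm_mono[OF m g le]) simp
  show "(\<integral>x. \<alpha> x * (norm (g x))\<^sup>2 \<partial>?S) = (L2_norm ?S (\<lambda>x. sqrt (max 0 (\<alpha> x)) *\<^sub>R g x))\<^sup>2"
    unfolding L2_norm_power2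
  proof (rule integral_cong_AE_complete)
    show "C \<in> sets ?S" if "N \<in> null_sets ?S" "C \<subseteq> N" for N C by (rule surface_measure_complete[OF that])
    show "AE x in ?S. \<alpha> x * (norm (g x))\<^sup>2 = (norm (sqrt (max 0 (\<alpha> x)) *\<^sub>R g x))\<^sup>2"
      using \<alpha>(3) by eventually_elim (simp add: power_mult_distrib)
  qed
qed

lemma tangential_trace_integral:
  assumes "open \<Omega>" "bounded \<Omega>" "smooth_boundary \<Omega>" "u \<in> H1_sigma_tan \<Omega>" "has_trace \<Omega> u g"
  shows "(\<integral>x. \<alpha> x * (norm (tangential \<Omega> x (g x)))\<^sup>2 \<partial>surface_measure \<Omega>) = (\<integral>x. \<alpha> x * (norm (g x))\<^sup>2 \<partial>surface_measure \<Omega>)"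
proof (rule integral_cong_AE_complete)
  show "C \<in> sets (surface_measure \<Omega>)" if "N \<in> null_sets (surface_measure \<Omega>)" "C \<subseteq> N" for N C
    by (rule surface_measure_complete[OF that])
  show "AE x in surface_measure \<Omega>. \<alpha> x * (norm (tangential \<Omega> x (g x)))\<^sup>2 = \<alpha> x * (norm (g x))\<^sup>2"
    using trace_tangential[OF assms] by eventually_elim (simp add: tangential_def)
qed

lemma integrable_square_bound:
  fixes f h :: "real \<Rightarrow> real"
  assumes "f \<in> borel_measurable M" "integrable M (\<lambda>t. (h t)\<^sup>2)" "AE t in M. \<bar>f t\<bar> \<le> c * h t"
  shows "integrable M (\<lambda>t. (f t)\<^sup>2)"
proof (rule Bochner_Integration.integrable_bound[of M "\<lambda>t. c\<^sup>2 * (h t)\<^sup>2"])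
  show "AE t in M. norm ((f t)\<^sup>2) \<le> norm (c\<^sup>2 * (h t)\<^sup>2)"
    using assms(3)
  proof eventually_elim
    case (elim t)
    then have "\<bar>f t\<bar>\<^sup>2 \<le> (c * h t)\<^sup>2" by (intro power_mono) auto
    then show ?case by (simp add: power_mult_distrib)
  qed
qed (use assms in auto)

text \<open>The Bochner spaces live on open intervals, the energy inequality on closed ones that may
  start at 0. The endpoint is a null set, and completeness takes care of measurability
  there.\<close>

lemma integrable_closed_interval:
  fixes f :: "real \<Rightarrow> real"
  assumes "integrable (lebesgue_on {0<..<T}) f" "0 \<le> s" "t < T"
  shows "integrable (lebesgue_on {s..t}) f"
proof -
  have "integrable (lebesgue_on {s<..t}) f"
    by (rule integrable_lebesgue_on_subset[OF assms(1)]) (use assms in auto)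
  then have i: "integrable lebesgue (\<lambda>x. indicator {s<..t} x *\<^sub>R f x)"
    by (subst (asm) integrable_restrict_space) auto
  have ae: "AE x in lebesgue. indicator {s<..t} x *\<^sub>R f x = indicator {s..t} x *\<^sub>R f x"
  proof -
    have "AE x in lebesgue. x \<noteq> s" by (intro AE_completion AE_lborel_singleton)
    then show ?thesis by eventually_elim (auto simp: indicator_def)
  qed
  have "(\<lambda>x. indicator {s..t} x *\<^sub>R f x) \<in> borel_measurable lebesgue"
    by (rule borel_measurable_AE_complete[OF _ borel_measurable_integrable[OF i] ae])
      (use null_sets_completion_subset in blast)
  then have "integrable lebesgue (\<lambda>x. indicator {s..t} x *\<^sub>R f x)"
    using i ae integrable_cong_AE borel_measurable_integrable[OF i] by blast
  then show ?thesis by (subst integrable_restrict_space) auto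
qed

theorem corollary5p2:
  fixes \<Omega> :: "(real^3) set" and \<nu> C :: real and \<alpha> :: "real^3 \<Rightarrow> real"
    and u0 :: "real^3 \<Rightarrow> real^3" and u :: "real \<Rightarrow> real^3 \<Rightarrow> real^3"
  assumes "open \<Omega>" and "bounded \<Omega>" and "connected \<Omega>" and "smooth_boundary \<Omega>"
    and "\<nu> > 0"
    and "\<alpha> \<in> Linfinity (surface_measure \<Omega>)"
    and "AE x in surface_measure \<Omega>. \<alpha> x \<ge> 0"
    and "emeasure (surface_measure \<Omega>) {x \<in> frontier \<Omega>. \<alpha> x > 0} > 0"
    and "C > 0"
    and "\<And>v g. v \<in> H1_sigma_tan \<Omega> \<Longrightarrow> has_trace \<Omega> v g \<Longrightarrow>
           (L2_norm (lebesgue_on \<Omega>) v)\<^sup>2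
             \<le> C * ((L2_norm (lebesgue_on \<Omega>) (sym_grad \<Omega> v))\<^sup>2
                    + (\<integral>x. \<alpha> x * (norm (g x))\<^sup>2 \<partial>surface_measure \<Omega>))"
    and "u0 \<in> L2_sigma_tan \<Omega>"
    and "leray_hopf_solution \<Omega> \<nu> \<alpha> u0 u"
  shows "\<forall>t\<ge>0. (L2_norm (lebesgue_on \<Omega>) (u t))\<^sup>2
           \<le> (L2_norm (lebesgue_on \<Omega>) u0)\<^sup>2 * exp (- (2 * \<nu> / C) * t)"
proof (intro allI impI)
  let ?M = "lebesgue_on \<Omega>" and ?S = "surface_measure \<Omega>"
  note \<Omega> = assms(1,2,4)
  obtain B0 where "\<alpha> \<in> borel_measurable ?S" "AE x in ?S. \<bar>\<alpha> x\<bar> \<le> B0"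
    using assms(6) by (auto simp: Linfinity_def)
  then have \<alpha>: "\<alpha> \<in> borel_measurable ?S" "AE x in ?S. \<bar>\<alpha> x\<bar> \<le> \<bar>B0\<bar>" by (auto elim!: eventually_mono)
  define B where "B = \<bar>B0\<bar>"
  have B: "B \<ge> 0" by (simp add: B_def)
  note weighted = surface_integral_weighted[OF \<alpha>(1) \<alpha>(2)[folded B_def] assms(7) B]
  obtain g S where tr: "AE t in lebesgue_on {0..}. has_trace \<Omega> (u t) (g t)"
    and wf: "\<And>T. T > 0 \<Longrightarrow> weak_formulation \<Omega> \<nu> \<alpha> u0 T u g"
    and S: "S \<subseteq> {0..}" "0 \<in> S" "AE t in lebesgue_on {0..}. t \<in> S"
    and energy: "\<And>s t. s \<in> S \<Longrightarrow> t \<ge> s \<Longrightarrow> energy_inequalities \<Omega> \<nu> \<alpha> u g s t"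
    using assms(12) unfolding leray_hopf_solution_def by blast
  have boch: "u \<in> bochner_Lp 2 T (H1_sigma_tan \<Omega>) (H1_norm \<Omega>)" and wc: "weakly_continuous \<Omega> T u" if "T > 0" for T
    using assms(12) that unfolding leray_hopf_solution_def by blast+
  have sm: "strongly_measurable {0<..<T} (H1_sigma_tan \<Omega>) (H1_norm \<Omega>) u"
    and aeH: "AE t in lebesgue_on {0<..<T}. u t \<in> H1_sigma_tan \<Omega>"
    and intN: "integrable (lebesgue_on {0<..<T}) (\<lambda>t. (H1_norm \<Omega> (u t))\<^sup>2)" if "T > 0" for T
    using boch[OF that] by (auto simp: bochner_Lp_def powr_numeral)
  have tr_on: "AE t in lebesgue_on {0<..<T}. has_trace \<Omega> (u t) (g t)" for T
  proof -
    have "AE t in lebesgue. t \<in> {0..} \<longrightarrow> has_trace \<Omega> (u t) (g t)" using tr by (subst (asm) AE_restrict_space_iff) auto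
    then have "AE t in lebesgue. t \<in> {0<..<T} \<longrightarrow> has_trace \<Omega> (u t) (g t)" by eventually_elim auto
    then show ?thesis by (subst AE_restrict_space_iff) auto
  qed
  have good: "AE t in lebesgue_on {0<..<T}. u t \<in> H1_sigma_tan \<Omega> \<and> has_trace \<Omega> (u t) (g t)" if "T > 0" for T
    using aeH[OF that] tr_on[of T] by eventually_elim simp
  obtain Kt where Kt: "Kt \<ge> 0" "\<And>u g. has_trace \<Omega> u g \<Longrightarrow> L2_norm ?S g \<le> Kt * H1_norm \<Omega> u"
    using trace_inequality[OF \<Omega>] by blast
  define b where "b h = L2_norm ?S (\<lambda>x. sqrt (max 0 (\<alpha> x)) *\<^sub>R h x)" for h :: vfield
  have b_le: "b h \<le> sqrt B * Kt * H1_norm \<Omega> v" if "has_trace \<Omega> v h" for v h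
  proof -
    have "b h \<le> sqrt B * L2_norm ?S h" unfolding b_def by (rule weighted(3)[OF has_trace_D(2)[OF that]])
    also have "\<dots> \<le> sqrt B * (Kt * H1_norm \<Omega> v)" using B by (intro mult_left_mono Kt(2) that) auto
    finally show ?thesis by (simp add: mult.assoc)
  qed
  have b_lip: "\<bar>b h1 - b h2\<bar> \<le> sqrt B * Kt * H1_norm \<Omega> (v1 - v2)" if "has_trace \<Omega> v1 h1" "has_trace \<Omega> v2 h2" for v1 v2 h1 h2
  proof -
    have "\<bar>b h1 - b h2\<bar> \<le> L2_norm ?S (\<lambda>x. sqrt (max 0 (\<alpha> x)) *\<^sub>R h1 x - sqrt (max 0 (\<alpha> x)) *\<^sub>R h2 x)"
      unfolding b_def by (rule L2_norm_diff_ge[OF weighted(1)[OF has_trace_D(2)[OF that(1)]] weighted(1)[OF has_trace_D(2)[OF that(2)]]])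
    also have "\<dots> = b (h1 - h2)" by (simp add: b_def scaleR_right_diff_distrib)
    also have "\<dots> \<le> sqrt B * Kt * H1_norm \<Omega> (v1 - v2)" by (rule b_le[OF has_trace_diff[OF \<Omega> that]])
    finally show ?thesis .
  qed
  \<comment> \<open>The measurability lemma allows the functional to be restricted to fields with a
    trace, where \<open>u t\<close> lies for almost every \<open>t\<close>.\<close>
  define X where "X = {v \<in> H1_sigma_tan \<Omega>. \<exists>h. has_trace \<Omega> v h}"
  \<comment> \<open>The boundary term depends on \<open>g t\<close>, but measurability is obtained
    for functionals of the field alone. The choice of the trace is harmless by
    \<open>A_eq\<close>.\<close>
  define A where "A v = b (SOME h. has_trace \<Omega> v h)" for v
  have X_tr: "has_trace \<Omega> v (SOME h. has_trace \<Omega> v h)" if "v \<in> X" for v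
    using that someI_ex[of "has_trace \<Omega> v"] unfolding X_def by blast
  have A_eq: "A v = b h" if "v \<in> H1_sigma_tan \<Omega>" "has_trace \<Omega> v h" for v h
  proof -
    have "v \<in> X" using that by (auto simp: X_def)
    from b_lip[OF X_tr[OF this] that(2)] show ?thesis
      unfolding A_def H1_norm_self[OF \<Omega>(1,2) H1_sigma_tan_D(1)[OF that(1)]] by simp
  qed
  have H1s: "H1_sigma_tan \<Omega> \<subseteq> H1 \<Omega>" using H1_sigma_tan_D(1) by blast
  have XH: "X \<subseteq> H1 \<Omega>" using H1s by (auto simp: X_def)
  define ds where "ds t = (L2_norm ?M (sym_grad \<Omega> (u t)))\<^sup>2" for t
  define db where "db t = (\<integral>x. \<alpha> x * (norm (tangential \<Omega> x (g t x)))\<^sup>2 \<partial>?S)" for t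
  have int_ds: "integrable (lebesgue_on {0<..<T}) ds" if T: "T > 0" for T
    unfolding ds_def
  proof (rule integrable_square_bound[OF _ intN[OF T], where c=1])
    show "(\<lambda>t. L2_norm ?M (sym_grad \<Omega> (u t))) \<in> borel_measurable (lebesgue_on {0<..<T})"
      by (rule strongly_measurable_Lipschitz_functional[OF \<Omega>(1,2) _ sm[OF T] H1s H1s, where C=1])
        (use sym_grad_Lipschitz[OF \<Omega>(1,2)] H1s aeH[OF T] in auto)
    show "AE t in lebesgue_on {0<..<T}. \<bar>L2_norm ?M (sym_grad \<Omega> (u t))\<bar> \<le> 1 * H1_norm \<Omega> (u t)"
      using aeH[OF T]
    proof eventually_elim
      case (elim t)
      have uH: "u t \<in> H1 \<Omega>" by (rule H1_sigma_tan_D(1)[OF elim])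
      have "L2_norm ?M (sym_grad \<Omega> (u t)) \<le> 1 * L2_norm ?M (weak_grad \<Omega> (u t))"
        by (rule L2_norm_mono[OF L2_borel[OF sym_grad_L2[OF uH]] H1_D(2)[OF uH]])
          (auto simp: sym_grad_def simp del: scaleR_add_right intro!: AE_I2 norm_symmetric_part_le[simplified])
      also have "\<dots> \<le> H1_norm \<Omega> (u t)" using L2_norm_le_H1_norm(2) by simp
      finally show ?case by simp
    qed
  qed
  have db_eq: "db t = (b (g t))\<^sup>2" "db t = (\<integral>x. \<alpha> x * (norm (g t x))\<^sup>2 \<partial>?S)"
    if "u t \<in> H1_sigma_tan \<Omega>" "has_trace \<Omega> (u t) (g t)" for t
    unfolding db_def b_def tangential_trace_integral[OF \<Omega> that] using weighted(2)[OF has_trace_D(2)[OF that(2)]] by auto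
  have int_db: "integrable (lebesgue_on {0<..<T}) db" if T: "T > 0" for T
  proof -
    have Am: "(\<lambda>t. A (u t)) \<in> borel_measurable (lebesgue_on {0<..<T})"
    proof (rule strongly_measurable_Lipschitz_functional[OF \<Omega>(1,2) _ sm[OF T] H1s XH, where C="sqrt B * Kt"])
      show "\<bar>A d - A e\<bar> \<le> sqrt B * Kt * H1_norm \<Omega> (d - e)" if "d \<in> X" "e \<in> X" for d e
        unfolding A_def by (rule b_lip[OF X_tr[OF that(1)] X_tr[OF that(2)]])
      show "AE t in lebesgue_on {0<..<T}. u t \<in> X" using good[OF T] by eventually_elim (auto simp: X_def)
    qed (use B Kt in auto)
    have i: "integrable (lebesgue_on {0<..<T}) (\<lambda>t. (A (u t))\<^sup>2)"
    proof (rule integrable_square_bound[OF Am intN[OF T], where c="sqrt B * Kt"])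
      show "AE t in lebesgue_on {0<..<T}. \<bar>A (u t)\<bar> \<le> sqrt B * Kt * H1_norm \<Omega> (u t)"
        using good[OF T]
      proof eventually_elim
        case (elim t)
        then show ?case using b_le[of "u t" "g t"] A_eq[of "u t" "g t"] by (simp add: b_def)
      qed
    qed
    have ae: "AE t in lebesgue_on {0<..<T}. (A (u t))\<^sup>2 = db t"
      using good[OF T]
    proof eventually_elim
      case (elim t)
      then show ?case using A_eq[of "u t" "g t"] db_eq(1)[of t] by simp
    qed
    have "db \<in> borel_measurable (lebesgue_on {0<..<T})"
      by (rule borel_measurable_AE_complete[OF _ borel_measurable_integrable[OF i] ae]) (rule lebesgue_on_complete; simp)
    then show ?thesis using i ae integrable_cong_AE borel_measurable_integrable[OF i] by blast
  qed
  define y where "y t = (L2_norm ?M (u t))\<^sup>2" for t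
  \<comment> \<open>The coefficients of the second energy inequality after multiplication by 2,
    which turns half the squared norm into \<open>y\<close>.\<close>
  define D where "D t = 4 * \<nu> * ds t + 2 * \<nu> * db t" for t
  fix t :: real assume t: "t \<ge> 0"
  have "y t \<le> y 0 * exp (- (2 * \<nu> / C) * t)"
  proof (rule energy_decay[where S=S and D=D])
    show "0 \<le> 2 * \<nu> / C" using assms(5,9) by simp
    show "AE t in lebesgue_on {0..}. t \<in> S" by (rule S(3))
    show "AE t in lebesgue_on {0..}. 2 * \<nu> / C * y t \<le> D t"
    proof -
      \<comment> \<open>The solution is described on bounded intervals only; countably many of them
        cover the positive half-line, and the time 0 is removed as a null set.\<close>
      have ae_n: "AE t in lebesgue. \<forall>n::nat. t \<in> {0<..<real (Suc n)} \<longrightarrow> u t \<in> H1_sigma_tan \<Omega> \<and> has_trace \<Omega> (u t) (g t)"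
        unfolding AE_all_countable
      proof
        fix n :: nat
        show "AE t in lebesgue. t \<in> {0<..<real (Suc n)} \<longrightarrow> u t \<in> H1_sigma_tan \<Omega> \<and> has_trace \<Omega> (u t) (g t)"
        proof -
          have "AE t in lebesgue_on {0<..<real (Suc n)}. u t \<in> H1_sigma_tan \<Omega> \<and> has_trace \<Omega> (u t) (g t)"
            by (rule good) simp
          then show ?thesis by (subst (asm) AE_restrict_space_iff) auto
        qed
      qed
      have ne: "AE t in lebesgue. t \<noteq> (0::real)" by (intro AE_completion AE_lborel_singleton)
      have "AE t in lebesgue. t \<in> {0..} \<longrightarrow> 2 * \<nu> / C * y t \<le> D t"
        using ae_n ne
      proof eventually_elim
        case (elim t)
        show ?case
        proof
          assume "t \<in> {0..}"
          then have "0 < t" using elim by simp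
          obtain n where "t < real n" using reals_Archimedean2 by blast
          then have "t \<in> {0<..<real (Suc n)}" using \<open>0 < t\<close> by simp
          then have ut: "u t \<in> H1_sigma_tan \<Omega>" "has_trace \<Omega> (u t) (g t)" using elim by blast+
          have "y t \<le> C * (ds t + db t)"
            using assms(10)[OF ut] unfolding y_def ds_def db_eq(2)[OF ut] .
          then have "2 * \<nu> / C * y t \<le> 2 * \<nu> / C * (C * (ds t + db t))"
            using assms(5,9) by (intro mult_left_mono) auto
          also have "\<dots> = 2 * \<nu> * (ds t + db t)" using assms(9) by simp
          \<comment> \<open>Half of the strain dissipation is given up to reach the equal
            coefficients required by the Korn inequality.\<close>
          also have "\<dots> \<le> D t"
          proof -
            have "0 \<le> \<nu> * ds t" using assms(5) by (simp add: ds_def)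
            then show ?thesis by (simp add: D_def distrib_left)
          qed
          finally show "2 * \<nu> / C * y t \<le> D t" .
        qed
      qed
      then show ?thesis by (subst AE_restrict_space_iff) auto
    qed
    have i: "integrable (lebesgue_on {s..t}) ds" "integrable (lebesgue_on {s..t}) db" if "0 \<le> s" "s \<le> t" for s t
      using that by (auto intro!: integrable_closed_interval[where T="t + 1"] int_ds int_db)
    show "integrable (lebesgue_on {s..t}) D" if "0 \<le> s" "s \<le> t" for s t
      unfolding D_def using i[OF that] by auto
    show "y t + (\<integral>\<tau>. D \<tau> \<partial>lebesgue_on {s..t}) \<le> y s" if "s \<in> S" "s \<le> t" for s t
    proof -
      have s0: "0 \<le> s" using that S(1) by auto
      have "1/2 * y t + 2 * \<nu> * (\<integral>\<tau>. ds \<tau> \<partial>lebesgue_on {s..t})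
          \<le> 1/2 * y s - \<nu> * (\<integral>\<tau>. db \<tau> \<partial>lebesgue_on {s..t})"
        using energy[OF that] unfolding energy_inequalities_def y_def ds_def db_def by blast
      moreover have "(\<integral>\<tau>. D \<tau> \<partial>lebesgue_on {s..t}) = 4 * \<nu> * (\<integral>\<tau>. ds \<tau> \<partial>lebesgue_on {s..t}) + 2 * \<nu> * (\<integral>\<tau>. db \<tau> \<partial>lebesgue_on {s..t})"
        unfolding D_def using i[OF s0 that(2)] by simp
      ultimately show ?thesis by linarith
    qed
  qed (use S t in \<open>auto simp: y_def\<close>)
  also have "y 0 * exp (- (2 * \<nu> / C) * t) \<le> (L2_norm ?M u0)\<^sup>2 * exp (- (2 * \<nu> / C) * t)"
    unfolding y_def
    using initial_value_le[OF \<Omega> wf[of 1] wc[of 1] assms(11) good[of 1]]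
    by (intro mult_right_mono power_mono) auto
  finally show "(L2_norm ?M (u t))\<^sup>2 \<le> (L2_norm ?M u0)\<^sup>2 * exp (- (2 * \<nu> / C) * t)"
    by (simp add: y_def)
qed

end
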